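(* Let $n\ge2$, let $\theta$ be a real antisymmetric $n\times n$ matrix, and let $g\in \mathrm{GL}_n^+(\mathscr{A}_\theta^{\mathbb{R}})$ be a Riemannian metric on $\mathbb{T}^n_\theta$, with spectral Riemannian density $\tilde\nu(g)=|\mathbb{S}^{n-1}|^{-1}\int_{\mathbb{S}^{n-1}}|\xi|_g^{-n}\,d^{n-1}\xi$. (1) $\tilde\nu(g)\in\mathscr{A}_\theta^{++}$. (2) $\tilde\nu(g)=\pi^{-\frac n2}\int_{\mathbb{R}^n}e^{-|\xi|_g^2}\,d\xi$. (3) Let $k\in\mathscr{A}_\theta^{++}$ be such that $[k,g]=0$. Then $\tilde\nu(k^2g)=k^n\tilde\nu(g)$. (4) If $g$ is self-compatible, then $\tilde\nu(g)=\nu(g)=\sqrt{\det(g)}$, where $\det(g)=\sum_{\sigma\in\mathfrak{S}_n}\varepsilon(\sigma)\,g_{1\sigma(1)}\cdots g_{n\sigma(n)}$.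
   Context: Noncommutative torus. Let $\theta_1,\dots,\theta_n$ be the columns of $\theta$, $\mathbb{T}^n=\mathbb{R}^n/2\pi\mathbb{Z}^n$, $L^2(\mathbb{T}^n)$ the usual $L^2$-space, $U_j$ the unitaries $(U_j\xi)(x)=e^{ix_j}\xi(x+\pi\theta_j)$ on $L^2(\mathbb{T}^n)$, $U^k=U_1^{k_1}\cdots U_n^{k_n}$ for $k\in\mathbb{Z}^n$, and $A_\theta$ the $C^*$-algebra they generate. $\mathscr{A}_\theta=\{\sum u_kU^k:\ (u_k)_{k\in\mathbb{Z}^n}\text{ rapidly decaying}\}$ is the smooth subalgebra of $A_\theta$; it is a Fréchet $*$-algebra for the semi-norms $u\mapsto\|\delta_1^{\alpha_1}\cdots\delta_n^{\alpha_n}u\|$, where $\delta_j(U^k)=k_jU^k$, and is closed under holomorphic functional calculus. $\mathscr{A}_\theta^{++}$ is the set of positive invertible elements of $\mathscr{A}_\theta$. Riemannian metrics. $\mathrm{GL}_n^+(\mathscr{A}_\theta^{\mathbb{R}})$ is the set of positive invertible matrices $g=(g_{ij})\in M_n(\mathscr{A}_\theta)$ such that all entries of $g$ and of $g^{-1}=(g^{ij})$ are selfadjoint; its elements are called Riemannian metrics on $\mathbb{T}^n_\theta$. Set $|\xi|_g=(\sum_{i,j}g^{ij}\xi_i\xi_j)^{1/2}$ for $\xi\in\mathbb{R}^n$ (an element of $\mathscr{A}_\theta^{++}$ for $\xi\neq0$). For $g$ positive invertible, $\det(g):=\exp[\operatorname{Tr}(\log g)]$ (matrix trace $M_n(\mathscr{A}_\theta)\to\mathscr{A}_\theta$,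 holomorphic functional calculus), and the Riemannian density is $\nu(g)=\sqrt{\det(g)}=\exp[\frac12\operatorname{Tr}(\log g)]$. $[k,g]=0$ means that $k$ commutes with every entry of $g$. $g$ is self-compatible if its entries pairwise commute. $\mathfrak{S}_n$ is the symmetric group and $\varepsilon$ the signature. *)

theory Defs
  imports "HOL-Complex_Analysis.Winding_Numbers"
begin

section \<open>The Hilbert space \<open>L\<^sup>2(\<T>\<^sup>n)\<close>\<close>

definition torus_cell :: "(real^'n::finite) set" where
  "torus_cell = {x. \<forall>i. 0 \<le> x $ i \<and> x $ i < 2 * pi}"

text \<open>
  Functions on \<open>\<T>\<^sup>n = \<real>\<^sup>n / 2\<pi>\<int>\<^sup>n\<close> are represented by \<open>2\<pi>\<int>\<^sup>n\<close>-periodic functions on \<open>\<real>\<^sup>n\<close>; the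
  measure is normalized Lebesgue measure on a fundamental domain.
\<close>

definition torus_measure :: "(real^'n) measure" where
  "torus_measure = uniform_measure lborel torus_cell"

definition torus_periodic :: "(real^'n \<Rightarrow> 'b) \<Rightarrow> bool" where
  "torus_periodic f \<longleftrightarrow> (\<forall>x j. f (x + axis j (2 * pi)) = f x)"

definition square_integrable :: "(real^'n \<Rightarrow> complex) set" where
  "square_integrable =
     {f. f \<in> borel_measurable borel \<and> torus_periodic f \<and>
         integrable torus_measure (\<lambda>x. (cmod (f x))\<^sup>2)}"

lemma torus_cell_box: "box 0 (\<chi> i. 2 * pi) \<subseteq> torus_cell" "torus_cell \<subseteq> cbox 0 (\<chi> i. 2 * pi)"
  by (auto simp: torus_cell_def mem_box_cart less_imp_le)

lemma torus_cell_measurable [measurable]: "(torus_cell :: (real^'n::finite) set) \<in> sets borel"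
proof -
  have "(torus_cell :: (real^'n) set) = (\<Inter>i::'n. {x. 0 \<le> x $ i \<and> x $ i < 2 * pi})"
    by (auto simp: torus_cell_def)
  moreover have "{x :: real^'n. 0 \<le> x $ i \<and> x $ i < 2 * pi} \<in> sets borel" for i
  proof -
    have "{x :: real^'n. 0 \<le> x $ i \<and> x $ i < 2 * pi} = {x. x $ i \<ge> 0} \<inter> {x. x $ i < 2 * pi}"
      by auto
    then show ?thesis
      by (auto intro!: borel_closed borel_open closed_halfspace_component_ge_cart open_halfspace_component_lt_cart)
  qed
  then have "(\<Inter>i::'n. {x :: real^'n. 0 \<le> x $ i \<and> x $ i < 2 * pi}) \<in> sets borel"
    by (intro sets.finite_INT) auto
  ultimately show ?thesis by simp
qed

lemma emeasure_torus_cell: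
  "emeasure lborel (torus_cell :: (real^'n::finite) set) \<noteq> 0"
  "emeasure lborel (torus_cell :: (real^'n) set) < \<infinity>"
proof -
  have "emeasure lborel (box 0 (\<chi> i. 2 * pi) :: (real^'n) set) \<le> emeasure lborel (torus_cell :: (real^'n) set)"
    by (rule emeasure_mono) (simp_all add: torus_cell_box)
  moreover have "0 < (\<Prod>b\<in>Basis. ((\<chi> i. 2 * pi) - 0 :: real^'n) \<bullet> b)"
    by (rule prod_pos) (auto simp: Basis_vec_def inner_axis)
  then have "emeasure lborel (box 0 (\<chi> i. 2 * pi) :: (real^'n) set) \<noteq> 0"
    by (subst emeasure_lborel_box) (auto simp: Basis_vec_def inner_axis)
  ultimately show "emeasure lborel (torus_cell :: (real^'n) set) \<noteq> 0" by auto
  have "emeasure lborel (torus_cell :: (real^'n) set) \<le> emeasure lborel (cbox 0 (\<chi> i. 2 * pi) :: (real^'n) set)"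
    by (rule emeasure_mono) (simp_all add: torus_cell_box)
  then show "emeasure lborel (torus_cell :: (real^'n) set) < \<infinity>"
    using emeasure_lborel_cbox_finite le_less_trans by blast
qed

lemma sets_torus_measure [simp, measurable_cong]: "sets torus_measure = sets borel"
  by (simp add: torus_measure_def)

lemma space_torus_measure [simp]: "space torus_measure = UNIV"
  by (simp add: torus_measure_def)

lemma emeasure_torus_measure_UNIV: "emeasure torus_measure UNIV = 1"
  unfolding torus_measure_def
  by (simp add: emeasure_torus_cell(1) emeasure_torus_cell(2)[unfolded infinity_ennreal_def] ennreal_divide_self)

lemma torus_periodic_shift:
  fixes x :: "real^'n::finite"
  assumes "torus_periodic f"
  shows "f (x + (\<chi> i. 2 * pi * of_int (k $ i))) = f x"
proof -
  have nat: "f (x + real m *\<^sub>R axis j (2 * pi)) = f x" for x j and m :: nat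
  proof (induction m)
    case (Suc m)
    have "f (x + real (Suc m) *\<^sub>R axis j (2 * pi)) = f ((x + real m *\<^sub>R axis j (2 * pi)) + axis j (2 * pi))"
      by (simp add: algebra_simps)
    then show ?case using assms Suc by (simp add: torus_periodic_def)
  qed simp
  have int: "f (x + of_int m *\<^sub>R axis j (2 * pi)) = f x" for x j and m :: int
  proof (cases "m \<ge> 0")
    case True
    then show ?thesis using nat[of x "nat m" j] by simp
  next
    case False
    then show ?thesis using nat[of "x + of_int m *\<^sub>R axis j (2 * pi)" "nat (- m)" j]
      by (simp add: algebra_simps)
  qed
  have "f (x + (\<Sum>i\<in>A. of_int (k $ i) *\<^sub>R axis i (2 * pi))) = f x" if "finite A" for A
    using that
  proof (induction A arbitrary: x)
    case (insert a A)
    have "f (x + (\<Sum>i\<in>insert a A. of_int (k $ i) *\<^sub>R axis i (2 * pi)))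
        = f ((x + of_int (k $ a) *\<^sub>R axis a (2 * pi)) + (\<Sum>i\<in>A. of_int (k $ i) *\<^sub>R axis i (2 * pi)))"
      using insert.hyps by (simp add: algebra_simps)
    also have "\<dots> = f x" using insert.IH int by metis
    finally show ?case .
  qed simp
  moreover have "(\<Sum>i\<in>UNIV. of_int (k $ i) *\<^sub>R axis i (2 * pi)) = (\<chi> i. 2 * pi * of_int (k $ i))"
    by (simp add: vec_eq_iff axis_def if_distrib sum.If_cases cong: if_cong)
  ultimately show ?thesis by (metis finite)
qed

lemma torus_cell_tiling:
  fixes a x :: "real^'n::finite"
  shows "\<exists>!k :: int^'n. x + (\<chi> i. 2 * pi * of_int (k $ i)) \<in> (\<lambda>y. y + a) ` torus_cell"
proof -
  have iff: "x + (\<chi> i. 2 * pi * of_int (k $ i)) \<in> (\<lambda>y. y + a) ` torus_cell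
     \<longleftrightarrow> (\<forall>i. k $ i = \<lceil>(a $ i - x $ i) / (2 * pi)\<rceil>)" for k :: "int^'n"
  proof -
    have "x + (\<chi> i. 2 * pi * of_int (k $ i)) \<in> (\<lambda>y. y + a) ` torus_cell
       \<longleftrightarrow> x + (\<chi> i. 2 * pi * of_int (k $ i)) - a \<in> torus_cell"
      by (force simp: image_iff)
    also have "\<dots> \<longleftrightarrow> (\<forall>i. 0 \<le> x $ i + 2 * pi * of_int (k $ i) - a $ i \<and> x $ i + 2 * pi * of_int (k $ i) - a $ i < 2 * pi)"
      by (simp add: torus_cell_def)
    also have "\<dots> \<longleftrightarrow> (\<forall>i. k $ i = \<lceil>(a $ i - x $ i) / (2 * pi)\<rceil>)"
    proof (intro all_cong1)
      fix i
      have "k $ i = \<lceil>(a $ i - x $ i) / (2 * pi)\<rceil> \<longleftrightarrow>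
         of_int (k $ i) - 1 < (a $ i - x $ i) / (2 * pi) \<and> (a $ i - x $ i) / (2 * pi) \<le> of_int (k $ i)"
        using ceiling_eq_iff by metis
      then show "(0 \<le> x $ i + 2 * pi * of_int (k $ i) - a $ i \<and> x $ i + 2 * pi * of_int (k $ i) - a $ i < 2 * pi)
        \<longleftrightarrow> k $ i = \<lceil>(a $ i - x $ i) / (2 * pi)\<rceil>"
        by (simp add: field_simps) (auto simp: algebra_simps)
    qed
    finally show ?thesis .
  qed
  show ?thesis
    by (rule ex1I[of _ "\<chi> i. \<lceil>(a $ i - x $ i) / (2 * pi)\<rceil>"]) (simp_all only: iff, auto simp: vec_eq_iff)
qed

lemma countable_int_vec: "countable (UNIV :: (int^'n::finite) set)"
proof -
  have "countable (Pi\<^sub>E (UNIV :: 'n set) (\<lambda>_. UNIV :: int set))"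
    by (intro countable_PiE) auto
  then have "countable (range (vec_lambda :: ('n \<Rightarrow> int) \<Rightarrow> int^'n))"
    by (simp add: PiE_UNIV_domain)
  moreover have "range (vec_lambda :: ('n \<Rightarrow> int) \<Rightarrow> int^'n) = UNIV"
    by (metis surj_def vec_nth_inverse)
  ultimately show ?thesis by simp
qed


lemma nn_integral_torus_measure:
  fixes f :: "real^'n::finite \<Rightarrow> ennreal"
  assumes [measurable]: "f \<in> borel_measurable borel"
  shows "(\<integral>\<^sup>+x. f x \<partial>torus_measure) =
         (\<integral>\<^sup>+x. f x * indicator torus_cell x \<partial>lborel) / emeasure lborel (torus_cell :: (real^'n) set)"
  unfolding torus_measure_def by (subst nn_integral_uniform_measure) auto

lemma nn_integral_torus_translate_aux:
  fixes f :: "real^'n::finite \<Rightarrow> ennreal"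
  assumes [measurable]: "f \<in> borel_measurable borel" and per: "torus_periodic f"
  shows "(\<integral>\<^sup>+x. f (x + a) * indicator torus_cell x \<partial>lborel) =
         (\<integral>\<^sup>+x. f x * indicator torus_cell x \<partial>lborel)"
proof -
  define e where "e = from_nat_into (UNIV :: (int^'n) set)"
  have "infinite (UNIV :: (int^'n) set)"
  proof
    assume "finite (UNIV :: (int^'n) set)"
    moreover have "inj (\<lambda>m :: int. (\<chi> i :: 'n. m))" by (auto simp: inj_def vec_eq_iff)
    ultimately have "finite (UNIV :: int set)" using finite_imageD finite_subset subset_UNIV by metis
    then show False by simp
  qed
  then have bij: "bij e" unfolding e_def using countable_int_vec bij_betw_from_nat_into by blast
  define s :: "nat \<Rightarrow> real^'n" where "s m = (\<chi> i. 2 * pi * of_int (e m $ i))" for m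
  define D where "D = (\<lambda>y. y + a) ` (torus_cell :: (real^'n) set)"
  have D_iff: "y \<in> D \<longleftrightarrow> y - a \<in> torus_cell" for y
    unfolding D_def by (force simp: image_iff)
  have D_vimage: "D = (\<lambda>y. y - a) -` torus_cell \<inter> space borel" using D_iff by auto
  have [measurable]: "D \<in> sets borel"
    unfolding D_vimage by (rule measurable_sets[OF _ torus_cell_measurable]) simp
  have tile: "(\<Sum>m. indicator E (x + s m)) = (1 :: ennreal)"
    if ex: "\<exists>!k :: int^'n. x + (\<chi> i. 2 * pi * of_int (k $ i)) \<in> E" for E x
  proof -
    define k where "k = (THE k :: int^'n. x + (\<chi> i. 2 * pi * of_int (k $ i)) \<in> E)"
    have k: "x + (\<chi> i. 2 * pi * of_int (k $ i)) \<in> E"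
      unfolding k_def by (rule theI'[OF ex])
    have uni: "k' = k" if k': "x + (\<chi> i. 2 * pi * of_int (k' $ i)) \<in> E" for k' :: "int^'n"
      unfolding k_def by (rule the1_equality[symmetric, OF ex k'])
    obtain m0 where m0: "e m0 = k" using bij by (metis bij_pointE)
    have "indicator E (x + s m) = (if m = m0 then 1 else 0 :: ennreal)" for m
    proof (cases "m = m0")
      case True
      then show ?thesis using k by (simp add: s_def m0)
    next
      case False
      then have "e m \<noteq> k" using m0 bij by (metis bij_is_inj injD)
      then have "x + s m \<notin> E" using uni[of "e m"] by (auto simp: s_def)
      then show ?thesis using False by simp
    qed
    then have "(\<Sum>m. indicator E (x + s m)) = (\<Sum>m. if m = m0 then 1 else 0 :: ennreal)" by simp
    also have "\<dots> = 1" using sums_single[of m0 "\<lambda>_. 1 :: ennreal"] sums_unique by force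
    finally show ?thesis .
  qed
  have tile1: "(\<Sum>m. indicator torus_cell (x + s m)) = (1 :: ennreal)" for x
    using tile[of x torus_cell] torus_cell_tiling[of x 0] by simp
  have tile2: "(\<Sum>m. indicator D (x - s m)) = (1 :: ennreal)" for x
  proof -
    have *: "(\<lambda>k. - k) ` UNIV = (UNIV :: (int^'n) set)" by (metis surj_def minus_minus)
    have "\<exists>!k :: int^'n. - x + (\<chi> i. 2 * pi * of_int (k $ i)) \<in> uminus ` D"
    proof -
      note D1 = torus_cell_tiling[of x a, folded D_def]
      define k where "k = (THE k :: int^'n. x + (\<chi> i. 2 * pi * of_int (k $ i)) \<in> D)"
      have k: "x + (\<chi> i. 2 * pi * of_int (k $ i)) \<in> D"
        unfolding k_def by (rule theI'[OF D1])
      have uni: "k' = k" if k': "x + (\<chi> i. 2 * pi * of_int (k' $ i)) \<in> D" for k' :: "int^'n"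
        unfolding k_def by (rule the1_equality[symmetric, OF D1 k'])
      have neg: "- x + (\<chi> i. 2 * pi * of_int (k' $ i)) \<in> uminus ` D
          \<longleftrightarrow> x + (\<chi> i. 2 * pi * of_int ((- k') $ i)) \<in> D" for k' :: "int^'n"
      proof -
        have "x + (\<chi> i. 2 * pi * of_int ((- k') $ i)) = - (- x + (\<chi> i. 2 * pi * of_int (k' $ i)))"
          by (simp add: vec_eq_iff)
        moreover have "z \<in> uminus ` D \<longleftrightarrow> - z \<in> D" for z
          by (metis (no_types, lifting) image_iff minus_minus)
        ultimately show ?thesis by metis
      qed
      show ?thesis
        unfolding neg
      proof (rule ex1I[of _ "- k"])
        show "x + (\<chi> i. 2 * pi * of_int ((- (- k)) $ i)) \<in> D" using k by simp
        show "k' = - k" if "x + (\<chi> i. 2 * pi * of_int ((- k') $ i)) \<in> D" for k' :: "int^'n"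
          using uni[OF that] by (metis minus_minus)
      qed
    qed
    from tile[OF this] have "(\<Sum>m. indicator (uminus ` D) (- x + s m)) = (1 :: ennreal)" .
    moreover have "indicator (uminus ` D) (- x + s m) = (indicator D (x - s m) :: ennreal)" for m
    proof -
      have "z \<in> uminus ` D \<longleftrightarrow> - z \<in> D" for z
        by (metis (no_types, lifting) image_iff minus_minus)
      then show ?thesis by (simp add: indicator_def)
    qed
    ultimately show ?thesis by simp
  qed
  have shift: "(\<integral>\<^sup>+x. h x \<partial>lborel) = (\<integral>\<^sup>+x. h (x + b) \<partial>lborel)"
    if [measurable]: "h \<in> borel_measurable borel" for h :: "real^'n \<Rightarrow> ennreal" and b
    by (subst (1) lborel_distr_plus[of b, symmetric]) (simp add: nn_integral_distr add.commute)
  have fs: "f (x - s m) = f x" for x m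
    using torus_periodic_shift[OF per, of "x - s m" "e m"] by (simp add: s_def)
  have "(\<integral>\<^sup>+x. f (x + a) * indicator torus_cell x \<partial>lborel)
      = (\<integral>\<^sup>+x. f x * indicator D x \<partial>lborel)"
    by (subst (2) shift[of _ a]) (auto simp: D_iff indicator_def intro!: nn_integral_cong)
  also have "\<dots> = (\<integral>\<^sup>+x. (\<Sum>m. f x * indicator D x * indicator torus_cell (x + s m)) \<partial>lborel)"
    by (simp add: tile1)
  also have "\<dots> = (\<Sum>m. \<integral>\<^sup>+x. f x * indicator D x * indicator torus_cell (x + s m) \<partial>lborel)"
    by (rule nn_integral_suminf) measurable
  also have "\<dots> = (\<Sum>m. \<integral>\<^sup>+x. f x * indicator torus_cell x * indicator D (x - s m) \<partial>lborel)"
  proof (rule suminf_cong)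
    fix m
    show "(\<integral>\<^sup>+x. f x * indicator D x * indicator torus_cell (x + s m) \<partial>lborel)
       = (\<integral>\<^sup>+x. f x * indicator torus_cell x * indicator D (x - s m) \<partial>lborel)"
      by (subst shift[of _ "- s m"]) (auto simp: fs mult_ac intro!: nn_integral_cong)
  qed
  also have "\<dots> = (\<integral>\<^sup>+x. (\<Sum>m. f x * indicator torus_cell x * indicator D (x - s m)) \<partial>lborel)"
    by (rule nn_integral_suminf[symmetric]) measurable
  also have "\<dots> = (\<integral>\<^sup>+x. f x * indicator torus_cell x \<partial>lborel)"
    by (simp add: tile2)
  finally show ?thesis .
qed

lemma nn_integral_torus_translate:
  fixes f :: "real^'n::finite \<Rightarrow> ennreal"
  assumes [measurable]: "f \<in> borel_measurable borel" and per: "torus_periodic f"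
  shows "(\<integral>\<^sup>+x. f (x + a) \<partial>torus_measure) = (\<integral>\<^sup>+x. f x \<partial>torus_measure)"
  by (subst (1 2) nn_integral_torus_measure) (simp_all add: nn_integral_torus_translate_aux[OF assms])

lemma square_integrableI:
  assumes "f \<in> borel_measurable borel" "torus_periodic f"
    and "(\<integral>\<^sup>+x. ennreal ((cmod (f x))\<^sup>2) \<partial>torus_measure) < \<infinity>"
  shows "f \<in> square_integrable"
  using assms by (auto simp: square_integrable_def intro!: integrableI_bounded)

lemma square_integrableD:
  assumes "f \<in> square_integrable"
  shows "f \<in> borel_measurable borel" "f \<in> borel_measurable torus_measure" "torus_periodic f"
    "integrable torus_measure (\<lambda>x. (cmod (f x))\<^sup>2)"
  using assms by (auto simp: square_integrable_def)

lemma borel_measurable_cnj [measurable (raw)]: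
  "f \<in> borel_measurable M \<Longrightarrow> (\<lambda>x. cnj (f x)) \<in> borel_measurable M"
  by (rule measurable_compose[of f M borel cnj borel])
     (auto intro!: borel_measurable_continuous_onI continuous_intros)

lemma square_integrable_prod:
  assumes "f \<in> square_integrable" "g \<in> square_integrable"
  shows "integrable torus_measure (\<lambda>x. f x * cnj (g x))"
proof (rule Bochner_Integration.integrable_bound)
  note [measurable] = square_integrableD(2)[OF assms(1)] square_integrableD(2)[OF assms(2)]
  show "integrable torus_measure (\<lambda>x. (cmod (f x))\<^sup>2 + (cmod (g x))\<^sup>2)"
    using assms square_integrableD by (intro Bochner_Integration.integrable_add) auto
  show "(\<lambda>x. f x * cnj (g x)) \<in> borel_measurable torus_measure"
    by measurable
  have "a * b \<le> a\<^sup>2 + b\<^sup>2" for a b :: real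
  proof -
    have "2 * (a * b) \<le> a\<^sup>2 + b\<^sup>2" "0 \<le> a\<^sup>2 + b\<^sup>2"
      using sum_squares_bound[of a b] by (auto simp: mult.assoc)
    then show ?thesis by linarith
  qed
  then show "AE x in torus_measure. norm (f x * cnj (g x)) \<le> norm ((cmod (f x))\<^sup>2 + (cmod (g x))\<^sup>2)"
    by (auto simp: norm_mult)
qed

lemma square_integrable_add:
  assumes "f \<in> square_integrable" "g \<in> square_integrable"
  shows "(\<lambda>x. f x + g x) \<in> square_integrable"
proof -
  note [measurable] = square_integrableD(1)[OF assms(1)] square_integrableD(1)[OF assms(2)]
  have "integrable torus_measure (\<lambda>x. (cmod (f x + g x))\<^sup>2)"
  proof (rule Bochner_Integration.integrable_bound)
    show "integrable torus_measure (\<lambda>x. 2 * (cmod (f x))\<^sup>2 + 2 * (cmod (g x))\<^sup>2)"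
      using assms square_integrableD
      by (intro Bochner_Integration.integrable_add Bochner_Integration.integrable_mult_right) auto
    show "(\<lambda>x. (cmod (f x + g x))\<^sup>2) \<in> borel_measurable torus_measure"
      by measurable
    have "(cmod (a + b))\<^sup>2 \<le> 2 * (cmod a)\<^sup>2 + 2 * (cmod b)\<^sup>2" for a b
    proof -
      have "(cmod (a + b))\<^sup>2 \<le> (cmod a + cmod b)\<^sup>2"
        by (simp add: norm_triangle_ineq power_mono)
      also have "\<dots> \<le> 2 * (cmod a)\<^sup>2 + 2 * (cmod b)\<^sup>2"
        using sum_squares_bound[of "cmod a" "cmod b"] by (simp add: power2_sum)
      finally show ?thesis .
    qed
    then show "AE x in torus_measure. norm ((cmod (f x + g x))\<^sup>2) \<le> norm (2 * (cmod (f x))\<^sup>2 + 2 * (cmod (g x))\<^sup>2)"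
      by auto
  qed
  then show ?thesis
    using assms unfolding square_integrable_def torus_periodic_def by auto
qed

lemma square_integrable_cmult:
  assumes "f \<in> square_integrable"
  shows "(\<lambda>x. c * f x) \<in> square_integrable"
  using assms unfolding square_integrable_def torus_periodic_def
  by (auto simp: norm_mult power_mult_distrib)

lemma square_integrable_const: "(\<lambda>x. c) \<in> square_integrable"
  by (rule square_integrableI) (auto simp: torus_periodic_def emeasure_torus_measure_UNIV)

definition torus_ae_eq :: "(real^'n::finite \<Rightarrow> complex) \<Rightarrow> (real^'n \<Rightarrow> complex) \<Rightarrow> bool" where
  "torus_ae_eq f g \<longleftrightarrow> f \<in> square_integrable \<and> g \<in> square_integrable \<and>
     (AE x in torus_measure. f x = g x)"

quotient_type 'n torus_L2 = "real^('n::finite) \<Rightarrow> complex" / partial: torus_ae_eq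
proof (rule part_equivpI)
  show "\<exists>f. torus_ae_eq f (f :: real^'n \<Rightarrow> complex)"
    using square_integrable_const by (auto simp: torus_ae_eq_def)
  show "symp (torus_ae_eq :: (real^'n \<Rightarrow> complex) \<Rightarrow> _)"
    by (auto simp: torus_ae_eq_def symp_def)
  show "transp (torus_ae_eq :: (real^'n \<Rightarrow> complex) \<Rightarrow> _)"
    unfolding transp_def torus_ae_eq_def by (auto elim: AE_mp)
qed

text \<open>Multiplication by complex scalars; the library has only the real one.\<close>

class scaleC = fixes scaleC :: "complex \<Rightarrow> 'a \<Rightarrow> 'a" (infixr \<open>*\<^sub>C\<close> 75)

text \<open>The inner product is linear in its first argument.\<close>

lift_definition cinner :: "'n::finite torus_L2 \<Rightarrow> 'n torus_L2 \<Rightarrow> complex" is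
  "\<lambda>f g. \<integral>x. f x * cnj (g x) \<partial>torus_measure"
proof -
  fix f1 f2 g1 g2 :: "real^'n \<Rightarrow> complex"
  assume fg: "torus_ae_eq f1 f2" "torus_ae_eq g1 g2"
  then show "(\<integral>x. f1 x * cnj (g1 x) \<partial>torus_measure) = (\<integral>x. f2 x * cnj (g2 x) \<partial>torus_measure)"
    unfolding torus_ae_eq_def
    by (intro integral_cong_AE) (auto intro!: borel_measurable_integrable square_integrable_prod)
qed

instantiation torus_L2 :: (finite) "{real_inner, scaleC}"
begin

lift_definition zero_torus_L2 :: "'a torus_L2" is "\<lambda>_. 0"
  by (simp add: torus_ae_eq_def square_integrable_const)

lift_definition plus_torus_L2 :: "'a torus_L2 \<Rightarrow> 'a torus_L2 \<Rightarrow> 'a torus_L2" is "\<lambda>f g x. f x + g x"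
  by (auto simp: torus_ae_eq_def intro: square_integrable_add)

lift_definition scaleC_torus_L2 :: "complex \<Rightarrow> 'a torus_L2 \<Rightarrow> 'a torus_L2" is "\<lambda>c f x. c * f x"
  by (auto simp: torus_ae_eq_def intro: square_integrable_cmult)

definition scaleR_torus_L2 :: "real \<Rightarrow> 'a torus_L2 \<Rightarrow> 'a torus_L2" where
  "scaleR_torus_L2 r f = complex_of_real r *\<^sub>C f"

definition uminus_torus_L2 :: "'a torus_L2 \<Rightarrow> 'a torus_L2" where
  "uminus_torus_L2 f = (-1) *\<^sub>C f"

definition minus_torus_L2 :: "'a torus_L2 \<Rightarrow> 'a torus_L2 \<Rightarrow> 'a torus_L2" where
  "minus_torus_L2 f g = f + - g"

definition inner_torus_L2 :: "'a torus_L2 \<Rightarrow> 'a torus_L2 \<Rightarrow> real" where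
  "inner_torus_L2 f g = Re (cinner f g)"

definition norm_torus_L2 :: "'a torus_L2 \<Rightarrow> real" where
  "norm_torus_L2 f = sqrt (inner f f)"

definition sgn_torus_L2 :: "'a torus_L2 \<Rightarrow> 'a torus_L2" where
  "sgn_torus_L2 f = inverse (norm f) *\<^sub>R f"

definition dist_torus_L2 :: "'a torus_L2 \<Rightarrow> 'a torus_L2 \<Rightarrow> real" where
  "dist_torus_L2 f g = norm (f - g)"

definition uniformity_torus_L2 :: "('a torus_L2 \<times> 'a torus_L2) filter" where
  "uniformity_torus_L2 = (INF e\<in>{0 <..}. principal {(x, y). dist x y < e})"

definition open_torus_L2 :: "'a torus_L2 set \<Rightarrow> bool" where
  "open_torus_L2 U = (\<forall>x\<in>U. eventually (\<lambda>(x', y). x' = x \<longrightarrow> y \<in> U) uniformity)"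

lemma cinner_add_left: "cinner (f + g) h = cinner f h + cinner g (h :: 'a torus_L2)"
proof (transfer, goal_cases)
  case (1 f g h)
  then show ?case
    by (simp add: torus_ae_eq_def distrib_right square_integrable_prod)
qed

lemma cinner_scaleC_left: "cinner (c *\<^sub>C f) (h :: 'a torus_L2) = c * cinner f h"
proof (transfer, goal_cases)
  case (1 c f h)
  then show ?case
    by (simp add: torus_ae_eq_def mult.assoc)
qed

lemma cinner_commute: "cinner f (h :: 'a torus_L2) = cnj (cinner h f)"
proof (transfer, goal_cases)
  case (1 f h)
  have "(\<lambda>x. f x * cnj (h x)) = (\<lambda>x. cnj (h x * cnj (f x)))"
    by (simp add: mult.commute)
  then show ?case using Bochner_Integration.integral_cnj[of torus_measure "\<lambda>x. h x * cnj (f x)"] by (simp only:)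
qed

lemma cinner_self: "cinner f (f :: 'a torus_L2) = complex_of_real (inner f f)" "inner f f \<ge> 0"
  "inner f f = 0 \<longleftrightarrow> f = 0"
proof -
  have "cinner f f = complex_of_real (Re (cinner f f)) \<and> Re (cinner f f) \<ge> 0 \<and> (Re (cinner f f) = 0 \<longleftrightarrow> f = 0)"
  proof (transfer, goal_cases)
    case (1 f)
    then have f: "f \<in> square_integrable" by (simp add: torus_ae_eq_def)
    have eq: "(\<integral>x. f x * cnj (f x) \<partial>torus_measure) = complex_of_real (\<integral>x. (cmod (f x))\<^sup>2 \<partial>torus_measure)"
      by (simp only: complex_norm_square[symmetric] flip: integral_complex_of_real)
    have "(\<integral>x. (cmod (f x))\<^sup>2 \<partial>torus_measure) = 0 \<longleftrightarrow> (AE x in torus_measure. f x = 0)"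
      using square_integrableD(4)[OF f] by (subst integral_nonneg_eq_0_iff_AE) auto
    then show ?case
      using f unfolding eq torus_ae_eq_def by (simp add: square_integrable_const)
  qed
  then show "cinner f (f :: 'a torus_L2) = complex_of_real (inner f f)" "inner f f \<ge> 0"
    "inner f f = 0 \<longleftrightarrow> f = 0"
    by (simp_all add: inner_torus_L2_def)
qed

instance
proof
  fix a b c :: "'a torus_L2" and r s :: real
  show "a + b + c = a + (b + c)"
    by (transfer) (auto simp: torus_ae_eq_def add.assoc intro!: square_integrable_add)
  show "a + b = b + a"
    by (transfer) (auto simp: torus_ae_eq_def add.commute intro!: square_integrable_add)
  show "0 + a = a"
    by (transfer) (auto simp: torus_ae_eq_def)
  show "- a + a = 0"
    unfolding uminus_torus_L2_def
    by (transfer) (auto simp: torus_ae_eq_def square_integrable_const)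
  show "a - b = a + - b" by (rule minus_torus_L2_def)
  show "r *\<^sub>R (a + b) = r *\<^sub>R a + r *\<^sub>R b"
    unfolding scaleR_torus_L2_def
    by (transfer) (auto simp: torus_ae_eq_def distrib_left intro!: square_integrable_add square_integrable_cmult)
  show "(r + s) *\<^sub>R a = r *\<^sub>R a + s *\<^sub>R a"
    unfolding scaleR_torus_L2_def
    by (transfer) (auto simp: torus_ae_eq_def distrib_right intro!: square_integrable_add square_integrable_cmult)
  show "r *\<^sub>R s *\<^sub>R a = (r * s) *\<^sub>R a"
    unfolding scaleR_torus_L2_def
    by (transfer) (auto simp: torus_ae_eq_def mult.assoc intro!: square_integrable_cmult)
  show "1 *\<^sub>R a = a"
    unfolding scaleR_torus_L2_def
    by (transfer) (auto simp: torus_ae_eq_def)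
  show "sgn a = inverse (norm a) *\<^sub>R a" by (rule sgn_torus_L2_def)
  show "dist a b = norm (a - b)" by (rule dist_torus_L2_def)
  show "uniformity = (INF e\<in>{0 <..}. principal {(x, y :: 'a torus_L2). dist x y < e})"
    by (rule uniformity_torus_L2_def)
  show "open U = (\<forall>x\<in>U. \<forall>\<^sub>F (x', y) in uniformity. x' = x \<longrightarrow> y \<in> U)" for U :: "'a torus_L2 set"
    by (rule open_torus_L2_def)
  show "inner a b = inner b a"
    unfolding inner_torus_L2_def by (metis cinner_commute complex_cnj(1) cnj.sel(1))
  show "inner (a + b) c = inner a c + inner b c"
    by (simp add: inner_torus_L2_def cinner_add_left)
  show "inner (r *\<^sub>R a) b = r * inner a b"
    by (simp add: inner_torus_L2_def scaleR_torus_L2_def cinner_scaleC_left)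
  show "0 \<le> inner a a" by (rule cinner_self)
  show "inner a a = 0 \<longleftrightarrow> a = 0" by (rule cinner_self)
  show "norm a = sqrt (inner a a)" by (rule norm_torus_L2_def)
qed

end

lemma norm_abs_torus_L2:
  assumes "f \<in> square_integrable"
  shows "(\<integral>\<^sup>+x. ennreal ((cmod (f x))\<^sup>2) \<partial>torus_measure) = ennreal ((norm (abs_torus_L2 f))\<^sup>2)"
proof -
  have "torus_ae_eq f f" using assms by (simp add: torus_ae_eq_def)
  then have "cinner (abs_torus_L2 f) (abs_torus_L2 f) = (\<integral>x. f x * cnj (f x) \<partial>torus_measure)"
    by (simp add: cinner.abs_eq)
  also have "\<dots> = complex_of_real (\<integral>x. (cmod (f x))\<^sup>2 \<partial>torus_measure)"
    by (simp only: complex_norm_square[symmetric] flip: integral_complex_of_real)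
  finally have "(norm (abs_torus_L2 f))\<^sup>2 = (\<integral>x. (cmod (f x))\<^sup>2 \<partial>torus_measure)"
    by (simp add: cinner_self power2_norm_eq_inner)
  then show ?thesis
    using nn_integral_eq_integral[OF square_integrableD(4)[OF assms]] by simp
qed

lemma rep_torus_L2_square_integrable: "rep_torus_L2 a \<in> square_integrable"
  by (metis Quotient3_rep_reflp Quotient3_torus_L2 torus_ae_eq_def)

lemma abs_rep_torus_L2: "abs_torus_L2 (rep_torus_L2 a) = a"
  by (rule Quotient3_abs_rep[OF Quotient3_torus_L2])


lemma Cauchy_convergentI_subseq:
  fixes X :: "nat \<Rightarrow> 'a :: metric_space"
  assumes "Cauchy X" "strict_mono r" "(X \<circ> r) \<longlonglongrightarrow> l"
  shows "convergent X"
proof -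
  have "X \<longlonglongrightarrow> l"
  proof (rule metric_LIMSEQ_I)
    fix e :: real assume e: "e > 0"
    then obtain M where M: "\<And>m n. m \<ge> M \<Longrightarrow> n \<ge> M \<Longrightarrow> dist (X m) (X n) < e / 2"
      using metric_CauchyD[OF assms(1), of "e / 2"] by auto
    obtain K where K: "\<And>k. k \<ge> K \<Longrightarrow> dist (X (r k)) l < e / 2"
      using metric_LIMSEQ_D[OF assms(3), of "e / 2"] e by auto
    have "dist (X n) l < e" if "n \<ge> M" for n
    proof -
      define k where "k = max K M"
      have "r k \<ge> M" using seq_suble[OF assms(2), of k] by (simp add: k_def)
      then have "dist (X n) (X (r k)) < e / 2" "dist (X (r k)) l < e / 2"
        using M[OF that] K[of k] by (auto simp: k_def)
      then show ?thesis using dist_triangle[of "X n" l "X (r k)"] by linarith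
    qed
    then show "\<exists>N. \<forall>n\<ge>N. dist (X n) l < e" by blast
  qed
  then show ?thesis by (auto simp: convergent_def)
qed

lemma complete_if_summable:
  fixes X :: "nat \<Rightarrow> 'a :: real_normed_vector"
  assumes *: "\<And>x :: nat \<Rightarrow> 'a. summable (\<lambda>k. norm (x k)) \<Longrightarrow> summable x"
    and "Cauchy X"
  shows "convergent X"
proof -
  have "\<exists>M. \<forall>m\<ge>M. \<forall>n\<ge>M. norm (X m - X n) < (1 / 2) ^ k" for k
    using CauchyD[OF assms(2), of "(1 / 2) ^ k"] by auto
  then obtain M where M: "\<And>k m n. m \<ge> M k \<Longrightarrow> n \<ge> M k \<Longrightarrow> norm (X m - X n) < (1 / 2) ^ k"
    by metis
  define r where "r k = (\<Sum>j\<le>k. Suc (M j))" for k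
  have "r k < r (Suc k)" for k by (simp add: r_def)
  then have r: "strict_mono r" by (simp add: strict_mono_Suc_iff)
  have rM: "r k \<ge> M k" for k
    unfolding r_def using member_le_sum[of k "{..k}" "\<lambda>j. Suc (M j)"] by simp
  have "norm (X (r (Suc k)) - X (r k)) \<le> (1 / 2) ^ k" for k
    using M[of k "r (Suc k)" "r k"] rM[of k] strict_mono_less_eq[OF r, of k "Suc k"] by simp
  then have "summable (\<lambda>k. norm (X (r (Suc k)) - X (r k)))"
    by (intro summable_comparison_test'[OF summable_geometric[of "1 / 2 :: real"]]) auto
  then have "summable (\<lambda>k. X (r (Suc k)) - X (r k))" by (rule *)
  then obtain s where "(\<lambda>k. X (r (Suc k)) - X (r k)) sums s" by (auto simp: summable_def)
  then have "(\<lambda>N. X (r N) - X (r 0)) \<longlonglongrightarrow> s"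
    unfolding sums_def by (subst (asm) sum_lessThan_telescope) simp
  then have "(\<lambda>N. X (r N) - X (r 0) + X (r 0)) \<longlonglongrightarrow> s + X (r 0)"
    by (intro tendsto_add) auto
  then have "(X \<circ> r) \<longlonglongrightarrow> s + X (r 0)" by (simp add: o_def)
  then show ?thesis using Cauchy_convergentI_subseq assms(2) r by blast
qed

lemma abs_torus_L2_plus:
  assumes "f \<in> square_integrable" "g \<in> square_integrable"
  shows "abs_torus_L2 f + abs_torus_L2 g = abs_torus_L2 (\<lambda>x. f x + g x)"
  using assms by (simp add: plus_torus_L2.abs_eq torus_ae_eq_def)

lemma square_integrable_sum:
  assumes "\<And>k. k \<in> A \<Longrightarrow> f k \<in> square_integrable" "finite A"
  shows "(\<lambda>x. \<Sum>k\<in>A. f k x) \<in> square_integrable \<and>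
     abs_torus_L2 (\<lambda>x. \<Sum>k\<in>A. f k x) = (\<Sum>k\<in>A. abs_torus_L2 (f k))"
  using assms(2,1)
proof (induction A)
  case empty
  then show ?case by (simp add: square_integrable_const zero_torus_L2.abs_eq)
next
  case (insert a A)
  then show ?case
    by (auto simp: abs_torus_L2_plus[symmetric] intro!: square_integrable_add)
qed

lemma norm_abs_torus_L2_norm:
  assumes "f \<in> square_integrable"
  shows "(\<lambda>x. complex_of_real (cmod (f x))) \<in> square_integrable"
    "norm (abs_torus_L2 (\<lambda>x. complex_of_real (cmod (f x)))) = norm (abs_torus_L2 f)"
proof -
  show *: "(\<lambda>x. complex_of_real (cmod (f x))) \<in> square_integrable"
    using assms by (auto simp: square_integrable_def torus_periodic_def)
  have "ennreal ((norm (abs_torus_L2 (\<lambda>x. complex_of_real (cmod (f x)))))\<^sup>2) = ennreal ((norm (abs_torus_L2 f))\<^sup>2)"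
    by (simp add: norm_abs_torus_L2[OF *, symmetric] norm_abs_torus_L2[OF assms, symmetric])
  then show "norm (abs_torus_L2 (\<lambda>x. complex_of_real (cmod (f x)))) = norm (abs_torus_L2 f)"
    by (simp add: ennreal_inj)
qed

lemma torus_L2_summable:
  fixes x :: "nat \<Rightarrow> 'n::finite torus_L2"
  assumes "summable (\<lambda>k. norm (x k))"
  shows "summable x"
proof -
  define f where "f k = rep_torus_L2 (x k)" for k
  have f: "f k \<in> square_integrable" and xf: "x k = abs_torus_L2 (f k)" for k
    by (simp_all add: f_def rep_torus_L2_square_integrable abs_rep_torus_L2)
  note [measurable] = square_integrableD(1)[OF f]
  define a where "a k = norm (x k)" for k
  have a: "summable a" using assms unfolding a_def .
  have a0: "a k \<ge> 0" for k by (simp add: a_def)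
  have part: "(\<integral>\<^sup>+y. ennreal ((\<Sum>k\<in>A. cmod (f k y))\<^sup>2) \<partial>torus_measure) \<le> ennreal ((\<Sum>k\<in>A. a k)\<^sup>2)"
    if "finite A" for A
  proof -
    let ?h = "\<lambda>k x. complex_of_real (cmod (f k x))"
    have h: "(\<lambda>x. \<Sum>k\<in>A. ?h k x) \<in> square_integrable"
       "abs_torus_L2 (\<lambda>x. \<Sum>k\<in>A. ?h k x) = (\<Sum>k\<in>A. abs_torus_L2 (?h k))"
      using square_integrable_sum[of A ?h] norm_abs_torus_L2_norm(1)[OF f] that by auto
    have "(\<integral>\<^sup>+y. ennreal ((\<Sum>k\<in>A. cmod (f k y))\<^sup>2) \<partial>torus_measure)
        = (\<integral>\<^sup>+y. ennreal ((cmod (\<Sum>k\<in>A. ?h k y))\<^sup>2) \<partial>torus_measure)"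
      by (simp flip: of_real_sum)
    also have "\<dots> = ennreal ((norm (\<Sum>k\<in>A. abs_torus_L2 (?h k)))\<^sup>2)"
      using norm_abs_torus_L2[OF h(1)] h(2) by simp
    also have "norm (\<Sum>k\<in>A. abs_torus_L2 (?h k)) \<le> (\<Sum>k\<in>A. a k)"
      by (rule order_trans[OF norm_sum])
         (simp add: norm_abs_torus_L2_norm(2)[OF f] a_def xf)
    then have "ennreal ((norm (\<Sum>k\<in>A. abs_torus_L2 (?h k)))\<^sup>2) \<le> ennreal ((\<Sum>k\<in>A. a k)\<^sup>2)"
      by (intro ennreal_leI power_mono) auto
    finally show ?thesis .
  qed
  have "AE y in torus_measure. summable (\<lambda>k. cmod (f k y))"
  proof -
    define F where "F y = liminf (\<lambda>N. ennreal ((\<Sum>k<N. cmod (f k y))\<^sup>2))" for y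
    have [measurable]: "F \<in> borel_measurable borel" unfolding F_def by measurable
    have "(\<integral>\<^sup>+y. F y \<partial>torus_measure)
        \<le> liminf (\<lambda>N. \<integral>\<^sup>+y. ennreal ((\<Sum>k<N. cmod (f k y))\<^sup>2) \<partial>torus_measure)"
      unfolding F_def by (rule nn_integral_liminf) measurable
    also have "\<dots> \<le> liminf (\<lambda>N. ennreal ((suminf a)\<^sup>2))"
    proof (intro Liminf_mono always_eventually allI)
      fix N
      have "(\<Sum>k<N. a k) \<le> suminf a" using a a0 by (intro sum_le_suminf) auto
      then show "(\<integral>\<^sup>+y. ennreal ((\<Sum>k<N. cmod (f k y))\<^sup>2) \<partial>torus_measure) \<le> ennreal ((suminf a)\<^sup>2)"
        by (intro order_trans[OF part] ennreal_leI power_mono sum_nonneg a0) auto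
    qed
    also have "\<dots> < \<infinity>" by (simp add: Liminf_const)
    finally have "AE y in torus_measure. F y \<noteq> \<infinity>"
      by (intro nn_integral_noteq_infinite) auto
    then show ?thesis
    proof (rule AE_mp, intro AE_I2 impI)
      fix y assume F: "F y \<noteq> \<infinity>"
      have lim: "(\<lambda>N. ennreal ((\<Sum>k<N. cmod (f k y))\<^sup>2)) \<longlonglongrightarrow> F y"
      proof -
        have "incseq (\<lambda>N. ennreal ((\<Sum>k<N. cmod (f k y))\<^sup>2))"
          by (intro incseq_SucI ennreal_leI power_mono sum_nonneg) auto
        from LIMSEQ_SUP[OF this] show ?thesis
          unfolding F_def by (metis lim_imp_Liminf trivial_limit_sequentially)
      qed
      have le: "ennreal ((\<Sum>k<N. cmod (f k y))\<^sup>2) \<le> F y" for N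
        by (rule incseq_le[OF _ lim]) (intro incseq_SucI ennreal_leI power_mono sum_nonneg, auto)
      obtain B where B: "F y = ennreal B" "B \<ge> 0" using F by (cases "F y") auto
      have "(\<Sum>k<N. cmod (f k y)) \<le> sqrt B" for N
        using le[of N] B by (intro real_le_rsqrt) (simp add: ennreal_le_iff)
      then show "summable (\<lambda>k. cmod (f k y))"
        by (intro bounded_imp_summable[of _ "sqrt B"]) (simp, metis lessThan_Suc_atMost)
    qed
  qed
  note AE_summable = this
  define g where "g y = (if Cauchy (\<lambda>N. \<Sum>k<N. f k y) then lim (\<lambda>N. \<Sum>k<N. f k y) else 0)" for y
  have [measurable]: "g \<in> borel_measurable borel"
    unfolding g_def by measurable
  have g_per: "torus_periodic g"
    unfolding torus_periodic_def g_def
    using square_integrableD(3)[OF f] by (simp add: torus_periodic_def)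
  have lim: "AE y in torus_measure. (\<lambda>N. \<Sum>k<N. f k y) \<longlonglongrightarrow> g y"
  proof (rule AE_mp[OF AE_summable], intro AE_I2 impI)
    fix y assume "summable (\<lambda>k. cmod (f k y))"
    then have "convergent (\<lambda>N. \<Sum>k<N. f k y)"
      by (simp add: summable_norm_cancel summable_iff_convergent[symmetric])
    then show "(\<lambda>N. \<Sum>k<N. f k y) \<longlonglongrightarrow> g y"
      by (simp add: g_def convergent_Cauchy convergent_LIMSEQ_iff)
  qed
  define T where "T N = (\<Sum>k. a (k + N))" for N
  have T0: "T N \<ge> 0" for N unfolding T_def using a a0 by (intro suminf_nonneg) (auto simp: summable_iff_shift)
  have tail: "(\<integral>\<^sup>+y. ennreal ((cmod (g y - (\<Sum>k<N. f k y)))\<^sup>2) \<partial>torus_measure) \<le> ennreal ((T N)\<^sup>2)" for N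
  proof -
    have "(\<integral>\<^sup>+y. ennreal ((cmod (g y - (\<Sum>k<N. f k y)))\<^sup>2) \<partial>torus_measure)
       \<le> (\<integral>\<^sup>+y. liminf (\<lambda>M. ennreal ((cmod ((\<Sum>k<M. f k y) - (\<Sum>k<N. f k y)))\<^sup>2)) \<partial>torus_measure)"
    proof (rule nn_integral_mono_AE, rule AE_mp[OF lim], intro AE_I2 impI)
      fix y assume "(\<lambda>N. \<Sum>k<N. f k y) \<longlonglongrightarrow> g y"
      then have "(\<lambda>M. ennreal ((cmod ((\<Sum>k<M. f k y) - (\<Sum>k<N. f k y)))\<^sup>2)) \<longlonglongrightarrow> ennreal ((cmod (g y - (\<Sum>k<N. f k y)))\<^sup>2)"
        by (intro tendsto_intros) auto
      then show "ennreal ((cmod (g y - (\<Sum>k<N. f k y)))\<^sup>2) \<le> liminf (\<lambda>M. ennreal ((cmod ((\<Sum>k<M. f k y) - (\<Sum>k<N. f k y)))\<^sup>2))"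
        using lim_imp_Liminf[OF sequentially_bot] by (metis order_refl)
    qed
    also have "\<dots> \<le> liminf (\<lambda>M. \<integral>\<^sup>+y. ennreal ((cmod ((\<Sum>k<M. f k y) - (\<Sum>k<N. f k y)))\<^sup>2) \<partial>torus_measure)"
      by (rule nn_integral_liminf) measurable
    also have "\<dots> \<le> liminf (\<lambda>M. ennreal ((T N)\<^sup>2))"
    proof (rule Liminf_mono, rule eventually_mono[OF eventually_ge_at_top[of N]])
      fix M assume M: "N \<le> M"
      have diff: "(\<Sum>k<M. f k y) - (\<Sum>k<N. f k y) = (\<Sum>k\<in>{N..<M}. f k y)" for y
        using sum_diff_nat_ivl[of 0 N M "\<lambda>k. f k y"] M by (simp add: atLeast0LessThan)
      have "(\<integral>\<^sup>+y. ennreal ((cmod ((\<Sum>k<M. f k y) - (\<Sum>k<N. f k y)))\<^sup>2) \<partial>torus_measure)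
        \<le> (\<integral>\<^sup>+y. ennreal ((\<Sum>k\<in>{N..<M}. cmod (f k y))\<^sup>2) \<partial>torus_measure)"
        unfolding diff by (intro nn_integral_mono ennreal_leI power_mono norm_sum) auto
      also have "\<dots> \<le> ennreal ((\<Sum>k\<in>{N..<M}. a k)\<^sup>2)" by (rule part) simp
      also have "\<dots> \<le> ennreal ((T N)\<^sup>2)"
      proof (intro ennreal_leI power_mono sum_nonneg a0)
        have "(\<Sum>k\<in>{N..<M}. a k) = (\<Sum>k<M - N. a (k + N))"
          using sum.shift_bounds_nat_ivl[of a 0 N "M - N"] M by (simp add: atLeast0LessThan)
        also have "\<dots> \<le> T N"
          unfolding T_def using a a0 by (intro sum_le_suminf) (auto simp: summable_iff_shift)
        finally show "(\<Sum>k\<in>{N..<M}. a k) \<le> T N" .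
      qed
      finally show "(\<integral>\<^sup>+y. ennreal ((cmod ((\<Sum>k<M. f k y) - (\<Sum>k<N. f k y)))\<^sup>2) \<partial>torus_measure) \<le> ennreal ((T N)\<^sup>2)" .
    qed
    also have "\<dots> = ennreal ((T N)\<^sup>2)" by (simp add: Liminf_const)
    finally show ?thesis .
  qed
  have g: "g \<in> square_integrable"
    by (rule square_integrableI) (use tail[of 0] g_per in \<open>auto intro: le_less_trans\<close>)
  define L where "L = abs_torus_L2 g"
  have L: "norm (L - (\<Sum>k<N. x k)) \<le> T N" for N
  proof -
    let ?S = "\<lambda>y. \<Sum>k<N. f k y"
    have S: "?S \<in> square_integrable" "abs_torus_L2 ?S = (\<Sum>k<N. x k)"
      using square_integrable_sum[of "{..<N}" f] f by (auto simp: xf)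
    have mS: "(\<lambda>y. (-1) * ?S y) \<in> square_integrable" using S(1) by (rule square_integrable_cmult)
    have "- abs_torus_L2 ?S = abs_torus_L2 (\<lambda>y. (-1) * ?S y)"
      unfolding uminus_torus_L2_def using S(1) by (simp add: scaleC_torus_L2.abs_eq torus_ae_eq_def)
    then have "L - (\<Sum>k<N. x k) = abs_torus_L2 (\<lambda>y. g y + (-1) * ?S y)"
      using abs_torus_L2_plus[OF g mS] S(2) by (metis L_def diff_conv_add_uminus)
    moreover have "(\<lambda>y. g y + (-1) * ?S y) \<in> square_integrable"
      using g mS by (rule square_integrable_add)
    ultimately have "ennreal ((norm (L - (\<Sum>k<N. x k)))\<^sup>2) \<le> ennreal ((T N)\<^sup>2)"
      using tail[of N] norm_abs_torus_L2[of "\<lambda>y. g y + (-1) * ?S y"] by simp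
    then have "(norm (L - (\<Sum>k<N. x k)))\<^sup>2 \<le> (T N)\<^sup>2" by (simp add: ennreal_le_iff)
    then show ?thesis using T0 by (rule power2_le_imp_le)
  qed
  have "T \<longlonglongrightarrow> 0"
    unfolding T_def using suminf_exist_split2[OF a] by simp
  then have "(\<lambda>N. L - (\<Sum>k<N. x k)) \<longlonglongrightarrow> 0"
    by (rule Lim_null_comparison[rotated]) (simp add: L always_eventually)
  then have "(\<lambda>N. L - (L - (\<Sum>k<N. x k))) \<longlonglongrightarrow> L - 0" by (intro tendsto_diff) auto
  then show ?thesis by (auto simp: sums_def summable_def)
qed

instance torus_L2 :: (finite) banach
proof
  fix X :: "nat \<Rightarrow> 'a torus_L2"
  assume "Cauchy X"
  then show "convergent X" using complete_if_summable torus_L2_summable by blast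
qed

section \<open>Bounded operators on \<open>L\<^sup>2(\<T>\<^sup>n)\<close>\<close>

lemma norm_scaleC_torus_L2: "norm (c *\<^sub>C (f :: 'n::finite torus_L2)) = cmod c * norm f"
proof -
  have "cinner f (c *\<^sub>C f) = cnj c * cinner f f"
    using cinner_commute[of f "c *\<^sub>C f"] by (simp add: cinner_scaleC_left cinner_self(1))
  then have "cinner (c *\<^sub>C f) (c *\<^sub>C f) = c * cnj c * cinner f f"
    by (simp only: cinner_scaleC_left mult.assoc)
  then have "inner (c *\<^sub>C f) (c *\<^sub>C f) = (cmod c)\<^sup>2 * inner f f"
    by (simp only: cinner_self complex_norm_square[symmetric] of_real_mult[symmetric] of_real_eq_iff)
  then show ?thesis by (simp add: norm_eq_sqrt_inner real_sqrt_mult)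
qed

lemma scaleC_torus_L2_simps:
  fixes f g :: "'n::finite torus_L2"
  shows "c *\<^sub>C (f + g) = c *\<^sub>C f + c *\<^sub>C g"
    and "(c + d) *\<^sub>C f = c *\<^sub>C f + d *\<^sub>C f"
    and "c *\<^sub>C d *\<^sub>C f = (c * d) *\<^sub>C f"
    and "1 *\<^sub>C f = f"
    and "r *\<^sub>R f = complex_of_real r *\<^sub>C f"
  by (transfer, auto simp: torus_ae_eq_def algebra_simps intro!: square_integrable_add square_integrable_cmult; fail)+
     (rule scaleR_torus_L2_def)

lemma bounded_linear_scaleC_torus_L2: "bounded_linear (\<lambda>f :: 'n::finite torus_L2. c *\<^sub>C f)"
  by (rule bounded_linear_intro[of _ "cmod c"])
     (simp_all add: scaleC_torus_L2_simps norm_scaleC_torus_L2 mult.commute)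

lemmas scaleC_torus_L2_linear = linear_simps[OF bounded_linear_scaleC_torus_L2]

text \<open>
  The bounded complex-linear operators on \<open>L\<^sup>2(\<T>\<^sup>n)\<close>; the library type of bounded linear
  functions contains all real-linear ones.
\<close>

typedef (overloaded) 'n torus_op =
  "{T :: ('n::finite) torus_L2 \<Rightarrow>\<^sub>L 'n torus_L2. \<forall>c f. blinfun_apply T (c *\<^sub>C f) = c *\<^sub>C blinfun_apply T f}"
  morphisms blinfun_of_op Abs_torus_op
  by (rule exI[of _ id_blinfun]) simp

setup_lifting type_definition_torus_op

definition op_apply :: "'n::finite torus_op \<Rightarrow> 'n torus_L2 \<Rightarrow> 'n torus_L2" where
  "op_apply T = blinfun_apply (blinfun_of_op T)"

instantiation torus_op :: (finite) "{real_normed_algebra_1, scaleC}"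
begin

lift_definition zero_torus_op :: "'a torus_op" is 0
  by (simp add: scaleC_torus_L2_linear)

lift_definition one_torus_op :: "'a torus_op" is id_blinfun by simp

lift_definition plus_torus_op :: "'a torus_op \<Rightarrow> 'a torus_op \<Rightarrow> 'a torus_op" is "(+)"
  by (simp add: blinfun.add_left scaleC_torus_L2_simps)

lift_definition uminus_torus_op :: "'a torus_op \<Rightarrow> 'a torus_op" is uminus
  by (simp add: blinfun.minus_left scaleC_torus_L2_linear)

lift_definition minus_torus_op :: "'a torus_op \<Rightarrow> 'a torus_op \<Rightarrow> 'a torus_op" is "(-)"
  by (simp add: blinfun.diff_left scaleC_torus_L2_linear)

lift_definition times_torus_op :: "'a torus_op \<Rightarrow> 'a torus_op \<Rightarrow> 'a torus_op" is "(o\<^sub>L)"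
  by simp

lift_definition scaleR_torus_op :: "real \<Rightarrow> 'a torus_op \<Rightarrow> 'a torus_op" is "(*\<^sub>R)"
  by (simp add: blinfun.scaleR_left scaleC_torus_L2_linear)

lift_definition scaleC_torus_op :: "complex \<Rightarrow> 'a torus_op \<Rightarrow> 'a torus_op"
  is "\<lambda>c T. Blinfun (\<lambda>f. c *\<^sub>C f) o\<^sub>L T"
  by (simp add: bounded_linear_Blinfun_apply bounded_linear_scaleC_torus_L2
      scaleC_torus_L2_simps mult.commute)

lift_definition norm_torus_op :: "'a torus_op \<Rightarrow> real" is norm .

definition sgn_torus_op :: "'a torus_op \<Rightarrow> 'a torus_op" where
  "sgn_torus_op T = inverse (norm T) *\<^sub>R T"

definition dist_torus_op :: "'a torus_op \<Rightarrow> 'a torus_op \<Rightarrow> real" where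
  "dist_torus_op S T = norm (S - T)"

definition uniformity_torus_op :: "('a torus_op \<times> 'a torus_op) filter" where
  "uniformity_torus_op = (INF e\<in>{0 <..}. principal {(x, y). dist x y < e})"

definition open_torus_op :: "'a torus_op set \<Rightarrow> bool" where
  "open_torus_op U = (\<forall>x\<in>U. eventually (\<lambda>(x', y). x' = x \<longrightarrow> y \<in> U) uniformity)"

instance
proof
  fix a b c :: "'a torus_op" and r s :: real
  show "a + b + c = a + (b + c)" by transfer simp
  show "a + b = b + a" by transfer simp
  show "0 + a = a" by transfer simp
  show "- a + a = 0" by transfer simp
  show "a - b = a + - b" by transfer simp
  show "r *\<^sub>R (a + b) = r *\<^sub>R a + r *\<^sub>R b" by transfer (simp add: scaleR_add_right)
  show "(r + s) *\<^sub>R a = r *\<^sub>R a + s *\<^sub>R a" by transfer (simp add: scaleR_add_left)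
  show "r *\<^sub>R s *\<^sub>R a = (r * s) *\<^sub>R a" by transfer simp
  show "1 *\<^sub>R a = a" by transfer simp
  show "a * b * c = a * (b * c)" by transfer (auto intro!: blinfun_eqI)
  show "(a + b) * c = a * c + b * c" by transfer (auto intro!: blinfun_eqI simp: blinfun.bilinear_simps)
  show "a * (b + c) = a * b + a * c" by transfer (auto intro!: blinfun_eqI simp: blinfun.bilinear_simps)
  show "r *\<^sub>R a * b = r *\<^sub>R (a * b)" by transfer (auto intro!: blinfun_eqI simp: blinfun.bilinear_simps)
  show "a * r *\<^sub>R b = r *\<^sub>R (a * b)" by transfer (auto intro!: blinfun_eqI simp: blinfun.bilinear_simps)
  show "1 * a = a" by transfer (auto intro!: blinfun_eqI)
  show "a * 1 = a" by transfer (auto intro!: blinfun_eqI)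
  show "sgn a = inverse (norm a) *\<^sub>R a" by (rule sgn_torus_op_def)
  show "dist a b = norm (a - b)" by (rule dist_torus_op_def)
  show "uniformity = (INF e\<in>{0 <..}. principal {(x, y :: 'a torus_op). dist x y < e})"
    by (rule uniformity_torus_op_def)
  show "open U = (\<forall>x\<in>U. \<forall>\<^sub>F (x', y) in uniformity. x' = x \<longrightarrow> y \<in> U)" for U :: "'a torus_op set"
    by (rule open_torus_op_def)
  show "norm a = 0 \<longleftrightarrow> a = 0" by transfer simp
  show "norm (a + b) \<le> norm a + norm b" by transfer (rule norm_triangle_ineq)
  show "norm (r *\<^sub>R a) = \<bar>r\<bar> * norm a" by transfer simp
  show "norm (a * b) \<le> norm a * norm b" by transfer (rule norm_blinfun_compose)
  have "norm (abs_torus_L2 (\<lambda>_. 1) :: 'a torus_L2) ^ 2 = 1"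
    using norm_abs_torus_L2[OF square_integrable_const[of 1]]
    by (simp add: emeasure_torus_measure_UNIV)
  then have nz: "abs_torus_L2 (\<lambda>_. 1) \<noteq> (0 :: 'a torus_L2)" by auto
  show norm1: "norm (1 :: 'a torus_op) = 1"
  proof transfer
    have "norm (id_blinfun :: 'a torus_L2 \<Rightarrow>\<^sub>L 'a torus_L2) \<le> 1"
      by (rule norm_blinfun_bound) auto
    moreover have "norm (abs_torus_L2 (\<lambda>_. 1) :: 'a torus_L2) \<le> norm (id_blinfun :: 'a torus_L2 \<Rightarrow>\<^sub>L 'a torus_L2) * norm (abs_torus_L2 (\<lambda>_. 1) :: 'a torus_L2)"
      by (metis norm_blinfun id_blinfun.rep_eq)
    then have "1 \<le> norm (id_blinfun :: 'a torus_L2 \<Rightarrow>\<^sub>L 'a torus_L2)"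
      using nz by simp
    ultimately show "norm (id_blinfun :: 'a torus_L2 \<Rightarrow>\<^sub>L 'a torus_L2) = 1" by simp
  qed
  show "(0 :: 'a torus_op) \<noteq> 1"
  proof
    assume "(0 :: 'a torus_op) = 1"
    then have "norm (0 :: 'a torus_op) = 1" using norm1 by simp
    then show False by transfer simp
  qed
qed

end

instance torus_op :: (finite) banach
proof
  fix X :: "nat \<Rightarrow> 'a torus_op"
  assume X: "Cauchy X"
  have dist: "dist (blinfun_of_op S) (blinfun_of_op T) = dist S T" for S T :: "'a torus_op"
    by (simp add: dist_norm norm_torus_op.rep_eq minus_torus_op.rep_eq)
  have "Cauchy (\<lambda>k. blinfun_of_op (X k))"
    using X by (simp add: Cauchy_def dist)
  then obtain L where L: "(\<lambda>k. blinfun_of_op (X k)) \<longlonglongrightarrow> L"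
    using Cauchy_convergent convergent_def by blast
  have lim: "(\<lambda>k. blinfun_apply (blinfun_of_op (X k)) f) \<longlonglongrightarrow> blinfun_apply L f" for f
    using L by (intro tendsto_intros)
  have "blinfun_apply L (c *\<^sub>C f) = c *\<^sub>C blinfun_apply L f" for c f
  proof (rule LIMSEQ_unique)
    show "(\<lambda>k. blinfun_apply (blinfun_of_op (X k)) (c *\<^sub>C f)) \<longlonglongrightarrow> blinfun_apply L (c *\<^sub>C f)"
      by (rule lim)
    have "blinfun_apply (blinfun_of_op (X k)) (c *\<^sub>C f) = c *\<^sub>C blinfun_apply (blinfun_of_op (X k)) f" for k
      using blinfun_of_op[of "X k"] by simp
    then show "(\<lambda>k. blinfun_apply (blinfun_of_op (X k)) (c *\<^sub>C f)) \<longlonglongrightarrow> c *\<^sub>C blinfun_apply L f"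
      using bounded_linear.tendsto[OF bounded_linear_scaleC_torus_L2 lim] by simp
  qed
  then have "blinfun_of_op (Abs_torus_op L) = L" by (simp add: Abs_torus_op_inverse)
  then have "X \<longlonglongrightarrow> Abs_torus_op L"
    using L by (simp add: tendsto_iff flip: dist)
  then show "convergent X" by (auto simp: convergent_def)
qed

lemma square_integrable_twist:
  fixes \<theta> :: "real^'n::finite^'n"
  assumes "f \<in> square_integrable"
  shows "(\<lambda>x. cis (x $ j) * f (x + pi *\<^sub>R column j \<theta>)) \<in> square_integrable" (is ?A)
    and "(\<integral>\<^sup>+x. ennreal ((cmod (cis (x $ j) * f (x + pi *\<^sub>R column j \<theta>)))\<^sup>2) \<partial>torus_measure)
       = (\<integral>\<^sup>+x. ennreal ((cmod (f x))\<^sup>2) \<partial>torus_measure)" (is ?B)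
proof -
  note f = square_integrableD[OF assms]
  note [measurable] = f(1)
  have per: "torus_periodic (\<lambda>x. ennreal ((cmod (f x))\<^sup>2))"
    using f(3) by (simp add: torus_periodic_def)
  show ?B
    using nn_integral_torus_translate[OF _ per, of "pi *\<^sub>R column j \<theta>"] by (simp add: norm_mult)
  have fin: "(\<integral>\<^sup>+x. ennreal ((cmod (f x))\<^sup>2) \<partial>torus_measure) < \<infinity>"
    by (simp add: norm_abs_torus_L2[OF assms])
  show ?A
  proof (rule square_integrableI)
    have "(\<lambda>x :: real^'n. cis (x $ j)) \<in> borel_measurable borel"
      by (intro borel_measurable_continuous_onI continuous_intros)
    then show "(\<lambda>x. cis (x $ j) * f (x + pi *\<^sub>R column j \<theta>)) \<in> borel_measurable borel"
      by measurable
    have "cis ((x + axis i (2 * pi)) $ j) = cis (x $ j)" for x :: "real^'n" and i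
      by (simp add: axis_def cis_mult[symmetric])
    moreover have "f (x + axis i (2 * pi) + pi *\<^sub>R column j \<theta>) = f (x + pi *\<^sub>R column j \<theta>)" for x i
      using f(3) unfolding torus_periodic_def by (metis add.assoc add.commute)
    ultimately show "torus_periodic (\<lambda>x. cis (x $ j) * f (x + pi *\<^sub>R column j \<theta>))"
      unfolding torus_periodic_def by simp
  qed (use fin \<open>?B\<close> in simp)
qed

text \<open>\<open>(U\<^sub>j \<xi>)(x) = e\<^bsup>i x\<^sub>j\<^esup> \<xi>(x + \<pi> \<theta>\<^sub>j)\<close>, where \<open>\<theta>\<^sub>j\<close> is the \<open>j\<close>-th column of \<open>\<theta>\<close>.\<close>

lift_definition torus_twist :: "real^'n::finite^'n \<Rightarrow> 'n \<Rightarrow> 'n torus_L2 \<Rightarrow> 'n torus_L2"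
  is "\<lambda>\<theta> j f x. cis (x $ j) * f (x + pi *\<^sub>R column j \<theta>)"
proof -
  fix \<theta> :: "real^'n^'n" and j :: 'n and f g :: "real^'n \<Rightarrow> complex"
  assume "torus_ae_eq f g"
  then have f: "f \<in> square_integrable" and g: "g \<in> square_integrable"
    and ae: "AE x in torus_measure. f x = g x"
    by (auto simp: torus_ae_eq_def)
  note [measurable] = square_integrableD(1)[OF f] square_integrableD(1)[OF g]
  let ?h = "\<lambda>x. indicator {x. f x \<noteq> g x} x :: ennreal"
  have per: "torus_periodic ?h"
    using square_integrableD(3)[OF f] square_integrableD(3)[OF g]
    by (simp add: torus_periodic_def indicator_def)
  have "(\<integral>\<^sup>+x. ?h (x + pi *\<^sub>R column j \<theta>) \<partial>torus_measure) = (\<integral>\<^sup>+x. ?h x \<partial>torus_measure)"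
    by (rule nn_integral_torus_translate[OF _ per]) measurable
  also have "\<dots> = 0"
    using ae by (subst nn_integral_0_iff_AE) (auto elim!: AE_mp)
  finally have "AE x in torus_measure. ?h (x + pi *\<^sub>R column j \<theta>) = 0"
    by (subst (asm) nn_integral_0_iff_AE) auto
  then have "AE x in torus_measure. f (x + pi *\<^sub>R column j \<theta>) = g (x + pi *\<^sub>R column j \<theta>)"
    by (auto elim!: AE_mp simp: indicator_def split: if_splits)
  then show "torus_ae_eq (\<lambda>x. cis (x $ j) * f (x + pi *\<^sub>R column j \<theta>)) (\<lambda>x. cis (x $ j) * g (x + pi *\<^sub>R column j \<theta>))"
    using square_integrable_twist(1)[OF f] square_integrable_twist(1)[OF g]
    by (auto simp: torus_ae_eq_def)
qed

lemma torus_twist_add: "torus_twist \<theta> j (f + g) = torus_twist \<theta> j f + torus_twist \<theta> j g"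
proof (transfer, goal_cases)
  case (1 \<theta> j f g)
  then show ?case
    using square_integrable_twist(1)[OF square_integrable_add[of f g]]
    by (simp add: torus_ae_eq_def distrib_left)
qed

lemma torus_twist_scaleC: "torus_twist \<theta> j (c *\<^sub>C f) = c *\<^sub>C torus_twist \<theta> j f"
proof (transfer, goal_cases)
  case (1 \<theta> j c f)
  then show ?case
    using square_integrable_twist(1)[OF square_integrable_cmult[of f c]]
    by (simp add: torus_ae_eq_def mult.left_commute)
qed

lemma norm_torus_twist: "norm (torus_twist \<theta> j f) = norm f"
proof -
  define h where "h = rep_torus_L2 f"
  have h: "h \<in> square_integrable" "f = abs_torus_L2 h"
    by (simp_all add: h_def rep_torus_L2_square_integrable abs_rep_torus_L2)
  have "torus_twist \<theta> j f = abs_torus_L2 (\<lambda>x. cis (x $ j) * h (x + pi *\<^sub>R column j \<theta>))"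
    using h by (simp add: torus_twist.abs_eq torus_ae_eq_def)
  then have "ennreal ((norm (torus_twist \<theta> j f))\<^sup>2) = ennreal ((norm f)\<^sup>2)"
    using norm_abs_torus_L2[OF square_integrable_twist(1)[OF h(1), of j \<theta>]]
      norm_abs_torus_L2[OF h(1)] square_integrable_twist(2)[OF h(1), of j \<theta>] h(2) by simp
  then show ?thesis by (simp add: ennreal_inj)
qed

lemma bounded_linear_torus_twist: "bounded_linear (torus_twist \<theta> j)"
  by (rule bounded_linear_intro[of _ 1])
     (simp_all add: torus_twist_add scaleC_torus_L2_simps torus_twist_scaleC norm_torus_twist)

lift_definition ncU :: "real^'n::finite^'n \<Rightarrow> 'n \<Rightarrow> 'n torus_op"
  is "\<lambda>\<theta> j. Blinfun (torus_twist \<theta> j)"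
  by (simp add: bounded_linear_Blinfun_apply bounded_linear_torus_twist torus_twist_scaleC)

lemma ncU_apply:
  assumes "f \<in> square_integrable"
  shows "op_apply (ncU \<theta> j) (abs_torus_L2 f) =
         abs_torus_L2 (\<lambda>x. cis (x $ j) * f (x + pi *\<^sub>R column j \<theta>))"
  using assms by (simp add: op_apply_def ncU.rep_eq bounded_linear_Blinfun_apply
      bounded_linear_torus_twist torus_twist.abs_eq torus_ae_eq_def)

instantiation vec :: (scaleC, finite) scaleC
begin

definition scaleC_vec :: "complex \<Rightarrow> 'a^'b \<Rightarrow> 'a^'b" where
  "scaleC_vec c v = (\<chi> i. c *\<^sub>C v $ i)"

instance ..

end

section \<open>Integration\<close>

text \<open>
  The space of operators is not separable, so the Bochner integral of the library is not
  available for operator-valued maps; vector-valued integrals are taken in the sense of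
  Gelfand and Pettis. As for the library integral, the value is \<open>0\<close> if the integral
  does not exist.
\<close>

definition has_weak_integral ::
    "'a measure \<Rightarrow> ('a \<Rightarrow> 'b::real_normed_vector) \<Rightarrow> 'b \<Rightarrow> bool" where
  "has_weak_integral M F v \<longleftrightarrow>
     (\<forall>\<phi> :: 'b \<Rightarrow> real. bounded_linear \<phi> \<longrightarrow> has_bochner_integral M (\<lambda>x. \<phi> (F x)) (\<phi> v))"

definition weak_integral :: "'a measure \<Rightarrow> ('a \<Rightarrow> 'b::real_normed_vector) \<Rightarrow> 'b" where
  "weak_integral M F =
     (if \<exists>v. has_weak_integral M F v then THE v. has_weak_integral M F v else 0)"

text \<open>
  The surface measure of the unit sphere: \<open>\<sigma>(E) = n \<lambda>({r \<omega> | 0 < r < 1, \<omega> \<in> E})\<close>,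
  where \<open>n\<close> is the dimension and \<open>\<lambda>\<close> is Lebesgue measure.
\<close>

definition sphere_measure :: "'a::euclidean_space measure" where
  "sphere_measure =
     scale_measure (of_nat DIM('a))
       (distr (restrict_space lborel (ball 0 1 - {0})) (restrict_space borel (sphere 0 1)) sgn)"

lemma emeasure_sphere_measure:
  fixes E :: "'a::euclidean_space set"
  assumes E: "E \<in> sets borel" "E \<subseteq> sphere 0 1"
  shows "emeasure sphere_measure E =
    of_nat DIM('a) * emeasure lborel {x \<in> ball 0 1 - {0}. sgn x \<in> E}"
proof -
  let ?B = "ball 0 1 - {0} :: 'a set"
  let ?S = "restrict_space borel (sphere 0 1) :: 'a measure"
  have meas: "sgn \<in> measurable (restrict_space lborel ?B) ?S"
  proof (rule measurable_restrict_space2)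
    have "(sgn :: 'a \<Rightarrow> 'a) \<in> borel_measurable borel"
      unfolding sgn_div_norm by measurable
    then show "sgn \<in> borel_measurable (restrict_space lborel ?B)"
      by (intro measurable_restrict_space1) simp
  qed (auto simp: space_restrict_space norm_sgn)
  have "E \<in> sets ?S"
    using E by (simp add: sets_restrict_space_iff)
  then have "emeasure (distr (restrict_space lborel ?B) ?S sgn) E
      = emeasure (restrict_space lborel ?B) (sgn -` E \<inter> space (restrict_space lborel ?B))"
    by (rule emeasure_distr[OF meas])
  also have "sgn -` E \<inter> space (restrict_space lborel ?B) = {x \<in> ?B. sgn x \<in> E}"
    by (auto simp: space_restrict_space)
  also have "emeasure (restrict_space lborel ?B) \<dots> = emeasure lborel \<dots>"
    by (rule emeasure_restrict_space) auto
  finally show ?thesis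
    by (simp add: sphere_measure_def)
qed

section \<open>The noncommutative torus\<close>

definition inv_el :: "'a::ring_1 \<Rightarrow> 'a" where
  "inv_el a = (THE b. a * b = 1 \<and> b * a = 1)"

definition int_pow :: "'a::ring_1 \<Rightarrow> int \<Rightarrow> 'a" where
  "int_pow a m = (if 0 \<le> m then a ^ nat m else inv_el a ^ nat (- m))"

text \<open>
  \<open>U\<^sup>k = U\<^sub>1\<^bsup>k\<^sub>1\<^esup> \<cdots> U\<^sub>n\<^bsup>k\<^sub>n\<^esup>\<close>; the factors do not commute, and their order is
  given by the linear order of the index type.
\<close>

definition ncU_pow :: "real^'n::{finite,linorder}^'n::{finite,linorder} \<Rightarrow> int^'n::{finite,linorder} \<Rightarrow> 'n torus_op" where
  "ncU_pow \<theta> k = prod_list (map (\<lambda>j. int_pow (ncU \<theta> j) (k $ j)) (sorted_list_of_set UNIV))"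

definition rapidly_decaying :: "(int^'n::finite \<Rightarrow> complex) \<Rightarrow> bool" where
  "rapidly_decaying u \<longleftrightarrow>
     (\<forall>N. \<exists>C. \<forall>k. (1 + (\<Sum>i\<in>UNIV. \<bar>real_of_int (k $ i)\<bar>)) ^ N * cmod (u k) \<le> C)"

definition nc_smooth :: "real^'n::{finite,linorder}^'n::{finite,linorder} \<Rightarrow> 'n torus_op set" where
  "nc_smooth \<theta> =
     {a. \<exists>u. rapidly_decaying u \<and> ((\<lambda>k. u k *\<^sub>C ncU_pow \<theta> k) has_sum a) UNIV}"

definition is_adjoint :: "'n::finite torus_op \<Rightarrow> 'n torus_op \<Rightarrow> bool" where
  "is_adjoint S T \<longleftrightarrow> (\<forall>f g. cinner (op_apply S f) g = cinner f (op_apply T g))"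

text \<open>
  Spectra are those of bounded operators on \<open>L\<^sup>2(\<T>\<^sup>n)\<close> and on its \<open>m\<close>-fold direct sum;
  by spectral permanence they agree with the spectra relative to the generated
  C*-algebra and to matrices over it.
\<close>

definition op_spectrum :: "'n::finite torus_op \<Rightarrow> complex set" where
  "op_spectrum a = {z. \<nexists>b. (z *\<^sub>C 1 - a) * b = 1 \<and> b * (z *\<^sub>C 1 - a) = 1}"

definition op_positive :: "'n::finite torus_op \<Rightarrow> bool" where
  "op_positive a \<longleftrightarrow> is_adjoint a a \<and> op_spectrum a \<subseteq> \<real>\<^sub>\<ge>\<^sub>0"

definition mat_spectrum :: "'n::finite torus_op^'m^'m \<Rightarrow> complex set" where
  "mat_spectrum g = {z. \<not> invertible (z *\<^sub>C mat 1 - g)}"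

definition mat_positive :: "'n::finite torus_op^'m^'m \<Rightarrow> bool" where
  "mat_positive g \<longleftrightarrow> (\<forall>i j. is_adjoint (g $ i $ j) (g $ j $ i)) \<and> mat_spectrum g \<subseteq> \<real>\<^sub>\<ge>\<^sub>0"

definition nc_smooth_pos :: "real^'n::{finite,linorder}^'n::{finite,linorder} \<Rightarrow> 'n torus_op set" where
  "nc_smooth_pos \<theta> =
     {a \<in> nc_smooth \<theta>. op_positive a \<and> (\<exists>b\<in>nc_smooth \<theta>. a * b = 1 \<and> b * a = 1)}"

definition riem_metrics :: "real^'n::{finite,linorder}^'n::{finite,linorder} \<Rightarrow> ('n torus_op^'n::{finite,linorder}^'n::{finite,linorder}) set" where
  "riem_metrics \<theta> =
     {g. (\<forall>i j. g $ i $ j \<in> nc_smooth \<theta>) \<and> mat_positive g \<and>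
         (\<forall>i j. is_adjoint (g $ i $ j) (g $ i $ j)) \<and>
         (\<exists>h. g ** h = mat 1 \<and> h ** g = mat 1 \<and>
              (\<forall>i j. h $ i $ j \<in> nc_smooth \<theta> \<and> is_adjoint (h $ i $ j) (h $ i $ j)))}"

section \<open>Riemannian metrics and densities\<close>

definition op_sqrt :: "'n::finite torus_op \<Rightarrow> 'n torus_op" where
  "op_sqrt a = (THE b. op_positive b \<and> b * b = a)"

text \<open>\<open>|\<xi>|\<^sub>g = (\<Sum>\<^sub>i\<^sub>j g\<^sup>i\<^sup>j \<xi>\<^sub>i \<xi>\<^sub>j)\<^bsup>1/2\<^esup>\<close>, with \<open>(g\<^sup>i\<^sup>j)\<close> the inverse matrix of \<open>g\<close>.\<close>

definition covec_norm :: "'n::finite torus_op^'n^'n \<Rightarrow> real^'n \<Rightarrow> 'n torus_op" where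
  "covec_norm g \<xi> = op_sqrt (\<Sum>i\<in>UNIV. \<Sum>j\<in>UNIV. (\<xi> $ i * \<xi> $ j) *\<^sub>R matrix_inv g $ i $ j)"

text \<open>
  Holomorphic functional calculus: \<open>f(g) = (1 / 2 \<pi> \<i>) \<integral>\<^sub>\<gamma> f(z) (z - g)\<^bsup>-1\<^esup> dz\<close> for a closed path
  \<open>\<gamma>\<close> in \<open>S\<close> winding once around the spectrum of \<open>g\<close> and not at all around points outside \<open>S\<close>.
  It is meaningful if \<open>S\<close> is an open set containing the spectrum and \<open>f\<close> is holomorphic on \<open>S\<close>.
\<close>

definition mat_hol_calc ::
    "complex set \<Rightarrow> (complex \<Rightarrow> complex) \<Rightarrow> 'n::finite torus_op^'m^'m \<Rightarrow> 'n torus_op^'m^'m" where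
  "mat_hol_calc S f g =
     (THE b. \<exists>\<gamma> I.
        valid_path \<gamma> \<and> pathfinish \<gamma> = pathstart \<gamma> \<and> path_image \<gamma> \<subseteq> S - mat_spectrum g \<and>
        (\<forall>z\<in>mat_spectrum g. winding_number \<gamma> z = 1) \<and> (\<forall>z. z \<notin> S \<longrightarrow> winding_number \<gamma> z = 0) \<and>
        ((\<lambda>t. (f (\<gamma> t) * vector_derivative \<gamma> (at t within {0..1})) *\<^sub>C
              matrix_inv (\<gamma> t *\<^sub>C mat 1 - g)) has_integral I) {0..1} \<and>
        b = (1 / (2 * of_real pi * \<i>)) *\<^sub>C I)"

definition mat_log :: "'n::finite torus_op^'m^'m \<Rightarrow> 'n torus_op^'m^'m" where
  "mat_log g = mat_hol_calc (- \<real>\<^sub>\<le>\<^sub>0) Ln g"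

definition nc_det :: "'n::finite torus_op^'m^'m \<Rightarrow> 'n torus_op" where
  "nc_det g = exp (trace (mat_log g))"

definition riem_density :: "'n::finite torus_op^'m^'m \<Rightarrow> 'n torus_op" where
  "riem_density g = exp ((1 / 2) *\<^sub>R trace (mat_log g))"

definition spectral_density :: "'n::finite torus_op^'n^'n \<Rightarrow> 'n torus_op" where
  "spectral_density g =
     inverse (measure sphere_measure (sphere 0 1 :: (real^'n) set)) *\<^sub>R
       weak_integral sphere_measure (\<lambda>\<xi> :: real^'n. inv_el (covec_norm g \<xi>) ^ CARD('n))"

end

theory Submission
  imports Defs "HOL-Complex_Analysis.Complex_Analysis" "HOL-Probability.Distributions"
begin

text \<open>
  On the unit sphere \<open>|\<xi>|\<^sub>g\<^sup>2 = c (1 - b \<xi>)\<close> with \<open>\<parallel>b \<xi>\<parallel> \<le> r < 1\<close>, so that \<open>|\<xi>|\<^sub>g\<close> to the power \<open>- n\<close> is a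
  binomial series in \<open>b \<xi>\<close>. The powers of \<open>b \<xi>\<close> decay geometrically in every seminorm of the smooth
  algebra, which makes the density smooth; integrating the Gaussian in polar coordinates gives the same
  series term by term.

  If the entries of \<open>g\<close> commute, \<open>g\<close> is joined to a multiple of the identity by the segment
  \<open>g\<^sub>s = c (1 - s B)\<close>. The \<open>s\<close>-derivative of \<open>exp (- Tr (log g\<^sub>s) / 2 - |\<xi>|\<^sup>2)\<close>, with the norm of \<open>g\<^sub>s\<close>, is a
  divergence in \<open>\<xi>\<close>, so its integral over \<open>\<real>\<^sup>n\<close> does not depend on \<open>s\<close>. Likewise
  \<open>exp (- Tr (log g\<^sub>s))\<close> times the Leibniz determinant of \<open>g\<^sub>s\<close> is constant by Jacobi's formula.
\<close>

text \<open>The entries of g need not commute, so the forms |\<xi>|_g^2 for different \<xi> cannot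
  be diagonalized together, and functions of operators are taken as norm-convergent series.
  Positivity is used as a lower bound d of the quadratic form (\<open>coercive\<close>): with an
  upper bound c of the norm it makes b = 1 - a / c a strict contraction, and inverse, square root,
  powers and logarithm of a = c (1 - b) are series in b. One pair c, d serves all unit covectors;
  this uniformity lets both smoothness and strict positivity survive the integral over the sphere.
  As that integral is weak, identities are tested on bounded real functionals, which turn them into
  statements on scalar series.

  In the self-compatible case the entries are still operators, and a deformation to the scalar c
  stands in for a diagonalization. All operators met on the way lie in the bicommutant of the
  entries, which is commutative, so exponentials can be differentiated as in calculus. The contour
  integral that defines log g is evaluated once, as ln c minus the series
  \<open>nlog\<close>.\<close>

no_notation fps_nth (infixl "$" 75)

section \<open>Real powers of \<open>1 - b\<close> in a Banach algebra\<close>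

text \<open>The coefficient of b^m in (1 - b) to the power - s. With this sign the coefficients are
  nonnegative for s \<ge> 0, which \<open>gauss_series_integral\<close> uses to remove absolute
  values.\<close>

definition ncoef :: "real \<Rightarrow> nat \<Rightarrow> real" where
  "ncoef s m = pochhammer s m / fact m"

definition npow :: "real \<Rightarrow> 'a::{real_normed_algebra_1,banach} \<Rightarrow> 'a" where
  "npow s b = (\<Sum>m. ncoef s m *\<^sub>R b ^ m)"

lemma ncoef_gbinomial: "ncoef s m = (- 1) ^ m * ((- s) gchoose m)"
  by (simp add: ncoef_def gbinomial_pochhammer flip: power_mult_distrib mult.assoc)

lemma summable_ncoef:
  assumes "0 \<le> r" "r < 1"
  shows "summable (\<lambda>m. \<bar>ncoef s m\<bar> * r ^ m)"
proof -
  have "ereal (norm r) < conv_radius (\<lambda>n. (- s) gchoose n)"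
    using assms by (simp add: conv_radius_gchoose)
  from abs_summable_in_conv_radius[OF this] show ?thesis
    using assms by (simp add: ncoef_gbinomial abs_mult power_abs)
qed

text \<open>Chu-Vandermonde, with the signs (-1)^i and (-1)^(m - i) collected into (-1)^m; this is
  the Cauchy product behind the power law \<open>npow_mult\<close>.\<close>

lemma ncoef_Vandermonde: "(\<Sum>i\<le>m. ncoef s i * ncoef t (m - i)) = ncoef (s + t) m"
proof -
  have "ncoef s i * ncoef t (m - i) = (- 1) ^ m * (((- s) gchoose i) * ((- t) gchoose (m - i)))"
    if "i \<le> m" for i
  proof -
    have "(- 1) ^ i * (- 1) ^ (m - i) = (- 1 :: real) ^ m"
      using that by (simp flip: power_add)
    moreover have "ncoef s i * ncoef t (m - i) =
        ((- 1) ^ i * (- 1) ^ (m - i)) * (((- s) gchoose i) * ((- t) gchoose (m - i)))"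
      by (simp only: ncoef_gbinomial mult_ac)
    ultimately show ?thesis by simp
  qed
  then show ?thesis
    using gbinomial_Vandermonde[of "- s" "- t" m]
    by (simp add: ncoef_gbinomial[of "s + t"] atMost_atLeast0 flip: sum_distrib_left)
qed

lemma norm_power_le:
  fixes b :: "'a::{real_normed_algebra_1,banach}"
  assumes "norm b \<le> r"
  shows "norm (b ^ m) \<le> r ^ m"
  using norm_power_ineq[of b m] power_mono[OF assms norm_ge_zero, of m] by linarith

lemma summable_norm_npow:
  fixes b :: "'a::{real_normed_algebra_1,banach}"
  assumes "norm b < 1"
  shows "summable (\<lambda>m. norm (ncoef s m *\<^sub>R b ^ m))"
proof (rule summable_comparison_test'[OF summable_ncoef[OF norm_ge_zero assms, of s], of 0])
  fix m
  show "norm (norm (ncoef s m *\<^sub>R b ^ m)) \<le> \<bar>ncoef s m\<bar> * norm b ^ m"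
    using mult_left_mono[OF norm_power_ineq[of b m], of "\<bar>ncoef s m\<bar>"] by simp
qed

lemma npow_sums:
  fixes b :: "'a::{real_normed_algebra_1,banach}"
  assumes "norm b < 1"
  shows "(\<lambda>m. ncoef s m *\<^sub>R b ^ m) sums npow s b"
  unfolding npow_def by (rule summable_sums[OF summable_norm_cancel[OF summable_norm_npow[OF assms]]])

text \<open>The majorant depends on r and s only, which makes the bound uniform over a ball;
  \<open>coercive_npow_uniform\<close> relies on this.\<close>

lemma norm_npow_le:
  fixes b :: "'a::{real_normed_algebra_1,banach}"
  assumes "norm b \<le> r" "r < 1"
  shows "norm (npow s b) \<le> (\<Sum>m. \<bar>ncoef s m\<bar> * r ^ m)"
proof -
  have r: "0 \<le> r" using assms(1) norm_ge_zero[of b] by linarith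
  have "norm (npow s b) \<le> (\<Sum>m. norm (ncoef s m *\<^sub>R b ^ m))"
    unfolding npow_def using assms summable_norm[OF summable_norm_npow[of b s]] by simp
  also have "\<dots> \<le> (\<Sum>m. \<bar>ncoef s m\<bar> * r ^ m)"
  proof (rule suminf_le)
    show "norm (ncoef s m *\<^sub>R b ^ m) \<le> \<bar>ncoef s m\<bar> * r ^ m" for m
      using mult_left_mono[OF norm_power_le[OF assms(1), of m], of "\<bar>ncoef s m\<bar>"] by simp
  qed (use assms r summable_norm_npow[of b s] summable_ncoef[of r s] in auto)
  finally show ?thesis .
qed

lemma npow_mult:
  fixes b :: "'a::{real_normed_algebra_1,banach}"
  assumes "norm b < 1"
  shows "npow s b * npow t b = npow (s + t) b"
proof -
  have "npow s b * npow t b =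
      (\<Sum>m. \<Sum>i\<le>m. (ncoef s i *\<^sub>R b ^ i) * (ncoef t (m - i) *\<^sub>R b ^ (m - i)))"
    unfolding npow_def by (rule Cauchy_product[OF summable_norm_npow[OF assms] summable_norm_npow[OF assms]])
  also have "\<dots> = npow (s + t) b"
    unfolding npow_def
  proof (rule suminf_cong)
    fix m
    have "(\<Sum>i\<le>m. (ncoef s i *\<^sub>R b ^ i) * (ncoef t (m - i) *\<^sub>R b ^ (m - i)))
        = (\<Sum>i\<le>m. (ncoef s i * ncoef t (m - i)) *\<^sub>R b ^ m)"
      by (intro sum.cong) (simp_all flip: power_add)
    then show "(\<Sum>i\<le>m. (ncoef s i *\<^sub>R b ^ i) * (ncoef t (m - i) *\<^sub>R b ^ (m - i)))
        = ncoef (s + t) m *\<^sub>R b ^ m"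
      by (simp add: ncoef_Vandermonde flip: scaleR_left.sum)
  qed
  finally show ?thesis .
qed

lemma npow_0 [simp]: "npow 0 b = 1"
proof -
  have "ncoef 0 m *\<^sub>R b ^ m = (if m = 0 then 1 else 0)" for m
    by (cases m) (simp_all add: ncoef_def pochhammer_rec)
  then show ?thesis
    unfolding npow_def using sums_single[of 0 "\<lambda>_. 1 :: 'a"] by (simp add: sums_iff)
qed

text \<open>The Pochhammer symbol of - 1 vanishes from m = 2 on, so the series is finite. Through
  the power law this makes \<open>npow 1 b\<close> the inverse of 1 - b.\<close>

lemma npow_minus_one: "npow (- 1) b = 1 - b"
proof -
  have "ncoef (- 1) m *\<^sub>R b ^ m = (if m \<in> {0,1} then (if m = 0 then 1 else - b) else 0)" for m
  proof -
    consider "m = 0" | "m = 1" | k where "m = Suc (Suc k)"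
      by (metis One_nat_def not0_implies_Suc)
    then show ?thesis by cases (simp_all add: ncoef_def pochhammer_rec)
  qed
  then show ?thesis
    unfolding npow_def
    using sums_If_finite_set[of "{0,1}" "\<lambda>m. if m = 0 then 1 else - b"] by (simp add: sums_iff)
qed

lemma npow_power:
  fixes b :: "'a::{real_normed_algebra_1,banach}"
  assumes "norm b < 1"
  shows "npow s b ^ m = npow (real m * s) b"
  by (induction m) (simp_all add: npow_mult[OF assms] algebra_simps)

lemma npow_inverse:
  fixes b :: "'a::{real_normed_algebra_1,banach}"
  assumes "norm b < 1"
  shows "npow s b * npow (- s) b = 1"
  by (simp add: npow_mult[OF assms])

lemma neumann_inverse:
  fixes b :: "'a::{real_normed_algebra_1,banach}"
  assumes "norm b < 1"
  shows "(1 - b) * npow 1 b = 1" "npow 1 b * (1 - b) = 1"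
  using npow_inverse[OF assms, of 1] npow_inverse[OF assms, of "- 1"]
  by (simp_all add: npow_minus_one)

lemma invertible_of_norm_lt_1:
  fixes x :: "'a::{real_normed_algebra_1,banach}"
  assumes "norm (1 - x) < 1"
  shows "\<exists>y. x * y = 1 \<and> y * x = 1"
  using neumann_inverse[OF assms] by auto

lemma suminf_commute:
  fixes f :: "nat \<Rightarrow> 'a::real_normed_algebra"
  assumes "summable f" "\<And>m. x * f m = f m * x"
  shows "x * suminf f = suminf f * x"
  using suminf_mult[OF assms(1), of x] suminf_mult2[OF assms(1), of x] assms(2) by simp

lemma power_commute:
  fixes x b :: "'a::monoid_mult"
  assumes "x * b = b * x"
  shows "x * b ^ m = b ^ m * x"
  by (induction m) (simp_all add: mult.assoc[symmetric] assms, simp add: mult.assoc assms)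

lemma npow_commute:
  fixes b :: "'a::{real_normed_algebra_1,banach}"
  assumes "norm b < 1" "x * b = b * x"
  shows "x * npow s b = npow s b * x"
  unfolding npow_def
  by (rule suminf_commute[OF summable_norm_cancel[OF summable_norm_npow[OF assms(1)]]])
     (simp add: power_commute[OF assms(2)])

lemma inv_el_eqI:
  fixes a :: "'a::ring_1"
  assumes "a * b = 1" "b * a = 1"
  shows "inv_el a = b"
  unfolding inv_el_def
proof (rule the_equality)
  fix c assume "a * c = 1 \<and> c * a = 1"
  then show "c = b" using assms by (metis mult.assoc mult.left_neutral mult.right_neutral)
qed (use assms in simp)

section \<open>Banach algebras of operators on an inner product space\<close>

text \<open>Formulated over a real inner product so that it applies both to operators on the Hilbert
  space and to matrices acting on its direct sum. By \<open>norm_leI\<close> the norm is no larger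
  than the operator norm of the action, which turns form bounds into norm bounds. Completeness is
  required of the algebra, where the Neumann series live.\<close>

locale hilbert_rep =
  fixes act :: "'a::{real_normed_algebra_1,banach} \<Rightarrow> 'h::real_inner \<Rightarrow> 'h"
  assumes act_add: "act (a + b) v = act a v + act b v"
    and act_scaleR: "act (r *\<^sub>R a) v = r *\<^sub>R act a v"
    and act_mult: "act (a * b) v = act a (act b v)"
    and act_1: "act 1 v = v"
    and act_add_right: "act a (v + w) = act a v + act a w"
    and act_scaleR_right: "act a (r *\<^sub>R v) = r *\<^sub>R act a v"
    and norm_act: "norm (act a v) \<le> norm a * norm v"
    and norm_leI: "0 \<le> K \<Longrightarrow> (\<And>v. norm (act a v) \<le> K * norm v) \<Longrightarrow> norm a \<le> K"
begin

lemma bounded_linear_act: "bounded_linear (\<lambda>a. act a v)"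
  by (rule bounded_linear_intro[of _ "norm v"]) (simp_all add: act_add act_scaleR norm_act)

lemma bounded_linear_act_right: "bounded_linear (act a)"
  by (rule bounded_linear_intro[of _ "norm a"])
     (simp_all add: act_add_right act_scaleR_right norm_act mult.commute[of "norm _" "norm a"])

lemmas act_simps = linear_simps[OF bounded_linear_act] linear_simps[OF bounded_linear_act_right]

definition sa :: "'a \<Rightarrow> bool" where
  "sa a \<longleftrightarrow> (\<forall>v w. inner (act a v) w = inner v (act a w))"

text \<open>The value d = 0 expresses positivity, d > 0 strict positivity. A numerical bound is
  carried along because it passes to integrals.\<close>

definition coercive :: "real \<Rightarrow> 'a \<Rightarrow> bool" where
  "coercive d a \<longleftrightarrow> sa a \<and> (\<forall>v. d * (norm v)\<^sup>2 \<le> inner (act a v) v)"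

lemma coerciveD: "coercive d a \<Longrightarrow> sa a" "coercive d a \<Longrightarrow> d * (norm v)\<^sup>2 \<le> inner (act a v) v"
  by (simp_all add: coercive_def)

lemma coercive_mono: "coercive d a \<Longrightarrow> e \<le> d \<Longrightarrow> coercive e a"
  unfolding coercive_def by (meson mult_right_mono order_trans zero_le_power2)

lemma sa_add: "sa a \<Longrightarrow> sa b \<Longrightarrow> sa (a + b)"
  by (simp add: sa_def act_simps inner_simps)

lemma sa_diff: "sa a \<Longrightarrow> sa b \<Longrightarrow> sa (a - b)"
  by (simp add: sa_def act_simps inner_simps)

lemma sa_scaleR: "sa a \<Longrightarrow> sa (r *\<^sub>R a)"
  by (simp add: sa_def act_simps inner_simps)

lemma sa_0 [simp]: "sa 0" and sa_1 [simp]: "sa 1"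
  by (simp_all add: sa_def act_simps act_1)

lemma sa_sum: "(\<And>i. i \<in> I \<Longrightarrow> sa (f i)) \<Longrightarrow> sa (sum f I)"
  by (induction I rule: infinite_finite_induct) (auto intro: sa_add)

lemma sa_mult: "sa a \<Longrightarrow> sa b \<Longrightarrow> a * b = b * a \<Longrightarrow> sa (a * b)"
  unfolding sa_def by (metis act_mult)

lemma sa_power: "sa a \<Longrightarrow> sa (a ^ m)"
  by (induction m) (auto intro!: sa_mult simp: power_commutes)

lemma sa_lim:
  assumes "\<And>m. sa (f m)" "f \<longlonglongrightarrow> a"
  shows "sa a"
  unfolding sa_def
proof (intro allI)
  fix v w
  have "(\<lambda>m. inner (act (f m) v) w) \<longlonglongrightarrow> inner (act a v) w"
    by (intro tendsto_inner bounded_linear.tendsto[OF bounded_linear_act] assms tendsto_const)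
  moreover have "(\<lambda>m. inner v (act (f m) w)) \<longlonglongrightarrow> inner v (act a w)"
    by (intro tendsto_inner bounded_linear.tendsto[OF bounded_linear_act] assms tendsto_const)
  ultimately show "inner (act a v) w = inner v (act a w)"
    using assms(1) LIMSEQ_unique unfolding sa_def by fastforce
qed

lemma sa_sums:
  assumes "\<And>m. sa (f m)" "f sums a"
  shows "sa a"
  using assms(2) unfolding sums_def by (rule sa_lim[rotated]) (intro sa_sum assms)

lemma sa_npow: "sa b \<Longrightarrow> norm b < 1 \<Longrightarrow> sa (npow s b)"
  by (rule sa_sums[OF _ npow_sums]) (intro sa_scaleR sa_power)

lemma sa_exp: "sa a \<Longrightarrow> sa (exp a)"
  by (rule sa_sums[OF _ exp_converges]) (intro sa_scaleR sa_power)

lemma inner_act_le: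
  fixes v :: 'h
  shows "inner (act a v) v \<le> norm a * (norm v)\<^sup>2"
proof -
  have "inner (act a v) v \<le> norm (act a v) * norm v"
    using Cauchy_Schwarz_ineq2[of "act a v" v] by linarith
  also have "\<dots> \<le> norm a * norm v * norm v" by (intro mult_right_mono norm_act) auto
  finally show ?thesis by (simp add: power2_eq_square mult.assoc)
qed

lemma coercive_le_norm:
  fixes v :: 'h
  assumes "coercive d a" "v \<noteq> 0"
  shows "d \<le> norm a"
  using coerciveD(2)[OF assms(1), of v] inner_act_le[of a v] assms(2)
  by (meson mult_le_cancel_right order_trans zero_less_norm_iff zero_less_power not_le)

text \<open>The discriminant argument: the form at v + t w is a nonnegative polynomial in t of
  degree at most 2.\<close>

lemma form_Cauchy_Schwarz:
  assumes "coercive 0 a"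
  shows "(inner (act a v) w)\<^sup>2 \<le> inner (act a v) v * inner (act a w) w"
proof -
  let ?A = "inner (act a v) v" and ?B = "inner (act a v) w" and ?C = "inner (act a w) w"
  have C: "0 \<le> ?C" and A: "0 \<le> ?A" using assms by (auto simp: coercive_def)
  have *: "0 \<le> ?A + 2 * t * ?B + t\<^sup>2 * ?C" for t
  proof -
    have "0 \<le> inner (act a (v + t *\<^sub>R w)) (v + t *\<^sub>R w)" using assms by (auto simp: coercive_def)
    also have "\<dots> = ?A + t * inner (act a w) v + t * ?B + t\<^sup>2 * ?C"
      by (simp add: act_simps inner_simps algebra_simps power2_eq_square)
    also have "inner (act a w) v = ?B"
      using assms unfolding coercive_def sa_def by (metis inner_commute)
    finally show ?thesis by (simp add: algebra_simps)
  qed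
  show ?thesis
  proof (cases "?C = 0")
    case True
    have "?B = 0"
    proof (rule ccontr)
      assume "?B \<noteq> 0"
      \<comment> \<open>At this t the polynomial, which is linear in the present case, takes the
        value - 1.\<close>
      then show False using *[of "- (?A + 1) / (2 * ?B)"] True A by (simp add: field_simps)
    qed
    then show ?thesis using A C by simp
  next
    case False
    then have "?C > 0" using C by simp
    then have "0 \<le> ?C * (?A + 2 * (- ?B / ?C) * ?B + (- ?B / ?C)\<^sup>2 * ?C)"
      using *[of "- ?B / ?C"] by (intro mult_nonneg_nonneg) auto
    also have "\<dots> = ?A * ?C - ?B\<^sup>2"
      using \<open>?C > 0\<close> by (simp add: field_simps power2_eq_square)
    finally show ?thesis by simp
  qed
qed

text \<open>Cauchy-Schwarz for the form of a at v and a v gives |a v|^4 \<le> (a v, v) (a a v, a v)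
  \<le> (a v, v) r |a v|^2; a factor |a v|^2 cancels. This stands in for an argument with the square
  root of a.\<close>

lemma norm_act_sq_le:
  assumes "coercive 0 a" "\<And>w. inner (act a w) w \<le> r * (norm w)\<^sup>2"
  shows "(norm (act a v))\<^sup>2 \<le> r * inner (act a v) v"
proof -
  let ?x = "(norm (act a v))\<^sup>2"
  have A: "0 \<le> inner (act a v) v" using assms(1) by (auto simp: coercive_def)
  have "?x\<^sup>2 \<le> inner (act a v) v * inner (act a (act a v)) (act a v)"
    using form_Cauchy_Schwarz[OF assms(1), of v "act a v"] by (simp add: power2_norm_eq_inner)
  also have "\<dots> \<le> inner (act a v) v * (r * ?x)"
    by (intro mult_left_mono assms A)
  finally have "?x * ?x \<le> (r * inner (act a v) v) * ?x" by (simp add: power2_eq_square algebra_simps)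
  moreover have "0 < ?x \<or> act a v = 0" by auto
  moreover have "0 \<le> r * inner (act a v) v" if "act a v = 0" using that by simp
  ultimately show ?thesis by (metis mult_le_cancel_right norm_zero not_le power_zero_numeral)
qed

lemma norm_le_of_form:
  assumes "coercive 0 a" "\<And>w. inner (act a w) w \<le> r * (norm w)\<^sup>2" "0 \<le> r"
  shows "norm a \<le> r"
proof (rule norm_leI[OF assms(3)])
  fix v
  have "(norm (act a v))\<^sup>2 \<le> r * inner (act a v) v" by (rule norm_act_sq_le) fact+
  also have "\<dots> \<le> r * (r * (norm v)\<^sup>2)" by (intro mult_left_mono assms)
  finally have "(norm (act a v))\<^sup>2 \<le> (r * norm v)\<^sup>2" by (simp add: power2_eq_square algebra_simps)
  then show "norm (act a v) \<le> r * norm v" by (rule power2_le_imp_le) (simp add: assms(3))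
qed

text \<open>The form of 1 - a / c lies between 0 and 1 - d / c, and for a positive operator the
  upper bound of the form bounds the norm. All contractions b below arise here.\<close>

lemma norm_one_minus_le:
  assumes "coercive d a" "norm a \<le> c" "d \<le> c" "0 < c"
  shows "norm (1 - (1 / c) *\<^sub>R a) \<le> 1 - d / c"
proof (rule norm_le_of_form)
  have *: "inner (act (1 - (1 / c) *\<^sub>R a) v) v = (norm v)\<^sup>2 - inner (act a v) v / c" for v
    by (simp add: act_simps act_1 inner_simps power2_norm_eq_inner)
  have "inner (act a v) v \<le> c * (norm v)\<^sup>2" for v
    using inner_act_le[of a v] mult_right_mono[OF assms(2), of "(norm v)\<^sup>2"] by simp
  then show "coercive 0 (1 - (1 / c) *\<^sub>R a)"
    using assms(4) coerciveD(1)[OF assms(1)]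
    unfolding coercive_def * by (auto simp: field_simps intro: sa_diff sa_scaleR)
  show "inner (act (1 - (1 / c) *\<^sub>R a) v) v \<le> (1 - d / c) * (norm v)\<^sup>2" for v
    unfolding * using coerciveD(2)[OF assms(1), of v] assms(4) by (simp add: field_simps)
  show "0 \<le> 1 - d / c" using assms by simp
qed

text \<open>Let m be the infimum of the form on the unit sphere. If m < 0, then a - m has a left
  inverse, which keeps its form away from 0 on the unit sphere, against the choice of m.\<close>

lemma coercive_0_of_spectrum:
  assumes sa: "sa a" and inv: "\<And>t. t < 0 \<Longrightarrow> \<exists>b. b * (a - t *\<^sub>R 1) = 1"
  shows "coercive 0 a"
proof (rule ccontr)
  assume "\<not> coercive 0 a"
  then obtain v0 where v0: "inner (act a v0) v0 < 0" using sa by (auto simp: coercive_def not_le)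
  define S where "S = (\<lambda>v. inner (act a v) v) ` {v. norm v = 1}"
  have hom: "inner (act a (r *\<^sub>R v)) (r *\<^sub>R v) = r\<^sup>2 * inner (act a v) v" for r v
    by (simp add: act_simps power2_eq_square)
  have "v0 \<noteq> 0" using v0 by (auto simp: act_simps)
  then have S1: "inner (act a (sgn v0)) (sgn v0) \<in> S" by (auto simp: S_def norm_sgn)
  have neg: "inner (act a (sgn v0)) (sgn v0) < 0"
    unfolding sgn_div_norm hom using v0 \<open>v0 \<noteq> 0\<close> by (intro mult_pos_neg) auto
  have bdd: "bdd_below S"
  proof (rule bdd_belowI)
    fix x assume "x \<in> S"
    then obtain v where v: "norm v = 1" "x = inner (act a v) v" by (auto simp: S_def)
    then show "- norm a \<le> x"
      using Cauchy_Schwarz_ineq2[of "act a v" v] norm_act[of a v] by simp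
  qed
  define m where "m = Inf S"
  have m: "m \<le> x" if "x \<in> S" for x unfolding m_def using that bdd by (rule cInf_lower)
  have "m < 0" using m[OF S1] neg by simp
  then obtain b where b: "b * (a - m *\<^sub>R 1) = 1" using inv by blast
  define p where "p = a - m *\<^sub>R 1"
  have p: "inner (act p v) v = inner (act a v) v - m * (norm v)\<^sup>2" for v
    by (simp add: p_def act_simps act_1 inner_simps power2_norm_eq_inner)
  have pos: "coercive 0 p"
    unfolding coercive_def
  proof (intro conjI allI)
    show "sa p" unfolding p_def by (intro sa_diff sa_scaleR sa sa_1)
    fix v
    show "0 * (norm v)\<^sup>2 \<le> inner (act p v) v"
    proof (cases "v = 0")
      case False
      then have "m \<le> inner (act a (sgn v)) (sgn v)" by (intro m) (auto simp: S_def norm_sgn)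
      also have "\<dots> = inner (act a v) v / (norm v)\<^sup>2"
        unfolding sgn_div_norm hom using False by (simp add: field_simps)
      finally show ?thesis using False by (simp add: p field_simps)
    qed (simp add: act_simps)
  qed
  \<comment> \<open>From v = b p v one gets a lower bound for |p v|, and
    \<open>norm_act_sq_le\<close> converts it into a lower bound for the form of p.\<close>
  have one: "1 \<le> (norm b)\<^sup>2 * (norm p * inner (act p v) v)" if v: "norm v = 1" for v
  proof -
    have "v = act b (act p v)" using b by (simp add: p_def act_1 flip: act_mult)
    then have "1 \<le> norm b * norm (act p v)" using norm_act[of b "act p v"] v by metis
    then have "1\<^sup>2 \<le> (norm b * norm (act p v))\<^sup>2" by (rule power_mono) simp
    also have "\<dots> \<le> (norm b)\<^sup>2 * (norm p * inner (act p v) v)"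
      unfolding power_mult_distrib by (intro mult_left_mono norm_act_sq_le pos inner_act_le) auto
    finally show ?thesis by simp
  qed
  define K where "K = (norm b)\<^sup>2 * norm p"
  have v1: "norm (sgn v0) = 1" using \<open>v0 \<noteq> 0\<close> by (simp add: norm_sgn)
  have "K \<noteq> 0" using one[OF v1] by (auto simp: K_def)
  then have K: "0 < K" by (simp add: K_def)
  have "m + 1 / K \<le> Inf S"
  proof (rule cInf_greatest)
    show "S \<noteq> {}" using S1 by auto
    fix x assume "x \<in> S"
    then obtain v where v: "norm v = 1" "x = inner (act a v) v" by (auto simp: S_def)
    have "1 \<le> K * inner (act p v) v" using one[OF v(1)] by (simp add: K_def mult.assoc)
    then have "1 / K \<le> inner (act p v) v" using K by (simp add: field_simps)
    then show "m + 1 / K \<le> x" using p[of v] v by simp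
  qed
  then show False using K by (simp add: m_def)
qed

text \<open>For small \<open>\<epsilon> > 0\<close> the operator \<open>1 - \<epsilon> a\<close> is a strict contraction.\<close>

lemma invertible_of_form_bound:
  assumes "\<And>v. d * (norm v)\<^sup>2 \<le> inner (act a v) v" "0 < d"
  shows "\<exists>b. a * b = 1 \<and> b * a = 1"
proof -
  define N where "N = norm a + d"
  have N: "0 < N" "norm a \<le> N" "d \<le> N"
    using assms(2) norm_ge_zero[of a] by (auto simp: N_def intro: add_nonneg_pos)
  \<comment> \<open>This e minimizes 1 - 2 e d + e^2 N^2; the minimum is 1 - d^2 / N^2, the square
    of the contraction factor r.\<close>
  define e where "e = d / N\<^sup>2"
  have e: "0 < e" using N assms(2) by (simp add: e_def)
  define r where "r = sqrt (1 - d\<^sup>2 / N\<^sup>2)"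
  have dN: "d\<^sup>2 / N\<^sup>2 \<le> 1" "0 < d\<^sup>2 / N\<^sup>2" using N assms(2) by (auto simp: power_mono)
  have "norm (1 - e *\<^sub>R a) \<le> r"
  proof (rule norm_leI)
    show "0 \<le> r" using dN by (simp add: r_def)
    fix v
    have "(norm (act (1 - e *\<^sub>R a) v))\<^sup>2 = (norm v)\<^sup>2 - 2 * e * inner (act a v) v + e\<^sup>2 * (norm (act a v))\<^sup>2"
    proof -
      have eq: "act (1 - e *\<^sub>R a) v = v - e *\<^sub>R act a v" by (simp add: act_simps act_1)
      show ?thesis
        unfolding eq power2_norm_eq_inner inner_diff_left inner_diff_right inner_scaleR_left
          inner_scaleR_right inner_commute[of v "act a v"] power2_eq_square[of e]
        by (simp only: algebra_simps)
    qed
    also have "\<dots> \<le> (norm v)\<^sup>2 - 2 * e * (d * (norm v)\<^sup>2) + e\<^sup>2 * (N * norm v)\<^sup>2"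
    proof -
      have "norm (act a v) \<le> N * norm v"
        using norm_act[of a v] mult_right_mono[OF N(2), of "norm v"] by simp
      then have "e\<^sup>2 * (norm (act a v))\<^sup>2 \<le> e\<^sup>2 * (N * norm v)\<^sup>2"
        by (intro mult_left_mono power_mono) auto
      moreover have "2 * e * (d * (norm v)\<^sup>2) \<le> 2 * e * inner (act a v) v"
        using assms(1) e by (intro mult_left_mono) auto
      ultimately show ?thesis by linarith
    qed
    also have "\<dots> = (1 - d\<^sup>2 / N\<^sup>2) * (norm v)\<^sup>2"
      using N(1) by (simp add: e_def field_simps power2_eq_square)
    also have "\<dots> = (r * norm v)\<^sup>2"
      using dN by (simp add: r_def power_mult_distrib)
    finally show "norm (act (1 - e *\<^sub>R a) v) \<le> r * norm v"
      by (rule power2_le_imp_le) (use dN in \<open>simp add: r_def\<close>)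
  qed
  also have "r < 1" using dN by (simp add: r_def)
  finally have "norm (1 - e *\<^sub>R a) < 1" .
  from invertible_of_norm_lt_1[OF this] obtain y where "(e *\<^sub>R a) * y = 1" "y * (e *\<^sub>R a) = 1" by auto
  then show ?thesis by (intro exI[of _ "e *\<^sub>R y"]) simp
qed

text \<open>For selfadjoint x the form of x^2 is |x v|^2, and |v| \<le> |y| |x v|. Lower bounds for
  \<open>npow\<close> and \<open>exp\<close> follow because each value is the square of the one at
  half the exponent.\<close>

lemma coercive_square:
  assumes "sa x" "x * y = 1" "y * x = 1"
  shows "coercive (1 / (norm y)\<^sup>2) (x * x)"
  unfolding coercive_def
proof (intro conjI allI)
  show "sa (x * x)" using assms by (intro sa_mult) auto
  fix v
  have "norm v \<le> norm y * norm (act x v)"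
    using norm_act[of y "act x v"] assms(3) by (simp add: act_1 flip: act_mult)
  then have "(norm v)\<^sup>2 \<le> (norm y)\<^sup>2 * (norm (act x v))\<^sup>2"
    by (metis norm_ge_zero power_mono power_mult_distrib)
  moreover have "inner (act (x * x) v) v = (norm (act x v))\<^sup>2"
    using assms(1) by (simp add: act_mult sa_def power2_norm_eq_inner)
  moreover have "norm y \<noteq> 0" using assms(2) by auto
  ultimately show "1 / (norm y)\<^sup>2 * (norm v)\<^sup>2 \<le> inner (act (x * x) v) v"
    by (simp add: field_simps)
qed

lemma coercive_npow:
  assumes "sa b" "norm b < 1"
  shows "coercive (1 / (norm (npow (- s / 2) b))\<^sup>2) (npow s b)"
  using coercive_square[of "npow (s / 2) b" "npow (- s / 2) b"] sa_npow[OF assms]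
  by (simp add: npow_mult[OF assms(2)])

text \<open>One d for the whole ball: this is what survives averaging over the sphere in
  \<open>density_coercive\<close> and gives a Gaussian bound along the whole segment in
  \<open>f_bound\<close>.\<close>

lemma coercive_npow_uniform:
  assumes "r < 1"
  obtains d where "0 < d" "\<And>b. sa b \<Longrightarrow> norm b \<le> r \<Longrightarrow> coercive d (npow s b)"
proof -
  \<comment> \<open>The absolute value here and the added 1 below make the bound positive without a
    discussion of signs.\<close>
  define K where "K = \<bar>\<Sum>m. \<bar>ncoef (- s / 2) m\<bar> * r ^ m\<bar>"
  have "coercive (1 / (K + 1)\<^sup>2) (npow s b)" if b: "sa b" "norm b \<le> r" for b
  proof (rule coercive_mono[OF coercive_npow[OF b(1)]])
    show b1: "norm b < 1" using assms b by simp
    have "norm (npow (- s / 2) b) \<le> K"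
      unfolding K_def using norm_npow_le[OF b(2) assms, of "- s / 2"] by linarith
    moreover have "0 < norm (npow (- s / 2) b)" using npow_inverse[OF b1, of "- s / 2"] by auto
    ultimately show "1 / (K + 1)\<^sup>2 \<le> 1 / (norm (npow (- s / 2) b))\<^sup>2"
      by (intro divide_left_mono power_mono mult_pos_pos zero_less_power) linarith+
  qed
  moreover have "0 < 1 / (K + 1)\<^sup>2" by (simp add: K_def add_nonneg_pos)
  ultimately show ?thesis by (rule that[rotated])
qed

lemma coercive_exp:
  assumes "sa a"
  shows "coercive (1 / (norm (exp (- ((1 / 2) *\<^sub>R a))))\<^sup>2) (exp a)"
proof -
  let ?h = "(1 / 2) *\<^sub>R a"
  have "exp ?h * exp ?h = exp (?h + ?h)" by (rule exp_add_commuting[symmetric]) simp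
  also have "?h + ?h = a" by (simp flip: scaleR_left_distrib)
  finally have sq: "exp ?h * exp ?h = exp a" .
  have "coercive (1 / (norm (exp (- ?h)))\<^sup>2) (exp ?h * exp ?h)"
  proof (rule coercive_square)
    show "sa (exp ?h)" by (intro sa_exp sa_scaleR assms)
    show "exp ?h * exp (- ?h) = 1" by (rule exp_minus_inverse)
    show "exp (- ?h) * exp ?h = 1" using exp_minus_inverse[of "- ?h"] by simp
  qed
  then show ?thesis unfolding sq .
qed

text \<open>Commutation turns m m a into m a m, whose form at v is the form of a at m v.\<close>

lemma coercive_mult:
  assumes "coercive 0 a" "sa m" "m * a = a * m"
  shows "coercive 0 (m * m * a)"
  unfolding coercive_def
proof (intro conjI allI)
  have eq: "m * m * a = m * a * m" using assms(3) by (metis mult.assoc)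
  have "inner (act (m * a * m) v) w = inner (act a (act m v)) (act m w)" for v w
    using assms(2) by (simp add: act_mult sa_def)
  moreover have "inner v (act (m * a * m) w) = inner (act m v) (act a (act m w))" for v w
    using assms(2) by (simp add: act_mult sa_def)
  ultimately show "sa (m * m * a)" "0 * (norm v)\<^sup>2 \<le> inner (act (m * m * a) v) v" for v
    unfolding eq using assms(1) by (auto simp: coercive_def sa_def)
qed

text \<open>If \<open>b\<^sup>2 = s\<^sup>2\<close> and \<open>b\<close>, \<open>s\<close> commute, then \<open>(b + s) (b - s) = 0\<close>, where \<open>b + s\<close> is invertible.\<close>

lemma sqrt_unique:
  assumes "coercive 0 b" "coercive d s" "0 < d" "b * b = s * s" "b * s = s * b"
  shows "b = s"
proof -
  have "d * (norm v)\<^sup>2 \<le> inner (act (b + s) v) v" for v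
    using coerciveD(2)[OF assms(1), of v] coerciveD(2)[OF assms(2), of v]
    by (simp add: act_add inner_simps)
  then obtain x where x: "x * (b + s) = 1"
    using invertible_of_form_bound assms(3) by blast
  have "(b + s) * (b - s) = 0" using assms by (simp add: algebra_simps)
  then have "x * (b + s) * (b - s) = 0" by (simp add: mult.assoc)
  then show ?thesis using x by simp
qed

end

section \<open>Positive operators on \<open>L\<^sup>2\<close>\<close>

lemma op_apply_simps:
  fixes a b :: "'n::finite torus_op"
  shows "op_apply (a + b) v = op_apply a v + op_apply b v"
    and "op_apply (a - b) v = op_apply a v - op_apply b v"
    and "op_apply (- a) v = - op_apply a v"
    and "op_apply (r *\<^sub>R a) v = r *\<^sub>R op_apply a v"
    and "op_apply (c *\<^sub>C a) v = c *\<^sub>C op_apply a v"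
    and "op_apply (a * b) v = op_apply a (op_apply b v)"
    and "op_apply 1 v = v" and "op_apply 0 v = 0"
  unfolding op_apply_def
  by (transfer, simp add: blinfun.bilinear_simps bounded_linear_Blinfun_apply bounded_linear_scaleC_torus_L2; fail)+

lemma op_apply_scaleC_right: "op_apply a (c *\<^sub>C v) = c *\<^sub>C op_apply a v"
  unfolding op_apply_def by transfer simp

lemma op_eqI: "(\<And>v. op_apply a v = op_apply b v) \<Longrightarrow> a = b"
  unfolding op_apply_def by transfer (rule blinfun_eqI)

interpretation op: hilbert_rep "op_apply :: 'n::finite torus_op \<Rightarrow> _"
proof
  fix a b :: "'n torus_op" and v w :: "'n torus_L2" and r K :: real
  show "op_apply a (v + w) = op_apply a v + op_apply a w"
    "op_apply a (r *\<^sub>R v) = r *\<^sub>R op_apply a v"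
    by (simp_all add: op_apply_def blinfun.bilinear_simps)
  show "norm (op_apply a v) \<le> norm a * norm v"
    unfolding op_apply_def norm_torus_op.rep_eq by (rule norm_blinfun)
  show "norm a \<le> K" if "0 \<le> K" "\<And>v. norm (op_apply a v) \<le> K * norm v"
    using that unfolding op_apply_def norm_torus_op.rep_eq by (rule norm_blinfun_bound)
qed (simp_all add: op_apply_simps)

lemma scaleC_torus_op_simps:
  fixes a b :: "'n::finite torus_op"
  shows "(c *\<^sub>C a) * b = c *\<^sub>C (a * b)"
    and "a * (c *\<^sub>C b) = c *\<^sub>C (a * b)"
    and "c *\<^sub>C d *\<^sub>C a = (c * d) *\<^sub>C a"
    and "complex_of_real r *\<^sub>C a = r *\<^sub>R a"
    and "1 *\<^sub>C a = a" and "0 *\<^sub>C a = 0"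
    and "c *\<^sub>C (a + b) = c *\<^sub>C a + c *\<^sub>C b"
    and "(c + d) *\<^sub>C a = c *\<^sub>C a + d *\<^sub>C a"
proof -
  have z: "0 *\<^sub>C v = (0 :: 'n torus_L2)" for v
    using scaleC_torus_L2_simps(5)[of 0 v] by simp
  show "(c *\<^sub>C a) * b = c *\<^sub>C (a * b)" "a * (c *\<^sub>C b) = c *\<^sub>C (a * b)"
    "c *\<^sub>C d *\<^sub>C a = (c * d) *\<^sub>C a" "complex_of_real r *\<^sub>C a = r *\<^sub>R a"
    "1 *\<^sub>C a = a" "0 *\<^sub>C a = 0" "c *\<^sub>C (a + b) = c *\<^sub>C a + c *\<^sub>C b"
    "(c + d) *\<^sub>C a = c *\<^sub>C a + d *\<^sub>C a"
    by (rule op_eqI, simp add: op_apply_simps op_apply_scaleC_right scaleC_torus_L2_simps z; fail)+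
qed

lemma norm_scaleC_torus_op: "norm (c *\<^sub>C (a :: 'n::finite torus_op)) = cmod c * norm a"
proof -
  have le: "norm (c *\<^sub>C a) \<le> cmod c * norm a" for c and a :: "'n torus_op"
    by (rule op.norm_leI)
       (simp_all add: op_apply_simps norm_scaleC_torus_L2 mult.assoc mult_left_mono op.norm_act)
  show ?thesis
  proof (cases "c = 0")
    case True
    then show ?thesis by (simp add: scaleC_torus_op_simps)
  next
    case False
    have "norm a = norm (inverse c *\<^sub>C c *\<^sub>C a)" using False by (simp add: scaleC_torus_op_simps)
    also have "\<dots> \<le> inverse (cmod c) * norm (c *\<^sub>C a)"
      using le[of "inverse c" "c *\<^sub>C a"] by (simp add: norm_inverse)
    finally have "cmod c * norm a \<le> norm (c *\<^sub>C a)" using False by (simp add: field_simps)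
    then show ?thesis using le[of c a] by simp
  qed
qed

lemma bounded_linear_scaleC_left: "bounded_linear (\<lambda>c. c *\<^sub>C (a :: 'n::finite torus_op))"
proof (rule bounded_linear_intro[of _ "norm a"])
  fix c d and r :: real
  show "(c + d) *\<^sub>C a = c *\<^sub>C a + d *\<^sub>C a" by (simp add: scaleC_torus_op_simps)
  have "(r *\<^sub>R c) *\<^sub>C a = complex_of_real r *\<^sub>C c *\<^sub>C a"
    by (simp only: scaleC_torus_op_simps(3) scaleR_conv_of_real)
  then show "(r *\<^sub>R c) *\<^sub>C a = r *\<^sub>R (c *\<^sub>C a)" by (simp only: scaleC_torus_op_simps(4))
qed (simp add: norm_scaleC_torus_op)

lemma bounded_linear_scaleC_right: "bounded_linear (\<lambda>a :: 'n::finite torus_op. c *\<^sub>C a)"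
proof (rule bounded_linear_intro[of _ "cmod c"])
  fix a b :: "'n torus_op" and r :: real
  show "c *\<^sub>C (a + b) = c *\<^sub>C a + c *\<^sub>C b" by (simp add: scaleC_torus_op_simps)
  have "c *\<^sub>C complex_of_real r *\<^sub>C a = complex_of_real r *\<^sub>C c *\<^sub>C a"
    by (simp only: scaleC_torus_op_simps(3) mult.commute)
  then show "c *\<^sub>C (r *\<^sub>R a) = r *\<^sub>R (c *\<^sub>C a)" by (simp only: scaleC_torus_op_simps(4))
qed (simp add: norm_scaleC_torus_op mult.commute)

lemma cinner_scaleC_right: "cinner f (c *\<^sub>C g) = cnj c * cinner f g"
  using cinner_commute[of f "c *\<^sub>C g"] cinner_commute[of g f] by (simp add: cinner_scaleC_left)

lemma inner_eq_Re_cinner: "inner f g = Re (cinner f g)"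
  by (simp add: inner_torus_L2_def)

lemma Im_cinner: "Im (cinner f g) = inner f (\<i> *\<^sub>C g)"
  by (simp add: inner_torus_L2_def cinner_scaleC_right)

lemma norm_cinner_le: "cmod (cinner f g) \<le> norm f * norm (g :: 'n::finite torus_L2)"
proof (cases "cinner f g = 0")
  case False
  define w where "w = cnj (sgn (cinner f g))"
  have w: "cmod w = 1" using False by (simp add: w_def norm_sgn)
  have "w * cinner f g = complex_of_real (cmod (cinner f g))"
    using False by (simp add: w_def sgn_eq complex_norm_square[symmetric] power2_eq_square mult.commute)
  then have "cmod (cinner f g) = Re (cinner (w *\<^sub>C f) g)" by (simp add: cinner_scaleC_left)
  also have "\<dots> \<le> norm (w *\<^sub>C f) * norm g"
    using Cauchy_Schwarz_ineq2[of "w *\<^sub>C f" g] by (simp add: inner_eq_Re_cinner)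
  finally show ?thesis using w by (simp add: norm_scaleC_torus_L2)
qed simp

text \<open>The real inner product determines the complex one: the imaginary part of (f, g) is the
  real part of (f, i g), and operators commute with i.\<close>

lemma is_adjoint_iff_inner:
  "is_adjoint a b \<longleftrightarrow> (\<forall>v w. inner (op_apply a v) w = inner v (op_apply b w))"
proof
  assume *: "\<forall>v w. inner (op_apply a v) w = inner v (op_apply b w)"
  show "is_adjoint a b"
    unfolding is_adjoint_def
  proof (intro allI complex_eqI)
    fix f g
    show "Re (cinner (op_apply a f) g) = Re (cinner f (op_apply b g))"
      using * by (simp add: inner_eq_Re_cinner)
    show "Im (cinner (op_apply a f) g) = Im (cinner f (op_apply b g))"
      using * by (simp add: Im_cinner flip: op_apply_scaleC_right)
  qed
qed (simp add: is_adjoint_def inner_eq_Re_cinner)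

lemma is_adjoint_self: "is_adjoint a a \<longleftrightarrow> op.sa a"
  by (simp add: is_adjoint_iff_inner op.sa_def)

text \<open>The form of a is real and nonnegative. Multiplying z - a by - i sgn (Im z) for non-real
  z, or by - 1 for negative z, therefore gives an operator whose form is bounded below, and
  \<open>invertible_of_form_bound\<close> does not ask for selfadjointness.\<close>

lemma not_in_op_spectrum:
  assumes "op.coercive 0 a" "z \<notin> \<real>\<^sub>\<ge>\<^sub>0"
  shows "z \<notin> op_spectrum a"
proof -
  define x where "x = z *\<^sub>C 1 - a"
  have real: "Im (cinner (op_apply a f) f) = 0" for f
  proof -
    have "cinner (op_apply a f) f = cinner f (op_apply a f)"
      using op.coerciveD(1)[OF assms(1)] unfolding is_adjoint_self[symmetric] is_adjoint_def by simp
    also have "\<dots> = cnj (cinner (op_apply a f) f)" by (rule cinner_commute)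
    finally have "Im (cinner (op_apply a f) f) = Im (cnj (cinner (op_apply a f) f))" by simp
    then show ?thesis by simp
  qed
  have pos: "0 \<le> Re (cinner (op_apply a f) f)" for f
    using op.coerciveD(2)[OF assms(1), of f] by (simp add: inner_eq_Re_cinner)
  have "\<exists>w d. w \<noteq> 0 \<and> 0 < d \<and> (\<forall>f. d * (norm f)\<^sup>2 \<le> inner (op_apply (w *\<^sub>C x) f) f)"
  proof (cases "Im z = 0")
    case False
    have eq: "inner (op_apply ((- (\<i> * sgn (Im z))) *\<^sub>C x) f) f = \<bar>Im z\<bar> * (norm f)\<^sup>2" for f
    proof -
      have "cinner (op_apply x f) f = z * (norm f)\<^sup>2 - cinner (op_apply a f) f"
        using cinner_add_left[of "op_apply x f" "op_apply a f" f]
        by (simp add: x_def op_apply_simps cinner_scaleC_left cinner_self power2_norm_eq_inner)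
      then show ?thesis
        using real[of f] by (simp add: inner_eq_Re_cinner op_apply_simps cinner_scaleC_left abs_sgn)
    qed
    show ?thesis
    proof (intro exI conjI allI)
      show "- (\<i> * sgn (Im z)) \<noteq> 0" "0 < \<bar>Im z\<bar>" using False by (auto simp: sgn_if)
    qed (rule eq_refl[OF eq[symmetric]])
  next
    case True
    then have z: "Re z < 0" "z = complex_of_real (Re z)"
      using assms(2) by (auto simp: complex_nonneg_Reals_iff complex_eq_iff)
    have "(- Re z) * (norm f)\<^sup>2 \<le> inner (op_apply ((-1) *\<^sub>C x) f) f" for f
    proof -
      have "cinner (op_apply x f) f = z * (norm f)\<^sup>2 - cinner (op_apply a f) f"
        using cinner_add_left[of "op_apply x f" "op_apply a f" f]
        by (simp add: x_def op_apply_simps cinner_scaleC_left cinner_self power2_norm_eq_inner)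
      then show ?thesis
        using pos[of f] True by (simp add: inner_eq_Re_cinner op_apply_simps cinner_scaleC_left)
    qed
    then show ?thesis using z(1) by (intro exI[of _ "- 1"] exI[of _ "- Re z"]) simp
  qed
  then obtain w d where w: "w \<noteq> 0" "0 < d" "\<And>f. d * (norm f)\<^sup>2 \<le> inner (op_apply (w *\<^sub>C x) f) f" by blast
  from op.invertible_of_form_bound[OF w(3,2)] obtain b where "(w *\<^sub>C x) * b = 1" "b * (w *\<^sub>C x) = 1" by blast
  then have "x * (w *\<^sub>C b) = 1 \<and> (w *\<^sub>C b) * x = 1" by (simp add: scaleC_torus_op_simps)
  then show ?thesis unfolding op_spectrum_def x_def by blast
qed

text \<open>The bridge from the spectral definition of positivity to the quadratic form, in which
  all later arguments on operators are carried out.\<close>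

lemma op_positive_iff: "op_positive a \<longleftrightarrow> op.coercive 0 a"
proof
  assume a: "op_positive a"
  show "op.coercive 0 a"
  proof (rule op.coercive_0_of_spectrum)
    show "op.sa a" using a by (simp add: op_positive_def is_adjoint_self)
    fix t :: real assume "t < 0"
    then have "complex_of_real t \<notin> op_spectrum a" using a by (auto simp: op_positive_def)
    then obtain b where b: "b * (t *\<^sub>R 1 - a) = 1"
      unfolding op_spectrum_def mem_Collect_eq scaleC_torus_op_simps by blast
    have "(- b) * (a - t *\<^sub>R 1) = b * (t *\<^sub>R 1 - a)" by (simp add: algebra_simps)
    then show "\<exists>b. b * (a - t *\<^sub>R 1) = 1" using b by metis
  qed
next
  assume a: "op.coercive 0 a"
  then show "op_positive a"
    using not_in_op_spectrum[OF a] op.coerciveD(1)[OF a] by (auto simp: op_positive_def is_adjoint_self)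
qed

definition one_vec :: "'n::finite torus_L2" where
  "one_vec = abs_torus_L2 (\<lambda>_. 1)"

lemma norm_one_vec [simp]: "norm (one_vec :: 'n::finite torus_L2) = 1"
proof -
  have "ennreal ((norm (one_vec :: 'n torus_L2))\<^sup>2) = ennreal 1"
    using norm_abs_torus_L2[OF square_integrable_const[of 1], where 'a = 'n]
    by (simp add: one_vec_def emeasure_torus_measure_UNIV)
  then have "(norm (one_vec :: 'n torus_L2))\<^sup>2 = 1" by (simp add: ennreal_inj del: ennreal_1)
  then show ?thesis using norm_ge_zero[of "one_vec :: 'n torus_L2"] by (auto simp: power2_eq_1_iff)
qed

lemma one_vec_nonzero: "one_vec \<noteq> (0 :: 'n::finite torus_L2)"
  by (metis norm_one_vec norm_zero zero_neq_one)

lemma op_coercive_le_norm: "op.coercive d a \<Longrightarrow> d \<le> norm a"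
  by (rule op.coercive_le_norm[OF _ one_vec_nonzero])

text \<open>Every operator that commutes with \<open>b\<^sup>2\<close> commutes with \<open>s\<close>, hence so does \<open>b\<close>.\<close>

lemma op_sqrt_eqI:
  assumes "op.coercive d s" "0 < d" "\<And>x. x * (s * s) = (s * s) * x \<Longrightarrow> x * s = s * x"
  shows "op_sqrt (s * s) = s"
  unfolding op_sqrt_def
proof (rule the_equality)
  show "op_positive s \<and> s * s = s * s"
    using assms(1,2) op.coercive_mono[of d s 0] by (simp add: op_positive_iff)
  fix b assume b: "op_positive b \<and> b * b = s * s"
  show "b = s"
  proof (rule op.sqrt_unique[OF _ assms(1,2)])
    have "b * (s * s) = (s * s) * b" using b by (metis mult.assoc)
    then show "b * s = s * b" by (rule assms(3))
  qed (use b in \<open>auto simp: op_positive_iff\<close>)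
qed

text \<open>Needed at \<xi> = 0, where the quadratic form of the metric vanishes and the series for
  the square root does not apply. For selfadjoint b with b b = 0 one has |b v|^2 = (b b v, v) =
  0.\<close>

lemma op_sqrt_0: "op_sqrt 0 = (0 :: 'n::finite torus_op)"
  unfolding op_sqrt_def
proof (rule the_equality)
  show "op_positive (0 :: 'n torus_op) \<and> 0 * 0 = (0 :: 'n torus_op)"
    by (simp add: op_positive_iff op.coercive_def op_apply_simps)
  fix b :: "'n torus_op" assume b: "op_positive b \<and> b * b = 0"
  show "b = 0"
  proof (rule op_eqI)
    fix v
    have "inner (op_apply b v) (op_apply b v) = inner (op_apply (b * b) v) v"
      using b unfolding op_positive_iff op.coercive_def op.sa_def op_apply_simps by metis
    then show "op_apply b v = op_apply 0 v" using b by (simp add: op_apply_simps)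
  qed
qed

text \<open>The bound c is a parameter instead of the norm of a, so that the forms at all unit
  covectors can share the same c.\<close>

locale scaled_operator =
  fixes a :: "'n::finite torus_op" and c d :: real
  assumes coercive: "op.coercive d a" and d_pos: "0 < d" and norm_le: "norm a \<le> c"
begin

definition b :: "'n torus_op" where "b = 1 - (1 / c) *\<^sub>R a"

lemma c_pos: "0 < c" and d_le: "d \<le> c"
  using op_coercive_le_norm[OF coercive] d_pos norm_le by linarith+

lemma a_eq: "a = c *\<^sub>R (1 - b)"
  using c_pos by (simp add: b_def)

lemma norm_b: "norm b \<le> 1 - d / c" "1 - d / c < 1" "norm b < 1"
proof -
  show *: "norm b \<le> 1 - d / c"
    unfolding b_def by (rule op.norm_one_minus_le[OF coercive norm_le d_le c_pos])
  show "1 - d / c < 1" using c_pos d_pos by simp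
  then show "norm b < 1" using * by linarith
qed

lemma sa_b: "op.sa b"
  unfolding b_def by (intro op.sa_diff op.sa_1 op.sa_scaleR op.coerciveD(1)[OF coercive])

lemma sqrt_square: "(sqrt c *\<^sub>R npow (- 1 / 2) b) * (sqrt c *\<^sub>R npow (- 1 / 2) b) = a"
  using c_pos by (simp add: npow_mult norm_b npow_minus_one flip: a_eq real_sqrt_mult)

lemma sqrt_coercive: "\<exists>e>0. op.coercive e (sqrt c *\<^sub>R npow (- 1 / 2) b)"
proof (intro exI conjI)
  \<comment> \<open>This is \<open>npow (1 / 4) b\<close>, the inverse of the square root of
    \<open>npow (- 1 / 2) b\<close>, written in the shape that \<open>coercive_npow\<close>
    produces.\<close>
  let ?y = "npow (- (- 1 / 2) / 2) b"
  have "?y \<noteq> 0" using npow_inverse[OF norm_b(3), of "- (- 1 / 2) / 2"] by auto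
  then show "0 < sqrt c * (1 / (norm ?y)\<^sup>2)" using c_pos by simp
  show "op.coercive (sqrt c * (1 / (norm ?y)\<^sup>2)) (sqrt c *\<^sub>R npow (- 1 / 2) b)"
    unfolding op.coercive_def
  proof (intro conjI allI)
    fix v
    have "1 / (norm ?y)\<^sup>2 * (norm v)\<^sup>2 \<le> inner (op_apply (npow (- 1 / 2) b) v) v"
      by (rule op.coerciveD(2)[OF op.coercive_npow[OF sa_b norm_b(3)]])
    from mult_left_mono[OF this, of "sqrt c"] c_pos
    show "sqrt c * (1 / (norm ?y)\<^sup>2) * (norm v)\<^sup>2 \<le> inner (op_apply (sqrt c *\<^sub>R npow (- 1 / 2) b) v) v"
      by (simp only: op_apply_simps inner_scaleR_left mult.assoc real_sqrt_ge_zero less_imp_le)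
  qed (intro op.sa_scaleR op.sa_npow sa_b norm_b)
qed

lemma commute_sqrt:
  assumes "x * a = a * x"
  shows "x * (sqrt c *\<^sub>R npow (- 1 / 2) b) = (sqrt c *\<^sub>R npow (- 1 / 2) b) * x"
proof -
  have "x * b = b * x" using assms by (simp add: b_def algebra_simps)
  then show ?thesis using npow_commute[OF norm_b(3)] by simp
qed

lemma op_sqrt_eq: "op_sqrt a = sqrt c *\<^sub>R npow (- 1 / 2) b"
  using sqrt_coercive op_sqrt_eqI[of _ "sqrt c *\<^sub>R npow (- 1 / 2) b"] commute_sqrt
  unfolding sqrt_square by blast

lemma op_sqrt_square: "op_sqrt a * op_sqrt a = a"
  unfolding op_sqrt_eq by (rule sqrt_square)

lemma op_sqrt_unique:
  assumes "op.coercive 0 x" "x * x = a"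
  shows "op_sqrt a = x"
proof -
  obtain e where e: "0 < e" "op.coercive e (sqrt c *\<^sub>R npow (- 1 / 2) b)" using sqrt_coercive by blast
  have "x * a = a * x" using assms(2) by (metis mult.assoc)
  then have "x = sqrt c *\<^sub>R npow (- 1 / 2) b"
    by (intro op.sqrt_unique[OF assms(1) e(2,1)] commute_sqrt) (simp only: sqrt_square assms(2))
  then show ?thesis by (simp add: op_sqrt_eq)
qed

lemma inv_sqrt_power: "inv_el (op_sqrt a) ^ m = c powr (- real m / 2) *\<^sub>R npow (real m / 2) b"
proof -
  have "inv_el (op_sqrt a) = (1 / sqrt c) *\<^sub>R npow (1 / 2) b"
  proof (rule inv_el_eqI)
    show "op_sqrt a * ((1 / sqrt c) *\<^sub>R npow (1 / 2) b) = 1"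
      "((1 / sqrt c) *\<^sub>R npow (1 / 2) b) * op_sqrt a = 1"
      using c_pos by (simp_all add: op_sqrt_eq npow_mult norm_b)
  qed
  moreover have "(1 / sqrt c) ^ m = c powr (- real m / 2)"
    using c_pos by (simp add: powr_half_sqrt[symmetric] power_divide powr_power powr_minus_divide)
  moreover have "(r *\<^sub>R x) ^ m = r ^ m *\<^sub>R x ^ m" for r and x :: "'n torus_op"
    by (induction m) (simp_all add: mult.commute)
  ultimately show ?thesis by (simp add: npow_power norm_b)
qed

lemma inverse_eq: "a * ((1 / c) *\<^sub>R npow 1 b) = 1" "((1 / c) *\<^sub>R npow 1 b) * a = 1"
proof -
  have "(c *\<^sub>R (1 - b)) * ((1 / c) *\<^sub>R npow 1 b) = 1" "((1 / c) *\<^sub>R npow 1 b) * (c *\<^sub>R (1 - b)) = 1"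
    using c_pos neumann_inverse[OF norm_b(3)] by simp_all
  then show "a * ((1 / c) *\<^sub>R npow 1 b) = 1" "((1 / c) *\<^sub>R npow 1 b) * a = 1"
    by (simp_all only: a_eq[symmetric])
qed

end

section \<open>Weyl operators\<close>

definition echar :: "int^'n::finite \<Rightarrow> real^'n \<Rightarrow> complex" where
  "echar k x = cis (\<Sum>i\<in>UNIV. real_of_int (k $ i) * x $ i)"

lemma norm_echar [simp]: "cmod (echar k x) = 1"
  by (simp add: echar_def)

lemma echar_nonzero [simp]: "echar k x \<noteq> 0"
  by (simp add: echar_def)

lemma echar_add_left: "echar (k + l) x = echar k x * echar l x"
  by (simp add: echar_def cis_mult sum.distrib algebra_simps)

lemma echar_add_right: "echar k (x + y) = echar k x * echar k y"
  by (simp add: echar_def cis_mult sum.distrib algebra_simps)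

lemma echar_0 [simp]: "echar 0 x = 1" "echar k 0 = 1"
  by (simp_all add: echar_def)

lemma echar_axis: "echar (axis j 1) x = cis (x $ j)"
  by (simp add: echar_def axis_def if_distrib[of real_of_int] if_distrib[of "\<lambda>t. t * _"] cong: if_cong)

lemma echar_axis_right: "echar k (axis j t) = cis (of_int (k $ j) * t)"
  by (simp add: echar_def axis_def if_distrib[of "\<lambda>t. _ * t"] cong: if_cong)

lemma measurable_echar [measurable]: "echar k \<in> borel_measurable borel"
  unfolding echar_def by (intro borel_measurable_continuous_onI continuous_intros)

lemma echar_periodic: "torus_periodic (echar k)"
  unfolding torus_periodic_def echar_add_right echar_axis_right
  by (auto simp: cis_conv_exp exp_eq_1 intro!: exI[of _ "k $ _"])

lemma square_integrable_translate:
  assumes "f \<in> square_integrable"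
  shows "(\<lambda>x. f (x + s)) \<in> square_integrable"
proof (rule square_integrableI)
  note [measurable] = square_integrableD(1)[OF assms]
  show "(\<lambda>x. f (x + s)) \<in> borel_measurable borel" by measurable
  show "torus_periodic (\<lambda>x. f (x + s))"
    using square_integrableD(3)[OF assms] unfolding torus_periodic_def by (metis add.assoc add.commute)
  have "torus_periodic (\<lambda>x. ennreal ((cmod (f x))\<^sup>2))"
    using square_integrableD(3)[OF assms] by (simp add: torus_periodic_def)
  from nn_integral_torus_translate[OF _ this, of s]
  show "(\<integral>\<^sup>+x. ennreal ((cmod (f (x + s)))\<^sup>2) \<partial>torus_measure) < \<infinity>"
    by (simp add: norm_abs_torus_L2[OF assms])
qed

lemma square_integrable_echar_mult:
  assumes "f \<in> square_integrable"
  shows "(\<lambda>x. echar k x * f x) \<in> square_integrable"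
  using assms echar_periodic[of k]
  unfolding square_integrable_def torus_periodic_def by (auto simp: norm_mult)

lemma torus_ae_eq_translate:
  fixes s :: "real^'n::finite"
  assumes "torus_ae_eq f g"
  shows "torus_ae_eq (\<lambda>x. f (x + s)) (\<lambda>x. g (x + s))"
proof -
  \<comment> \<open>All columns of this matrix are s / \<pi>, so well-definedness of
    \<open>torus_twist\<close> contains that of the translation by s; the character in front has
    modulus 1 and cancels.\<close>
  define \<theta> :: "real^'n^'n" where "\<theta> = (\<chi> i j. s $ i / pi)"
  obtain j :: 'n where True by blast
  have s: "pi *\<^sub>R column j \<theta> = s" by (simp add: \<theta>_def column_def vec_eq_iff)
  have "torus_ae_eq (\<lambda>x. cis (x $ j) * f (x + pi *\<^sub>R column j \<theta>)) (\<lambda>x. cis (x $ j) * g (x + pi *\<^sub>R column j \<theta>))"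
    using torus_twist.rsp assms unfolding rel_fun_def by blast
  then show ?thesis
    using assms unfolding s torus_ae_eq_def
    by (auto intro: square_integrable_translate elim: AE_mp)
qed

lift_definition weyl :: "int^'n::finite \<Rightarrow> real^'n \<Rightarrow> 'n torus_L2 \<Rightarrow> 'n torus_L2"
  is "\<lambda>k s f x. echar k x * f (x + s)"
proof -
  fix k :: "int^'n" and s :: "real^'n" and f g :: "real^'n \<Rightarrow> complex"
  assume "torus_ae_eq f g"
  from torus_ae_eq_translate[OF this, of s]
  show "torus_ae_eq (\<lambda>x. echar k x * f (x + s)) (\<lambda>x. echar k x * g (x + s))"
    by (auto simp: torus_ae_eq_def intro: square_integrable_echar_mult elim: AE_mp)
qed

lemma weyl_abs:
  assumes "f \<in> square_integrable"
  shows "weyl k s (abs_torus_L2 f) = abs_torus_L2 (\<lambda>x. echar k x * f (x + s))"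
  using assms by (simp add: weyl.abs_eq torus_ae_eq_def)

lemma weyl_add: "weyl k s (f + g) = weyl k s f + weyl k s g"
proof (transfer, goal_cases)
  case (1 k s f g)
  then have "torus_ae_eq (\<lambda>x. f x + g x) (\<lambda>x. f x + g x)"
    by (auto simp: torus_ae_eq_def intro: square_integrable_add)
  from torus_ae_eq_translate[OF this, of s] show ?case
    by (auto simp: torus_ae_eq_def distrib_left dest: square_integrable_echar_mult[of _ k])
qed

lemma weyl_scaleC: "weyl k s (c *\<^sub>C f) = c *\<^sub>C weyl k s f"
proof (transfer, goal_cases)
  case (1 k s c f)
  then have "torus_ae_eq (\<lambda>x. c * f x) (\<lambda>x. c * f x)"
    by (auto simp: torus_ae_eq_def intro: square_integrable_cmult)
  from torus_ae_eq_translate[OF this, of s] show ?case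
    by (auto simp: torus_ae_eq_def mult.left_commute dest: square_integrable_echar_mult[of _ k])
qed

lemma norm_weyl: "norm (weyl k s f) = norm f"
proof -
  define h where "h = rep_torus_L2 f"
  have h: "h \<in> square_integrable" "f = abs_torus_L2 h"
    by (simp_all add: h_def rep_torus_L2_square_integrable abs_rep_torus_L2)
  note [measurable] = square_integrableD(1)[OF h(1)]
  have "torus_periodic (\<lambda>x. ennreal ((cmod (h x))\<^sup>2))"
    using square_integrableD(3)[OF h(1)] by (simp add: torus_periodic_def)
  from nn_integral_torus_translate[OF _ this, of s]
  have "(\<integral>\<^sup>+x. ennreal ((cmod (echar k x * h (x + s)))\<^sup>2) \<partial>torus_measure)
      = (\<integral>\<^sup>+x. ennreal ((cmod (h x))\<^sup>2) \<partial>torus_measure)"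
    by (simp add: norm_mult)
  then have "ennreal ((norm (weyl k s f))\<^sup>2) = ennreal ((norm f)\<^sup>2)"
    using norm_abs_torus_L2[OF square_integrable_echar_mult[OF square_integrable_translate[OF h(1)]], of k s]
      norm_abs_torus_L2[OF h(1)] weyl_abs[OF h(1)] h(2) by simp
  then show ?thesis by (simp add: ennreal_inj)
qed

lemma bounded_linear_weyl: "bounded_linear (weyl k s)"
  by (rule bounded_linear_intro[of _ 1])
     (simp_all add: weyl_add scaleC_torus_L2_simps weyl_scaleC norm_weyl)

lift_definition weyl_op :: "int^'n::finite \<Rightarrow> real^'n \<Rightarrow> 'n torus_op" is "\<lambda>k s. Blinfun (weyl k s)"
  by (simp add: bounded_linear_Blinfun_apply bounded_linear_weyl weyl_scaleC)

lemma op_apply_weyl_op: "op_apply (weyl_op k s) f = weyl k s f"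
  by (simp add: op_apply_def weyl_op.rep_eq bounded_linear_Blinfun_apply bounded_linear_weyl)

lemma op_eqI_abs:
  assumes "\<And>f. f \<in> square_integrable \<Longrightarrow> op_apply a (abs_torus_L2 f) = op_apply b (abs_torus_L2 f)"
  shows "a = b"
  by (rule op_eqI) (metis assms abs_rep_torus_L2 rep_torus_L2_square_integrable)

lemma scaleC_abs:
  assumes "f \<in> square_integrable"
  shows "c *\<^sub>C abs_torus_L2 f = abs_torus_L2 (\<lambda>x. c * f x)"
  using assms by (simp add: scaleC_torus_L2.abs_eq torus_ae_eq_def)

text \<open>The Weyl relation: moving the translation by s past the character of l produces the
  phase \<open>echar l s\<close>.\<close>

lemma weyl_op_mult: "weyl_op k s * weyl_op l t = echar l s *\<^sub>C weyl_op (k + l) (s + t)"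
proof (rule op_eqI_abs)
  fix f :: "real^'a \<Rightarrow> complex" assume f: "f \<in> square_integrable"
  have "(\<lambda>x. echar k x * (echar l (x + s) * f (x + s + t))) =
      (\<lambda>x. echar l s * (echar (k + l) x * f (x + (s + t))))"
    by (simp add: echar_add_left echar_add_right algebra_simps)
  then show "op_apply (weyl_op k s * weyl_op l t) (abs_torus_L2 f) =
      op_apply (echar l s *\<^sub>C weyl_op (k + l) (s + t)) (abs_torus_L2 f)"
    using f by (simp add: op_apply_simps op_apply_weyl_op weyl_abs square_integrable_echar_mult
        square_integrable_translate scaleC_abs)
qed

lemma weyl_op_0: "weyl_op 0 0 = 1"
  by (rule op_eqI_abs) (simp add: op_apply_simps op_apply_weyl_op weyl_abs)

text \<open>The phase is left existential. Products, inverses and powers of the unitaries then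
  reduce to adding, negating and scaling k and s.\<close>

definition weyl_phase :: "'n::finite torus_op \<Rightarrow> int^'n \<Rightarrow> real^'n \<Rightarrow> bool" where
  "weyl_phase a k s \<longleftrightarrow> (\<exists>c. cmod c = 1 \<and> a = c *\<^sub>C weyl_op k s)"

lemma weyl_phase_mult: "weyl_phase a k s \<Longrightarrow> weyl_phase b l t \<Longrightarrow> weyl_phase (a * b) (k + l) (s + t)"
  unfolding weyl_phase_def
proof (elim exE conjE)
  fix c d assume "cmod c = 1" "cmod d = 1" "a = c *\<^sub>C weyl_op k s" "b = d *\<^sub>C weyl_op l t"
  then show "\<exists>e. cmod e = 1 \<and> a * b = e *\<^sub>C weyl_op (k + l) (s + t)"
    by (intro exI[of _ "c * d * echar l s"])
       (simp add: norm_mult scaleC_torus_op_simps weyl_op_mult mult_ac)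
qed

lemma weyl_phase_1: "weyl_phase 1 0 0"
  unfolding weyl_phase_def by (rule exI[of _ 1]) (simp add: weyl_op_0 scaleC_torus_op_simps)

lemma weyl_phase_inv_el:
  assumes "weyl_phase a k s"
  shows "weyl_phase (inv_el a) (- k) (- s)"
proof -
  obtain c where c: "cmod c = 1" "a = c *\<^sub>C weyl_op k s" using assms by (auto simp: weyl_phase_def)
  then have [simp]: "c \<noteq> 0" by auto
  \<comment> \<open>The factor \<open>echar k s\<close> compensates the phase
    \<open>echar (- k) s\<close> that the Weyl relation produces.\<close>
  let ?b = "(inverse c * echar k s) *\<^sub>C weyl_op (- k) (- s)"
  have e: "echar (- k) s * echar k s = 1" "echar k (- s) * echar k s = 1"
    by (simp_all flip: echar_add_left echar_add_right)
  have "a * ?b = 1" "?b * a = 1"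
    using e by (simp_all add: c(2) scaleC_torus_op_simps weyl_op_mult weyl_op_0 mult_ac)
  then have "inv_el a = ?b" by (rule inv_el_eqI)
  then show ?thesis
    unfolding weyl_phase_def using c(1)
    by (intro exI[of _ "inverse c * echar k s"]) (simp add: norm_mult norm_inverse)
qed

lemma weyl_phase_power:
  assumes "weyl_phase a k s"
  shows "weyl_phase (a ^ m) (\<chi> i. int m * k $ i) (real m *\<^sub>R s)"
proof (induction m)
  case 0
  have "(\<chi> i. int 0 * k $ i) = 0" by (simp add: vec_eq_iff)
  then show ?case using weyl_phase_1 by (simp only: power_0 of_nat_0 scaleR_zero_left)
next
  case (Suc m)
  have "(\<chi> i. int (Suc m) * k $ i) = k + (\<chi> i. int m * k $ i)"
    "real (Suc m) *\<^sub>R s = s + real m *\<^sub>R s"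
    by (simp_all add: vec_eq_iff algebra_simps)
  then show ?case using weyl_phase_mult[OF assms Suc] by (simp only: power_Suc)
qed

lemma weyl_phase_int_pow:
  assumes "weyl_phase a k s"
  shows "weyl_phase (int_pow a m) (\<chi> i. m * k $ i) (real_of_int m *\<^sub>R s)"
proof (cases "0 \<le> m")
  case True
  then show ?thesis using weyl_phase_power[OF assms, of "nat m"] by (simp add: int_pow_def)
next
  case False
  then show ?thesis
    using weyl_phase_power[OF weyl_phase_inv_el[OF assms], of "nat (- m)"] by (simp add: int_pow_def)
qed

lemma weyl_phase_ncU: "weyl_phase (ncU \<theta> j) (axis j 1) (pi *\<^sub>R column j \<theta>)"
  unfolding weyl_phase_def
  by (intro exI[of _ 1] conjI op_eqI_abs)
     (simp_all add: scaleC_torus_op_simps ncU_apply op_apply_weyl_op weyl_abs echar_axis)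

definition nc_shift :: "real^'n::finite^'n \<Rightarrow> int^'n \<Rightarrow> real^'n" where
  "nc_shift \<theta> k = (\<Sum>j\<in>UNIV. real_of_int (k $ j) *\<^sub>R (pi *\<^sub>R column j \<theta>))"

lemma weyl_phase_ncU_pow: "weyl_phase (ncU_pow \<theta> k) k (nc_shift \<theta> k)"
proof -
  have "weyl_phase (prod_list (map (\<lambda>j. int_pow (ncU \<theta> j) (k $ j)) js))
      (\<chi> i. \<Sum>j\<in>set js. k $ j * axis j 1 $ i) (\<Sum>j\<in>set js. real_of_int (k $ j) *\<^sub>R (pi *\<^sub>R column j \<theta>))"
    if "distinct js" for js
    using that
  proof (induction js)
    case Nil
    have "(\<chi> i. \<Sum>j\<in>set []. k $ j * axis j 1 $ i) = 0" by (simp add: vec_eq_iff)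
    then show ?case using weyl_phase_1 by simp
  next
    case (Cons a js)
    have "(\<chi> i. \<Sum>j\<in>set (a # js). k $ j * axis j 1 $ i) =
        (\<chi> i. k $ a * axis a 1 $ i) + (\<chi> i. \<Sum>j\<in>set js. k $ j * axis j 1 $ i)"
      using Cons.prems by (simp add: vec_eq_iff)
    moreover have "(\<Sum>j\<in>set (a # js). real_of_int (k $ j) *\<^sub>R (pi *\<^sub>R column j \<theta>)) =
        real_of_int (k $ a) *\<^sub>R (pi *\<^sub>R column a \<theta>) + (\<Sum>j\<in>set js. real_of_int (k $ j) *\<^sub>R (pi *\<^sub>R column j \<theta>))"
      using Cons.prems by simp
    ultimately show ?case
      using weyl_phase_mult[OF weyl_phase_int_pow[OF weyl_phase_ncU[of \<theta> a], of "k $ a"] Cons.IH] Cons.prems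
      by (simp only: list.map prod_list.Cons distinct.simps)
  qed
  from this[of "sorted_list_of_set UNIV"] show ?thesis
    by (simp add: ncU_pow_def nc_shift_def axis_def if_distrib[of "\<lambda>t. _ * t"] cong: if_cong)
qed

lemma nc_shift_add: "nc_shift \<theta> (k + l) = nc_shift \<theta> k + nc_shift \<theta> l"
  by (simp add: nc_shift_def scaleR_left_distrib sum.distrib algebra_simps)

text \<open>Both sides are unimodular multiples of the same Weyl operator, since frequencies and
  translations add.\<close>

lemma ncU_pow_mult:
  obtains c where "cmod c = 1" "ncU_pow \<theta> k * ncU_pow \<theta> l = c *\<^sub>C ncU_pow \<theta> (k + l)"
proof -
  obtain c where c: "cmod c = 1" "ncU_pow \<theta> k * ncU_pow \<theta> l = c *\<^sub>C weyl_op (k + l) (nc_shift \<theta> (k + l))"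
    using weyl_phase_mult[OF weyl_phase_ncU_pow[of \<theta> k] weyl_phase_ncU_pow[of \<theta> l]]
    by (auto simp: weyl_phase_def nc_shift_add)
  obtain d where d: "cmod d = 1" "ncU_pow \<theta> (k + l) = d *\<^sub>C weyl_op (k + l) (nc_shift \<theta> (k + l))"
    using weyl_phase_ncU_pow[of \<theta> "k + l"] by (auto simp: weyl_phase_def)
  have "d \<noteq> 0" using d(1) by auto
  then have "ncU_pow \<theta> k * ncU_pow \<theta> l = (c / d) *\<^sub>C ncU_pow \<theta> (k + l)"
    by (simp add: c(2) d(2) scaleC_torus_op_simps)
  then show ?thesis using c(1) d(1) by (intro that[of "c / d"]) (simp_all add: norm_divide)
qed

lemma norm_ncU_pow_le: "norm (ncU_pow \<theta> k) \<le> 1"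
proof -
  obtain c where c: "cmod c = 1" "ncU_pow \<theta> k = c *\<^sub>C weyl_op k (nc_shift \<theta> k)"
    using weyl_phase_ncU_pow[of \<theta> k] by (auto simp: weyl_phase_def)
  have "norm (weyl_op k (nc_shift \<theta> k)) \<le> 1"
    by (rule op.norm_leI) (simp_all add: op_apply_weyl_op norm_weyl)
  then show ?thesis by (simp add: c norm_scaleC_torus_op)
qed

lemma ncU_pow_0: "ncU_pow \<theta> 0 = 1"
proof -
  have "prod_list (map (\<lambda>_. 1) xs) = (1 :: 'a torus_op)" for xs :: "'a list"
    by (induction xs) auto
  then show ?thesis by (simp add: ncU_pow_def int_pow_def)
qed

text \<open>Up to a phase this is the character of k, hence the family is orthonormal; it detects
  the coefficient of U^k of an operator from its value at the constant function 1.\<close>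

definition nc_vec :: "real^'n::{finite,linorder}^'n::{finite,linorder} \<Rightarrow> int^'n::{finite,linorder} \<Rightarrow> 'n torus_L2" where
  "nc_vec \<theta> k = op_apply (ncU_pow \<theta> k) one_vec"

lemma nc_vec_eq:
  obtains c where "cmod c = 1" "nc_vec \<theta> k = c *\<^sub>C abs_torus_L2 (echar k)"
proof -
  obtain c where c: "cmod c = 1" "ncU_pow \<theta> k = c *\<^sub>C weyl_op k (nc_shift \<theta> k)"
    using weyl_phase_ncU_pow[of \<theta> k] by (auto simp: weyl_phase_def)
  have "nc_vec \<theta> k = c *\<^sub>C abs_torus_L2 (echar k)"
    by (simp add: nc_vec_def c(2) op_apply_simps op_apply_weyl_op one_vec_def weyl_abs square_integrable_const)
  then show ?thesis using c(1) that by blast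
qed

lemma cinner_weyl: "cinner (weyl k s f) (weyl k s g) = cinner f g"
proof -
  have inner: "inner (weyl k s f) (weyl k s g) = inner f g" for f g
    unfolding dot_norm by (simp add: norm_weyl flip: weyl_add)
  show ?thesis
    by (rule complex_eqI) (simp_all add: Im_cinner inner flip: inner_eq_Re_cinner weyl_scaleC)
qed

text \<open>Translations are unitary and act on the characters by different phases.\<close>

lemma echar_orthogonal:
  assumes "k \<noteq> l"
  shows "cinner (abs_torus_L2 (echar k)) (abs_torus_L2 (echar l)) = 0"
proof -
  obtain i where i: "k $ i \<noteq> l $ i" using assms by (auto simp: vec_eq_iff)
  \<comment> \<open>With this shift the phases acquired by the two characters have quotient cis
    \<pi> = - 1.\<close>
  define s where "s = (axis i (pi / (k $ i - l $ i)) :: real^'a)"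
  have sq: "echar k \<in> square_integrable" for k :: "int^'a"
    using square_integrable_echar_mult[OF square_integrable_const[of 1], of k] by simp
  have w: "weyl 0 s (abs_torus_L2 (echar k)) = echar k s *\<^sub>C abs_torus_L2 (echar k)" for k
    using sq[of k] by (simp add: weyl_abs scaleC_abs echar_add_right mult.commute)
  have "echar k s * cnj (echar l s) = cis (of_int (k $ i) * (pi / (k $ i - l $ i)) - of_int (l $ i) * (pi / (k $ i - l $ i)))"
    by (simp add: s_def echar_axis_right cis_cnj cis_mult)
  also have "of_int (k $ i) * (pi / (k $ i - l $ i)) - of_int (l $ i) * (pi / (k $ i - l $ i)) = pi"
  proof -
    have "real_of_int (k $ i) - real_of_int (l $ i) \<noteq> 0" using i by simp
    then show ?thesis unfolding left_diff_distrib[symmetric] by simp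
  qed
  finally have "echar k s * cnj (echar l s) = - 1" by simp
  moreover have "(echar k s * cnj (echar l s)) * cinner (abs_torus_L2 (echar k)) (abs_torus_L2 (echar l))
      = cinner (abs_torus_L2 (echar k)) (abs_torus_L2 (echar l))"
    using cinner_weyl[of 0 s "abs_torus_L2 (echar k)" "abs_torus_L2 (echar l)"]
    unfolding w cinner_scaleC_left cinner_scaleC_right by (simp only: mult_ac)
  ultimately show ?thesis by simp
qed

lemma nc_vec_orthonormal: "cinner (nc_vec \<theta> k) (nc_vec \<theta> l) = (if k = l then 1 else 0)"
proof (cases "k = l")
  case True
  obtain c where c: "cmod c = 1" "ncU_pow \<theta> k = c *\<^sub>C weyl_op k (nc_shift \<theta> k)"
    using weyl_phase_ncU_pow[of \<theta> k] by (auto simp: weyl_phase_def)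
  have "norm (nc_vec \<theta> k) = 1"
    by (simp add: nc_vec_def c op_apply_simps op_apply_weyl_op norm_scaleC_torus_L2 norm_weyl)
  then show ?thesis using True by (simp add: cinner_self(1) flip: power2_norm_eq_inner)
next
  case False
  obtain c d where "nc_vec \<theta> k = c *\<^sub>C abs_torus_L2 (echar k)" "nc_vec \<theta> l = d *\<^sub>C abs_torus_L2 (echar l)"
    by (metis nc_vec_eq)
  then show ?thesis
    using False by (simp add: cinner_scaleC_left cinner_scaleC_right echar_orthogonal)
qed

section \<open>The smooth subalgebra\<close>

lemma has_sum_finite_sum:
  fixes f :: "'i \<Rightarrow> 'b \<Rightarrow> 'a::topological_comm_monoid_add"
  assumes "finite I" "\<And>i. i \<in> I \<Longrightarrow> (f i has_sum s i) A"
  shows "((\<lambda>x. \<Sum>i\<in>I. f i x) has_sum (\<Sum>i\<in>I. s i)) A"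
  using assms by (induction I) (auto intro: has_sum_add)

section \<open>Polynomial weights and summation over the lattice of frequencies\<close>

definition wt :: "int^'n::finite \<Rightarrow> real" where
  "wt k = 1 + (\<Sum>i\<in>UNIV. \<bar>real_of_int (k $ i)\<bar>)"

lemma wt_ge_1: "1 \<le> wt k"
  by (simp add: wt_def sum_nonneg)

lemma component_le_wt: "1 + \<bar>real_of_int (k $ j)\<bar> \<le> wt k"
  unfolding wt_def using member_le_sum[of j UNIV "\<lambda>i. \<bar>real_of_int (k $ i)\<bar>"] by simp

lemma rapidly_decaying_wt: "rapidly_decaying u \<longleftrightarrow> (\<forall>N. \<exists>C. \<forall>k. wt k ^ N * cmod (u k) \<le> C)"
  by (simp add: rapidly_decaying_def wt_def)

text \<open>With m the largest |k_j|, the weight is at most (n + 1) max (1, m), and the power m^N is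
  one of the terms of the sum.\<close>

lemma wt_power_le:
  fixes k :: "int^'n::finite"
  shows "wt k ^ N \<le> (real CARD('n) + 1) ^ N * (1 + (\<Sum>j\<in>UNIV. \<bar>real_of_int (k $ j)\<bar> ^ N))"
proof -
  define m where "m = Max (range (\<lambda>j. \<bar>real_of_int (k $ j)\<bar>))"
  have le: "\<bar>real_of_int (k $ j)\<bar> \<le> m" for j unfolding m_def by (rule Max_ge) auto
  have "m \<in> range (\<lambda>j. \<bar>real_of_int (k $ j)\<bar>)" unfolding m_def by (rule Max_in) auto
  then obtain j where j: "m = \<bar>real_of_int (k $ j)\<bar>" by blast
  then have "0 \<le> m" by simp
  have "wt k \<le> 1 + real CARD('n) * m"
    unfolding wt_def using sum_bounded_above[of UNIV "\<lambda>j. \<bar>real_of_int (k $ j)\<bar>" m] le by simp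
  also have "\<dots> \<le> (real CARD('n) + 1) * max 1 m"
  proof -
    have "real CARD('n) * m \<le> real CARD('n) * max 1 m" by (intro mult_left_mono) auto
    moreover have "1 \<le> max 1 m" by simp
    ultimately show ?thesis unfolding distrib_right by linarith
  qed
  finally have "wt k ^ N \<le> ((real CARD('n) + 1) * max 1 m) ^ N"
    using wt_ge_1[of k] by (intro power_mono) auto
  also have "\<dots> = (real CARD('n) + 1) ^ N * max 1 m ^ N" by (simp add: power_mult_distrib)
  also have "max 1 m ^ N \<le> 1 + m ^ N"
    using \<open>0 \<le> m\<close> by (simp add: max_def)
  also have "m ^ N \<le> (\<Sum>j\<in>UNIV. \<bar>real_of_int (k $ j)\<bar> ^ N)"
    unfolding j by (rule member_le_sum) auto
  finally show ?thesis by simp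
qed

text \<open>Decay in each coordinate direction separately suffices, so only powers of a single
  derivation at a time have to be controlled.\<close>

lemma rapidly_decayingI:
  fixes u :: "int^'n::finite \<Rightarrow> complex"
  assumes "\<And>j i. \<exists>C. \<forall>k. \<bar>real_of_int (k $ j)\<bar> ^ i * cmod (u k) \<le> C"
  shows "rapidly_decaying u"
  unfolding rapidly_decaying_wt
proof
  fix N
  have "\<forall>j. \<exists>C. \<forall>k. \<bar>real_of_int (k $ j)\<bar> ^ N * cmod (u k) \<le> C" using assms by blast
  from choice[OF this] obtain C where C: "\<And>j k. \<bar>real_of_int (k $ j)\<bar> ^ N * cmod (u k) \<le> C j" by blast
  obtain C0 where C0: "\<And>k. cmod (u k) \<le> C0" using assms[of undefined 0] by auto
  have "wt k ^ N * cmod (u k) \<le> (real CARD('n) + 1) ^ N * (C0 + (\<Sum>j\<in>UNIV. C j))" for k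
  proof -
    have "wt k ^ N * cmod (u k) \<le>
        (real CARD('n) + 1) ^ N * (1 + (\<Sum>j\<in>UNIV. \<bar>real_of_int (k $ j)\<bar> ^ N)) * cmod (u k)"
      by (intro mult_right_mono wt_power_le) auto
    also have "\<dots> = (real CARD('n) + 1) ^ N *
        (cmod (u k) + (\<Sum>j\<in>UNIV. \<bar>real_of_int (k $ j)\<bar> ^ N * cmod (u k)))"
      by (simp add: algebra_simps sum_distrib_left sum_distrib_right)
    also have "\<dots> \<le> (real CARD('n) + 1) ^ N * (C0 + (\<Sum>j\<in>UNIV. C j))"
      by (intro mult_left_mono add_mono sum_mono C C0) auto
    finally show ?thesis .
  qed
  then show "\<exists>C. \<forall>k. wt k ^ N * cmod (u k) \<le> C" by blast
qed

text \<open>The map m to |m| is at most two to one, which bounds every finite sum by twice a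
  convergent series over the naturals.\<close>

lemma sum_inverse_square_bounded:
  obtains C where "0 \<le> C" "\<And>A. finite A \<Longrightarrow> (\<Sum>m\<in>A. 1 / (1 + \<bar>real_of_int m\<bar>)\<^sup>2) \<le> C"
proof -
  have "summable (\<lambda>n. inverse (real n ^ 2))" by (rule inverse_power_summable) simp
  then have s: "summable (\<lambda>n. 1 / (1 + real n)\<^sup>2)"
    by (subst (asm) summable_Suc_iff[symmetric]) (simp add: inverse_eq_divide add.commute)
  let ?a = "\<lambda>m. 1 / (1 + \<bar>real_of_int m\<bar>)\<^sup>2"
  have "sum ?a A \<le> 2 * (\<Sum>n. 1 / (1 + real n)\<^sup>2)" if A: "finite A" for A
  proof -
    define B where "B = (\<lambda>m. nat \<bar>m\<bar>) ` A"
    have B: "finite B" using A by (simp add: B_def)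
    have "A \<subseteq> int ` B \<union> (\<lambda>n. - int n) ` B"
    proof
      fix m assume "m \<in> A"
      then have "nat \<bar>m\<bar> \<in> B" by (simp add: B_def)
      moreover have "m = int (nat \<bar>m\<bar>) \<or> m = - int (nat \<bar>m\<bar>)" by auto
      ultimately show "m \<in> int ` B \<union> (\<lambda>n. - int n) ` B" by blast
    qed
    then have "sum ?a A \<le> sum ?a (int ` B \<union> (\<lambda>n. - int n) ` B)"
      using B by (intro sum_mono2) auto
    also have "\<dots> \<le> sum ?a (int ` B) + sum ?a ((\<lambda>n. - int n) ` B)"
      using B sum.union_inter[of "int ` B" "(\<lambda>n. - int n) ` B" ?a] sum_nonneg[of _ ?a]
      by (smt (verit) finite_imageI zero_le_divide_1_iff zero_le_power2)
    also have "sum ?a (int ` B) = (\<Sum>n\<in>B. 1 / (1 + real n)\<^sup>2)"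
      by (subst sum.reindex) (auto simp: inj_on_def)
    also have "sum ?a ((\<lambda>n. - int n) ` B) = (\<Sum>n\<in>B. 1 / (1 + real n)\<^sup>2)"
      by (subst sum.reindex) (auto simp: inj_on_def)
    also have "(\<Sum>n\<in>B. 1 / (1 + real n)\<^sup>2) \<le> (\<Sum>n. 1 / (1 + real n)\<^sup>2)"
      by (rule sum_le_suminf[OF s B]) auto
    finally show ?thesis by simp
  qed
  moreover have "0 \<le> (\<Sum>n. 1 / (1 + real n)\<^sup>2)" by (rule suminf_nonneg[OF s]) auto
  ultimately show ?thesis using that[of "2 * (\<Sum>n. 1 / (1 + real n)\<^sup>2)"] by simp
qed

text \<open>The weight dominates each of the n factors 1 + |k_i|, so its power 2 n dominates the
  product of their squares, and the sum over a box factors into n one-dimensional sums. The exponent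
  2 n is the loss of decay in all later estimates of norms by coefficients.\<close>

lemma summable_wt: "(\<lambda>k :: int^'n::finite. 1 / wt k ^ (2 * CARD('n))) summable_on UNIV"
proof (rule nonneg_bdd_above_summable_on)
  obtain C where C: "0 \<le> C" "\<And>A. finite A \<Longrightarrow> (\<Sum>m\<in>A. 1 / (1 + \<bar>real_of_int m\<bar>)\<^sup>2) \<le> C"
    using sum_inverse_square_bounded by blast
  show "bdd_above (sum (\<lambda>k :: int^'n. 1 / wt k ^ (2 * CARD('n))) ` {F. F \<subseteq> UNIV \<and> finite F})"
  proof (rule bdd_aboveI, clarify)
    fix F :: "(int^'n) set" assume F: "finite F"
    define A where "A = (\<Union>i. (\<lambda>k. k $ i) ` F)"
    have A: "finite A" using F by (simp add: A_def)
    have "1 / wt k ^ (2 * CARD('n)) \<le> (\<Prod>i\<in>UNIV. 1 / (1 + \<bar>real_of_int (k $ i)\<bar>)\<^sup>2)" for k :: "int^'n"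
    proof -
      have "(\<Prod>i\<in>UNIV. (1 + \<bar>real_of_int (k $ i)\<bar>)\<^sup>2) \<le> (\<Prod>i\<in>(UNIV :: 'n set). (wt k)\<^sup>2)"
        by (intro prod_mono conjI power_mono component_le_wt) auto
      also have "\<dots> = wt k ^ (2 * CARD('n))" by (simp add: power_mult)
      moreover have "0 < (\<Prod>i\<in>UNIV. (1 + \<bar>real_of_int (k $ i)\<bar>)\<^sup>2)"
        by (intro prod_pos) (auto intro!: zero_less_power add_pos_nonneg)
      ultimately have "1 / wt k ^ (2 * CARD('n)) \<le> 1 / (\<Prod>i\<in>UNIV. (1 + \<bar>real_of_int (k $ i)\<bar>)\<^sup>2)"
        by (intro divide_left_mono mult_pos_pos) auto
      then show ?thesis by (simp add: prod_dividef)
    qed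
    then have "(\<Sum>k\<in>F. 1 / wt k ^ (2 * CARD('n))) \<le> (\<Sum>k\<in>F. \<Prod>i\<in>UNIV. 1 / (1 + \<bar>real_of_int (k $ i)\<bar>)\<^sup>2)"
      by (intro sum_mono)
    also have "\<dots> = (\<Sum>f\<in>vec_nth ` F. \<Prod>i\<in>UNIV. 1 / (1 + \<bar>real_of_int (f i)\<bar>)\<^sup>2)"
      by (subst sum.reindex) (auto simp: inj_on_def vec_nth_inject)
    also have "\<dots> \<le> (\<Sum>f\<in>Pi\<^sub>E (UNIV :: 'n set) (\<lambda>_. A). \<Prod>i\<in>UNIV. 1 / (1 + \<bar>real_of_int (f i)\<bar>)\<^sup>2)"
      using A by (intro sum_mono2 finite_PiE prod_nonneg) (auto simp: A_def)
    also have "\<dots> = (\<Prod>i\<in>(UNIV :: 'n set). \<Sum>m\<in>A. 1 / (1 + \<bar>real_of_int m\<bar>)\<^sup>2)"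
      using A by (subst prod_sum_PiE) auto
    also have "\<dots> \<le> (\<Prod>i\<in>(UNIV :: 'n set). C)"
      by (intro prod_mono conjI C A sum_nonneg) auto
    finally show "(\<Sum>k\<in>F. 1 / wt k ^ (2 * CARD('n))) \<le> (\<Prod>i\<in>(UNIV :: 'n set). C)" .
  qed
qed (use wt_ge_1 in \<open>auto intro!: zero_le_power order_trans[OF zero_le_one]\<close>)

definition wt_sum :: "'n::finite itself \<Rightarrow> real" where
  "wt_sum _ = (\<Sum>\<^sub>\<infinity>k :: int^'n. 1 / wt k ^ (2 * CARD('n)))"

lemma wt_sum_nonneg: "0 \<le> wt_sum TYPE('n::finite)"
  unfolding wt_sum_def
  by (intro infsum_nonneg) (use wt_ge_1 in \<open>auto intro!: zero_le_power order_trans[OF zero_le_one]\<close>)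

definition absum :: "(int^'n::finite \<Rightarrow> complex) \<Rightarrow> bool" where
  "absum u \<longleftrightarrow> (\<lambda>k. cmod (u k)) summable_on UNIV"

lemma absum_of_bound:
  fixes u :: "int^'n::finite \<Rightarrow> complex"
  assumes "\<And>k. wt k ^ (2 * CARD('n)) * cmod (u k) \<le> C"
  shows "absum u" "(\<Sum>\<^sub>\<infinity>k. cmod (u k)) \<le> C * wt_sum TYPE('n)"
proof -
  have le: "cmod (u k) \<le> C * (1 / wt k ^ (2 * CARD('n)))" for k
  proof -
    have "0 < wt k ^ (2 * CARD('n))" using wt_ge_1[of k] by (intro zero_less_power) simp
    then show ?thesis using assms[of k] by (simp add: field_simps)
  qed
  have s: "(\<lambda>k :: int^'n. C * (1 / wt k ^ (2 * CARD('n)))) summable_on UNIV"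
    by (intro summable_on_cmult_right summable_wt)
  show "absum u"
    unfolding absum_def by (rule Infinite_Sum.abs_summable_on_comparison_test'[OF s le])
  then have "(\<Sum>\<^sub>\<infinity>k. cmod (u k)) \<le> (\<Sum>\<^sub>\<infinity>k :: int^'n. C * (1 / wt k ^ (2 * CARD('n))))"
    unfolding absum_def by (rule infsum_mono[OF _ s le])
  also have "\<dots> = C * wt_sum TYPE('n)"
    unfolding wt_sum_def by (intro infsum_cmult_right summable_wt)
  finally show "(\<Sum>\<^sub>\<infinity>k. cmod (u k)) \<le> C * wt_sum TYPE('n)" .
qed

lemma rapidly_decaying_absum: "rapidly_decaying u \<Longrightarrow> absum u"
  unfolding rapidly_decaying_wt by (meson absum_of_bound(1))

lemma rapidly_decaying_polynomial:
  assumes "rapidly_decaying u"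
  shows "rapidly_decaying (\<lambda>k. of_int (k $ j) ^ i * u k)"
  unfolding rapidly_decaying_wt
proof
  fix N
  obtain C where C: "\<And>k. wt k ^ (N + i) * cmod (u k) \<le> C"
    using assms unfolding rapidly_decaying_wt by blast
  have "wt k ^ N * cmod (of_int (k $ j) ^ i * u k) \<le> C" for k
  proof -
    have "wt k ^ N * cmod (of_int (k $ j) ^ i * u k) = wt k ^ N * (\<bar>real_of_int (k $ j)\<bar> ^ i * cmod (u k))"
      by (simp add: norm_mult norm_power)
    also have "\<dots> \<le> wt k ^ N * (wt k ^ i * cmod (u k))"
      using component_le_wt[of k j] wt_ge_1[of k]
      by (intro mult_left_mono mult_right_mono power_mono) auto
    also have "\<dots> \<le> C" using C[of k] by (simp add: power_add mult.assoc)
    finally show ?thesis .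
  qed
  then show "\<exists>C. \<forall>k. wt k ^ N * cmod (of_int (k $ j) ^ i * u k) \<le> C" by blast
qed

text \<open>Defined for every operator as a matrix coefficient, which makes it a bounded functional;
  \<open>has_sum_coef\<close> identifies it with the coefficients of a convergent series in the
  U^k.\<close>

definition coef :: "real^'n::{finite,linorder}^'n::{finite,linorder} \<Rightarrow> 'n torus_op \<Rightarrow> int^'n::{finite,linorder} \<Rightarrow> complex" where
  "coef \<theta> a k = cinner (op_apply a one_vec) (nc_vec \<theta> k)"

lemma norm_nc_vec [simp]: "norm (nc_vec \<theta> k) = 1"
proof -
  have "complex_of_real ((norm (nc_vec \<theta> k))\<^sup>2) = 1"
    using nc_vec_orthonormal[of \<theta> k k] by (simp add: cinner_self(1) power2_norm_eq_inner)
  then have "(norm (nc_vec \<theta> k))\<^sup>2 = 1" by (metis of_real_eq_1_iff)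
  then show ?thesis using norm_ge_zero[of "nc_vec \<theta> k"] by (auto simp: power2_eq_1_iff)
qed

lemma coef_add: "coef \<theta> (a + b) k = coef \<theta> a k + coef \<theta> b k"
  by (simp add: coef_def op_apply_simps cinner_add_left)

lemma coef_scaleC: "coef \<theta> (c *\<^sub>C a) k = c * coef \<theta> a k"
  by (simp add: coef_def op_apply_simps cinner_scaleC_left)

lemma coef_scaleR: "coef \<theta> (r *\<^sub>R a) k = r * coef \<theta> a k"
  using coef_scaleC[of \<theta> "complex_of_real r" a k] by (simp add: scaleC_torus_op_simps)

lemma norm_coef_le: "cmod (coef \<theta> a k) \<le> norm a"
  using norm_cinner_le[of "op_apply a one_vec" "nc_vec \<theta> k"] op.norm_act[of a one_vec]
  by (simp add: coef_def)

lemma bounded_linear_coef: "bounded_linear (\<lambda>a. coef \<theta> a k)"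
  by (rule bounded_linear_intro[of _ 1]) (simp_all add: coef_add coef_scaleR norm_coef_le scaleR_conv_of_real[of _ "coef _ _ _"])

lemmas coef_simps = linear_simps[OF bounded_linear_coef]

definition sm :: "real^'n::{finite,linorder}^'n::{finite,linorder} \<Rightarrow> (int^'n::{finite,linorder} \<Rightarrow> complex) \<Rightarrow> 'n torus_op" where
  "sm \<theta> u = (\<Sum>\<^sub>\<infinity>k. u k *\<^sub>C ncU_pow \<theta> k)"

lemma norm_term_le: "norm (c *\<^sub>C ncU_pow \<theta> k) \<le> cmod c"
  by (simp add: norm_scaleC_torus_op mult_left_le norm_ncU_pow_le)

lemma sm_abs_summable: "absum u \<Longrightarrow> (\<lambda>k. norm (u k *\<^sub>C ncU_pow \<theta> k)) summable_on UNIV"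
  unfolding absum_def by (rule Infinite_Sum.abs_summable_on_comparison_test'[OF _ norm_term_le])

lemma sm_has_sum: "absum u \<Longrightarrow> ((\<lambda>k. u k *\<^sub>C ncU_pow \<theta> k) has_sum sm \<theta> u) UNIV"
  unfolding sm_def by (rule has_sum_infsum[OF abs_summable_summable[OF sm_abs_summable]])

lemma norm_sm_le: "absum u \<Longrightarrow> norm (sm \<theta> u) \<le> (\<Sum>\<^sub>\<infinity>k. cmod (u k))"
  unfolding sm_def
  by (rule order_trans[OF norm_infsum_bound[OF sm_abs_summable] infsum_mono[OF sm_abs_summable]])
     (simp_all add: norm_term_le absum_def)

text \<open>A bounded functional may be applied term by term, and orthonormality of
  \<open>nc_vec\<close> leaves a single term. In particular the coefficients of a smooth element are
  unique.\<close>

lemma has_sum_coef: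
  assumes "((\<lambda>k. u k *\<^sub>C ncU_pow \<theta> k) has_sum a) UNIV"
  shows "coef \<theta> a = u"
proof
  fix k
  have tm: "coef \<theta> (u l *\<^sub>C ncU_pow \<theta> l) k = (if l = k then u k else 0)" for l
    by (simp add: coef_scaleC) (simp add: coef_def nc_vec_orthonormal flip: nc_vec_def)
  have "((\<lambda>l. coef \<theta> (u l *\<^sub>C ncU_pow \<theta> l) k) has_sum coef \<theta> a k) UNIV"
    by (rule has_sum_bounded_linear[OF bounded_linear_coef assms])
  moreover have "((\<lambda>l. if l = k then u k else 0) has_sum u k) UNIV"
    using has_sum_cong_neutral[of UNIV "{k}" "\<lambda>l. if l = k then u k else 0" "\<lambda>_. u k" "u k"]
      has_sum_finite[of "{k}" "\<lambda>_. u k"] by simp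
  ultimately show "coef \<theta> a k = u k" unfolding tm by (rule has_sum_unique)
qed

lemma coef_sm: "absum u \<Longrightarrow> coef \<theta> (sm \<theta> u) = u"
  by (rule has_sum_coef[OF sm_has_sum])

text \<open>Membership splits into two checks: decay of the canonical coefficients, and equality of
  the element with its own Fourier series. The second is the delicate one for limits.\<close>

lemma nc_smooth_iff: "a \<in> nc_smooth \<theta> \<longleftrightarrow> rapidly_decaying (coef \<theta> a) \<and> a = sm \<theta> (coef \<theta> a)"
proof
  assume "a \<in> nc_smooth \<theta>"
  then obtain u where u: "rapidly_decaying u" "((\<lambda>k. u k *\<^sub>C ncU_pow \<theta> k) has_sum a) UNIV"
    by (auto simp: nc_smooth_def)
  then show "rapidly_decaying (coef \<theta> a) \<and> a = sm \<theta> (coef \<theta> a)"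
    by (simp add: has_sum_coef sm_def infsumI)
next
  assume a: "rapidly_decaying (coef \<theta> a) \<and> a = sm \<theta> (coef \<theta> a)"
  then have "((\<lambda>k. coef \<theta> a k *\<^sub>C ncU_pow \<theta> k) has_sum a) UNIV"
    using sm_has_sum[OF rapidly_decaying_absum, of "coef \<theta> a" \<theta>] by simp
  with a show "a \<in> nc_smooth \<theta>" unfolding nc_smooth_def by blast
qed

lemma nc_smoothD:
  assumes "a \<in> nc_smooth \<theta>"
  shows "rapidly_decaying (coef \<theta> a)" "absum (coef \<theta> a)" "a = sm \<theta> (coef \<theta> a)"
  using assms rapidly_decaying_absum nc_smooth_iff by blast+

lemma sm_smooth: "rapidly_decaying u \<Longrightarrow> sm \<theta> u \<in> nc_smooth \<theta>"
  by (simp add: nc_smooth_iff coef_sm rapidly_decaying_absum)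

lemma rapidly_decaying_add:
  assumes "rapidly_decaying u" "rapidly_decaying w"
  shows "rapidly_decaying (\<lambda>k. u k + w k)"
  unfolding rapidly_decaying_wt
proof
  fix N
  obtain C D where CD: "\<And>k. wt k ^ N * cmod (u k) \<le> C" "\<And>k. wt k ^ N * cmod (w k) \<le> D"
    using assms unfolding rapidly_decaying_wt by blast
  have "wt k ^ N * cmod (u k + w k) \<le> C + D" for k
  proof -
    have "wt k ^ N * cmod (u k + w k) \<le> wt k ^ N * (cmod (u k) + cmod (w k))"
      using wt_ge_1[of k] by (intro mult_left_mono norm_triangle_ineq zero_le_power) simp
    then show ?thesis using CD[of k] by (simp add: distrib_left)
  qed
  then show "\<exists>C. \<forall>k. wt k ^ N * cmod (u k + w k) \<le> C" by blast
qed

lemma smooth_add: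
  assumes "a \<in> nc_smooth \<theta>" "b \<in> nc_smooth \<theta>"
  shows "a + b \<in> nc_smooth \<theta>"
proof -
  obtain u w where uw: "rapidly_decaying u" "((\<lambda>k. u k *\<^sub>C ncU_pow \<theta> k) has_sum a) UNIV"
    "rapidly_decaying w" "((\<lambda>k. w k *\<^sub>C ncU_pow \<theta> k) has_sum b) UNIV"
    using assms by (auto simp: nc_smooth_def)
  then show ?thesis
    unfolding nc_smooth_def
    using rapidly_decaying_add[OF uw(1,3)] has_sum_add[OF uw(2,4)]
    by (auto simp: scaleC_torus_op_simps(8)[symmetric])
qed

lemma smooth_scaleC:
  assumes "a \<in> nc_smooth \<theta>"
  shows "c *\<^sub>C a \<in> nc_smooth \<theta>"
proof -
  obtain u where u: "rapidly_decaying u" "((\<lambda>k. u k *\<^sub>C ncU_pow \<theta> k) has_sum a) UNIV"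
    using assms by (auto simp: nc_smooth_def)
  have "rapidly_decaying (\<lambda>k. c * u k)"
    unfolding rapidly_decaying_wt
  proof
    fix N
    obtain C where C: "\<And>k. wt k ^ N * cmod (u k) \<le> C" using u(1) unfolding rapidly_decaying_wt by blast
    have "wt k ^ N * cmod (c * u k) \<le> cmod c * C" for k
      using mult_left_mono[OF C[of k], of "cmod c"] by (simp add: norm_mult mult_ac)
    then show "\<exists>C. \<forall>k. wt k ^ N * cmod (c * u k) \<le> C" by blast
  qed
  moreover have "((\<lambda>k. (c * u k) *\<^sub>C ncU_pow \<theta> k) has_sum c *\<^sub>C a) UNIV"
    using has_sum_bounded_linear[OF bounded_linear_scaleC_right u(2), of c]
    by (simp add: scaleC_torus_op_simps)
  ultimately show ?thesis unfolding nc_smooth_def by blast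
qed

lemma smooth_scaleR: "a \<in> nc_smooth \<theta> \<Longrightarrow> r *\<^sub>R a \<in> nc_smooth \<theta>"
  using smooth_scaleC[of a \<theta> "complex_of_real r"] by (simp add: scaleC_torus_op_simps)

lemma smooth_diff: "a \<in> nc_smooth \<theta> \<Longrightarrow> b \<in> nc_smooth \<theta> \<Longrightarrow> a - b \<in> nc_smooth \<theta>"
  using smooth_add[of a \<theta> "(- 1) *\<^sub>R b"] smooth_scaleR[of b \<theta> "- 1"] by simp

lemma coef_1: "coef \<theta> 1 k = (if k = 0 then 1 else 0)"
proof -
  have one: "one_vec = nc_vec \<theta> 0" by (simp add: nc_vec_def ncU_pow_0 op_apply_simps)
  show ?thesis unfolding coef_def op_apply_simps one nc_vec_orthonormal by auto
qed

lemma smooth_1: "1 \<in> nc_smooth \<theta>"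
  unfolding nc_smooth_def
proof (intro CollectI exI[of _ "\<lambda>k. if k = 0 then 1 else 0"] conjI)
  show "rapidly_decaying (\<lambda>k. if k = 0 then 1 else 0)"
    unfolding rapidly_decaying_wt by (auto simp: wt_def intro!: exI[of _ 1])
  let ?F = "\<lambda>k. (if k = 0 then 1 else 0) *\<^sub>C ncU_pow \<theta> k"
  have "(?F has_sum sum ?F {0}) {0}" by (rule has_sum_finite) simp
  then show "(?F has_sum 1) UNIV"
    using has_sum_cong_neutral[of UNIV "{0}" ?F ?F 1]
    by (simp add: ncU_pow_0 scaleC_torus_op_simps)
qed

lemma smooth_0: "0 \<in> nc_smooth \<theta>"
  using smooth_scaleR[OF smooth_1, of 0] by simp

lemma smooth_sum: "(\<And>i. i \<in> I \<Longrightarrow> f i \<in> nc_smooth \<theta>) \<Longrightarrow> sum f I \<in> nc_smooth \<theta>"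
  by (induction I rule: infinite_finite_induct) (auto intro: smooth_add smooth_0)

section \<open>Products of smooth elements as twisted convolutions\<close>

definition cocycle :: "real^'n::{finite,linorder}^'n::{finite,linorder} \<Rightarrow> int^'n::{finite,linorder} \<Rightarrow> int^'n::{finite,linorder} \<Rightarrow> complex" where
  "cocycle \<theta> k l = (SOME c. cmod c = 1 \<and> ncU_pow \<theta> k * ncU_pow \<theta> l = c *\<^sub>C ncU_pow \<theta> (k + l))"

lemma cocycle:
  "cmod (cocycle \<theta> k l) = 1"
  "ncU_pow \<theta> k * ncU_pow \<theta> l = cocycle \<theta> k l *\<^sub>C ncU_pow \<theta> (k + l)"
proof -
  have "\<exists>c. cmod c = 1 \<and> ncU_pow \<theta> k * ncU_pow \<theta> l = c *\<^sub>C ncU_pow \<theta> (k + l)"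
    using ncU_pow_mult by blast
  from someI_ex[OF this]
  show "cmod (cocycle \<theta> k l) = 1" "ncU_pow \<theta> k * ncU_pow \<theta> l = cocycle \<theta> k l *\<^sub>C ncU_pow \<theta> (k + l)"
    unfolding cocycle_def by auto
qed

definition conv_term :: "real^'n::{finite,linorder}^'n::{finite,linorder} \<Rightarrow> (int^'n::{finite,linorder} \<Rightarrow> complex) \<Rightarrow> (int^'n::{finite,linorder} \<Rightarrow> complex) \<Rightarrow> int^'n::{finite,linorder} \<Rightarrow> int^'n::{finite,linorder} \<Rightarrow> complex" where
  "conv_term \<theta> u w m k = cocycle \<theta> k (m - k) * (u k * w (m - k))"

text \<open>Convolution twisted by the phases of U^k U^l: the coefficient sequence of a product, see
  \<open>sm_mult\<close>.\<close>

definition conv :: "real^'n::{finite,linorder}^'n::{finite,linorder} \<Rightarrow> (int^'n::{finite,linorder} \<Rightarrow> complex) \<Rightarrow> (int^'n::{finite,linorder} \<Rightarrow> complex) \<Rightarrow> int^'n::{finite,linorder} \<Rightarrow> complex" where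
  "conv \<theta> u w m = (\<Sum>\<^sub>\<infinity>k. conv_term \<theta> u w m k)"

text \<open>Rearranges a double series over pairs of frequencies (k, l) by the total frequency m = k
  + l.\<close>

lemma bij_shear: "bij_betw (\<lambda>(m :: int^'n::finite, k). (k, m - k)) (UNIV \<times> UNIV) (UNIV \<times> UNIV)"
  by (rule bij_betwI[of _ _ _ "\<lambda>(k, l). (k + l, k)"]) auto

lemma absum_product:
  assumes "absum u" "absum w"
  shows "(\<lambda>(k, l). cmod (u k) * cmod (w l)) summable_on UNIV \<times> UNIV"
proof -
  have "(\<lambda>x. norm ((\<lambda>(k, l). cmod (u k) * cmod (w l)) x)) summable_on UNIV \<times> UNIV"
    unfolding Infinite_Sum.abs_summable_on_Sigma_iff
  proof (intro conjI ballI)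
    fix k
    show "(\<lambda>l. norm (case (k, l) of (k, l) \<Rightarrow> cmod (u k) * cmod (w l))) summable_on UNIV"
      using assms(2) by (simp add: absum_def summable_on_cmult_right)
    show "(\<lambda>k. norm (\<Sum>\<^sub>\<infinity>l. norm (case (k, l) of (k, l) \<Rightarrow> cmod (u k) * cmod (w l)))) summable_on UNIV"
      using assms by (simp add: absum_def infsum_cmult_right' abs_mult infsum_nonneg summable_on_cmult_left)
  qed
  then show ?thesis by (rule abs_summable_summable)
qed

lemma conv_term_summable:
  assumes "absum u" "absum w"
  shows "(\<lambda>x. norm ((\<lambda>(m, k). conv_term \<theta> u w m k) x)) summable_on UNIV \<times> UNIV"
proof -
  have "(\<lambda>x. (\<lambda>(k, l). cmod (u k) * cmod (w l)) ((\<lambda>(m, k). (k, m - k)) x)) summable_on UNIV \<times> UNIV"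
    using absum_product[OF assms] summable_on_reindex_bij_betw[OF bij_shear] by blast
  then show ?thesis
    by (simp add: conv_term_def norm_mult cocycle case_prod_unfold)
qed

text \<open>The l^1 estimate of a convolution. The third bound is uniform in m;
  \<open>rapidly_decaying_conv\<close> applies it to factors weighted by powers of one
  component.\<close>

lemma conv_props:
  assumes "absum u" "absum w"
  shows "absum (conv \<theta> u w)" "conv_term \<theta> u w m summable_on UNIV"
    "cmod (conv \<theta> u w m) \<le> (\<Sum>\<^sub>\<infinity>x\<in>UNIV \<times> UNIV. norm ((\<lambda>(m, k). conv_term \<theta> u w m k) x))"
proof -
  note s = conv_term_summable[OF assms, of \<theta>]
  note s' = s[unfolded Infinite_Sum.abs_summable_on_Sigma_iff]
  have s1: "(\<lambda>k. norm (conv_term \<theta> u w m k)) summable_on UNIV" for m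
    using s' by simp
  show "conv_term \<theta> u w m summable_on UNIV" using s1 by (rule abs_summable_summable)
  have le: "cmod (conv \<theta> u w m) \<le> (\<Sum>\<^sub>\<infinity>k. norm (conv_term \<theta> u w m k))" for m
    unfolding conv_def using s1 by (rule norm_infsum_bound)
  have s2: "(\<lambda>m. \<Sum>\<^sub>\<infinity>k. norm (conv_term \<theta> u w m k)) summable_on UNIV"
    using s' by (auto intro: abs_summable_summable)
  show absum: "absum (conv \<theta> u w)"
    unfolding absum_def by (rule Infinite_Sum.abs_summable_on_comparison_test'[OF s2 le])
  have "(\<Sum>\<^sub>\<infinity>k. norm (conv_term \<theta> u w m k)) \<le> (\<Sum>\<^sub>\<infinity>m. \<Sum>\<^sub>\<infinity>k. norm (conv_term \<theta> u w m k))"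
    using finite_sum_le_infsum[OF s2, of "{m}"] by (simp add: infsum_nonneg)
  also have "\<dots> = (\<Sum>\<^sub>\<infinity>x\<in>UNIV \<times> UNIV. norm ((\<lambda>(m, k). conv_term \<theta> u w m k) x))"
    using infsum_Sigma_banach[OF s] by simp
  finally show "cmod (conv \<theta> u w m) \<le> (\<Sum>\<^sub>\<infinity>x\<in>UNIV \<times> UNIV. norm ((\<lambda>(m, k). conv_term \<theta> u w m k) x))"
    using le[of m] by simp
qed

text \<open>The absolutely summable double series is summed once as an iterated series, which gives
  the product, and once along the lines k + l = m, which gives the convolution.\<close>

lemma sm_mult:
  fixes u w :: "int^'n::{finite,linorder} \<Rightarrow> complex"
  assumes "absum u" "absum w"
  shows "sm \<theta> u * sm \<theta> w = sm \<theta> (conv \<theta> u w)"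
proof -
  define G where "G = (\<lambda>(k, l). (u k *\<^sub>C ncU_pow \<theta> k) * (w l *\<^sub>C ncU_pow \<theta> l))"
  have "(\<lambda>x. norm (G x)) summable_on UNIV \<times> UNIV"
  proof (rule Infinite_Sum.abs_summable_on_comparison_test'[OF absum_product[OF assms]])
    fix x :: "(int^'n::{finite,linorder}) \<times> (int^'n::{finite,linorder})"
    obtain k l where x: "x = (k, l)" by force
    have "norm (G x) \<le> norm (u k *\<^sub>C ncU_pow \<theta> k) * norm (w l *\<^sub>C ncU_pow \<theta> l)"
      unfolding x G_def by (simp add: norm_mult_ineq)
    also have "\<dots> \<le> cmod (u k) * cmod (w l)" by (intro mult_mono norm_term_le) auto
    finally show "norm (G x) \<le> (case x of (k, l) \<Rightarrow> cmod (u k) * cmod (w l))" by (simp add: x)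
  qed
  then have G: "G summable_on UNIV \<times> UNIV" by (rule abs_summable_summable)
  have "(G has_sum sm \<theta> u * sm \<theta> w) (UNIV \<times> UNIV)"
  proof (rule has_sum_SigmaI[OF _ _ G])
    show "((\<lambda>l. G (k, l)) has_sum (u k *\<^sub>C ncU_pow \<theta> k) * sm \<theta> w) UNIV" for k
      unfolding G_def prod.case by (rule has_sum_cmult_right[OF sm_has_sum[OF assms(2)]])
    show "((\<lambda>k. (u k *\<^sub>C ncU_pow \<theta> k) * sm \<theta> w) has_sum sm \<theta> u * sm \<theta> w) UNIV"
      by (rule has_sum_cmult_left[OF sm_has_sum[OF assms(1)]])
  qed
  then have *: "((\<lambda>x. G ((\<lambda>(m, k). (k, m - k)) x)) has_sum sm \<theta> u * sm \<theta> w) (UNIV \<times> UNIV)"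
    using has_sum_reindex_bij_betw[OF bij_shear] by blast
  have "((\<lambda>m. conv \<theta> u w m *\<^sub>C ncU_pow \<theta> m) has_sum sm \<theta> u * sm \<theta> w) UNIV"
  proof (rule has_sum_SigmaD[OF *])
    fix m
    have "(conv_term \<theta> u w m has_sum conv \<theta> u w m) UNIV"
      unfolding conv_def by (rule has_sum_infsum[OF conv_props(2)[OF assms]])
    from has_sum_bounded_linear[OF bounded_linear_scaleC_left this]
    show "((\<lambda>k. G ((\<lambda>(m, k). (k, m - k)) (m, k))) has_sum conv \<theta> u w m *\<^sub>C ncU_pow \<theta> m) UNIV"
      by (simp add: G_def conv_term_def scaleC_torus_op_simps cocycle mult_ac)
  qed
  then show ?thesis by (simp add: sm_def infsumI)
qed

section \<open>Iterated derivations, their Leibniz rule and jet norms\<close>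

definition dcoef :: "'n::finite \<Rightarrow> nat \<Rightarrow> (int^'n \<Rightarrow> complex) \<Rightarrow> int^'n \<Rightarrow> complex" where
  "dcoef j i u k = of_int (k $ j) ^ i * u k"

lemma rapidly_decaying_dcoef: "rapidly_decaying u \<Longrightarrow> rapidly_decaying (dcoef j i u)"
  unfolding dcoef_def by (rule rapidly_decaying_polynomial)

lemma absum_dcoef: "rapidly_decaying u \<Longrightarrow> absum (dcoef j i u)"
  by (intro rapidly_decaying_absum rapidly_decaying_dcoef)

text \<open>The Leibniz rule on coefficients: the factor m_j^i of the i-fold derivation is expanded
  by the binomial theorem from m_j = k_j + (m - k)_j inside the convolution.\<close>

lemma dcoef_conv:
  assumes "rapidly_decaying u" "rapidly_decaying w"
  shows "dcoef j i (conv \<theta> u w) m =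
    (\<Sum>p\<le>i. of_nat (i choose p) * conv \<theta> (dcoef j p u) (dcoef j (i - p) w) m)"
proof -
  have "((\<lambda>k. \<Sum>p\<le>i. of_nat (i choose p) * conv_term \<theta> (dcoef j p u) (dcoef j (i - p) w) m k) has_sum
      (\<Sum>p\<le>i. of_nat (i choose p) * conv \<theta> (dcoef j p u) (dcoef j (i - p) w) m)) UNIV"
    unfolding conv_def
    by (intro has_sum_finite_sum has_sum_cmult_right has_sum_infsum conv_props(2) absum_dcoef assms finite_atMost)
  moreover have "(\<Sum>p\<le>i. of_nat (i choose p) * conv_term \<theta> (dcoef j p u) (dcoef j (i - p) w) m k) =
      of_int (m $ j) ^ i * conv_term \<theta> u w m k" for k
  proof -
    have "(of_int (m $ j) :: complex) ^ i = (of_int (k $ j) + of_int ((m - k) $ j)) ^ i" by simp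
    also have "\<dots> = (\<Sum>p\<le>i. of_nat (i choose p) * of_int (k $ j) ^ p * of_int ((m - k) $ j) ^ (i - p))"
      by (rule binomial_ring)
    finally show ?thesis
      by (simp add: conv_term_def dcoef_def sum_distrib_left sum_distrib_right mult_ac)
  qed
  moreover have "((\<lambda>k. of_int (m $ j) ^ i * conv_term \<theta> u w m k) has_sum dcoef j i (conv \<theta> u w) m) UNIV"
    unfolding conv_def dcoef_def
    by (intro has_sum_cmult_right has_sum_infsum conv_props(2) rapidly_decaying_absum assms)
  ultimately show ?thesis by (simp add: has_sum_unique)
qed

lemma rapidly_decaying_conv:
  assumes "rapidly_decaying u" "rapidly_decaying w"
  shows "rapidly_decaying (conv \<theta> u w)"
proof (rule rapidly_decayingI)
  fix j i
  let ?B = "\<lambda>p. \<Sum>\<^sub>\<infinity>x\<in>UNIV \<times> UNIV. norm ((\<lambda>(m, k). conv_term \<theta> (dcoef j p u) (dcoef j (i - p) w) m k) x)"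
  have "\<bar>real_of_int (m $ j)\<bar> ^ i * cmod (conv \<theta> u w m) \<le> (\<Sum>p\<le>i. real (i choose p) * ?B p)" for m
  proof -
    have "\<bar>real_of_int (m $ j)\<bar> ^ i * cmod (conv \<theta> u w m) = cmod (dcoef j i (conv \<theta> u w) m)"
      by (simp add: dcoef_def norm_mult norm_power)
    also have "\<dots> \<le> (\<Sum>p\<le>i. cmod (of_nat (i choose p) * conv \<theta> (dcoef j p u) (dcoef j (i - p) w) m))"
      unfolding dcoef_conv[OF assms] by (rule norm_sum)
    also have "\<dots> \<le> (\<Sum>p\<le>i. real (i choose p) * ?B p)"
      unfolding norm_mult norm_of_nat
      by (intro sum_mono mult_left_mono conv_props absum_dcoef assms) auto
    finally show ?thesis .
  qed
  then show "\<exists>C. \<forall>m. \<bar>real_of_int (m $ j)\<bar> ^ i * cmod (conv \<theta> u w m) \<le> C" by blast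
qed

lemma smooth_mult:
  assumes "a \<in> nc_smooth \<theta>" "b \<in> nc_smooth \<theta>"
  shows "a * b \<in> nc_smooth \<theta>" "coef \<theta> (a * b) = conv \<theta> (coef \<theta> a) (coef \<theta> b)"
proof -
  note a = nc_smoothD[OF assms(1)] and b = nc_smoothD[OF assms(2)]
  have ab: "a * b = sm \<theta> (conv \<theta> (coef \<theta> a) (coef \<theta> b))"
    using sm_mult[OF a(2) b(2), of \<theta>] a(3) b(3) by simp
  show "a * b \<in> nc_smooth \<theta>"
    unfolding ab by (intro sm_smooth rapidly_decaying_conv a b)
  show "coef \<theta> (a * b) = conv \<theta> (coef \<theta> a) (coef \<theta> b)"
    unfolding ab by (intro coef_sm conv_props a b)
qed

lemma smooth_power: "a \<in> nc_smooth \<theta> \<Longrightarrow> a ^ m \<in> nc_smooth \<theta>"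
  by (induction m) (auto intro: smooth_mult smooth_1)

text \<open>The iterated derivation \<open>\<delta>\<^sub>j\<^sup>i\<close>.\<close>

definition nc_deriv :: "real^'n::{finite,linorder}^'n::{finite,linorder} \<Rightarrow> 'n \<Rightarrow> nat \<Rightarrow> 'n torus_op \<Rightarrow> 'n torus_op" where
  "nc_deriv \<theta> j i a = sm \<theta> (dcoef j i (coef \<theta> a))"

lemma nc_deriv_0: "a \<in> nc_smooth \<theta> \<Longrightarrow> nc_deriv \<theta> j 0 a = a"
  using nc_smoothD(3)[of a \<theta>] by (simp add: nc_deriv_def dcoef_def[abs_def])

lemma sm_sum:
  assumes "finite I" "\<And>i. i \<in> I \<Longrightarrow> absum (u i)"
  shows "sm \<theta> (\<lambda>k. \<Sum>i\<in>I. c i * u i k) = (\<Sum>i\<in>I. c i *\<^sub>C sm \<theta> (u i))"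
proof -
  have sum: "(\<Sum>i\<in>I. c i * u i k) *\<^sub>C ncU_pow \<theta> k = (\<Sum>i\<in>I. c i *\<^sub>C u i k *\<^sub>C ncU_pow \<theta> k)" for k
    by (simp add: bounded_linear.linear[OF bounded_linear_scaleC_left, THEN linear_sum] scaleC_torus_op_simps)
  have "((\<lambda>k. \<Sum>i\<in>I. c i *\<^sub>C u i k *\<^sub>C ncU_pow \<theta> k) has_sum (\<Sum>i\<in>I. c i *\<^sub>C sm \<theta> (u i))) UNIV"
    by (intro has_sum_finite_sum has_sum_bounded_linear[OF bounded_linear_scaleC_right] sm_has_sum assms)
  then show ?thesis unfolding sm_def[of \<theta> "\<lambda>k. \<Sum>i\<in>I. c i * u i k"] sum by (rule infsumI)
qed

lemma nc_deriv_mult: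
  assumes "a \<in> nc_smooth \<theta>" "b \<in> nc_smooth \<theta>"
  shows "nc_deriv \<theta> j i (a * b) = (\<Sum>p\<le>i. of_nat (i choose p) *\<^sub>C (nc_deriv \<theta> j p a * nc_deriv \<theta> j (i - p) b))"
proof -
  note a = nc_smoothD[OF assms(1)] and b = nc_smoothD[OF assms(2)]
  have "dcoef j i (coef \<theta> (a * b)) =
      (\<lambda>m. \<Sum>p\<le>i. of_nat (i choose p) * conv \<theta> (dcoef j p (coef \<theta> a)) (dcoef j (i - p) (coef \<theta> b)) m)"
    unfolding smooth_mult(2)[OF assms] by (rule ext, rule dcoef_conv[OF a(1) b(1)])
  then have "nc_deriv \<theta> j i (a * b) =
      (\<Sum>p\<le>i. of_nat (i choose p) *\<^sub>C sm \<theta> (conv \<theta> (dcoef j p (coef \<theta> a)) (dcoef j (i - p) (coef \<theta> b))))"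
    unfolding nc_deriv_def by (simp add: sm_sum conv_props absum_dcoef a(1) b(1))
  then show ?thesis unfolding nc_deriv_def by (simp add: sm_mult absum_dcoef a(1) b(1))
qed

text \<open>
  By the Leibniz rule this weighted norm of the jet of order \<open>N\<close> in the direction \<open>j\<close> is
  submultiplicative; for small \<open>e\<close> it is close to the operator norm.
\<close>

definition jet_norm :: "real^'n::{finite,linorder}^'n::{finite,linorder} \<Rightarrow> 'n \<Rightarrow> nat \<Rightarrow> real \<Rightarrow> 'n torus_op \<Rightarrow> real" where
  "jet_norm \<theta> j N e a = (\<Sum>i\<le>N. e ^ i / fact i * norm (nc_deriv \<theta> j i a))"

lemma jet_norm_nonneg: "0 \<le> e \<Longrightarrow> 0 \<le> jet_norm \<theta> j N e a"
  unfolding jet_norm_def by (intro sum_nonneg) simp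

lemma jet_norm_mult:
  assumes "a \<in> nc_smooth \<theta>" "b \<in> nc_smooth \<theta>" "0 \<le> e"
  shows "jet_norm \<theta> j N e (a * b) \<le> jet_norm \<theta> j N e a * jet_norm \<theta> j N e b"
proof -
  let ?x = "\<lambda>a i. e ^ i / fact i * norm (nc_deriv \<theta> j i a)"
  have x: "0 \<le> ?x a i" for a i using assms(3) by simp
  have "?x (a * b) i \<le> (\<Sum>p\<le>i. ?x a p * ?x b (i - p))" for i
  proof -
    have "norm (nc_deriv \<theta> j i (a * b)) \<le>
        (\<Sum>p\<le>i. real (i choose p) * (norm (nc_deriv \<theta> j p a) * norm (nc_deriv \<theta> j (i - p) b)))"
      unfolding nc_deriv_mult[OF assms(1,2)]
      by (intro sum_norm_le) (simp add: norm_scaleC_torus_op mult_left_mono norm_mult_ineq)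
    then have "?x (a * b) i \<le> e ^ i / fact i *
        (\<Sum>p\<le>i. real (i choose p) * (norm (nc_deriv \<theta> j p a) * norm (nc_deriv \<theta> j (i - p) b)))"
      using assms(3) by (intro mult_left_mono) auto
    \<comment> \<open>The weights e^i / i! absorb the binomial coefficients, which leaves a plain
      Cauchy product.\<close>
    also have "\<dots> = (\<Sum>p\<le>i. ?x a p * ?x b (i - p))"
      unfolding sum_distrib_left
    proof (intro sum.cong refl)
      fix p assume p: "p \<in> {..i}"
      then have "e ^ i = e ^ p * e ^ (i - p)" by (simp flip: power_add)
      moreover have "real (i choose p) = fact i / (fact p * fact (i - p))"
        using p by (simp add: binomial_fact)
      ultimately show "e ^ i / fact i * (real (i choose p) * (norm (nc_deriv \<theta> j p a) * norm (nc_deriv \<theta> j (i - p) b)))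
          = ?x a p * ?x b (i - p)" by simp
    qed
    finally show ?thesis .
  qed
  then have "jet_norm \<theta> j N e (a * b) \<le> (\<Sum>i\<le>N. \<Sum>p\<le>i. ?x a p * ?x b (i - p))"
    unfolding jet_norm_def by (intro sum_mono)
  also have "\<dots> = (\<Sum>(p, q)\<in>{(p, q). p + q \<le> N}. ?x a p * ?x b q)"
    by (rule sum.triangle_reindex_eq[symmetric])
  \<comment> \<open>All terms are nonnegative, so the triangle may be enlarged to the square, where
    the sum factors.\<close>
  also have "\<dots> \<le> (\<Sum>(p, q)\<in>{..N} \<times> {..N}. ?x a p * ?x b q)"
  proof (rule sum_mono2)
    show "0 \<le> (case z of (p, q) \<Rightarrow> ?x a p * ?x b q)" for z
      unfolding split_beta by (rule mult_nonneg_nonneg[OF x x])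
  qed auto
  also have "\<dots> = jet_norm \<theta> j N e a * jet_norm \<theta> j N e b"
    unfolding jet_norm_def sum_product by (rule sum.cartesian_product[symmetric])
  finally show ?thesis .
qed

lemma jet_norm_1: "jet_norm \<theta> j N e 1 = 1"
proof -
  have "nc_deriv \<theta> j i 1 = 0" if "i > 0" for i
  proof -
    have "dcoef j i (coef \<theta> 1) = (\<lambda>_. 0)" using that by (auto simp: dcoef_def coef_1)
    then show ?thesis by (simp add: nc_deriv_def sm_def scaleC_torus_op_simps)
  qed
  then have "e ^ i / fact i * norm (nc_deriv \<theta> j i 1) = (if i = 0 then 1 else 0)" for i
    by (cases "i = 0") (simp_all add: nc_deriv_0 smooth_1)
  then show ?thesis unfolding jet_norm_def by simp
qed

lemma jet_norm_power:
  assumes "a \<in> nc_smooth \<theta>" "0 \<le> e"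
  shows "jet_norm \<theta> j N e (a ^ m) \<le> jet_norm \<theta> j N e a ^ m"
proof (induction m)
  case (Suc m)
  have "jet_norm \<theta> j N e (a * a ^ m) \<le> jet_norm \<theta> j N e a * jet_norm \<theta> j N e (a ^ m)"
    by (intro jet_norm_mult smooth_power assms)
  also have "\<dots> \<le> jet_norm \<theta> j N e a * jet_norm \<theta> j N e a ^ m"
    by (intro mult_left_mono Suc jet_norm_nonneg assms)
  finally show ?case by simp
qed (simp add: jet_norm_1)

lemma coef_le_jet_norm:
  assumes "a \<in> nc_smooth \<theta>" "0 < e"
  shows "\<bar>real_of_int (k $ j)\<bar> ^ N * cmod (coef \<theta> a k) \<le> fact N / e ^ N * jet_norm \<theta> j N e a"
proof -
  have "coef \<theta> (nc_deriv \<theta> j N a) k = dcoef j N (coef \<theta> a) k"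
    unfolding nc_deriv_def by (simp add: coef_sm absum_dcoef nc_smoothD(1)[OF assms(1)])
  then have "\<bar>real_of_int (k $ j)\<bar> ^ N * cmod (coef \<theta> a k) \<le> norm (nc_deriv \<theta> j N a)"
    using norm_coef_le[of \<theta> "nc_deriv \<theta> j N a" k] by (simp add: dcoef_def norm_mult norm_power)
  also have "\<dots> = fact N / e ^ N * (e ^ N / fact N * norm (nc_deriv \<theta> j N a))"
    using assms(2) by simp
  also have "\<dots> \<le> fact N / e ^ N * jet_norm \<theta> j N e a"
    unfolding jet_norm_def using assms(2)
    by (intro mult_left_mono member_le_sum) auto
  finally show ?thesis .
qed

text \<open>The bounded subsets of the smooth algebra as a Frechet space. Uniform constants C are
  needed because families over the sphere are to be integrated.\<close>

definition smooth_bounded :: "real^'n::{finite,linorder}^'n::{finite,linorder} \<Rightarrow> (nat \<Rightarrow> real) \<Rightarrow> 'n torus_op set" where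
  "smooth_bounded \<theta> C = {a \<in> nc_smooth \<theta>. \<forall>N k. wt k ^ N * cmod (coef \<theta> a k) \<le> C N}"

lemma smooth_boundedE:
  assumes "a \<in> nc_smooth \<theta>"
  obtains C where "a \<in> smooth_bounded \<theta> C"
proof -
  have "\<forall>N. \<exists>C. \<forall>k. wt k ^ N * cmod (coef \<theta> a k) \<le> C"
    using nc_smoothD(1)[OF assms] by (simp add: rapidly_decaying_wt)
  from choice[OF this] show ?thesis using assms that by (auto simp: smooth_bounded_def)
qed

text \<open>The norm is at most the l^1 norm of the coefficients; 2 n further powers of the weight
  pay for summability.\<close>

lemma norm_nc_deriv_le:
  fixes a :: "'n::{finite,linorder} torus_op"
  assumes "a \<in> smooth_bounded \<theta> C"
  shows "norm (nc_deriv \<theta> j i a) \<le> C (2 * CARD('n) + i) * wt_sum TYPE('n)"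
proof -
  have a: "a \<in> nc_smooth \<theta>" using assms by (simp add: smooth_bounded_def)
  have "wt k ^ (2 * CARD('n)) * cmod (dcoef j i (coef \<theta> a) k) \<le> C (2 * CARD('n) + i)" for k
  proof -
    have "wt k ^ (2 * CARD('n)) * cmod (dcoef j i (coef \<theta> a) k) =
        wt k ^ (2 * CARD('n)) * (\<bar>real_of_int (k $ j)\<bar> ^ i * cmod (coef \<theta> a k))"
      by (simp add: dcoef_def norm_mult norm_power)
    also have "\<dots> \<le> wt k ^ (2 * CARD('n)) * (wt k ^ i * cmod (coef \<theta> a k))"
      using component_le_wt[of k j] wt_ge_1[of k]
      by (intro mult_left_mono mult_right_mono power_mono zero_le_power) auto
    also have "\<dots> \<le> C (2 * CARD('n) + i)"
    proof -
      have "wt k ^ (2 * CARD('n) + i) * cmod (coef \<theta> a k) \<le> C (2 * CARD('n) + i)"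
        using assms unfolding smooth_bounded_def by blast
      then show ?thesis by (simp only: power_add mult.assoc)
    qed
    finally show ?thesis .
  qed
  from absum_of_bound[OF this] norm_sm_le[of "dcoef j i (coef \<theta> a)" \<theta>]
  show ?thesis unfolding nc_deriv_def by linarith
qed

text \<open>The jet norm of b is at most |b| + e B, where B depends on C and N only and e \<le> 1
  gives e^i / i! \<le> e for i \<ge> 1. A small e keeps it below q = (1 + r) / 2 < 1, so
  submultiplicativity yields q^m for the power b^m. Returning from the jet norm to coefficients
  costs the factor N! / e^N, which enters K and does not depend on m.\<close>

lemma power_coef_bound:
  fixes \<theta> :: "real^'n::{finite,linorder}^'n::{finite,linorder}"
  assumes "0 \<le> r" "r < 1"
  obtains K q where "0 \<le> K" "0 \<le> q" "q < 1"
    "\<And>b m k. b \<in> smooth_bounded \<theta> C \<Longrightarrow> norm b \<le> r \<Longrightarrow> wt k ^ N * cmod (coef \<theta> (b ^ m) k) \<le> K * q ^ m"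
proof -
  define B where "B = (\<Sum>i\<in>{1..N}. \<bar>C (2 * CARD('n) + i)\<bar> * wt_sum TYPE('n))"
  have B: "0 \<le> B" unfolding B_def by (intro sum_nonneg mult_nonneg_nonneg wt_sum_nonneg) auto
  define e where "e = min 1 ((1 - r) / (2 * (B + 1)))"
  have e: "0 < e" "e \<le> 1" using B assms by (auto simp: e_def)
  have eB: "e * B \<le> (1 - r) / 2"
  proof -
    have "e * B \<le> (1 - r) / (2 * (B + 1)) * (B + 1)"
      using B assms by (intro mult_mono) (auto simp: e_def)
    also have "\<dots> = (1 - r) / 2" using B by (simp add: field_simps)
    finally show ?thesis .
  qed
  define q where "q = (1 + r) / 2"
  have q: "0 \<le> q" "q < 1" "r \<le> q" using assms by (auto simp: q_def)
  have jet: "jet_norm \<theta> j N e b \<le> q" if b: "b \<in> smooth_bounded \<theta> C" "norm b \<le> r" for b j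
  proof -
    have "jet_norm \<theta> j N e b = norm (nc_deriv \<theta> j 0 b) + (\<Sum>i\<in>{1..N}. e ^ i / fact i * norm (nc_deriv \<theta> j i b))"
      unfolding jet_norm_def using sum.remove[of "{..N}" 0 "\<lambda>i. e ^ i / fact i * norm (nc_deriv \<theta> j i b)"]
      by (simp add: atLeast1_atMost_eq_remove0)
    also have "nc_deriv \<theta> j 0 b = b" using b by (intro nc_deriv_0) (simp add: smooth_bounded_def)
    also have "(\<Sum>i\<in>{1..N}. e ^ i / fact i * norm (nc_deriv \<theta> j i b)) \<le>
        (\<Sum>i\<in>{1..N}. e * (\<bar>C (2 * CARD('n) + i)\<bar> * wt_sum TYPE('n)))"
    proof (intro sum_mono mult_mono)
      fix i assume i: "i \<in> {1..N}"
      have "e ^ i / fact i \<le> e ^ i" using e by (simp add: divide_le_eq mult_le_cancel_left1 fact_ge_1)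
      also have "\<dots> \<le> e ^ 1" using i e by (intro power_decreasing) auto
      finally show "e ^ i / fact i \<le> e" by simp
      have "norm (nc_deriv \<theta> j i b) \<le> C (2 * CARD('n) + i) * wt_sum TYPE('n)"
        by (rule norm_nc_deriv_le[OF b(1)])
      also have "\<dots> \<le> \<bar>C (2 * CARD('n) + i)\<bar> * wt_sum TYPE('n)"
        by (intro mult_right_mono wt_sum_nonneg) auto
      finally show "norm (nc_deriv \<theta> j i b) \<le> \<bar>C (2 * CARD('n) + i)\<bar> * wt_sum TYPE('n)" .
    qed (use e in auto)
    also have "\<dots> = e * B" by (simp add: B_def sum_distrib_left)
    finally show ?thesis using eB b by (simp add: q_def field_simps)
  qed
  define K where "K = (real CARD('n) + 1) ^ N * (1 + real CARD('n) * (fact N / e ^ N))"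
  have "wt k ^ N * cmod (coef \<theta> (b ^ m) k) \<le> K * q ^ m"
    if b: "b \<in> smooth_bounded \<theta> C" "norm b \<le> r" for b m k
  proof -
    have sb: "b \<in> nc_smooth \<theta>" using b by (simp add: smooth_bounded_def)
    have "wt k ^ N * cmod (coef \<theta> (b ^ m) k) \<le>
        (real CARD('n) + 1) ^ N * (1 + (\<Sum>j\<in>UNIV. \<bar>real_of_int (k $ j)\<bar> ^ N)) * cmod (coef \<theta> (b ^ m) k)"
      by (intro mult_right_mono wt_power_le) auto
    also have "\<dots> = (real CARD('n) + 1) ^ N *
        (cmod (coef \<theta> (b ^ m) k) + (\<Sum>j\<in>UNIV. \<bar>real_of_int (k $ j)\<bar> ^ N * cmod (coef \<theta> (b ^ m) k)))"
      by (simp add: algebra_simps sum_distrib_left sum_distrib_right)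
    also have "\<dots> \<le> (real CARD('n) + 1) ^ N * (q ^ m + (\<Sum>j\<in>(UNIV :: 'n set). fact N / e ^ N * q ^ m))"
    proof (intro mult_left_mono add_mono sum_mono)
      have "cmod (coef \<theta> (b ^ m) k) \<le> norm (b ^ m)" by (rule norm_coef_le)
      also have "\<dots> \<le> q ^ m" using b q by (intro norm_power_le) auto
      finally show "cmod (coef \<theta> (b ^ m) k) \<le> q ^ m" .
      fix j
      have "\<bar>real_of_int (k $ j)\<bar> ^ N * cmod (coef \<theta> (b ^ m) k) \<le> fact N / e ^ N * jet_norm \<theta> j N e (b ^ m)"
        by (intro coef_le_jet_norm smooth_power sb e)
      also have "\<dots> \<le> fact N / e ^ N * q ^ m"
        using e by (intro mult_left_mono order_trans[OF jet_norm_power[OF sb]] power_mono jet b jet_norm_nonneg) auto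
      finally show "\<bar>real_of_int (k $ j)\<bar> ^ N * cmod (coef \<theta> (b ^ m) k) \<le> fact N / e ^ N * q ^ m" .
    qed simp
    also have "\<dots> = K * q ^ m" by (simp add: K_def algebra_simps)
    finally show ?thesis .
  qed
  moreover have "0 \<le> K" using e by (simp add: K_def)
  ultimately show ?thesis using q that by blast
qed

lemma sm_diff: "absum u \<Longrightarrow> absum w \<Longrightarrow> sm \<theta> u - sm \<theta> w = sm \<theta> (\<lambda>k. u k - w k)"
  using sm_sum[of UNIV "\<lambda>b. if b then u else w" \<theta> "\<lambda>b. if b then 1 else - 1"]
    scaleC_torus_op_simps(4)[of "- 1" "sm \<theta> w"]
  by (simp add: UNIV_bool scaleC_torus_op_simps)

text \<open>Geometric decay of the coefficients of b^m makes the coefficients of the sum decay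
  rapidly, with constants that depend on C, r and f only. It remains to see that the sum is the
  operator given by these coefficients: the partial sums converge in norm to both.\<close>

lemma power_series_smooth:
  fixes \<theta> :: "real^'n::{finite,linorder}^'n::{finite,linorder}"
  assumes r: "0 \<le> r" "r < 1" and f: "\<And>q. 0 \<le> q \<Longrightarrow> q < 1 \<Longrightarrow> summable (\<lambda>m. \<bar>f m\<bar> * q ^ m)"
  obtains C' where "\<And>b a. b \<in> smooth_bounded \<theta> C \<Longrightarrow> norm b \<le> r \<Longrightarrow>
    (\<lambda>m. f m *\<^sub>R b ^ m) sums a \<Longrightarrow> a \<in> smooth_bounded \<theta> C'"
proof -
  have "\<exists>K q. \<forall>b m k. 0 \<le> K \<and> 0 \<le> q \<and> q < 1 \<and> (b \<in> smooth_bounded \<theta> C \<longrightarrow> norm b \<le> r \<longrightarrow>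
      wt k ^ N * cmod (coef \<theta> (b ^ m) k) \<le> K * q ^ m)" for N
    using power_coef_bound[OF r, of \<theta> C N] by metis
  then obtain K q where Kq: "\<And>N. 0 \<le> K N" "\<And>N. 0 \<le> q N" "\<And>N. q N < 1"
    "\<And>N b m k. b \<in> smooth_bounded \<theta> C \<Longrightarrow> norm b \<le> r \<Longrightarrow> wt k ^ N * cmod (coef \<theta> (b ^ m) k) \<le> K N * q N ^ m"
    by metis
  define t where "t N m = K N * (\<bar>f m\<bar> * q N ^ m)" for N m
  have t: "summable (t N)" for N unfolding t_def using f Kq by (intro summable_mult) auto
  define C' where "C' N = suminf (t N)" for N
  have "a \<in> smooth_bounded \<theta> C'" if b: "b \<in> smooth_bounded \<theta> C" "norm b \<le> r" and a: "(\<lambda>m. f m *\<^sub>R b ^ m) sums a" for a b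
  proof -
    have sb: "b \<in> nc_smooth \<theta>" using b by (simp add: smooth_bounded_def)
    define F where "F P = (\<Sum>m<P. f m *\<^sub>R b ^ m)" for P
    have F: "F P \<in> nc_smooth \<theta>" for P unfolding F_def by (intro smooth_sum smooth_scaleR smooth_power sb)
    have lim: "F \<longlonglongrightarrow> a" using a by (simp add: sums_def F_def[abs_def])
    have coefF: "coef \<theta> (F P) k = (\<Sum>m<P. of_real (f m) * coef \<theta> (b ^ m) k)" for P k
      unfolding F_def by (simp add: linear_sum[OF bounded_linear.linear[OF bounded_linear_coef]] coef_scaleR)
    have tm: "wt k ^ N * cmod (of_real (f m) * coef \<theta> (b ^ m) k) \<le> t N m" for N m k
      using mult_left_mono[OF Kq(4)[OF b, of k N m], of "\<bar>f m\<bar>"] by (simp add: t_def norm_mult mult_ac)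
    have sums: "(\<lambda>m. of_real (f m) * coef \<theta> (b ^ m) k) sums coef \<theta> a k" for k
      using bounded_linear.sums[OF bounded_linear_coef a, of \<theta> k] by (simp add: coef_scaleR)
    have tail: "wt k ^ N * cmod (coef \<theta> a k - coef \<theta> (F P) k) \<le> (\<Sum>m. t N (m + P))" for N k P
    proof -
      have s: "(\<lambda>m. of_real (f (m + P)) * coef \<theta> (b ^ (m + P)) k) sums (coef \<theta> a k - coef \<theta> (F P) k)"
        using sums[of k] unfolding coefF by (subst sums_iff_shift) simp
      have w: "0 \<le> wt k" using wt_ge_1[of k] by simp
      have s': "(\<lambda>m. of_real (wt k ^ N) * (of_real (f (m + P)) * coef \<theta> (b ^ (m + P)) k)) sums
          (of_real (wt k ^ N) * (coef \<theta> a k - coef \<theta> (F P) k))"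
        by (rule sums_mult[OF s])
      have bd: "norm (of_real (wt k ^ N) * (of_real (f (m + P)) * coef \<theta> (b ^ (m + P)) k)) \<le> t N (m + P)" for m
        using tm[of k N "m + P"] w by (simp add: norm_mult norm_power)
      have "norm (of_real (wt k ^ N) * (coef \<theta> a k - coef \<theta> (F P) k)) \<le> (\<Sum>m. t N (m + P))"
        using t
        unfolding sums_unique[OF s']
        by (intro norm_suminf_le bd) (simp add: summable_iff_shift)
      then show ?thesis using w by (simp add: norm_mult norm_power)
    qed
    have bound: "wt k ^ N * cmod (coef \<theta> a k) \<le> C' N" for N k
      using tail[of k N 0] by (simp add: coefF C'_def)
    then have rd: "rapidly_decaying (coef \<theta> a)" unfolding rapidly_decaying_wt by blast
    then have abs: "absum (coef \<theta> a)" by (rule rapidly_decaying_absum)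
    \<comment> \<open>The tail estimate with weight exponent 2 n controls the l^1 norm of the
      coefficients and thereby the operator norm.\<close>
    have "(\<lambda>P. sm \<theta> (coef \<theta> a) - F P) \<longlonglongrightarrow> 0"
    proof (rule Lim_null_comparison)
      let ?M = "2 * CARD('n)"
      show "\<forall>\<^sub>F P in sequentially. norm (sm \<theta> (coef \<theta> a) - F P) \<le> (\<Sum>m. t ?M (m + P)) * wt_sum TYPE('n)"
      proof (intro always_eventually allI)
        fix P
        have "sm \<theta> (coef \<theta> a) - F P = sm \<theta> (\<lambda>k. coef \<theta> a k - coef \<theta> (F P) k)"
          using nc_smoothD[OF F] abs sm_diff by metis
        moreover have "norm (sm \<theta> (\<lambda>k. coef \<theta> a k - coef \<theta> (F P) k)) \<le> (\<Sum>m. t ?M (m + P)) * wt_sum TYPE('n)"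
          using absum_of_bound[OF tail] norm_sm_le order_trans by blast
        ultimately show "norm (sm \<theta> (coef \<theta> a) - F P) \<le> (\<Sum>m. t ?M (m + P)) * wt_sum TYPE('n)" by simp
      qed
      show "(\<lambda>P. (\<Sum>m. t ?M (m + P)) * wt_sum TYPE('n)) \<longlonglongrightarrow> 0"
        by (intro tendsto_mult_left_zero suminf_exist_split2 t)
    qed
    then have "(\<lambda>P. sm \<theta> (coef \<theta> a) - (sm \<theta> (coef \<theta> a) - F P)) \<longlonglongrightarrow> sm \<theta> (coef \<theta> a) - 0"
      by (intro tendsto_diff tendsto_const)
    then have "F \<longlonglongrightarrow> sm \<theta> (coef \<theta> a)" by simp
    then have "a = sm \<theta> (coef \<theta> a)" using lim LIMSEQ_unique by blast
    then show ?thesis using rd bound by (simp add: smooth_bounded_def nc_smooth_iff)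
  qed
  then show ?thesis using that by blast
qed

section \<open>Matrices of operators\<close>

definition mat_act :: "'n::finite torus_op^'m^'m \<Rightarrow> 'n torus_L2^'m \<Rightarrow> 'n torus_L2^'m" where
  "mat_act A v = (\<chi> i. \<Sum>j\<in>UNIV. op_apply (A $ i $ j) (v $ j))"

lemma mat_act_nth: "mat_act A v $ i = (\<Sum>j\<in>UNIV. op_apply (A $ i $ j) (v $ j))"
  by (simp add: mat_act_def)

lemma mat_act_axis: "mat_act A (axis j f) $ i = op_apply (A $ i $ j) f"
proof -
  have "op_apply (A $ i $ k) (axis j f $ k) = (if k = j then op_apply (A $ i $ j) f else 0)" for k
    by (simp add: axis_def op.act_simps)
  then show ?thesis by (simp add: mat_act_nth)
qed

lemma norm_axis_vec: "norm (axis j f) = norm (f :: 'a::real_inner)"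
  by (simp add: norm_eq_sqrt_inner inner_axis_axis)

lemma mat_act_eqI: "(\<And>v. mat_act A v = mat_act B v) \<Longrightarrow> A = B"
  by (simp add: vec_eq_iff) (metis mat_act_axis op_eqI)

lemma mat_act_simps:
  "mat_act (A + B) v = mat_act A v + mat_act B v"
  "mat_act (A - B) v = mat_act A v - mat_act B v"
  "mat_act (- A) v = - mat_act A v"
  "mat_act (r *\<^sub>R A) v = r *\<^sub>R mat_act A v"
  "mat_act 0 v = 0"
  "mat_act A (v + w) = mat_act A v + mat_act A w"
  "mat_act A (r *\<^sub>R v) = r *\<^sub>R mat_act A v"
  by (simp_all add: vec_eq_iff mat_act_nth op.act_simps sum.distrib sum_subtractf sum_negf scaleR_sum_right)

lemma mat_act_mat_1: "mat_act (mat 1) v = v"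
proof -
  have "op_apply (mat 1 $ i $ j) (v $ j) = (if j = i then v $ j else 0)" for i j
    by (simp add: mat_def op_apply_simps)
  then show ?thesis by (simp add: vec_eq_iff mat_act_nth)
qed

lemma mat_act_mult: "mat_act (A ** B) v = mat_act A (mat_act B v)"
proof -
  have "mat_act (A ** B) v $ i = mat_act A (mat_act B v) $ i" for i
  proof -
    have "mat_act (A ** B) v $ i = (\<Sum>j\<in>UNIV. \<Sum>k\<in>UNIV. op_apply (A $ i $ k) (op_apply (B $ k $ j) (v $ j)))"
      by (simp add: mat_act_nth matrix_matrix_mult_def op_apply_simps
          linear_sum[OF bounded_linear.linear[OF op.bounded_linear_act]])
    also have "\<dots> = (\<Sum>k\<in>UNIV. \<Sum>j\<in>UNIV. op_apply (A $ i $ k) (op_apply (B $ k $ j) (v $ j)))"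
      by (rule sum.swap)
    also have "\<dots> = mat_act A (mat_act B v) $ i"
      by (simp add: mat_act_nth linear_sum[OF bounded_linear.linear[OF op.bounded_linear_act_right]])
    finally show ?thesis .
  qed
  then show ?thesis by (simp add: vec_eq_iff)
qed

definition entry_sum :: "'n::finite torus_op^'m^'m \<Rightarrow> real" where
  "entry_sum A = (\<Sum>i\<in>UNIV. \<Sum>j\<in>UNIV. norm (A $ i $ j))"

lemma norm_mat_act_le: "norm (mat_act A v) \<le> entry_sum A * norm v"
proof -
  have "norm (mat_act A v) \<le> (\<Sum>i\<in>UNIV. norm (mat_act A v $ i))"
    unfolding norm_vec_def by (rule L2_set_le_sum) simp
  also have "\<dots> \<le> (\<Sum>i\<in>UNIV. \<Sum>j\<in>UNIV. norm (A $ i $ j) * norm v)"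
    unfolding mat_act_nth
    by (intro sum_mono sum_norm_le order_trans[OF op.norm_act] mult_left_mono Finite_Cartesian_Product.norm_nth_le norm_ge_zero)
  finally show ?thesis by (simp add: entry_sum_def sum_distrib_right)
qed

lemma bounded_linear_mat_act: "bounded_linear (mat_act A)"
  by (rule bounded_linear_intro[of _ "entry_sum A"])
     (use norm_mat_act_le[of A] in \<open>auto simp: mat_act_simps mult.commute\<close>)

text \<open>A copy of the space of matrices, as the norm of the vector type is not the operator norm.\<close>

typedef (overloaded) ('n, 'm) torus_mat = "UNIV :: ('n::finite torus_op^'m::finite^'m) set"
  morphisms mat_of Mat
  by simp

setup_lifting type_definition_torus_mat

instantiation torus_mat :: (finite, finite) real_normed_algebra_1
begin

lift_definition zero_torus_mat :: "('a, 'b) torus_mat" is 0 .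
lift_definition one_torus_mat :: "('a, 'b) torus_mat" is "mat 1" .
lift_definition plus_torus_mat :: "('a, 'b) torus_mat \<Rightarrow> ('a, 'b) torus_mat \<Rightarrow> ('a, 'b) torus_mat" is "(+)" .
lift_definition minus_torus_mat :: "('a, 'b) torus_mat \<Rightarrow> ('a, 'b) torus_mat \<Rightarrow> ('a, 'b) torus_mat" is "(-)" .
lift_definition uminus_torus_mat :: "('a, 'b) torus_mat \<Rightarrow> ('a, 'b) torus_mat" is uminus .
lift_definition times_torus_mat :: "('a, 'b) torus_mat \<Rightarrow> ('a, 'b) torus_mat \<Rightarrow> ('a, 'b) torus_mat" is "(**)" .
lift_definition scaleR_torus_mat :: "real \<Rightarrow> ('a, 'b) torus_mat \<Rightarrow> ('a, 'b) torus_mat" is "(*\<^sub>R)" .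
lift_definition norm_torus_mat :: "('a, 'b) torus_mat \<Rightarrow> real" is "\<lambda>A. onorm (mat_act A)" .

definition sgn_torus_mat :: "('a, 'b) torus_mat \<Rightarrow> ('a, 'b) torus_mat" where
  "sgn_torus_mat T = inverse (norm T) *\<^sub>R T"

definition dist_torus_mat :: "('a, 'b) torus_mat \<Rightarrow> ('a, 'b) torus_mat \<Rightarrow> real" where
  "dist_torus_mat S T = norm (S - T)"

definition uniformity_torus_mat :: "(('a, 'b) torus_mat \<times> ('a, 'b) torus_mat) filter" where
  "uniformity_torus_mat = (INF e\<in>{0 <..}. principal {(x, y). dist x y < e})"

definition open_torus_mat :: "('a, 'b) torus_mat set \<Rightarrow> bool" where
  "open_torus_mat U = (\<forall>x\<in>U. eventually (\<lambda>(x', y). x' = x \<longrightarrow> y \<in> U) uniformity)"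

instance
proof
  fix a b c :: "('a, 'b) torus_mat" and r s :: real
  show "a + b + c = a + (b + c)" by transfer simp
  show "a + b = b + a" by transfer simp
  show "0 + a = a" by transfer simp
  show "- a + a = 0" by transfer simp
  show "a - b = a + - b" by transfer simp
  show "r *\<^sub>R (a + b) = r *\<^sub>R a + r *\<^sub>R b" by transfer (simp add: scaleR_add_right)
  show "(r + s) *\<^sub>R a = r *\<^sub>R a + s *\<^sub>R a" by transfer (simp add: scaleR_add_left)
  show "r *\<^sub>R s *\<^sub>R a = (r * s) *\<^sub>R a" by transfer simp
  show "1 *\<^sub>R a = a" by transfer simp
  show "a * b * c = a * (b * c)" by transfer (rule mat_act_eqI, simp add: mat_act_mult)
  show "(a + b) * c = a * c + b * c" by transfer (rule mat_act_eqI, simp add: mat_act_mult mat_act_simps)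
  show "a * (b + c) = a * b + a * c" by transfer (rule mat_act_eqI, simp add: mat_act_mult mat_act_simps)
  show "r *\<^sub>R a * b = r *\<^sub>R (a * b)" by transfer (rule mat_act_eqI, simp add: mat_act_mult mat_act_simps)
  show "a * r *\<^sub>R b = r *\<^sub>R (a * b)" by transfer (rule mat_act_eqI, simp add: mat_act_mult mat_act_simps)
  show "1 * a = a" by transfer (rule mat_act_eqI, simp add: mat_act_mult mat_act_mat_1)
  show "a * 1 = a" by transfer (rule mat_act_eqI, simp add: mat_act_mult mat_act_mat_1)
  show "sgn a = inverse (norm a) *\<^sub>R a" by (rule sgn_torus_mat_def)
  show "dist a b = norm (a - b)" by (rule dist_torus_mat_def)
  show "uniformity = (INF e\<in>{0 <..}. principal {(x, y :: ('a, 'b) torus_mat). dist x y < e})"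
    by (rule uniformity_torus_mat_def)
  show "open U = (\<forall>x\<in>U. \<forall>\<^sub>F (x', y) in uniformity. x' = x \<longrightarrow> y \<in> U)" for U :: "('a, 'b) torus_mat set"
    by (rule open_torus_mat_def)
  show "norm a = 0 \<longleftrightarrow> a = 0"
  proof transfer
    fix A :: "'a torus_op^'b^'b"
    have "onorm (mat_act A) = 0 \<longleftrightarrow> (\<forall>v. mat_act A v = mat_act 0 v)"
      by (simp add: onorm_eq_0[OF bounded_linear_mat_act] mat_act_simps)
    then show "onorm (mat_act A) = 0 \<longleftrightarrow> A = 0" using mat_act_eqI by metis
  qed
  show "norm (a + b) \<le> norm a + norm b"
  proof transfer
    fix A B :: "'a torus_op^'b^'b"
    have "mat_act (A + B) = (\<lambda>v. mat_act A v + mat_act B v)" by (simp add: fun_eq_iff mat_act_simps)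
    then show "onorm (mat_act (A + B)) \<le> onorm (mat_act A) + onorm (mat_act B)"
      using onorm_triangle[OF bounded_linear_mat_act bounded_linear_mat_act, of A B] by simp
  qed
  show "norm (r *\<^sub>R a) = \<bar>r\<bar> * norm a"
  proof transfer
    fix r and A :: "'a torus_op^'b^'b"
    have "mat_act (r *\<^sub>R A) = (\<lambda>v. r *\<^sub>R mat_act A v)" by (simp add: fun_eq_iff mat_act_simps)
    then show "onorm (mat_act (r *\<^sub>R A)) = \<bar>r\<bar> * onorm (mat_act A)"
      using onorm_scaleR[OF bounded_linear_mat_act, of r A] by simp
  qed
  show "norm (a * b) \<le> norm a * norm b"
  proof transfer
    fix A B :: "'a torus_op^'b^'b"
    have "mat_act (A ** B) = mat_act A \<circ> mat_act B" by (simp add: fun_eq_iff mat_act_mult)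
    then show "onorm (mat_act (A ** B)) \<le> onorm (mat_act A) * onorm (mat_act B)"
      using onorm_compose[OF bounded_linear_mat_act bounded_linear_mat_act, of A B] by simp
  qed
  show norm_1: "norm (1 :: ('a, 'b) torus_mat) = 1"
  proof transfer
    obtain j :: 'b where True by blast
    have n: "norm (axis j one_vec :: 'a torus_L2^'b) = 1" by (simp add: norm_axis_vec)
    have id: "mat_act (mat 1) = (\<lambda>v :: 'a torus_L2^'b. v)" by (simp add: fun_eq_iff mat_act_mat_1)
    have "norm (axis j one_vec :: 'a torus_L2^'b) \<le> onorm (\<lambda>v :: 'a torus_L2^'b. v) * norm (axis j one_vec :: 'a torus_L2^'b)"
      by (rule onorm[OF bounded_linear_ident])
    then have "1 \<le> onorm (\<lambda>v :: 'a torus_L2^'b. v)" using n by simp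
    moreover have "onorm (\<lambda>v :: 'a torus_L2^'b. v) \<le> 1" by (rule onorm_id_le)
    ultimately show "onorm (mat_act (mat 1 :: 'a torus_op^'b^'b)) = 1" by (simp add: id)
  qed
  show "(0 :: ('a, 'b) torus_mat) \<noteq> 1"
  proof
    assume "(0 :: ('a, 'b) torus_mat) = 1"
    then have "norm (0 :: ('a, 'b) torus_mat) = 1" using norm_1 by simp
    moreover have "norm (0 :: ('a, 'b) torus_mat) = 0"
      by transfer (simp add: mat_act_simps[abs_def] onorm_zero)
    ultimately show False by simp
  qed
qed

end

lemma norm_entry_le: "norm (mat_of A $ i $ j) \<le> norm A"
proof (rule op.norm_leI[OF norm_ge_zero])
  fix f
  have "norm (op_apply (mat_of A $ i $ j) f) \<le> norm (mat_act (mat_of A) (axis j f))"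
    using Finite_Cartesian_Product.norm_nth_le[of "mat_act (mat_of A) (axis j f)" i] by (simp add: mat_act_axis)
  also have "\<dots> \<le> norm A * norm f"
    unfolding norm_torus_mat.rep_eq
    using onorm[OF bounded_linear_mat_act, of "mat_of A" "axis j f"] by (simp add: norm_axis_vec)
  finally show "norm (op_apply (mat_of A $ i $ j) f) \<le> norm A * norm f" .
qed

lemma norm_le_entry_sum: "norm A \<le> entry_sum (mat_of A)"
  unfolding norm_torus_mat.rep_eq by (rule onorm_bound[OF _ norm_mat_act_le]) (simp add: entry_sum_def sum_nonneg)

lemma bounded_linear_entry: "bounded_linear (\<lambda>A. mat_of A $ i $ j)"
  by (rule bounded_linear_intro[of _ 1])
     (simp_all add: plus_torus_mat.rep_eq scaleR_torus_mat.rep_eq norm_entry_le)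

lemmas entry_simps = linear_simps[OF bounded_linear_entry]

lemma mat_tendstoI:
  fixes L :: "('n::finite, 'm::finite) torus_mat"
  assumes "\<And>i j. ((\<lambda>x. mat_of (X x) $ i $ j) \<longlongrightarrow> mat_of L $ i $ j) F"
  shows "(X \<longlongrightarrow> L) F"
proof (rule Lim_null[THEN iffD2], rule Lim_null_comparison)
  show "\<forall>\<^sub>F x in F. norm (X x - L) \<le> entry_sum (mat_of (X x - L))"
    by (intro always_eventually allI norm_le_entry_sum)
  have "((\<lambda>x. \<Sum>i\<in>UNIV. \<Sum>j\<in>UNIV. norm (mat_of (X x) $ i $ j - mat_of L $ i $ j)) \<longlongrightarrow>
      (\<Sum>i\<in>(UNIV :: 'm set). \<Sum>j\<in>(UNIV :: 'm set). norm (mat_of L $ i $ j - mat_of L $ i $ j))) F"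
    by (intro tendsto_sum tendsto_norm tendsto_diff assms tendsto_const)
  then show "((\<lambda>x. entry_sum (mat_of (X x - L))) \<longlongrightarrow> 0) F"
    by (simp add: entry_sum_def entry_simps)
qed

instance torus_mat :: (finite, finite) banach
proof
  fix X :: "nat \<Rightarrow> ('a, 'b) torus_mat"
  assume X: "Cauchy X"
  have "convergent (\<lambda>m. mat_of (X m) $ i $ j)" for i j
    by (rule Cauchy_convergent, rule bounded_linear.Cauchy[OF bounded_linear_entry X])
  then have lim: "(\<lambda>m. mat_of (X m) $ i $ j) \<longlonglongrightarrow> lim (\<lambda>m. mat_of (X m) $ i $ j)" for i j
    by (simp add: convergent_LIMSEQ_iff)
  have "X \<longlonglongrightarrow> Mat (\<chi> i j. lim (\<lambda>m. mat_of (X m) $ i $ j))"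
    by (rule mat_tendstoI) (simp add: Mat_inverse lim)
  then show "convergent X" by (auto simp: convergent_def)
qed

interpretation mat: hilbert_rep "\<lambda>A. mat_act (mat_of A :: 'n::finite torus_op^'m::finite^'m)"
proof
  fix a b :: "('n, 'm) torus_mat" and v w :: "'n torus_L2^'m" and r K :: real
  show "norm (mat_act (mat_of a) v) \<le> norm a * norm v"
    unfolding norm_torus_mat.rep_eq by (rule onorm[OF bounded_linear_mat_act])
  show "norm a \<le> K" if "0 \<le> K" "\<And>v. norm (mat_act (mat_of a) v) \<le> K * norm v"
    using that unfolding norm_torus_mat.rep_eq by (rule onorm_bound)
qed (simp_all add: plus_torus_mat.rep_eq scaleR_torus_mat.rep_eq times_torus_mat.rep_eq
    one_torus_mat.rep_eq mat_act_simps mat_act_mult mat_act_mat_1)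

lemma mat_of_eqI: "(\<And>i j. mat_of A $ i $ j = mat_of B $ i $ j) \<Longrightarrow> A = B"
  by (simp add: vec_eq_iff flip: mat_of_inject)

lemma entry_mult: "mat_of (A * B) $ i $ j = (\<Sum>k\<in>UNIV. mat_of A $ i $ k * mat_of B $ k $ j)"
  by (simp add: times_torus_mat.rep_eq matrix_matrix_mult_def)

lemma entry_1: "mat_of 1 $ i $ j = (if i = j then 1 else 0)"
  by (simp add: one_torus_mat.rep_eq mat_def)

lemma mat_sa_of_entries:
  assumes "\<And>i j. is_adjoint (mat_of A $ i $ j) (mat_of A $ j $ i)"
  shows "mat.sa A"
  unfolding mat.sa_def
proof (intro allI)
  fix v w
  have "inner (mat_act (mat_of A) v) w = (\<Sum>i\<in>UNIV. \<Sum>j\<in>UNIV. inner (op_apply (mat_of A $ i $ j) (v $ j)) (w $ i))"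
    by (simp add: inner_vec_def mat_act_nth inner_sum_left)
  also have "\<dots> = (\<Sum>i\<in>UNIV. \<Sum>j\<in>UNIV. inner (v $ j) (op_apply (mat_of A $ j $ i) (w $ i)))"
    using assms by (simp add: is_adjoint_iff_inner)
  also have "\<dots> = (\<Sum>j\<in>UNIV. \<Sum>i\<in>UNIV. inner (v $ j) (op_apply (mat_of A $ j $ i) (w $ i)))"
    by (rule sum.swap)
  also have "\<dots> = inner v (mat_act (mat_of A) w)"
    by (simp add: inner_vec_def mat_act_nth inner_sum_right)
  finally show "inner (mat_act (mat_of A) v) w = inner v (mat_act (mat_of A) w)" .
qed

lemma matrix_inv_eqI:
  fixes A :: "'a::semiring_1^'m^'m"
  assumes "A ** B = mat 1" "B ** A = mat 1"
  shows "matrix_inv A = B"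
proof -
  have "A ** matrix_inv A = mat 1 \<and> matrix_inv A ** A = mat 1"
    unfolding matrix_inv_def by (rule someI[of _ B]) (use assms in simp)
  then show ?thesis using assms by (metis matrix_mul_assoc matrix_mul_lid matrix_mul_rid)
qed

lemma scaleC_of_real_vec: "complex_of_real r *\<^sub>C (A :: 'n::finite torus_op^'m^'m) = r *\<^sub>R A"
  by (simp add: vec_eq_iff scaleC_vec_def scaleC_torus_op_simps)

lemma mat_positive_coercive:
  assumes "mat_positive g"
  shows "mat.coercive 0 (Mat g)"
proof (rule mat.coercive_0_of_spectrum)
  show "mat.sa (Mat g)"
    using assms by (intro mat_sa_of_entries) (simp add: mat_positive_def Mat_inverse)
  fix t :: real assume "t < 0"
  then have "complex_of_real t \<notin> mat_spectrum g" using assms by (auto simp: mat_positive_def)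
  then obtain B where "B ** (t *\<^sub>R mat 1 - g) = mat 1"
    unfolding mat_spectrum_def invertible_def scaleC_of_real_vec mem_Collect_eq by blast
  then have "Mat B * (t *\<^sub>R 1 - Mat g) = 1"
    by (simp add: mat_of_inject[symmetric] times_torus_mat.rep_eq minus_torus_mat.rep_eq
        scaleR_torus_mat.rep_eq one_torus_mat.rep_eq Mat_inverse)
  then have "(- Mat B) * (Mat g - t *\<^sub>R 1) = 1" by (simp add: algebra_simps)
  then show "\<exists>b. b * (Mat g - t *\<^sub>R 1) = 1" by blast
qed

context hilbert_rep
begin

text \<open>Apply |a w|^2 \<le> |a| (a w, w) at w = b v, where a w = v.\<close>

lemma coercive_inverse:
  assumes "coercive 0 a" "a * b = 1" "b * a = 1"
  shows "coercive (1 / norm a) b"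
  unfolding coercive_def
proof (intro conjI allI)
  have ab: "act a (act b v) = v" for v using assms(2) by (simp add: act_1 flip: act_mult)
  show "sa b"
    unfolding sa_def using assms(1) ab unfolding coercive_def sa_def by metis
  fix v
  have "(norm (act a (act b v)))\<^sup>2 \<le> norm a * inner (act a (act b v)) (act b v)"
    by (rule norm_act_sq_le[OF assms(1) inner_act_le])
  moreover have "norm a \<noteq> 0" using assms(2) by auto
  ultimately show "1 / norm a * (norm v)\<^sup>2 \<le> inner (act b v) v"
    unfolding ab by (simp add: field_simps inner_commute)
qed

end

definition quad_form :: "'n::finite torus_op^'m^'m \<Rightarrow> real^'m \<Rightarrow> 'n torus_op" where
  "quad_form H \<xi> = (\<Sum>i\<in>UNIV. \<Sum>j\<in>UNIV. (\<xi> $ i * \<xi> $ j) *\<^sub>R H $ i $ j)"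

lemma inner_quad_form:
  "inner (op_apply (quad_form H \<xi>) v) w = inner (mat_act H (\<chi> i. \<xi> $ i *\<^sub>R v)) (\<chi> i. \<xi> $ i *\<^sub>R w)"
  by (simp add: quad_form_def inner_vec_def mat_act_nth op.act_simps inner_sum_left sum_distrib_left
      linear_sum[OF bounded_linear.linear[OF op.bounded_linear_act]] op_apply_simps mult_ac)

text \<open>The form of \<open>quad_form H \<xi>\<close> at v is the form of H at the vector with
  components \<xi>_i v, whose norm is |\<xi>| |v|.\<close>

lemma coercive_quad_form:
  fixes H :: "('n::finite, 'm::finite) torus_mat"
  assumes "mat.coercive d H"
  shows "op.coercive (d * (norm \<xi>)\<^sup>2) (quad_form (mat_of H) \<xi>)"
  unfolding op.coercive_def
proof (intro conjI allI)
  have "inner v (op_apply (quad_form (mat_of H) \<xi>) w) = inner (\<chi> i. \<xi> $ i *\<^sub>R v) (mat_act (mat_of H) (\<chi> i. \<xi> $ i *\<^sub>R w))" for v w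
    unfolding inner_commute[of v] inner_quad_form by (rule inner_commute)
  then show "op.sa (quad_form (mat_of H) \<xi>)"
    unfolding op.sa_def inner_quad_form using mat.coerciveD(1)[OF assms] by (simp add: mat.sa_def)
  fix v :: "'n torus_L2"
  have "(norm (\<chi> i. \<xi> $ i *\<^sub>R v))\<^sup>2 = (norm \<xi>)\<^sup>2 * (norm v)\<^sup>2"
    by (simp add: norm_vec_def L2_set_def sum_nonneg power_mult_distrib sum_distrib_right)
  then show "d * (norm \<xi>)\<^sup>2 * (norm v)\<^sup>2 \<le> inner (op_apply (quad_form (mat_of H) \<xi>) v) v"
    unfolding inner_quad_form using mat.coerciveD(2)[OF assms, of "\<chi> i. \<xi> $ i *\<^sub>R v"] by (simp add: mult.assoc)
qed

lemma norm_quad_form_le: "norm (quad_form H \<xi>) \<le> entry_sum H * (norm \<xi>)\<^sup>2"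
proof -
  have "norm (quad_form H \<xi>) \<le> (\<Sum>i\<in>UNIV. \<Sum>j\<in>UNIV. (norm \<xi>)\<^sup>2 * norm (H $ i $ j))"
    unfolding quad_form_def
  proof (intro sum_norm_le)
    fix i j
    have "\<bar>\<xi> $ i\<bar> * \<bar>\<xi> $ j\<bar> \<le> norm \<xi> * norm \<xi>"
      by (intro mult_mono component_le_norm_cart) auto
    then show "norm ((\<xi> $ i * \<xi> $ j) *\<^sub>R H $ i $ j) \<le> (norm \<xi>)\<^sup>2 * norm (H $ i $ j)"
      by (simp add: abs_mult power2_eq_square mult_right_mono)
  qed
  then show ?thesis by (simp add: entry_sum_def sum_distrib_left mult.commute)
qed

lemma quad_form_scaleR: "quad_form H (r *\<^sub>R \<xi>) = r\<^sup>2 *\<^sub>R quad_form H \<xi>"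
  by (simp add: quad_form_def scaleR_sum_right power2_eq_square mult_ac)

lemma continuous_quad_form: "continuous_on UNIV (quad_form H)"
  unfolding quad_form_def by (intro continuous_intros)

section \<open>Integration over the sphere in polar coordinates\<close>

lemma space_sphere_measure: "space (sphere_measure :: 'a::euclidean_space measure) = sphere 0 1"
  and sets_sphere_measure: "sets (sphere_measure :: 'a::euclidean_space measure) = sets (restrict_space borel (sphere 0 1))"
  by (simp_all add: sphere_measure_def space_scale_measure space_restrict_space)

lemma measurable_sphere_measure:
  "f \<in> borel_measurable borel \<Longrightarrow> f \<in> borel_measurable (sphere_measure :: 'a::euclidean_space measure)"
  by (simp add: measurable_cong_sets[OF sets_sphere_measure refl] measurable_restrict_space1)

lemma nn_integral_sphere_measure:
  fixes f :: "'a::euclidean_space \<Rightarrow> ennreal"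
  assumes [measurable]: "f \<in> borel_measurable borel"
  shows "(\<integral>\<^sup>+x. f x \<partial>sphere_measure) =
    of_nat DIM('a) * (\<integral>\<^sup>+x. f (sgn x) * indicator (ball 0 1) x \<partial>lborel)"
proof -
  let ?B = "ball 0 1 - {0} :: 'a set"
  let ?S = "restrict_space borel (sphere 0 1) :: 'a measure"
  have meas: "sgn \<in> measurable (restrict_space lborel ?B) ?S"
  proof (rule measurable_restrict_space2)
    show "sgn \<in> borel_measurable (restrict_space lborel ?B)"
      by (intro measurable_restrict_space1) simp
  qed (auto simp: space_restrict_space norm_sgn)
  have f: "f \<in> borel_measurable (distr (restrict_space lborel ?B) ?S sgn)"
    by (simp add: measurable_restrict_space1)
  have "(\<integral>\<^sup>+x. f x \<partial>sphere_measure) = of_nat DIM('a) * (\<integral>\<^sup>+x. f (sgn x) \<partial>restrict_space lborel ?B)"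
    unfolding sphere_measure_def
    by (simp add: nn_integral_scale_measure[OF f] nn_integral_distr[OF meas] measurable_restrict_space1)
  also have "(\<integral>\<^sup>+x. f (sgn x) \<partial>restrict_space lborel ?B) = (\<integral>\<^sup>+x. f (sgn x) * indicator ?B x \<partial>lborel)"
    by (rule nn_integral_restrict_space) simp
  also have "\<dots> = (\<integral>\<^sup>+x. f (sgn x) * indicator (ball 0 1) x \<partial>lborel)"
    by (rule nn_integral_cong_AE, rule eventually_mono[OF AE_lborel_singleton[of 0]]) (auto simp: indicator_def)
  finally show ?thesis .
qed

definition sphere_area :: "'a::euclidean_space itself \<Rightarrow> real" where
  "sphere_area _ = measure sphere_measure (sphere 0 1 :: 'a set)"

lemma emeasure_sphere_measure_space:
  "emeasure sphere_measure (sphere 0 1 :: 'a::euclidean_space set) = ennreal (sphere_area TYPE('a))"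
  "0 < sphere_area TYPE('a)"
proof -
  have "emeasure sphere_measure (sphere 0 1 :: 'a set) = of_nat DIM('a) * emeasure lborel (ball 0 1 :: 'a set)"
    using nn_integral_sphere_measure[of "\<lambda>_ :: 'a. 1"] by (simp add: space_sphere_measure)
  also have "\<dots> = ennreal (real DIM('a) * unit_ball_vol (real DIM('a)))"
    by (simp add: emeasure_ball ennreal_mult ennreal_of_nat_eq_real_of_nat)
  finally have *: "emeasure sphere_measure (sphere 0 1 :: 'a set) = ennreal (real DIM('a) * unit_ball_vol (real DIM('a)))" .
  then have **: "sphere_area TYPE('a) = real DIM('a) * unit_ball_vol (real DIM('a))"
    by (simp add: sphere_area_def measure_def)
  show "emeasure sphere_measure (sphere 0 1 :: 'a set) = ennreal (sphere_area TYPE('a))"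
    using * ** by simp
  show "0 < sphere_area TYPE('a)" unfolding ** by simp
qed

lemma finite_measure_sphere: "finite_measure (sphere_measure :: 'a::euclidean_space measure)"
  by (rule finite_measureI) (simp add: space_sphere_measure emeasure_sphere_measure_space)

text \<open>
  Layer cake: \<open>exp (- c |x|\<^sup>2)\<close> is the integral of \<open>2 c t exp (- c t\<^sup>2)\<close> over \<open>t > |x|\<close>, and the
  integral of a function of \<open>sgn x\<close> over the ball of radius \<open>t\<close> scales like \<open>t\<^sup>n\<close>.
\<close>

lemma nn_integral_gaussian_tail:
  assumes "0 < c" "0 \<le> r"
  shows "(\<integral>\<^sup>+t. ennreal (2 * c * t * exp (- c * t\<^sup>2)) * indicator {r<..} t \<partial>lborel) = ennreal (exp (- c * r\<^sup>2))"
proof -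
  have "(\<integral>\<^sup>+t. ennreal (2 * c * t * exp (- c * t\<^sup>2)) * indicator {r<..} t \<partial>lborel) =
      (\<integral>\<^sup>+t. ennreal (2 * c * t * exp (- c * t\<^sup>2)) * indicator {r..} t \<partial>lborel)"
    by (rule nn_integral_cong_AE, rule eventually_mono[OF AE_lborel_singleton[of r]]) (auto simp: indicator_def)
  also have "\<dots> = ennreal (0 - (- exp (- c * r\<^sup>2)))"
  proof (rule nn_integral_FTC_atLeast)
    fix t assume "r \<le> t"
    show "((\<lambda>t. - exp (- c * t\<^sup>2)) has_real_derivative 2 * c * t * exp (- c * t\<^sup>2)) (at t)"
      by (auto intro!: derivative_eq_intros)
    show "0 \<le> 2 * c * t * exp (- c * t\<^sup>2)" using assms \<open>r \<le> t\<close> by simp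
  next
    have "filterlim (\<lambda>t::real. c * t\<^sup>2) at_top at_top"
      using assms(1) by (intro filterlim_tendsto_pos_mult_at_top[OF tendsto_const _ filterlim_pow_at_top]) (auto simp: filterlim_ident)
    then have "((\<lambda>t. - exp (- (c * t\<^sup>2))) \<longlongrightarrow> - 0) at_top"
      by (intro tendsto_minus filterlim_compose[OF exp_at_bot]) (simp add: filterlim_uminus_at_bot)
    then show "((\<lambda>t. - exp (- c * t\<^sup>2)) \<longlongrightarrow> 0) at_top" by simp
  qed measurable
  finally show ?thesis by simp
qed

lemma nn_integral_lborel_scale:
  fixes f :: "'a::euclidean_space \<Rightarrow> ennreal"
  assumes [measurable]: "f \<in> borel_measurable borel" and "0 < t"
  shows "(\<integral>\<^sup>+x. f x \<partial>lborel) = ennreal (t ^ DIM('a)) * (\<integral>\<^sup>+x. f (t *\<^sub>R x) \<partial>lborel)"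
proof -
  have "(lborel :: 'a measure) = density (distr lborel borel (\<lambda>x. t *\<^sub>R x)) (\<lambda>_. ennreal (t ^ DIM('a)))"
    using lborel_affine[of t "0 :: 'a"] assms(2) by simp
  from arg_cong[OF this, of "\<lambda>M. nn_integral M f"] show ?thesis
    by (simp add: nn_integral_density nn_integral_distr nn_integral_cmult)
qed

text \<open>Fubini exchanges the layer variable t with x. The radial integral is kept as an
  unevaluated factor; balls of radius t \<le> 0 are empty, whence the indicator.\<close>

lemma nn_integral_gaussian_polar_aux:
  fixes f :: "'a::euclidean_space \<Rightarrow> ennreal"
  assumes [measurable]: "f \<in> borel_measurable borel" and c: "0 < c"
  shows "(\<integral>\<^sup>+x. ennreal (exp (- c * (norm x)\<^sup>2)) * f (sgn x) \<partial>lborel) =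
    (\<integral>\<^sup>+t. ennreal (2 * c * t * exp (- c * t\<^sup>2)) * ennreal (t ^ DIM('a)) * indicator {0<..} t \<partial>lborel) *
    (\<integral>\<^sup>+x. f (sgn x) * indicator (ball 0 1) x \<partial>lborel)"
proof -
  let ?k = "\<lambda>t. ennreal (2 * c * t * exp (- c * t\<^sup>2))"
  have "(\<integral>\<^sup>+x. ennreal (exp (- c * (norm x)\<^sup>2)) * f (sgn x) \<partial>lborel) =
      (\<integral>\<^sup>+x. (\<integral>\<^sup>+t. ?k t * indicator {norm x<..} t * f (sgn x) \<partial>lborel) \<partial>(lborel :: 'a measure))"
    using nn_integral_gaussian_tail[OF c] by (simp add: nn_integral_multc)
  also have "\<dots> = (\<integral>\<^sup>+t. (\<integral>\<^sup>+x. ?k t * indicator {norm x<..} t * f (sgn x) \<partial>(lborel :: 'a measure)) \<partial>lborel)"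
  proof (rule lborel_pair.Fubini'[symmetric])
    have "{z \<in> space (lborel \<Otimes>\<^sub>M lborel). norm (fst z :: 'a) < (snd z :: real)} \<in> sets (lborel \<Otimes>\<^sub>M lborel)"
      by measurable
    then have "{(x :: 'a, t :: real). norm x < t} \<in> sets (lborel \<Otimes>\<^sub>M lborel)"
      by (simp add: space_pair_measure case_prod_unfold)
    moreover have "(\<lambda>(x :: 'a, t :: real). indicator {norm x<..} t :: ennreal) =
        (\<lambda>(x, t). indicator {(x, t). norm x < t} (x, t))"
      by (auto simp: fun_eq_iff indicator_def)
    ultimately have [measurable]: "(\<lambda>(x :: 'a, t :: real). indicator {norm x<..} t :: ennreal) \<in> borel_measurable (lborel \<Otimes>\<^sub>M lborel)"
      by (simp add: case_prod_unfold)
    show "(\<lambda>(x, t). ?k t * indicator {norm x<..} t * f (sgn x)) \<in> borel_measurable ((lborel :: 'a measure) \<Otimes>\<^sub>M lborel)"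
      by measurable
  qed
  also have "\<dots> = (\<integral>\<^sup>+t. ?k t * ennreal (t ^ DIM('a)) * indicator {0<..} t *
      (\<integral>\<^sup>+x. f (sgn x) * indicator (ball 0 1) x \<partial>(lborel :: 'a measure)) \<partial>lborel)"
  proof (rule nn_integral_cong)
    fix t :: real
    have eq: "?k t * indicator {norm x<..} t * f (sgn x) = ?k t * (f (sgn x) * indicator (ball 0 t) x)" for x :: 'a
      by (simp add: indicator_def)
    show "(\<integral>\<^sup>+x. ?k t * indicator {norm x<..} t * f (sgn x) \<partial>(lborel :: 'a measure)) =
        ?k t * ennreal (t ^ DIM('a)) * indicator {0<..} t * (\<integral>\<^sup>+x. f (sgn x) * indicator (ball 0 1) x \<partial>(lborel :: 'a measure))"
    proof (cases "0 < t")
      case True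
      have [measurable]: "ball (0 :: 'a) t \<in> sets borel" by simp
      have "(\<integral>\<^sup>+x. f (sgn x) * indicator (ball 0 t) x \<partial>(lborel :: 'a measure)) =
          ennreal (t ^ DIM('a)) * (\<integral>\<^sup>+x. f (sgn (t *\<^sub>R x)) * indicator (ball 0 t) (t *\<^sub>R x) \<partial>(lborel :: 'a measure))"
        by (rule nn_integral_lborel_scale[OF _ True]) measurable
      also have "(\<lambda>x :: 'a. f (sgn (t *\<^sub>R x)) * indicator (ball 0 t) (t *\<^sub>R x)) = (\<lambda>x. f (sgn x) * indicator (ball 0 1) x)"
        using True by (auto simp: fun_eq_iff sgn_scaleR indicator_def)
      finally show ?thesis unfolding eq using True by (simp add: nn_integral_cmult mult.assoc)
    next
      case False
      then have "indicator (ball (0 :: 'a) t) x = (0 :: ennreal)" for x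
        using norm_ge_zero[of x] by (simp add: indicator_def del: norm_ge_zero)
      then show ?thesis unfolding eq using False by simp
    qed
  qed
  also have "\<dots> = (\<integral>\<^sup>+t. ?k t * ennreal (t ^ DIM('a)) * indicator {0<..} t \<partial>lborel) *
      (\<integral>\<^sup>+x. f (sgn x) * indicator (ball 0 1) x \<partial>(lborel :: 'a measure))"
    by (rule nn_integral_multc) measurable
  finally show ?thesis .
qed

lemma nn_integral_gaussian_1:
  assumes "0 < c"
  shows "(\<integral>\<^sup>+x. ennreal (exp (- c * x\<^sup>2)) \<partial>lborel) = ennreal (sqrt (pi / c))"
proof -
  have half: "(\<integral>\<^sup>+x. ennreal (indicator {0..} x *\<^sub>R exp (- x\<^sup>2)) \<partial>lborel) = ennreal (sqrt pi / 2)"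
    using gaussian_moment_0 by (subst nn_integral_eq_integral) (auto simp: has_bochner_integral_iff)
  have "(\<integral>\<^sup>+x. ennreal (exp (- x\<^sup>2)) \<partial>lborel) =
      (\<integral>\<^sup>+x. ennreal (indicator {0..} x *\<^sub>R exp (- x\<^sup>2)) + ennreal (indicator {0..} (- x) *\<^sub>R exp (- (- x)\<^sup>2)) \<partial>lborel)"
    by (rule nn_integral_cong_AE, rule eventually_mono[OF AE_lborel_singleton[of "0 :: real"]])
       (auto simp: indicator_def)
  also have "\<dots> = (\<integral>\<^sup>+x. ennreal (indicator {0..} x *\<^sub>R exp (- x\<^sup>2)) \<partial>lborel) +
      (\<integral>\<^sup>+x. ennreal (indicator {0..} (- x) *\<^sub>R exp (- (- x)\<^sup>2)) \<partial>lborel)"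
    by (rule nn_integral_add) measurable
  also have "(\<integral>\<^sup>+x. ennreal (indicator {0..} (- x) *\<^sub>R exp (- (- x)\<^sup>2)) \<partial>lborel) =
      (\<integral>\<^sup>+x. ennreal (indicator {0..} x *\<^sub>R exp (- x\<^sup>2)) \<partial>lborel)"
    by (subst (2) nn_integral_real_affine[where c = "-1" and t = 0]) auto
  finally have one: "(\<integral>\<^sup>+x. ennreal (exp (- x\<^sup>2)) \<partial>lborel) = ennreal (sqrt pi)"
    unfolding half by (simp flip: ennreal_plus)
  have "ennreal (sqrt pi) = ennreal (sqrt c) * (\<integral>\<^sup>+x. ennreal (exp (- (sqrt c * x)\<^sup>2)) \<partial>lborel)"
    unfolding one[symmetric] using assms
    by (subst nn_integral_real_affine[where c = "sqrt c" and t = 0]) auto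
  then have "ennreal (1 / sqrt c) * ennreal (sqrt pi) =
      (ennreal (1 / sqrt c) * ennreal (sqrt c)) * (\<integral>\<^sup>+x. ennreal (exp (- (sqrt c * x)\<^sup>2)) \<partial>lborel)"
    by (simp only: mult.assoc)
  then show ?thesis
    using assms by (simp add: power_mult_distrib real_sqrt_divide flip: ennreal_mult)
qed

lemma nn_integral_gaussian:
  assumes "0 < c"
  shows "(\<integral>\<^sup>+x. ennreal (exp (- c * (norm x)\<^sup>2)) \<partial>(lborel :: 'a::euclidean_space measure)) =
    ennreal ((pi / c) powr (real DIM('a) / 2))"
proof -
  have "exp (- c * (norm x)\<^sup>2) = (\<Prod>b\<in>Basis. exp (- c * (x \<bullet> b)\<^sup>2))" for x :: 'a
  proof -
    have "(norm x)\<^sup>2 = (\<Sum>b\<in>Basis. (x \<bullet> b)\<^sup>2)"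
      unfolding power2_norm_eq_inner by (subst euclidean_inner) (simp add: power2_eq_square)
    then show ?thesis by (simp add: sum_distrib_left exp_sum flip: sum_negf)
  qed
  then have "(\<integral>\<^sup>+x. ennreal (exp (- c * (norm x)\<^sup>2)) \<partial>(lborel :: 'a measure)) =
      (\<integral>\<^sup>+x. (\<Prod>b\<in>Basis. ennreal (exp (- c * (x \<bullet> b)\<^sup>2))) \<partial>(lborel :: 'a measure))"
    by (simp add: prod_ennreal)
  also have "\<dots> = (\<Prod>b\<in>(Basis :: 'a set). \<integral>\<^sup>+x. ennreal (exp (- c * x\<^sup>2)) \<partial>lborel)"
    by (rule nn_integral_lborel_prod) auto
  also have "\<dots> = ennreal (sqrt (pi / c) ^ DIM('a))"
    unfolding nn_integral_gaussian_1[OF assms] using assms by (simp add: ennreal_power)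
  also have "sqrt (pi / c) ^ DIM('a) = (pi / c) powr (real DIM('a) / 2)"
    using assms by (simp add: powr_half_sqrt[symmetric] powr_power)
  finally show ?thesis .
qed

text \<open>The radial factor K is never computed: the case f = 1, where the Gaussian integral is
  known from its product form, determines it.\<close>

lemma nn_integral_gaussian_polar:
  fixes f :: "'a::euclidean_space \<Rightarrow> ennreal"
  assumes f: "f \<in> borel_measurable borel" and c: "0 < c"
  shows "(\<integral>\<^sup>+x. ennreal (exp (- c * (norm x)\<^sup>2)) * f (sgn x) \<partial>lborel) =
    ennreal ((pi / c) powr (real DIM('a) / 2) / sphere_area TYPE('a)) * (\<integral>\<^sup>+x. f x \<partial>sphere_measure)"
proof -
  define K where "K = (\<integral>\<^sup>+t. ennreal (2 * c * t * exp (- c * t\<^sup>2)) * ennreal (t ^ DIM('a)) * indicator {0<..} t \<partial>lborel)"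
  have n: "(of_nat DIM('a) :: ennreal) * ennreal (1 / real DIM('a)) = 1"
    by (simp add: ennreal_of_nat_eq_real_of_nat flip: ennreal_mult)
  have polar: "(\<integral>\<^sup>+x. ennreal (exp (- c * (norm x)\<^sup>2)) * f (sgn x) \<partial>lborel) =
      K * ennreal (1 / real DIM('a)) * (\<integral>\<^sup>+x. f x \<partial>sphere_measure)" if "f \<in> borel_measurable borel" for f :: "'a \<Rightarrow> ennreal"
  proof -
    have "K * ennreal (1 / real DIM('a)) * (\<integral>\<^sup>+x. f x \<partial>sphere_measure) =
        K * (of_nat DIM('a) * ennreal (1 / real DIM('a))) * (\<integral>\<^sup>+x. f (sgn x) * indicator (ball 0 1) x \<partial>lborel)"
      unfolding nn_integral_sphere_measure[OF that] by (simp only: mult_ac)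
    then show ?thesis unfolding n nn_integral_gaussian_polar_aux[OF that c] K_def by simp
  qed
  have "ennreal ((pi / c) powr (real DIM('a) / 2)) = K * ennreal (1 / real DIM('a)) * ennreal (sphere_area TYPE('a))"
    using polar[of "\<lambda>_. 1"] nn_integral_gaussian[OF c, where 'a = 'a]
    by (simp add: space_sphere_measure emeasure_sphere_measure_space)
  then have "ennreal ((pi / c) powr (real DIM('a) / 2)) * ennreal (1 / sphere_area TYPE('a)) =
      K * ennreal (1 / real DIM('a)) * (ennreal (sphere_area TYPE('a)) * ennreal (1 / sphere_area TYPE('a)))"
    by (simp only: mult.assoc)
  moreover have "ennreal (sphere_area TYPE('a)) * ennreal (1 / sphere_area TYPE('a)) = 1"
    using emeasure_sphere_measure_space(2)[where 'a = 'a] by (simp flip: ennreal_mult)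
  ultimately have "K * ennreal (1 / real DIM('a)) = ennreal ((pi / c) powr (real DIM('a) / 2) / sphere_area TYPE('a))"
    using emeasure_sphere_measure_space(2)[where 'a = 'a] by (simp flip: ennreal_mult)
  then show ?thesis using polar[OF f] by simp
qed

lemma integrable_sphere_bounded:
  fixes A :: "'a::euclidean_space \<Rightarrow> 'b::{banach, second_countable_topology}"
  assumes "A \<in> borel_measurable borel" "\<And>x. norm x = 1 \<Longrightarrow> norm (A x) \<le> B"
  shows "integrable sphere_measure A"
proof -
  interpret finite_measure "sphere_measure :: 'a measure" by (rule finite_measure_sphere)
  show ?thesis
    by (rule integrable_const_bound[of _ B])
       (auto simp: space_sphere_measure assms intro!: AE_I2 measurable_sphere_measure)
qed

lemma gaussian_polar:
  fixes A :: "'a::euclidean_space \<Rightarrow> real"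
  assumes A [measurable]: "A \<in> borel_measurable borel" and bd: "\<And>x. norm x = 1 \<Longrightarrow> \<bar>A x\<bar> \<le> B" and c: "0 < c"
  shows "has_bochner_integral lborel (\<lambda>x. exp (- c * (norm x)\<^sup>2) * A (sgn x))
    ((pi / c) powr (real DIM('a) / 2) / sphere_area TYPE('a) * integral\<^sup>L sphere_measure A)"
proof -
  define K where "K = (pi / c) powr (real DIM('a) / 2) / sphere_area TYPE('a)"
  have K: "0 \<le> K" unfolding K_def using emeasure_sphere_measure_space(2)[where 'a = 'a] by (simp add: less_imp_le)
  have nn: "(\<integral>\<^sup>+x. ennreal (exp (- c * (norm x)\<^sup>2) * F (sgn x)) \<partial>lborel) = ennreal K * (\<integral>\<^sup>+x. ennreal (F x) \<partial>sphere_measure)"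
    if [measurable]: "F \<in> borel_measurable borel" for F :: "'a \<Rightarrow> real"
    using nn_integral_gaussian_polar[of "\<lambda>x. ennreal (F x)" c] c by (simp add: ennreal_mult' K_def)
  have SA: "integrable sphere_measure A" by (rule integrable_sphere_bounded[OF A]) (use bd in auto)
  have fin: "(\<integral>\<^sup>+x. ennreal \<bar>A x\<bar> \<partial>sphere_measure) < \<infinity>"
    using SA by (simp add: integrable_iff_bounded)
  have int: "integrable lborel (\<lambda>x. exp (- c * (norm x)\<^sup>2) * A (sgn x))"
  proof (rule integrableI_bounded)
    have "(\<integral>\<^sup>+x. ennreal (norm (exp (- c * (norm x)\<^sup>2) * A (sgn x))) \<partial>lborel) =
        (\<integral>\<^sup>+x. ennreal (exp (- c * (norm x)\<^sup>2) * \<bar>A (sgn x)\<bar>) \<partial>lborel)"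
      by (simp add: abs_mult)
    also have "\<dots> = ennreal K * (\<integral>\<^sup>+x. ennreal \<bar>A x\<bar> \<partial>sphere_measure)" by (rule nn) measurable
    also have "\<dots> < \<infinity>" using fin by (simp add: ennreal_mult_less_top)
    finally show "(\<integral>\<^sup>+x. ennreal (norm (exp (- c * (norm x)\<^sup>2) * A (sgn x))) \<partial>lborel) < \<infinity>" .
  qed measurable
  have "integral\<^sup>L lborel (\<lambda>x. exp (- c * (norm x)\<^sup>2) * A (sgn x)) =
      enn2real (\<integral>\<^sup>+x. ennreal (exp (- c * (norm x)\<^sup>2) * A (sgn x)) \<partial>lborel) -
      enn2real (\<integral>\<^sup>+x. ennreal (exp (- c * (norm x)\<^sup>2) * (- A (sgn x))) \<partial>lborel)"
    using real_lebesgue_integral_def[OF int] by simp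
  also have "\<dots> = K * (enn2real (\<integral>\<^sup>+x. ennreal (A x) \<partial>sphere_measure) - enn2real (\<integral>\<^sup>+x. ennreal (- A x) \<partial>sphere_measure))"
    using nn[of A] nn[of "\<lambda>x. - A x"] K by (simp add: enn2real_mult right_diff_distrib)
  also have "\<dots> = K * integral\<^sup>L sphere_measure A"
    using real_lebesgue_integral_def[OF SA] by simp
  finally show ?thesis using int by (simp add: has_bochner_integral_iff K_def)
qed

section \<open>Gaussian moments as coefficients of power series\<close>

lemma powser_coeff_unique:
  fixes a b :: "nat \<Rightarrow> real"
  assumes "0 < r" "\<And>z. \<bar>z\<bar> < r \<Longrightarrow> (\<lambda>m. a m * z ^ m) sums f z" "\<And>z. \<bar>z\<bar> < r \<Longrightarrow> (\<lambda>m. b m * z ^ m) sums f z"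
  shows "a = b"
proof (rule ccontr)
  assume "a \<noteq> b"
  then obtain m where m: "a m - b m \<noteq> 0" by auto
  have sums: "(\<lambda>m. (a m - b m) * (z - 0) ^ m) sums 0" if "norm (z - 0) < r" for z
    using sums_diff[OF assms(2)[of z] assms(3)[of z]] that by (simp add: algebra_simps)
  have "a 0 - b 0 = 0"
    using sums[of 0] powser_sums_zero[of "\<lambda>m. a m - b m"] assms(1) sums_unique2
    unfolding diff_zero norm_zero by blast
  with m have "0 < m" by (cases m) auto
  obtain s where "0 < s" "\<And>z. z \<in> cball 0 s - {0 :: real} \<Longrightarrow> (0 :: real) \<noteq> 0"
    using powser_0_nonzero[of r 0 "\<lambda>m. a m - b m" "\<lambda>_. 0" m] assms(1) sums m \<open>0 < m\<close> by metis
  from this(2)[of s] this(1) show False by simp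
qed

text \<open>The coefficient of z^m in exp (- c (1 - z) |x|^2). Later z is replaced by the
  contraction b at the direction of x.\<close>

definition gauss_term :: "real \<Rightarrow> nat \<Rightarrow> 'a::euclidean_space \<Rightarrow> real" where
  "gauss_term c m x = exp (- c * (norm x)\<^sup>2) * ((c * (norm x)\<^sup>2) ^ m / fact m)"

lemma gauss_term_sums: "(\<lambda>m. gauss_term c m x * z ^ m) sums exp (- (c * (1 - z)) * (norm x)\<^sup>2)"
proof -
  have "(\<lambda>m. exp (- c * (norm x)\<^sup>2) * ((z * (c * (norm x)\<^sup>2)) ^ m /\<^sub>R fact m)) sums
      (exp (- c * (norm x)\<^sup>2) * exp (z * (c * (norm x)\<^sup>2)))"
    by (intro sums_mult exp_converges)
  moreover have "exp (- c * (norm x)\<^sup>2) * exp (z * (c * (norm x)\<^sup>2)) = exp (- (c * (1 - z)) * (norm x)\<^sup>2)"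
    by (simp add: algebra_simps flip: exp_add)
  ultimately show ?thesis by (simp add: gauss_term_def power_mult_distrib divide_inverse mult_ac)
qed

lemma gauss_term_nonneg: "0 \<le> c \<Longrightarrow> 0 \<le> gauss_term c m x"
  by (simp add: gauss_term_def)

lemma measurable_gauss_term [measurable]: "gauss_term c m \<in> borel_measurable borel"
  unfolding gauss_term_def by measurable

text \<open>Each term of the generating function at z = 1/2 is at most its sum, a Gaussian with
  exponent c / 2; this gives the constant 2^m.\<close>

lemma gauss_term_integrable:
  fixes A :: "'a::euclidean_space \<Rightarrow> real"
  assumes A [measurable]: "A \<in> borel_measurable borel" and bd: "\<And>x. norm x = 1 \<Longrightarrow> \<bar>A x\<bar> \<le> B" and c: "0 < c"
  shows "integrable lborel (\<lambda>x. gauss_term c m x * A (sgn x))"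
proof (rule Bochner_Integration.integrable_bound)
  have "integrable lborel (\<lambda>x :: 'a. exp (- (c / 2) * (norm x)\<^sup>2) * \<bar>A (sgn x)\<bar>)"
    using gaussian_polar[of "\<lambda>x. \<bar>A x\<bar>" B "c / 2"] bd c by (auto simp: has_bochner_integral_iff)
  then show "integrable lborel (\<lambda>x :: 'a. 2 ^ m * (exp (- (c / 2) * (norm x)\<^sup>2) * \<bar>A (sgn x)\<bar>))"
    by (rule integrable_mult_right)
  have "gauss_term c m x \<le> 2 ^ m * exp (- (c / 2) * (norm x)\<^sup>2)" for x :: 'a
  proof -
    have s: "(\<lambda>m. gauss_term c m x * (1 / 2) ^ m) sums exp (- (c * (1 - 1 / 2)) * (norm x)\<^sup>2)"
      by (rule gauss_term_sums)
    have "gauss_term c m x * (1 / 2) ^ m \<le> exp (- (c * (1 - 1 / 2)) * (norm x)\<^sup>2)"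
      using sum_le_suminf[OF sums_summable[OF s], of "{m}"] s c
      by (simp add: sums_iff gauss_term_nonneg)
    then show ?thesis by (simp add: field_simps)
  qed
  from mult_right_mono[OF this, of "\<bar>A (sgn _)\<bar>"]
  show "AE x in lborel. norm (gauss_term c m x * A (sgn x)) \<le> norm (2 ^ m * (exp (- (c / 2) * (norm x)\<^sup>2) * \<bar>A (sgn x)\<bar>))"
    using c by (auto simp: abs_mult gauss_term_nonneg less_imp_le mult.assoc)
qed measurable

text \<open>
  The integrals of \<open>gauss_term c m\<close> against a function of \<open>sgn x\<close> are read off from the power
  series in \<open>z\<close> of the integrals of \<open>exp (- c (1 - z) |x|\<^sup>2)\<close>, which are known for all \<open>z < 1\<close>.
\<close>

lemma gauss_term_integral:
  fixes A :: "'a::euclidean_space \<Rightarrow> real"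
  assumes A [measurable]: "A \<in> borel_measurable borel" and bd: "\<And>x. norm x = 1 \<Longrightarrow> \<bar>A x\<bar> \<le> B" and c: "0 < c"
  shows "integral\<^sup>L lborel (\<lambda>x. gauss_term c m x * A (sgn x)) =
    ncoef (real DIM('a) / 2) m * ((pi / c) powr (real DIM('a) / 2) / sphere_area TYPE('a) * integral\<^sup>L sphere_measure A)"
proof -
  define p where "p m x = gauss_term c m x * A (sgn x)" for m and x :: 'a
  note int = gauss_term_integrable[OF A bd c]
  define J where "J = (pi / c) powr (real DIM('a) / 2) / sphere_area TYPE('a) * integral\<^sup>L sphere_measure A"
  have "(\<lambda>m. integral\<^sup>L lborel (p m)) = (\<lambda>m. ncoef (real DIM('a) / 2) m * J)"
  proof (rule powser_coeff_unique)
    show "(0 :: real) < 1" by simp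
    fix z :: real assume z: "\<bar>z\<bar> < 1"
    have "(pi / (c * (1 - z))) powr (real DIM('a) / 2) = (pi / c) powr (real DIM('a) / 2) * (1 - z) powr (- (real DIM('a) / 2))"
    proof -
      have "(pi / (c * (1 - z))) powr (real DIM('a) / 2) = ((pi / c) * inverse (1 - z)) powr (real DIM('a) / 2)"
        unfolding divide_inverse inverse_mult_distrib by (simp only: mult.assoc)
      also have "\<dots> = (pi / c) powr (real DIM('a) / 2) * inverse (1 - z) powr (real DIM('a) / 2)"
        by (rule powr_mult)
      also have "inverse (1 - z) powr (real DIM('a) / 2) = (1 - z) powr (- (real DIM('a) / 2))"
        using z by (simp add: powr_def ln_inverse)
      finally show ?thesis .
    qed
    then have J: "(pi / (c * (1 - z))) powr (real DIM('a) / 2) / sphere_area TYPE('a) * integral\<^sup>L sphere_measure A =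
        (1 - z) powr (- (real DIM('a) / 2)) * J"
      by (simp add: J_def)
    have "(\<lambda>m. (- (real DIM('a) / 2) gchoose m) * (- z) ^ m) sums (1 + - z) powr (- (real DIM('a) / 2))"
      using z by (intro gen_binomial_real) auto
    then have "(\<lambda>m. ncoef (real DIM('a) / 2) m * z ^ m) sums (1 - z) powr (- (real DIM('a) / 2))"
      by (simp add: ncoef_gbinomial power_minus[of z] mult_ac)
    from sums_mult2[OF this, of J]
    show "(\<lambda>m. ncoef (real DIM('a) / 2) m * J * z ^ m) sums ((1 - z) powr (- (real DIM('a) / 2)) * J)"
      by (simp add: mult_ac)
    \<comment> \<open>The partial sums are dominated by the generating function at |z|, which is
      integrable as c (1 - |z|) > 0.\<close>
    have bound: "summable (\<lambda>m. \<integral>x. norm (p m x * z ^ m) \<partial>lborel)"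
    proof (rule bounded_imp_summable)
      fix M
      let ?E = "\<lambda>x :: 'a. exp (- (c * (1 - \<bar>z\<bar>)) * (norm x)\<^sup>2) * \<bar>A (sgn x)\<bar>"
      have E: "integrable lborel ?E"
        using gaussian_polar[of "\<lambda>x. \<bar>A x\<bar>" B "c * (1 - \<bar>z\<bar>)"] bd c z by (auto simp: has_bochner_integral_iff)
      have "(\<Sum>m\<le>M. \<integral>x. norm (p m x * z ^ m) \<partial>lborel) = (\<integral>x. (\<Sum>m\<le>M. norm (p m x * z ^ m)) \<partial>lborel)"
        unfolding p_def by (intro Bochner_Integration.integral_sum[symmetric] integrable_norm integrable_mult_left int)
      also have "\<dots> \<le> integral\<^sup>L lborel ?E"
      proof (rule integral_mono[OF _ E])
        show "integrable lborel (\<lambda>x. \<Sum>m\<le>M. norm (p m x * z ^ m))"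
          unfolding p_def by (intro Bochner_Integration.integrable_sum integrable_norm integrable_mult_left int)
        fix x :: 'a
        have s: "(\<lambda>m. gauss_term c m x * \<bar>z\<bar> ^ m) sums exp (- (c * (1 - \<bar>z\<bar>)) * (norm x)\<^sup>2)"
          by (rule gauss_term_sums)
        have "(\<Sum>m\<le>M. norm (p m x * z ^ m)) = (\<Sum>m\<le>M. gauss_term c m x * \<bar>z\<bar> ^ m) * \<bar>A (sgn x)\<bar>"
          using c by (simp add: p_def abs_mult power_abs gauss_term_nonneg sum_distrib_left sum_distrib_right mult_ac)
        also have "(\<Sum>m\<le>M. gauss_term c m x * \<bar>z\<bar> ^ m) \<le> exp (- (c * (1 - \<bar>z\<bar>)) * (norm x)\<^sup>2)"
          using sum_le_suminf[OF sums_summable[OF s], of "{..M}"] s c by (simp add: sums_iff gauss_term_nonneg)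
        finally show "(\<Sum>m\<le>M. norm (p m x * z ^ m)) \<le> ?E x" by (simp add: mult_right_mono)
      qed
      finally show "(\<Sum>m\<le>M. \<integral>x. norm (p m x * z ^ m) \<partial>lborel) \<le> integral\<^sup>L lborel ?E" .
    qed simp
    have psum: "(\<lambda>m. p m x * z ^ m) sums (exp (- (c * (1 - z)) * (norm x)\<^sup>2) * A (sgn x))" for x
      using sums_mult2[OF gauss_term_sums[of c x z], of "A (sgn x)"] by (simp add: p_def mult_ac)
    have sn: "summable (\<lambda>m. norm (p m x * z ^ m))" for x
    proof -
      have "summable (\<lambda>m. gauss_term c m x * \<bar>z\<bar> ^ m * \<bar>A (sgn x)\<bar>)"
        by (rule summable_mult2[OF sums_summable[OF gauss_term_sums]])
      then show ?thesis using c by (simp add: p_def abs_mult power_abs gauss_term_nonneg mult_ac)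
    qed
    have "(\<lambda>m. integral\<^sup>L lborel (\<lambda>x. p m x * z ^ m)) sums (\<integral>x. (\<Sum>m. p m x * z ^ m) \<partial>lborel)"
      by (rule sums_integral[OF _ _ bound]) (use int sn in \<open>auto simp: p_def intro!: integrable_mult_left\<close>)
    also have "(\<integral>x. (\<Sum>m. p m x * z ^ m) \<partial>lborel) = (\<integral>x. exp (- (c * (1 - z)) * (norm x)\<^sup>2) * A (sgn x) \<partial>lborel)"
      using psum by (simp add: sums_iff)
    also have "\<dots> = (1 - z) powr (- (real DIM('a) / 2)) * J"
      using gaussian_polar[of A B "c * (1 - z)"] A bd c z unfolding J by (simp add: has_bochner_integral_iff)
    finally show "(\<lambda>m. integral\<^sup>L lborel (p m) * z ^ m) sums ((1 - z) powr (- (real DIM('a) / 2)) * J)"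
      by simp
  qed
  from fun_cong[OF this, of m] show ?thesis by (simp add: p_def[abs_def] J_def)
qed

text \<open>Integrating out the radius replaces \<open>gauss_term\<close> by \<open>ncoef\<close>,
  that is, the exponential series by the binomial series of exponent n / 2. The bound B r^m with r <
  1 justifies the interchange on both sides: on the sphere by \<open>summable_ncoef\<close>, and on
  the whole space because the L^1 norms of the terms are given by the same moments.\<close>

lemma gauss_series_integral:
  fixes A :: "nat \<Rightarrow> 'a::euclidean_space \<Rightarrow> real"
  assumes A [measurable]: "\<And>m. A m \<in> borel_measurable borel"
    and bd: "\<And>m x. norm x = 1 \<Longrightarrow> \<bar>A m x\<bar> \<le> B * r ^ m" and r: "0 \<le> r" "r < 1" and c: "0 < c"
  shows "has_bochner_integral lborel (\<lambda>x. \<Sum>m. gauss_term c m x * A m (sgn x))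
    ((pi / c) powr (real DIM('a) / 2) / sphere_area TYPE('a) *
      integral\<^sup>L sphere_measure (\<lambda>x. \<Sum>m. ncoef (real DIM('a) / 2) m * A m x))"
proof -
  define J where "J = (pi / c) powr (real DIM('a) / 2) / sphere_area TYPE('a)"
  note int = gauss_term_integrable[OF A bd c]
  obtain b :: 'a where b: "b \<in> Basis" using nonempty_Basis by blast
  have "\<bar>A 0 b\<bar> \<le> B" using bd[of b 0] b by simp
  then have B: "0 \<le> B" by linarith
  have sgn1: "norm (sgn x) = 1" if "x \<noteq> 0" for x :: 'a using that by (simp add: norm_sgn)
  have ae: "AE x in (lborel :: 'a measure). x \<noteq> 0" by (rule AE_lborel_singleton)
  have sn: "AE x in lborel. summable (\<lambda>m. norm (gauss_term c m x * A m (sgn x)))"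
    using ae
  proof eventually_elim
    fix x :: 'a assume x: "x \<noteq> 0"
    show "summable (\<lambda>m. norm (gauss_term c m x * A m (sgn x)))"
    proof (rule summable_comparison_test'[of "\<lambda>m. gauss_term c m x * r ^ m * B" 0])
      show "summable (\<lambda>m. gauss_term c m x * r ^ m * B)"
        by (rule summable_mult2[OF sums_summable[OF gauss_term_sums]])
      show "norm (norm (gauss_term c m x * A m (sgn x))) \<le> gauss_term c m x * r ^ m * B" for m
        using mult_left_mono[OF bd[OF sgn1[OF x], of m], of "gauss_term c m x"] c
        by (simp add: abs_mult gauss_term_nonneg mult_ac)
    qed
  qed
  have S: "finite_measure (sphere_measure :: 'a measure)" by (rule finite_measure_sphere)
  have intA: "integrable sphere_measure (A m)" for m
    by (rule integrable_sphere_bounded[OF A]) (use bd in auto)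
  have int_le: "(\<integral>x. norm (ncoef s m * A m x) \<partial>sphere_measure) \<le> \<bar>ncoef s m\<bar> * r ^ m * (B * sphere_area TYPE('a))" for s m
  proof -
    have "(\<integral>x. norm (ncoef s m * A m x) \<partial>sphere_measure) \<le> (\<integral>x. \<bar>ncoef s m\<bar> * (B * r ^ m) \<partial>(sphere_measure :: 'a measure))"
      by (rule integral_mono)
         (auto simp: space_sphere_measure abs_mult bd finite_measure.integrable_const[OF S] intro!: integrable_mult_right intA mult_left_mono integrable_abs)
    also have "\<dots> = \<bar>ncoef s m\<bar> * r ^ m * (B * sphere_area TYPE('a))"
      by (simp add: space_sphere_measure sphere_area_def mult_ac)
    finally show ?thesis .
  qed
  have sb: "summable (\<lambda>m. \<integral>x. norm (ncoef s m * A m x) \<partial>sphere_measure)" for s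
    by (rule summable_comparison_test'[OF summable_mult2[OF summable_ncoef[OF r]], of 0])
       (use int_le in \<open>auto intro!: integral_nonneg_AE\<close>)
  have bound: "summable (\<lambda>m. \<integral>x. norm (gauss_term c m x * A m (sgn x)) \<partial>lborel)"
  proof (rule summable_comparison_test'[of "\<lambda>m. J * (\<integral>x. norm (ncoef (real DIM('a) / 2) m * A m x) \<partial>sphere_measure)" 0])
    show "summable (\<lambda>m. J * (\<integral>x. norm (ncoef (real DIM('a) / 2) m * A m x) \<partial>sphere_measure))"
      by (rule summable_mult[OF sb])
    fix m
    have "(\<integral>x. norm (gauss_term c m x * A m (sgn x)) \<partial>lborel) = (\<integral>x. gauss_term c m x * \<bar>A m (sgn x)\<bar> \<partial>(lborel :: 'a measure))"
      using c by (simp add: abs_mult gauss_term_nonneg)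
    also have "\<dots> = ncoef (real DIM('a) / 2) m * (J * (\<integral>x. \<bar>A m x\<bar> \<partial>sphere_measure))"
      unfolding J_def by (rule gauss_term_integral[of "\<lambda>x. \<bar>A m x\<bar>" "B * r ^ m"]) (use bd c in auto)
    also have "\<dots> = J * (\<integral>x. norm (ncoef (real DIM('a) / 2) m * A m x) \<partial>sphere_measure)"
      by (simp add: abs_mult ncoef_def pochhammer_nonneg mult_ac)
    finally have eq: "(\<integral>x. norm (gauss_term c m x * A m (sgn x)) \<partial>lborel) =
        J * (\<integral>x. norm (ncoef (real DIM('a) / 2) m * A m x) \<partial>sphere_measure)" .
    have "0 \<le> (\<integral>x. norm (gauss_term c m x * A m (sgn x)) \<partial>(lborel :: 'a measure))"
      by (rule integral_nonneg_AE) simp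
    then show "norm (\<integral>x. norm (gauss_term c m x * A m (sgn x)) \<partial>lborel) \<le>
        J * (\<integral>x. norm (ncoef (real DIM('a) / 2) m * A m x) \<partial>sphere_measure)"
      unfolding eq[symmetric] by (simp only: real_norm_def abs_of_nonneg order_refl)
  qed
  have "(\<lambda>m. integral\<^sup>L lborel (\<lambda>x. gauss_term c m x * A m (sgn x))) sums (\<integral>x. (\<Sum>m. gauss_term c m x * A m (sgn x)) \<partial>lborel)"
    by (rule sums_integral[OF int sn bound])
  moreover have "(\<lambda>m. integral\<^sup>L lborel (\<lambda>x. gauss_term c m x * A m (sgn x))) sums
      (J * (\<integral>x. (\<Sum>m. ncoef (real DIM('a) / 2) m * A m x) \<partial>sphere_measure))"
  proof -
    have "integral\<^sup>L lborel (\<lambda>x. gauss_term c m x * A m (sgn x)) =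
        J * (\<integral>x. ncoef (real DIM('a) / 2) m * A m x \<partial>sphere_measure)" for m
      using gauss_term_integral[OF A bd c, of m m] by (simp add: J_def)
    moreover have sI: "integrable sphere_measure (\<lambda>x. ncoef (real DIM('a) / 2) m * A m x)" for m
      by (intro integrable_mult_right intA)
    have "(\<lambda>m. \<integral>x. ncoef (real DIM('a) / 2) m * A m x \<partial>sphere_measure) sums
        (\<integral>x. (\<Sum>m. ncoef (real DIM('a) / 2) m * A m x) \<partial>sphere_measure)"
    proof (rule sums_integral[OF sI _ sb])
      show "AE x in sphere_measure. summable (\<lambda>m. norm (ncoef (real DIM('a) / 2) m * A m x))"
      proof (rule AE_I2)
        fix x :: 'a assume "x \<in> space sphere_measure"
        then have x: "norm x = 1" by (simp add: space_sphere_measure)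
        show "summable (\<lambda>m. norm (ncoef (real DIM('a) / 2) m * A m x))"
        proof (rule summable_comparison_test'[OF summable_mult2[OF summable_ncoef[OF r, of "real DIM('a) / 2"], of B], of 0])
          show "norm (norm (ncoef (real DIM('a) / 2) m * A m x)) \<le> \<bar>ncoef (real DIM('a) / 2) m\<bar> * r ^ m * B" for m
            using mult_left_mono[OF bd[OF x, of m], of "\<bar>ncoef (real DIM('a) / 2) m\<bar>"]
            by (simp add: abs_mult mult_ac)
        qed
      qed
    qed
    ultimately show ?thesis using sums_mult by simp
  qed
  ultimately have "(\<integral>x. (\<Sum>m. gauss_term c m x * A m (sgn x)) \<partial>lborel) =
      J * (\<integral>x. (\<Sum>m. ncoef (real DIM('a) / 2) m * A m x) \<partial>sphere_measure)"
    by (rule sums_unique2)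
  moreover have "integrable lborel (\<lambda>x. \<Sum>m. gauss_term c m x * A m (sgn x))"
    by (rule integrable_suminf[OF int sn bound])
  ultimately show ?thesis by (simp add: has_bochner_integral_iff J_def)
qed

section \<open>Weak integrals of smooth families\<close>

lemma has_weak_integral_unique:
  fixes v w :: "'n::finite torus_op"
  assumes "has_weak_integral M F v" "has_weak_integral M F w"
  shows "v = w"
proof (rule op_eqI)
  fix f
  have "inner (op_apply v f) g = inner (op_apply w f) g" for g
  proof -
    have "bounded_linear (\<lambda>a :: 'n torus_op. inner (op_apply a f) g)"
      by (rule bounded_linear_compose[OF bounded_linear_inner_left op.bounded_linear_act])
    then show ?thesis
      using assms unfolding has_weak_integral_def by (metis has_bochner_integral_eq)
  qed
  then show "op_apply v f = op_apply w f" by (metis inner_eq_zero_iff inner_diff_left right_minus_eq)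
qed

lemma weak_integral_eqI:
  fixes v :: "'n::finite torus_op"
  assumes "has_weak_integral M F v"
  shows "weak_integral M F = v"
  unfolding weak_integral_def using assms has_weak_integral_unique by (metis (mono_tags, lifting) the_equality)

lemma has_weak_integral_cong:
  assumes "\<And>x. x \<in> space M \<Longrightarrow> F x = G x"
  shows "has_weak_integral M F v \<longleftrightarrow> has_weak_integral M G v"
proof -
  have "has_bochner_integral M (\<lambda>x. \<phi> (F x)) y \<longleftrightarrow> has_bochner_integral M (\<lambda>x. \<phi> (G x)) y" for \<phi> :: "_ \<Rightarrow> real" and y
    by (rule has_bochner_integral_cong) (auto simp: assms)
  then show ?thesis by (simp add: has_weak_integral_def)
qed

lemma has_weak_integral_bounded_linear:
  fixes T :: "'b::real_normed_vector \<Rightarrow> 'c::real_normed_vector"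
  assumes "bounded_linear T" "has_weak_integral M F v"
  shows "has_weak_integral M (\<lambda>x. T (F x)) (T v)"
  unfolding has_weak_integral_def
proof (intro allI impI)
  fix \<phi> :: "'c \<Rightarrow> real" assume "bounded_linear \<phi>"
  then have "bounded_linear (\<lambda>x. \<phi> (T x))" using assms(1) by (rule bounded_linear_compose)
  then show "has_bochner_integral M (\<lambda>x. \<phi> (T (F x))) (\<phi> (T v))"
    using assms(2) unfolding has_weak_integral_def by blast
qed

text \<open>Each Fourier coefficient is a scalar function and can be integrated; v is the operator
  with the integrated coefficients, which inherit the bounds C. An arbitrary functional is handled
  by expanding F x in its Fourier series and integrating term by term, with the summable majorant
  given by the weight to the power - 2 n.\<close>

lemma smooth_weak_integral:
  fixes \<theta> :: "real^'n::{finite,linorder}^'n::{finite,linorder}"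
  assumes M: "finite_measure M" and F: "\<And>x. x \<in> space M \<Longrightarrow> F x \<in> smooth_bounded \<theta> C"
    and meas [measurable]: "\<And>k. (\<lambda>x. coef \<theta> (F x) k) \<in> borel_measurable M"
  obtains v where "v \<in> nc_smooth \<theta>" "has_weak_integral M F v"
proof -
  interpret finite_measure M by (rule M)
  have bd: "wt k ^ N * cmod (coef \<theta> (F x) k) \<le> C N" if "x \<in> space M" for x k N
    using F[OF that] by (auto simp: smooth_bounded_def)
  have bd0: "cmod (coef \<theta> (F x) k) \<le> C 0" if "x \<in> space M" for x k
    using bd[OF that, of k 0] by simp
  have int: "integrable M (\<lambda>x. coef \<theta> (F x) k)" for k
    by (rule integrable_const_bound[of _ "C 0"]) (auto intro!: AE_I2 bd0)
  define u where "u k = (\<integral>x. coef \<theta> (F x) k \<partial>M)" for k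
  have w: "0 \<le> wt k" for k :: "int^'n::{finite,linorder}" using wt_ge_1[of k] by simp
  have bdu: "wt k ^ N * cmod (u k) \<le> C N * measure M (space M)" for k N
  proof -
    have "wt k ^ N * cmod (u k) \<le> wt k ^ N * (\<integral>x. cmod (coef \<theta> (F x) k) \<partial>M)"
      unfolding u_def using w by (intro mult_left_mono integral_norm_bound) auto
    also have "\<dots> = (\<integral>x. wt k ^ N * cmod (coef \<theta> (F x) k) \<partial>M)" by simp
    also have "\<dots> \<le> (\<integral>x. C N \<partial>M)"
      by (rule integral_mono) (auto intro!: integrable_mult_right integrable_norm int bd)
    finally show ?thesis by (simp add: mult.commute)
  qed
  then have rd: "rapidly_decaying u" unfolding rapidly_decaying_wt by blast
  define v where "v = sm \<theta> u"
  \<comment> \<open>An enumeration of the lattice, so that the results on term by term integration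
    of series over the naturals apply.\<close>
  define e where "e = from_nat_into (UNIV :: (int^'n::{finite,linorder}) set)"
  have "infinite (UNIV :: (int^'n::{finite,linorder}) set)"
  proof
    assume "finite (UNIV :: (int^'n::{finite,linorder}) set)"
    moreover have "inj (\<lambda>m :: int. (\<chi> i :: 'n. m))" by (auto simp: inj_def vec_eq_iff)
    ultimately have "finite (UNIV :: int set)" using finite_imageD finite_subset subset_UNIV by metis
    then show False by simp
  qed
  then have e: "bij_betw e UNIV UNIV" unfolding e_def using countable_int_vec bij_betw_from_nat_into by blast
  have enum: "(\<lambda>m. w (e m) *\<^sub>C ncU_pow \<theta> (e m)) sums sm \<theta> w" if "absum w" for w
  proof -
    have "((\<lambda>m. w (e m) *\<^sub>C ncU_pow \<theta> (e m)) has_sum sm \<theta> w) UNIV"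
      using sm_has_sum[OF that, of \<theta>] has_sum_reindex_bij_betw[OF e, of "\<lambda>k. w k *\<^sub>C ncU_pow \<theta> k"] by simp
    then show ?thesis by (rule has_sum_imp_sums)
  qed
  have sume: "summable (\<lambda>m. 1 / wt (e m) ^ (2 * CARD('n)))"
  proof -
    have "(\<lambda>m. 1 / wt (e m) ^ (2 * CARD('n))) summable_on UNIV"
      using summable_wt[where 'n = 'n] summable_on_reindex_bij_betw[OF e, of "\<lambda>k. 1 / wt k ^ (2 * CARD('n))"] by simp
    then show ?thesis by (metis has_sum_imp_sums summable_on_def sums_summable)
  qed
  have "has_weak_integral M F v"
    unfolding has_weak_integral_def
  proof (intro allI impI)
    fix \<phi> :: "'n torus_op \<Rightarrow> real" assume \<phi>: "bounded_linear \<phi>"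
    obtain K where K: "0 \<le> K" "\<And>a. norm (\<phi> a) \<le> norm a * K" using bounded_linear.nonneg_bounded[OF \<phi>] by blast
    define \<psi> where "\<psi> k c = \<phi> (c *\<^sub>C ncU_pow \<theta> k)" for k c
    have \<psi>: "bounded_linear (\<psi> k)" for k
      unfolding \<psi>_def by (rule bounded_linear_compose[OF \<phi> bounded_linear_scaleC_left])
    define t where "t m x = \<psi> (e m) (coef \<theta> (F x) (e m))" for m x
    have t_bd: "norm (t m x) \<le> K * C (2 * CARD('n)) * (1 / wt (e m) ^ (2 * CARD('n)))" if x: "x \<in> space M" for m x
    proof -
      have "norm (t m x) \<le> cmod (coef \<theta> (F x) (e m)) * K"
        unfolding t_def \<psi>_def using K(2)[of "coef \<theta> (F x) (e m) *\<^sub>C ncU_pow \<theta> (e m)"]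
          mult_right_mono[OF norm_term_le[of "coef \<theta> (F x) (e m)" \<theta> "e m"] K(1)] by linarith
      moreover have "cmod (coef \<theta> (F x) (e m)) \<le> C (2 * CARD('n)) * (1 / wt (e m) ^ (2 * CARD('n)))"
      proof -
        have "0 < wt (e m) ^ (2 * CARD('n))" using wt_ge_1[of "e m"] by (intro zero_less_power) simp
        then show ?thesis using bd[OF x, of "e m" "2 * CARD('n)"] by (simp add: field_simps)
      qed
      ultimately show ?thesis using K(1) by (smt (verit, best) mult.assoc mult.commute mult_left_mono)
    qed
    have t_int: "integrable M (t m)" for m
      unfolding t_def by (rule integrable_bounded_linear[OF \<psi> int])
    have sn: "AE x in M. summable (\<lambda>m. norm (t m x))"
    proof (rule AE_I2)
      fix x assume "x \<in> space M"
      from t_bd[OF this] show "summable (\<lambda>m. norm (t m x))"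
        by (intro summable_comparison_test'[OF summable_mult[OF sume, of "K * C (2 * CARD('n))"], of 0]) simp
    qed
    have sb: "summable (\<lambda>m. \<integral>x. norm (t m x) \<partial>M)"
    proof (rule summable_comparison_test'[OF summable_mult[OF sume, of "K * C (2 * CARD('n)) * measure M (space M)"], of 0])
      fix m
      have "(\<integral>x. norm (t m x) \<partial>M) \<le> (\<integral>x. K * C (2 * CARD('n)) * (1 / wt (e m) ^ (2 * CARD('n))) \<partial>M)"
        by (rule integral_mono[OF integrable_norm[OF t_int] _ t_bd]) auto
      moreover have "0 \<le> (\<integral>x. norm (t m x) \<partial>M)" by (rule integral_nonneg_AE) simp
      ultimately show "norm (\<integral>x. norm (t m x) \<partial>M) \<le> K * C (2 * CARD('n)) * measure M (space M) * (1 / wt (e m) ^ (2 * CARD('n)))"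
        by (simp add: mult_ac)
    qed
    have eq: "\<phi> (F x) = (\<Sum>m. t m x)" if x: "x \<in> space M" for x
    proof -
      have sx: "F x \<in> nc_smooth \<theta>" using F[OF x] by (simp add: smooth_bounded_def)
      have "(\<lambda>m. t m x) sums \<phi> (sm \<theta> (coef \<theta> (F x)))"
        unfolding t_def \<psi>_def by (rule bounded_linear.sums[OF \<phi> enum[OF nc_smoothD(2)[OF sx]]])
      then show ?thesis using nc_smoothD(3)[OF sx] by (simp add: sums_iff)
    qed
    have "(\<lambda>m. integral\<^sup>L M (t m)) sums (\<integral>x. (\<Sum>m. t m x) \<partial>M)" by (rule sums_integral[OF t_int sn sb])
    moreover have int_t: "integral\<^sup>L M (t m) = \<psi> (e m) (u (e m))" for m
      unfolding t_def u_def by (rule integral_bounded_linear[OF \<psi> int])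
    moreover have "(\<lambda>m. integral\<^sup>L M (t m)) sums \<phi> v"
      unfolding int_t unfolding \<psi>_def v_def by (rule bounded_linear.sums[OF \<phi> enum[OF rapidly_decaying_absum[OF rd]]])
    ultimately have "(\<integral>x. (\<Sum>m. t m x) \<partial>M) = \<phi> v" by (blast intro: sums_unique2)
    moreover have "integrable M (\<lambda>x. \<Sum>m. t m x)" by (rule integrable_suminf[OF t_int sn sb])
    ultimately have "has_bochner_integral M (\<lambda>x. \<Sum>m. t m x) (\<phi> v)" by (simp add: has_bochner_integral_iff)
    moreover have "has_bochner_integral M (\<lambda>x. \<Sum>m. t m x) (\<phi> v) \<longleftrightarrow> has_bochner_integral M (\<lambda>x. \<phi> (F x)) (\<phi> v)"
      by (rule has_bochner_integral_cong) (auto simp: eq)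
    ultimately show "has_bochner_integral M (\<lambda>x. \<phi> (F x)) (\<phi> v)" by blast
  qed
  moreover have "v \<in> nc_smooth \<theta>" unfolding v_def by (rule sm_smooth[OF rd])
  ultimately show ?thesis using that by blast
qed

lemma npow_smooth:
  fixes \<theta> :: "real^'n::{finite,linorder}^'n::{finite,linorder}"
  assumes "0 \<le> r" "r < 1"
  obtains C' where "\<And>b. b \<in> smooth_bounded \<theta> C \<Longrightarrow> norm b \<le> r \<Longrightarrow> x *\<^sub>R npow s b \<in> smooth_bounded \<theta> C'"
proof -
  have "summable (\<lambda>m. \<bar>x * ncoef s m\<bar> * q ^ m)" if "0 \<le> q" "q < 1" for q
    using summable_mult[OF summable_ncoef[OF that], of "\<bar>x\<bar>" s] by (simp add: abs_mult mult.assoc)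
  then obtain C' where C': "\<And>b a. b \<in> smooth_bounded \<theta> C \<Longrightarrow> norm b \<le> r \<Longrightarrow>
      (\<lambda>m. (x * ncoef s m) *\<^sub>R b ^ m) sums a \<Longrightarrow> a \<in> smooth_bounded \<theta> C'"
    using power_series_smooth[OF assms, of "\<lambda>m. x * ncoef s m" \<theta> C] by blast
  show ?thesis
  proof (rule that)
    fix b assume b: "b \<in> smooth_bounded \<theta> C" "norm b \<le> r"
    have "(\<lambda>m. x *\<^sub>R ncoef s m *\<^sub>R b ^ m) sums (x *\<^sub>R npow s b)"
      using b assms by (intro sums_scaleR_right npow_sums) simp
    then show "x *\<^sub>R npow s b \<in> smooth_bounded \<theta> C'" by (intro C'[OF b]) simp
  qed
qed

text \<open>Inverse-closedness for strictly positive elements: the inverse is a Neumann series in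
  the smooth contraction b.\<close>

lemma smooth_inverse:
  assumes "a \<in> nc_smooth \<theta>" "op.coercive d a" "0 < d"
  obtains b where "b \<in> nc_smooth \<theta>" "a * b = 1" "b * a = 1"
proof -
  interpret scaled_operator a "norm a" d using assms by unfold_locales auto
  have "b \<in> nc_smooth \<theta>" unfolding b_def by (intro smooth_diff smooth_1 smooth_scaleR assms)
  then obtain C where "b \<in> smooth_bounded \<theta> C" by (rule smooth_boundedE)
  then have "(1 / norm a) *\<^sub>R npow 1 b \<in> nc_smooth \<theta>"
    using npow_smooth[OF norm_ge_zero norm_b(3), of \<theta> C "1 / norm a" 1]
    by (metis (no_types, lifting) mem_Collect_eq order_refl smooth_bounded_def)
  then show ?thesis using inverse_eq that by blast
qed

section \<open>The spectral density\<close>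

locale riem_metric =
  fixes \<theta> :: "real^'n::{finite,linorder}^'n::{finite,linorder}"
    and g :: "'n torus_op^'n::{finite,linorder}^'n::{finite,linorder}"
  assumes metric: "g \<in> riem_metrics \<theta>"
begin

definition h :: "'n torus_op^'n::{finite,linorder}^'n::{finite,linorder}" where "h = matrix_inv g"

lemma h_inverse: "g ** h = mat 1" "h ** g = mat 1"
  and h_smooth: "h $ i $ j \<in> nc_smooth \<theta>"
  and h_adjoint: "is_adjoint (h $ i $ j) (h $ i $ j)"
proof -
  obtain h' where h': "g ** h' = mat 1" "h' ** g = mat 1"
    "\<forall>i j. h' $ i $ j \<in> nc_smooth \<theta> \<and> is_adjoint (h' $ i $ j) (h' $ i $ j)"
    using metric unfolding riem_metrics_def by blast
  have "h = h'" unfolding h_def using h'(1,2) by (rule matrix_inv_eqI)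
  then show "g ** h = mat 1" "h ** g = mat 1" "h $ i $ j \<in> nc_smooth \<theta>" "is_adjoint (h $ i $ j) (h $ i $ j)"
    using h' by auto
qed

lemma Mat_inverse_h: "Mat g * Mat h = 1" "Mat h * Mat g = 1"
  using h_inverse by (simp_all add: mat_of_inject[symmetric] times_torus_mat.rep_eq one_torus_mat.rep_eq Mat_inverse)

lemma coercive_g: "mat.coercive 0 (Mat g)"
  using metric by (intro mat_positive_coercive) (simp add: riem_metrics_def)

text \<open>Bounds d and c for |\<omega>|_g^2 on the unit sphere. The lower one comes from
  \<open>coercive_inverse\<close>, as h is the inverse of g; the upper one is the sum of the norms
  of the entries of h.\<close>

definition d where "d = 1 / norm (Mat g)"
definition c where "c = entry_sum h"

lemma d_pos: "0 < d"
proof -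
  have "Mat g \<noteq> 0" using Mat_inverse_h(1) by auto
  then show ?thesis by (simp add: d_def)
qed

lemma coercive_h: "mat.coercive d (Mat h)"
  unfolding d_def by (rule mat.coercive_inverse[OF coercive_g Mat_inverse_h])

lemma coercive_Q: "op.coercive (d * (norm \<xi>)\<^sup>2) (quad_form h \<xi>)"
  using coercive_quad_form[OF coercive_h, of \<xi>] by (simp add: Mat_inverse)

lemma scaled_Q: "norm \<omega> = 1 \<Longrightarrow> scaled_operator (quad_form h \<omega>) c d"
  using coercive_Q[of \<omega>] d_pos norm_quad_form_le[of h \<omega>] by unfold_locales (simp_all add: c_def)

definition b :: "real^'n::{finite,linorder} \<Rightarrow> 'n torus_op" where
  "b \<omega> = 1 - (1 / c) *\<^sub>R quad_form h \<omega>"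

lemma b_eq: "norm \<omega> = 1 \<Longrightarrow> scaled_operator.b (quad_form h \<omega>) c = b \<omega>"
  by (simp add: scaled_operator.b_def[OF scaled_Q] b_def)

definition r where "r = 1 - d / c"

lemma exists_unit: "\<exists>\<omega> :: real^'n::{finite,linorder}. norm \<omega> = 1"
  using vector_choose_size[of 1] by auto

lemma c_pos: "0 < c" and r_bounds: "0 \<le> r" "r < 1"
proof -
  obtain \<omega> :: "real^'n::{finite,linorder}" where w: "norm \<omega> = 1" using exists_unit by blast
  note so = scaled_operator.c_pos[OF scaled_Q[OF w]] scaled_operator.d_le[OF scaled_Q[OF w]]
  then show "0 < c" "0 \<le> r" "r < 1" using d_pos by (simp_all add: r_def)
qed

lemma norm_b: "norm \<omega> = 1 \<Longrightarrow> norm (b \<omega>) \<le> r" "norm \<omega> = 1 \<Longrightarrow> norm (b \<omega>) < 1"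
  using scaled_operator.norm_b[OF scaled_Q, of \<omega>] by (auto simp: b_eq r_def)

lemma covec_norm_eq: "covec_norm g \<xi> = op_sqrt (quad_form h \<xi>)"
  by (simp add: covec_norm_def quad_form_def h_def)

text \<open>On the unit sphere this is |\<omega>|_g to the power - n, see
  \<open>inv_covec_norm\<close>. The series is preferred to the operator power because its
  coefficients are visibly measurable in \<omega>.\<close>

definition F :: "real^'n::{finite,linorder} \<Rightarrow> 'n torus_op" where
  "F \<omega> = c powr (- real CARD('n) / 2) *\<^sub>R npow (real CARD('n) / 2) (b \<omega>)"

lemma inv_covec_norm: "norm \<omega> = 1 \<Longrightarrow> inv_el (covec_norm g \<omega>) ^ CARD('n) = F \<omega>"
  unfolding covec_norm_eq F_def using scaled_operator.inv_sqrt_power[OF scaled_Q] by (simp add: b_eq)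

lemma covec_norm_square: "(covec_norm g \<xi>)\<^sup>2 = quad_form h \<xi>"
proof (cases "\<xi> = 0")
  case True
  then show ?thesis by (simp add: covec_norm_eq quad_form_def op_sqrt_0)
next
  case False
  interpret Q: scaled_operator "quad_form h \<xi>" "norm (quad_form h \<xi>)" "d * (norm \<xi>)\<^sup>2"
    using coercive_Q d_pos False by unfold_locales auto
  show ?thesis by (simp add: covec_norm_eq power2_eq_square Q.op_sqrt_square)
qed

lemma b_smooth: obtains C where "\<And>\<omega>. norm \<omega> = 1 \<Longrightarrow> b \<omega> \<in> smooth_bounded \<theta> C"
proof -
  have "\<forall>i j. \<exists>C. h $ i $ j \<in> smooth_bounded \<theta> C" using smooth_boundedE[OF h_smooth] by metis
  then obtain C where C: "\<And>i j. h $ i $ j \<in> smooth_bounded \<theta> (C i j)" by metis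
  obtain C1 where C1: "1 \<in> smooth_bounded \<theta> C1" using smooth_boundedE[OF smooth_1] by blast
  define D where "D N = C1 N + (1 / c) * (\<Sum>i\<in>UNIV. \<Sum>j\<in>UNIV. C i j N)" for N
  show ?thesis
  proof (rule that)
    fix \<omega> :: "real^'n::{finite,linorder}" assume w: "norm \<omega> = 1"
    have "b \<omega> \<in> nc_smooth \<theta>"
      unfolding b_def quad_form_def by (intro smooth_diff smooth_1 smooth_scaleR smooth_sum h_smooth)
    moreover have "wt k ^ N * cmod (coef \<theta> (b \<omega>) k) \<le> D N" for N k
    proof -
      have wt: "0 \<le> wt k ^ N" using wt_ge_1[of k] by (intro zero_le_power) simp
      have co: "coef \<theta> (b \<omega>) k = coef \<theta> 1 k - (1 / c) *\<^sub>R (\<Sum>i\<in>UNIV. \<Sum>j\<in>UNIV. (\<omega> $ i * \<omega> $ j) *\<^sub>R coef \<theta> (h $ i $ j) k)"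
        unfolding b_def quad_form_def
        by (simp add: coef_simps linear_sum[OF bounded_linear.linear[OF bounded_linear_coef]])
      have "cmod (\<Sum>i\<in>UNIV. \<Sum>j\<in>UNIV. (\<omega> $ i * \<omega> $ j) *\<^sub>R coef \<theta> (h $ i $ j) k) \<le>
          (\<Sum>i\<in>UNIV. \<Sum>j\<in>UNIV. cmod (coef \<theta> (h $ i $ j) k))"
      proof (intro sum_norm_le)
        fix i j
        have "\<bar>\<omega> $ i\<bar> * \<bar>\<omega> $ j\<bar> \<le> 1 * 1"
          using component_le_norm_cart[of \<omega>] w by (intro mult_mono) auto
        then show "norm ((\<omega> $ i * \<omega> $ j) *\<^sub>R coef \<theta> (h $ i $ j) k) \<le> cmod (coef \<theta> (h $ i $ j) k)"
          by (simp add: abs_mult mult_left_le_one_le)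
      qed
      then have "cmod (coef \<theta> (b \<omega>) k) \<le> cmod (coef \<theta> 1 k) + (1 / c) * (\<Sum>i\<in>UNIV. \<Sum>j\<in>UNIV. cmod (coef \<theta> (h $ i $ j) k))"
        unfolding co using c_pos
        by (intro order_trans[OF norm_triangle_ineq4] add_left_mono) (simp add: divide_right_mono)
      from mult_left_mono[OF this wt]
      have "wt k ^ N * cmod (coef \<theta> (b \<omega>) k) \<le> wt k ^ N * cmod (coef \<theta> 1 k) +
          (1 / c) * (\<Sum>i\<in>UNIV. \<Sum>j\<in>UNIV. wt k ^ N * cmod (coef \<theta> (h $ i $ j) k))"
        by (simp add: distrib_left sum_distrib_left)
      also have "\<dots> \<le> D N"
        unfolding D_def using c_pos C C1
        by (intro add_mono mult_left_mono sum_mono) (auto simp: smooth_bounded_def)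
      finally show ?thesis .
    qed
    ultimately show "b \<omega> \<in> smooth_bounded \<theta> D" by (simp add: smooth_bounded_def)
  qed
qed

lemma continuous_b_power: "continuous_on UNIV (\<lambda>\<omega>. b \<omega> ^ m)"
  unfolding b_def by (intro continuous_intros continuous_quad_form)

lemma F_sums:
  assumes "norm \<omega> = 1" "bounded_linear \<phi>"
  shows "(\<lambda>m. c powr (- real CARD('n) / 2) *\<^sub>R ncoef (real CARD('n) / 2) m *\<^sub>R \<phi> (b \<omega> ^ m)) sums \<phi> (F \<omega>)"
  using bounded_linear.sums[OF assms(2) sums_scaleR_right[OF npow_sums[OF norm_b(2)[OF assms(1)]],
        of "c powr (- real CARD('n) / 2)" "real CARD('n) / 2"]]
  by (simp add: F_def linear_simps[OF assms(2)])

lemma F_integral: obtains v where "v \<in> nc_smooth \<theta>" "has_weak_integral sphere_measure F v"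
proof -
  obtain C where C: "\<And>\<omega>. norm \<omega> = 1 \<Longrightarrow> b \<omega> \<in> smooth_bounded \<theta> C" using b_smooth by blast
  obtain C' where C': "\<And>b. b \<in> smooth_bounded \<theta> C \<Longrightarrow> norm b \<le> r \<Longrightarrow>
      c powr (- real CARD('n) / 2) *\<^sub>R npow (real CARD('n) / 2) b \<in> smooth_bounded \<theta> C'"
    using npow_smooth[OF r_bounds, of \<theta> C "c powr (- real CARD('n) / 2)" "real CARD('n) / 2"] by blast
  show ?thesis
  proof (rule smooth_weak_integral[OF finite_measure_sphere])
    show "F \<omega> \<in> smooth_bounded \<theta> C'" if "\<omega> \<in> space sphere_measure" for \<omega>
      unfolding F_def using that by (intro C' C norm_b) (auto simp: space_sphere_measure)
    show "(\<lambda>\<omega>. coef \<theta> (F \<omega>) k) \<in> borel_measurable sphere_measure" for k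
    proof -
      have [measurable]: "(\<lambda>\<omega>. coef \<theta> (b \<omega> ^ m) k) \<in> borel_measurable borel" for m
        by (intro borel_measurable_continuous_onI continuous_intros continuous_b_power
            continuous_on_compose2[OF linear_continuous_on[OF bounded_linear_coef]]) auto
      have "(\<lambda>\<omega>. \<Sum>m. c powr (- real CARD('n) / 2) *\<^sub>R ncoef (real CARD('n) / 2) m *\<^sub>R coef \<theta> (b \<omega> ^ m) k) \<in> borel_measurable borel"
        by measurable
      from measurable_sphere_measure[OF this]
      show ?thesis
        by (rule measurable_cong[THEN iffD1, rotated])
           (use F_sums[OF _ bounded_linear_coef] in \<open>auto simp: space_sphere_measure sums_iff\<close>)
    qed
  qed (use that in blast)
qed

definition area where "area = sphere_area TYPE(real^'n::{finite,linorder})"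

lemma area_pos: "0 < area"
  unfolding area_def by (rule emeasure_sphere_measure_space(2))

lemma density_integral: "has_weak_integral sphere_measure F (area *\<^sub>R spectral_density g)"
  and density_smooth: "spectral_density g \<in> nc_smooth \<theta>"
proof -
  obtain v where v: "v \<in> nc_smooth \<theta>" "has_weak_integral sphere_measure F v" by (rule F_integral)
  have "has_weak_integral sphere_measure (\<lambda>\<omega>. inv_el (covec_norm g \<omega>) ^ CARD('n)) v"
    using v(2) has_weak_integral_cong[of sphere_measure F "\<lambda>\<omega>. inv_el (covec_norm g \<omega>) ^ CARD('n)" v]
    by (simp add: space_sphere_measure inv_covec_norm)
  then have dens: "spectral_density g = (1 / area) *\<^sub>R v"
    unfolding spectral_density_def by (simp add: weak_integral_eqI area_def sphere_area_def inverse_eq_divide)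
  show "has_weak_integral sphere_measure F (area *\<^sub>R spectral_density g)"
    using v(2) area_pos by (simp add: dens)
  show "spectral_density g \<in> nc_smooth \<theta>" unfolding dens by (rule smooth_scaleR[OF v(1)])
qed

lemma F_functional:
  assumes "bounded_linear \<phi>"
  shows "integrable sphere_measure (\<lambda>\<omega>. \<phi> (F \<omega>))" "(\<integral>\<omega>. \<phi> (F \<omega>) \<partial>sphere_measure) = area * \<phi> (spectral_density g)"
  using density_integral assms unfolding has_weak_integral_def
  by (auto simp: has_bochner_integral_iff linear_simps)

text \<open>The values F \<omega> share a lower bound e, and testing the weak integral on the
  functionals a to (a f, f) shows that the average keeps it. Symmetry is obtained in the same
  way.\<close>

lemma density_coercive: obtains e where "0 < e" "op.coercive e (spectral_density g)"
proof -
  obtain e0 where e0: "0 < e0" "\<And>b :: 'n torus_op. op.sa b \<Longrightarrow> norm b \<le> r \<Longrightarrow> op.coercive e0 (npow (real CARD('n) / 2) b)"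
    using op.coercive_npow_uniform[OF r_bounds(2), of "real CARD('n) / 2"] by blast
  define e where "e = c powr (- real CARD('n) / 2) * e0"
  have e: "0 < e" using e0 c_pos by (simp add: e_def)
  have sab: "op.sa (b \<omega>)" if "norm \<omega> = 1" for \<omega>
    using scaled_operator.sa_b[OF scaled_Q[OF that]] by (simp add: b_eq that)
  have F: "op.sa (F \<omega>)" "e * (norm f)\<^sup>2 \<le> inner (op_apply (F \<omega>) f) f" if w: "norm \<omega> = 1"
    for \<omega> and f :: "'n torus_L2"
  proof -
    have co: "op.coercive e0 (npow (real CARD('n) / 2) (b \<omega>))" using e0(2) sab[OF w] norm_b(1)[OF w] by blast
    show "op.sa (F \<omega>)" unfolding F_def by (intro op.sa_scaleR op.coerciveD(1)[OF co])
    show "e * (norm f)\<^sup>2 \<le> inner (op_apply (F \<omega>) f) f"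
      using mult_left_mono[OF op.coerciveD(2)[OF co, of f], of "c powr (- real CARD('n) / 2)"]
      by (simp add: F_def op_apply_simps e_def mult.assoc)
  qed
  have bl: "bounded_linear (\<lambda>a :: 'n torus_op. inner (op_apply a f) f')" for f f'
    by (rule bounded_linear_compose[OF bounded_linear_inner_left op.bounded_linear_act])
  have "op.coercive e (spectral_density g)"
    unfolding op.coercive_def op.sa_def
  proof (intro conjI allI)
    fix f f' :: "'n torus_L2"
    have "area * inner (op_apply (spectral_density g) f) f' = (\<integral>\<omega>. inner (op_apply (F \<omega>) f) f' \<partial>sphere_measure)"
      by (rule F_functional(2)[OF bl, symmetric])
    also have "\<dots> = (\<integral>\<omega>. inner (op_apply (F \<omega>) f') f \<partial>sphere_measure)"
      by (rule Bochner_Integration.integral_cong)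
         (use F(1) in \<open>auto simp: space_sphere_measure op.sa_def inner_commute\<close>)
    also have "\<dots> = area * inner (op_apply (spectral_density g) f') f"
      by (rule F_functional(2)[OF bl])
    finally show "inner (op_apply (spectral_density g) f) f' = inner f (op_apply (spectral_density g) f')"
      using area_pos by (simp add: inner_commute)
  next
    fix f :: "'n torus_L2"
    have "e * (norm f)\<^sup>2 * area = (\<integral>\<omega>. e * (norm f)\<^sup>2 \<partial>(sphere_measure :: (real^'n::{finite,linorder}) measure))"
      by (simp add: space_sphere_measure area_def sphere_area_def)
    also have "\<dots> \<le> (\<integral>\<omega>. inner (op_apply (F \<omega>) f) f \<partial>sphere_measure)"
      by (rule integral_mono)
         (auto simp: space_sphere_measure F finite_measure.integrable_const[OF finite_measure_sphere] intro!: F_functional(1)[OF bl])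
    also have "\<dots> = area * inner (op_apply (spectral_density g) f) f" by (rule F_functional(2)[OF bl])
    finally show "e * (norm f)\<^sup>2 \<le> inner (op_apply (spectral_density g) f) f"
      using area_pos by (simp add: mult.commute)
  qed
  then show ?thesis using e that by blast
qed

lemma density_positive: "spectral_density g \<in> nc_smooth_pos \<theta>"
proof -
  obtain e where e: "0 < e" "op.coercive e (spectral_density g)" by (rule density_coercive)
  obtain b where "b \<in> nc_smooth \<theta>" "spectral_density g * b = 1" "b * spectral_density g = 1"
    using smooth_inverse[OF density_smooth e(2,1)] by blast
  then show ?thesis
    using density_smooth op.coercive_mono[OF e(2), of 0] e(1) by (auto simp: nc_smooth_pos_def op_positive_iff)
qed

text \<open>For \<xi> \<noteq> 0 the exponent is - t + t b(\<omega>) with t = c |\<xi>|^2 and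
  \<omega> the direction of \<xi>. As the scalar commutes with b, the exponential is the sum of
  \<open>gauss_term c m \<xi>\<close> times b(\<omega>)^m, and \<open>gauss_series_integral\<close>
  with A m = \<phi> (b^m) turns it into the series of F. The powers of c cancel and leave \<pi> to
  the power n / 2.\<close>

lemma gaussian_integral:
  "has_weak_integral lborel (\<lambda>\<xi>. exp (- quad_form h \<xi>)) (pi powr (real CARD('n) / 2) *\<^sub>R spectral_density g)"
  unfolding has_weak_integral_def
proof (intro allI impI)
  fix \<phi> :: "'n torus_op \<Rightarrow> real" assume \<phi>: "bounded_linear \<phi>"
  define s where "s = real CARD('n) / 2"
  obtain K where K: "0 \<le> K" "\<And>a. norm (\<phi> a) \<le> norm a * K" using bounded_linear.nonneg_bounded[OF \<phi>] by blast
  have meas: "(\<lambda>\<omega>. \<phi> (b \<omega> ^ m)) \<in> borel_measurable borel" for m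
    by (intro borel_measurable_continuous_onI continuous_on_compose2[OF linear_continuous_on[OF \<phi>] continuous_b_power]) auto
  have bd: "\<bar>\<phi> (b \<omega> ^ m)\<bar> \<le> K * r ^ m" if "norm \<omega> = 1" for \<omega> m
    using K(2)[of "b \<omega> ^ m"] mult_right_mono[OF norm_power_le[OF norm_b(1)[OF that], of m] K(1)] by (simp add: mult.commute)
  from gauss_series_integral[OF meas bd r_bounds c_pos]
  have I: "has_bochner_integral lborel (\<lambda>\<xi>. \<Sum>m. gauss_term c m \<xi> * \<phi> (b (sgn \<xi>) ^ m))
      ((pi / c) powr s / area * (\<integral>\<omega>. (\<Sum>m. ncoef s m * \<phi> (b \<omega> ^ m)) \<partial>sphere_measure))"
    by (simp add: s_def area_def)
  have cs: "c powr s * c powr (- s) = 1" using c_pos by (simp add: powr_minus)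
  have "(\<Sum>m. ncoef s m * \<phi> (b \<omega> ^ m)) = c powr s * \<phi> (F \<omega>)" if w: "norm \<omega> = 1" for \<omega>
  proof -
    have "(\<lambda>m. c powr s * (c powr (- s) * (ncoef s m * \<phi> (b \<omega> ^ m)))) sums (c powr s * \<phi> (F \<omega>))"
      using F_sums[OF w \<phi>] by (intro sums_mult) (simp add: s_def)
    then show ?thesis by (simp add: cs sums_iff flip: mult.assoc)
  qed
  then have "(\<integral>\<omega>. (\<Sum>m. ncoef s m * \<phi> (b \<omega> ^ m)) \<partial>sphere_measure) = (\<integral>\<omega>. c powr s * \<phi> (F \<omega>) \<partial>sphere_measure)"
    by (intro Bochner_Integration.integral_cong) (auto simp: space_sphere_measure)
  also have "\<dots> = c powr s * (area * \<phi> (spectral_density g))" using F_functional[OF \<phi>] by simp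
  finally have val: "(pi / c) powr s / area * (\<integral>\<omega>. (\<Sum>m. ncoef s m * \<phi> (b \<omega> ^ m)) \<partial>sphere_measure) =
      pi powr s * \<phi> (spectral_density g)"
    using area_pos c_pos by (simp add: powr_divide)
  have "\<phi> (exp (- quad_form h \<xi>)) = (\<Sum>m. gauss_term c m \<xi> * \<phi> (b (sgn \<xi>) ^ m))" if "\<xi> \<noteq> 0" for \<xi>
  proof -
    let ?w = "sgn \<xi>" and ?t = "c * (norm \<xi>)\<^sup>2"
    have "\<xi> = norm \<xi> *\<^sub>R ?w" using that by (simp add: sgn_div_norm)
    then have "quad_form h \<xi> = (norm \<xi>)\<^sup>2 *\<^sub>R quad_form h ?w" using quad_form_scaleR[of h "norm \<xi>" ?w] by simp
    also have "quad_form h ?w = c *\<^sub>R (1 - b ?w)" using c_pos by (simp add: b_def)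
    finally have "- quad_form h \<xi> = (- ?t) *\<^sub>R 1 + ?t *\<^sub>R b ?w" by (simp add: algebra_simps)
    then have "exp (- quad_form h \<xi>) = exp ((- ?t) *\<^sub>R 1) * exp (?t *\<^sub>R b ?w)"
      by (simp only:) (rule exp_add_commuting, simp)
    also have "exp ((- ?t) *\<^sub>R (1 :: 'n torus_op)) = exp (- ?t) *\<^sub>R 1"
      using exp_of_real[of "- ?t", where 'a = "'n torus_op"] by (simp add: of_real_def)
    finally have ex: "exp (- quad_form h \<xi>) = exp (- ?t) *\<^sub>R exp (?t *\<^sub>R b ?w)" by simp
    have "(\<lambda>m. exp (- ?t) *\<^sub>R ((?t *\<^sub>R b ?w) ^ m /\<^sub>R fact m)) sums exp (- quad_form h \<xi>)"
      unfolding ex by (intro sums_scaleR_right exp_converges)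
    moreover have "(x *\<^sub>R a) ^ m = x ^ m *\<^sub>R a ^ m" for x m and a :: "'n torus_op"
      by (induction m) (simp_all add: mult.commute)
    ultimately have "(\<lambda>m. gauss_term c m \<xi> *\<^sub>R b ?w ^ m) sums exp (- quad_form h \<xi>)"
      by (simp add: gauss_term_def divide_inverse mult_ac)
    from bounded_linear.sums[OF \<phi> this] show ?thesis by (simp add: linear_simps[OF \<phi>] sums_iff)
  qed
  then have ae: "AE \<xi> in lborel. (\<Sum>m. gauss_term c m \<xi> * \<phi> (b (sgn \<xi>) ^ m)) = \<phi> (exp (- quad_form h \<xi>))"
    by (intro eventually_mono[OF AE_lborel_singleton[of 0]]) auto
  have m2: "(\<lambda>\<xi>. \<phi> (exp (- quad_form h \<xi>))) \<in> borel_measurable lborel"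
  proof -
    have [measurable]: "(\<lambda>\<xi>. \<phi> ((- quad_form h \<xi>) ^ m /\<^sub>R fact m)) \<in> borel_measurable borel" for m
      by (intro borel_measurable_continuous_onI continuous_on_compose2[OF linear_continuous_on[OF \<phi>]]
          continuous_intros continuous_quad_form) auto
    have "(\<lambda>\<xi>. \<Sum>m. \<phi> ((- quad_form h \<xi>) ^ m /\<^sub>R fact m)) \<in> borel_measurable lborel"
      by measurable
    moreover have "(\<Sum>m. \<phi> ((- quad_form h \<xi>) ^ m /\<^sub>R fact m)) = \<phi> (exp (- quad_form h \<xi>))" for \<xi>
      using bounded_linear.sums[OF \<phi> exp_converges[of "- quad_form h \<xi>"]] by (simp add: sums_iff)
    ultimately show ?thesis by simp
  qed
  have m1: "(\<lambda>\<xi>. \<Sum>m. gauss_term c m \<xi> * \<phi> (b (sgn \<xi>) ^ m)) \<in> borel_measurable lborel"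
    using I by (auto simp: has_bochner_integral_iff intro: borel_measurable_integrable)
  show "has_bochner_integral lborel (\<lambda>\<xi>. \<phi> (exp (- quad_form h \<xi>))) (\<phi> (pi powr (real CARD('n) / 2) *\<^sub>R spectral_density g))"
    using I has_bochner_integral_cong_AE[OF m1 m2 ae] unfolding val by (simp add: linear_simps[OF \<phi>] s_def)
qed

lemma density_eq_gaussian:
  "spectral_density g = pi powr (- (real CARD('n) / 2)) *\<^sub>R weak_integral lborel (\<lambda>\<xi>. exp (- (covec_norm g \<xi>)\<^sup>2))"
  unfolding covec_norm_square weak_integral_eqI[OF gaussian_integral]
  by (simp flip: powr_add)

end

section \<open>Conformal changes of the metric\<close>

lemma inverse_commute:
  fixes a b x :: "'a::monoid_mult"
  assumes "a * b = 1" "b * a = 1" "a * x = x * a"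
  shows "b * x = x * b"
proof -
  have "b * x = b * (x * a) * b" by (simp only: mult.assoc assms(1) mult_1_right)
  also have "\<dots> = (b * a) * x * b" by (simp only: mult.assoc flip: assms(3))
  finally show ?thesis by (simp add: assms(2))
qed

lemma power_mult_commuting:
  fixes a b :: "'a::monoid_mult"
  assumes "b * a = a * b"
  shows "(a * b) ^ m = a ^ m * b ^ m"
proof (induction m)
  case (Suc m)
  have "(a * b) ^ Suc m = a * (b * a ^ m) * b ^ m" by (simp add: Suc mult.assoc)
  also have "\<dots> = a ^ Suc m * b ^ Suc m" by (simp add: power_commute[OF assms] mult.assoc)
  finally show ?case .
qed simp

text \<open>With k' the inverse of k, the new inverse metric is k'^2 h. Its square root on a
  covector is k' |\<omega>|_g, because this product squares to the right operator and is positive.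
  Hence the integrand is multiplied by k^n pointwise, and a bounded linear map may be taken out of
  the weak integral.\<close>

lemma (in riem_metric) density_conformal:
  assumes k: "k \<in> nc_smooth_pos \<theta>" and kg: "\<And>i j. k * g $ i $ j = g $ i $ j * k"
  shows "spectral_density (\<chi> i j. k\<^sup>2 * g $ i $ j) = k ^ CARD('n) * spectral_density g"
proof -
  obtain k' where k': "k * k' = 1" "k' * k = 1" using k by (auto simp: nc_smooth_pos_def)
  have kpos: "op.coercive 0 k" using k by (simp add: nc_smooth_pos_def op_positive_iff)
  have "k \<noteq> 0" using k' by auto
  then have k'pos: "op.coercive (1 / norm k) k'" "0 < 1 / norm k"
    using op.coercive_inverse[OF kpos k'] by auto
  interpret k': scaled_operator k' "norm k'" "1 / norm k" using k'pos by unfold_locales auto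
  have kh: "k * h $ i $ j = h $ i $ j * k" for i j
  proof -
    \<comment> \<open>Commuting with every entry of g means that the diagonal matrix K commutes with
      g, hence with its inverse.\<close>
    define K where "K = (Mat (\<chi> i j. if i = j then k else 0) :: ('n, 'n) torus_mat)"
    have Kl: "mat_of (K * A) $ i $ j = k * mat_of A $ i $ j" for A i j
      unfolding entry_mult by (simp add: K_def Mat_inverse if_distrib[of "\<lambda>t. t * _"] cong: if_cong)
    have Kr: "mat_of (A * K) $ i $ j = mat_of A $ i $ j * k" for A i j
      unfolding entry_mult by (simp add: K_def Mat_inverse if_distrib[of "\<lambda>t. _ * t"] cong: if_cong)
    have "K * Mat g = Mat g * K" by (rule mat_of_eqI) (simp add: Kl Kr Mat_inverse kg)
    then have "Mat h * K = K * Mat h" by (intro inverse_commute[OF Mat_inverse_h]) simp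
    then show ?thesis using Kl[of "Mat h" i j] Kr[of "Mat h" i j] by (simp add: Mat_inverse)
  qed
  have k'comm: "k' * x = x * k'" if "k * x = x * k" for x
    by (rule inverse_commute[OF k' that])
  define g2 where "g2 = (\<chi> i j. k\<^sup>2 * g $ i $ j)"
  define h2 where "h2 = (\<chi> i j. k' * k' * h $ i $ j)"
  have kk: "k\<^sup>2 * (k' * k') = 1" "(k' * k') * k\<^sup>2 = 1"
  proof -
    have "k\<^sup>2 * (k' * k') = k * (k * k') * k'" "(k' * k') * k\<^sup>2 = k' * (k' * k) * k"
      by (simp_all only: power2_eq_square mult.assoc)
    then show "k\<^sup>2 * (k' * k') = 1" "(k' * k') * k\<^sup>2 = 1" by (simp_all add: k')
  qed
  have "g2 ** h2 = mat 1"
  proof -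
    have "(g2 ** h2) $ i $ j = (g ** h) $ i $ j" for i j
    proof -
      have "k\<^sup>2 * g $ i $ l * (k' * k' * h $ l $ j) = g $ i $ l * h $ l $ j" for l
      proof -
        have "g $ i $ l * (k' * z) = k' * (g $ i $ l * z)" for z
          using k'comm[OF kg, of i l] by (simp add: mult.assoc[symmetric])
        then have "k\<^sup>2 * g $ i $ l * (k' * k' * h $ l $ j) = (k\<^sup>2 * (k' * k')) * (g $ i $ l * h $ l $ j)"
          by (simp only: mult.assoc)
        then show ?thesis by (simp add: kk)
      qed
      then show ?thesis by (simp add: matrix_matrix_mult_def g2_def h2_def)
    qed
    then show ?thesis using h_inverse by (simp add: vec_eq_iff)
  qed
  moreover have "h2 ** g2 = mat 1"
  proof -
    have "(h2 ** g2) $ i $ j = (h ** g) $ i $ j" for i j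
    proof -
      have "k' * k' * h $ i $ l * (k\<^sup>2 * g $ l $ j) = h $ i $ l * g $ l $ j" for l
      proof -
        have "h $ i $ l * (k * z) = k * (h $ i $ l * z)" for z
          using kh[of i l] by (simp add: mult.assoc[symmetric])
        then have "k' * k' * h $ i $ l * (k\<^sup>2 * g $ l $ j) = ((k' * k') * k\<^sup>2) * (h $ i $ l * g $ l $ j)"
          by (simp only: mult.assoc power2_eq_square)
        then show ?thesis by (simp add: kk)
      qed
      then show ?thesis by (simp add: matrix_matrix_mult_def g2_def h2_def)
    qed
    then show ?thesis using h_inverse by (simp add: vec_eq_iff)
  qed
  ultimately have h2: "matrix_inv g2 = h2" by (rule matrix_inv_eqI)
  have "inv_el (covec_norm g2 \<omega>) ^ CARD('n) = k ^ CARD('n) * F \<omega>" if w: "norm \<omega> = 1" for \<omega>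
  proof -
    interpret Q: scaled_operator "quad_form h \<omega>" c d by (rule scaled_Q[OF w])
    define s where "s = op_sqrt (quad_form h \<omega>)"
    define s' where "s' = (1 / sqrt c) *\<^sub>R npow (1 / 2) (b \<omega>)"
    have ss': "s * s' = 1" "s' * s = 1"
      unfolding s_def s'_def Q.op_sqrt_eq b_eq[OF w] using c_pos norm_b(2)[OF w]
      by (simp_all add: npow_mult)
    have Q2: "quad_form h2 \<omega> = k' * k' * quad_form h \<omega>"
      by (simp add: quad_form_def h2_def sum_distrib_left)
    have kQ: "k * quad_form h \<omega> = quad_form h \<omega> * k"
      unfolding quad_form_def by (simp add: sum_distrib_left sum_distrib_right kh)
    then have ks: "k * s = s * k" unfolding s_def Q.op_sqrt_eq by (rule Q.commute_sqrt)
    have k's: "k' * s = s * k'" and k'Q: "k' * quad_form h \<omega> = quad_form h \<omega> * k'"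
      by (rule k'comm, fact)+
    \<comment> \<open>The product k' s is written as m m s with m the square root of k', so that
      \<open>coercive_mult\<close> shows its positivity.\<close>
    define m where "m = op_sqrt k'"
    have mm: "m * m = k'" unfolding m_def by (rule k'.op_sqrt_square)
    have "op.sa m"
      unfolding m_def k'.op_sqrt_eq by (intro op.sa_scaleR op.sa_npow k'.sa_b k'.norm_b)
    moreover have "s * m = m * s"
      unfolding m_def k'.op_sqrt_eq by (rule k'.commute_sqrt) (simp add: k's)
    moreover have "op.coercive 0 s"
    proof -
      obtain e where "0 < e" "op.coercive e s" unfolding s_def Q.op_sqrt_eq using Q.sqrt_coercive by blast
      then show ?thesis by (auto intro: op.coercive_mono)
    qed
    ultimately have pos: "op.coercive 0 (k' * s)"
      using op.coercive_mult[of s m] by (simp add: mm)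
    have sq: "(k' * s) * (k' * s) = quad_form h2 \<omega>"
    proof -
      have "s * (k' * z) = k' * (s * z)" for z using k's by (simp add: mult.assoc[symmetric])
      then have "(k' * s) * (k' * s) = k' * k' * (s * s)" by (simp only: mult.assoc)
      then show ?thesis unfolding Q2 s_def Q.op_sqrt_square .
    qed
    have Q2pos: "op.coercive 0 (quad_form h2 \<omega>)"
      unfolding Q2 using op.coercive_mono[OF Q.coercive, of 0] d_pos k'pos op.coerciveD(1) k'Q
      by (intro op.coercive_mult) auto
    have inv: "(k' * s) * (s' * k) = 1" "(s' * k) * (k' * s) = 1"
    proof -
      have "(k' * s) * (s' * k) = k' * (s * s') * k" "(s' * k) * (k' * s) = s' * (k * k') * s"
        by (simp_all only: mult.assoc)
      then show "(k' * s) * (s' * k) = 1" "(s' * k) * (k' * s) = 1" by (simp_all add: ss' k')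
    qed
    let ?y = "(s' * k) * (s' * k)"
    have inv2: "quad_form h2 \<omega> * ?y = 1" "?y * quad_form h2 \<omega> = 1"
    proof -
      have "((k' * s) * (k' * s)) * ?y = (k' * s) * ((k' * s) * (s' * k)) * (s' * k)"
        "?y * ((k' * s) * (k' * s)) = (s' * k) * ((s' * k) * (k' * s)) * (k' * s)"
        by (simp_all only: mult.assoc)
      then show "quad_form h2 \<omega> * ?y = 1" "?y * quad_form h2 \<omega> = 1"
        unfolding sq[symmetric] inv by (simp_all add: inv)
    qed
    \<comment> \<open>\<open>coercive_inverse\<close> is used twice: first for the positivity of the
      inverse ?y, then back to obtain a strictly positive lower bound for the form itself.\<close>
    have "op.coercive 0 ?y" by (rule op.coercive_mono[OF op.coercive_inverse[OF Q2pos inv2]]) simp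
    then have co: "op.coercive (1 / norm ?y) (quad_form h2 \<omega>)" by (rule op.coercive_inverse[OF _ inv2(2,1)])
    have nz: "?y \<noteq> 0" using inv2(1) by auto
    interpret Q2: scaled_operator "quad_form h2 \<omega>" "norm (quad_form h2 \<omega>)" "1 / norm ((s' * k) * (s' * k))"
      using co nz by unfold_locales (auto simp: zero_less_divide_iff)
    have "covec_norm g2 \<omega> = k' * s"
      unfolding covec_norm_def h2 using Q2.op_sqrt_unique[OF pos sq] by (simp add: quad_form_def)
    then have "inv_el (covec_norm g2 \<omega>) = s' * k" using inv by (simp add: inv_el_eqI)
    moreover have "inv_el (covec_norm g \<omega>) = s'" unfolding covec_norm_eq s_def[symmetric] using ss' by (rule inv_el_eqI)
    moreover have "s' * k = k * s'" by (rule inverse_commute[OF ss']) (simp add: ks)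
    ultimately show ?thesis using inv_covec_norm[OF w] by (simp add: power_mult_commuting)
  qed
  then have "has_weak_integral sphere_measure (\<lambda>\<omega>. inv_el (covec_norm g2 \<omega>) ^ CARD('n)) (k ^ CARD('n) * (area *\<^sub>R spectral_density g))"
    using has_weak_integral_bounded_linear[OF bounded_linear_mult_right density_integral, of "k ^ CARD('n)"]
      has_weak_integral_cong[of sphere_measure "\<lambda>\<omega>. inv_el (covec_norm g2 \<omega>) ^ CARD('n)" "\<lambda>\<omega>. k ^ CARD('n) * F \<omega>"]
    by (simp add: space_sphere_measure)
  from weak_integral_eqI[OF this] show ?thesis
    unfolding g2_def[symmetric] spectral_density_def[of g2]
    using area_pos by (simp add: area_def sphere_area_def)
qed

section \<open>The holomorphic functional calculus of a positive matrix\<close>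

text \<open>\<open>torus_mat\<close> is treated as a real algebra; complex scalars enter as these
  central elements.\<close>

definition scal_mat :: "complex \<Rightarrow> ('n::finite, 'm::finite) torus_mat" where
  "scal_mat z = Mat (z *\<^sub>C mat 1)"

lemma entry_scal_mat_mult: "mat_of (scal_mat z * A) $ i $ j = z *\<^sub>C mat_of A $ i $ j"
proof -
  have "(z *\<^sub>C mat 1) $ i $ k * mat_of A $ k $ j = (if k = i then z *\<^sub>C mat_of A $ i $ j else 0)" for k
    by (auto simp: scaleC_vec_def mat_def scaleC_torus_op_simps linear_simps[OF bounded_linear_scaleC_right])
  then show ?thesis by (simp add: entry_mult scal_mat_def Mat_inverse)
qed

lemma scal_mat_mult_eq: "mat_of (scal_mat z * A) = z *\<^sub>C mat_of A"
  by (simp add: vec_eq_iff entry_scal_mat_mult scaleC_vec_def)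

lemma scal_mat_add: "scal_mat (z + w) = scal_mat z + scal_mat w"
  and scal_mat_diff: "scal_mat (z - w) = scal_mat z - scal_mat w"
  and scal_mat_of_real: "scal_mat (complex_of_real r) = r *\<^sub>R 1"
  and scal_mat_mult: "scal_mat (z * w) = scal_mat z * scal_mat w"
  and scal_mat_1: "scal_mat 1 = 1"
  and scal_mat_commute: "A * scal_mat z = scal_mat z * A"
proof -
  have e: "mat_of (scal_mat z) $ i $ j = (if i = j then z *\<^sub>C 1 else 0)" for z i j
    by (simp add: scal_mat_def Mat_inverse scaleC_vec_def mat_def linear_simps[OF bounded_linear_scaleC_right])
  have e2: "mat_of (A * scal_mat z) $ i $ j = z *\<^sub>C mat_of A $ i $ j" for A z i j
  proof -
    have "mat_of A $ i $ k * mat_of (scal_mat z) $ k $ j = (if k = j then z *\<^sub>C mat_of A $ i $ j else 0)" for k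
      by (auto simp: e scaleC_torus_op_simps)
    then show ?thesis by (simp add: entry_mult)
  qed
  show "scal_mat (z + w) = scal_mat z + scal_mat w" "scal_mat (z - w) = scal_mat z - scal_mat w"
    "scal_mat (complex_of_real r) = r *\<^sub>R 1"
    by (rule mat_of_eqI, simp add: e entry_simps entry_1 scaleC_torus_op_simps
        linear_simps[OF bounded_linear_scaleC_left] linear_simps[OF bounded_linear_scaleC_right]; fail)+
  show "scal_mat (z * w) = scal_mat z * scal_mat w"
    by (rule mat_of_eqI) (simp add: e entry_scal_mat_mult scaleC_torus_op_simps linear_simps[OF bounded_linear_scaleC_right])
  show "scal_mat 1 = 1" by (rule mat_of_eqI) (simp add: e entry_1 scaleC_torus_op_simps)
  show "A * scal_mat z = scal_mat z * A" by (rule mat_of_eqI) (simp add: e2 entry_scal_mat_mult)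
qed

lemma scal_mat_power: "scal_mat z ^ m = scal_mat (z ^ m)"
  by (induction m) (simp_all add: scal_mat_1 scal_mat_mult)

lemma norm_scal_mat_le: "norm (scal_mat z) \<le> cmod z"
proof (rule mat.norm_leI[OF norm_ge_zero])
  fix v :: "'a torus_L2^'b"
  have "mat_act (mat_of (scal_mat z)) v $ i = z *\<^sub>C v $ i" for i
  proof -
    have "op_apply ((z *\<^sub>C mat 1) $ i $ j) (v $ j) = (if j = i then z *\<^sub>C v $ i else 0)" for j
      by (auto simp: scaleC_vec_def mat_def op_apply_simps scaleC_torus_L2_linear linear_simps[OF bounded_linear_scaleC_right])
    then show ?thesis by (simp add: mat_act_nth scal_mat_def Mat_inverse)
  qed
  then show "norm (mat_act (mat_of (scal_mat z)) v) \<le> cmod z * norm v"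
    by (simp add: norm_vec_def norm_scaleC_torus_L2 L2_set_right_distrib)
qed

lemma bounded_linear_mat_of: "bounded_linear (mat_of :: ('n::finite, 'm::finite) torus_mat \<Rightarrow> _)"
proof (rule bounded_linear_intro)
  fix A :: "('n, 'm) torus_mat"
  have "norm (mat_of A) \<le> (\<Sum>i\<in>UNIV. \<Sum>j\<in>UNIV. norm (mat_of A $ i $ j))"
    unfolding norm_vec_def[of "mat_of A"]
    by (rule order_trans[OF L2_set_le_sum]) (auto intro!: sum_mono L2_set_le_sum simp: norm_vec_def[of "mat_of A $ _"])
  also have "\<dots> \<le> (\<Sum>i\<in>(UNIV :: 'm set). \<Sum>j\<in>(UNIV :: 'm set). norm A)" by (intro sum_mono norm_entry_le)
  finally show "norm (mat_of A) \<le> norm A * (real CARD('m) * real CARD('m))" by (simp add: mult_ac)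
qed (simp_all add: plus_torus_mat.rep_eq scaleR_torus_mat.rep_eq)

text \<open>These scalar coefficients separate matrices and commute with integrals, so that Cauchy's
  theorem is applied to complex functions only.\<close>

definition mat_coeff :: "'m \<Rightarrow> 'm \<Rightarrow> 'n::finite torus_L2 \<Rightarrow> 'n torus_L2 \<Rightarrow> 'n torus_op^'m^'m \<Rightarrow> complex" where
  "mat_coeff i j f f' A = cinner (op_apply (A $ i $ j) f) f'"

lemma bounded_linear_mat_coeff: "bounded_linear (mat_coeff i j f f')"
proof (rule bounded_linear_intro)
  fix A B :: "'a torus_op^'b^'b" and r :: real
  show "mat_coeff i j f f' (A + B) = mat_coeff i j f f' A + mat_coeff i j f f' B"
    by (simp add: mat_coeff_def op_apply_simps cinner_add_left)
  show "mat_coeff i j f f' (r *\<^sub>R A) = r *\<^sub>R mat_coeff i j f f' A"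
    by (simp add: mat_coeff_def op_apply_simps scaleC_torus_L2_simps(5) cinner_scaleC_left scaleR_conv_of_real[of r "mat_coeff i j f f' A", unfolded mat_coeff_def])
  have "cmod (mat_coeff i j f f' A) \<le> norm (op_apply (A $ i $ j) f) * norm f'"
    unfolding mat_coeff_def by (rule norm_cinner_le)
  also have "\<dots> \<le> (norm A * norm f) * norm f'"
    by (intro mult_right_mono order_trans[OF op.norm_act] order_trans[OF Finite_Cartesian_Product.norm_nth_le Finite_Cartesian_Product.norm_nth_le]) auto
  finally show "cmod (mat_coeff i j f f' A) \<le> norm A * (norm f * norm f')" by (simp add: mult.assoc)
qed

lemma mat_coeff_scaleC: "mat_coeff i j f f' (z *\<^sub>C A) = z * mat_coeff i j f f' A"
  by (simp add: mat_coeff_def scaleC_vec_def op_apply_simps cinner_scaleC_left)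

lemma mat_coeff_eqI:
  assumes "\<And>i j f f'. mat_coeff i j f f' A = mat_coeff i j f f' B"
  shows "A = B"
proof -
  have "op_apply (A $ i $ j) f = op_apply (B $ i $ j) f" for i j f
  proof -
    have "inner (op_apply (A $ i $ j) f - op_apply (B $ i $ j) f) f' = 0" for f'
    proof -
      have "inner (op_apply (A $ i $ j) f) f' = inner (op_apply (B $ i $ j) f) f'"
        using assms[of i j f f'] by (simp add: mat_coeff_def inner_eq_Re_cinner)
      then show ?thesis by (simp add: inner_diff_left)
    qed
    then show ?thesis by (metis inner_eq_zero_iff right_minus_eq)
  qed
  then show ?thesis by (auto simp: vec_eq_iff intro: op_eqI)
qed

section \<open>The resolvent and its scalar coefficients\<close>

definition resolvent :: "'n::finite torus_op^'m^'m \<Rightarrow> complex \<Rightarrow> ('n, 'm::finite) torus_mat" where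
  "resolvent g z = Mat (matrix_inv (z *\<^sub>C mat 1 - g))"

lemma Mat_mult: "Mat A * Mat B = Mat (A ** B)"
  by (simp add: mat_of_inject[symmetric] times_torus_mat.rep_eq Mat_inverse)

lemma Mat_diff: "Mat (A - B) = Mat A - Mat B"
  by (simp add: mat_of_inject[symmetric] minus_torus_mat.rep_eq Mat_inverse)

lemma Mat_one: "Mat (mat 1) = 1"
  by (simp add: one_torus_mat.abs_eq)

lemma resolvent_eqI:
  assumes "(scal_mat z - Mat g) * A = 1" "A * (scal_mat z - Mat g) = 1"
  shows "z \<notin> mat_spectrum g" "resolvent g z = A"
proof -
  have "(z *\<^sub>C mat 1 - g) ** mat_of A = mat 1" "mat_of A ** (z *\<^sub>C mat 1 - g) = mat 1"
    using arg_cong[OF assms(1), of mat_of] arg_cong[OF assms(2), of mat_of]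
    by (simp_all add: times_torus_mat.rep_eq minus_torus_mat.rep_eq one_torus_mat.rep_eq scal_mat_def Mat_inverse)
  then show "z \<notin> mat_spectrum g" "resolvent g z = A"
    by (auto simp: mat_spectrum_def invertible_def resolvent_def matrix_inv_eqI mat_of_inverse)
qed

lemma resolvent:
  assumes "z \<notin> mat_spectrum g"
  shows "(scal_mat z - Mat g) * resolvent g z = 1" "resolvent g z * (scal_mat z - Mat g) = 1"
proof -
  obtain B where B: "(z *\<^sub>C mat 1 - g) ** B = mat 1" "B ** (z *\<^sub>C mat 1 - g) = mat 1"
    using assms by (auto simp: mat_spectrum_def invertible_def)
  then have "matrix_inv (z *\<^sub>C mat 1 - g) = B" by (rule matrix_inv_eqI)
  then show "(scal_mat z - Mat g) * resolvent g z = 1" "resolvent g z * (scal_mat z - Mat g) = 1"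
    using B by (simp_all add: resolvent_def scal_mat_def Mat_mult Mat_one flip: Mat_diff)
qed

lemma resolvent_identity:
  assumes "z \<notin> mat_spectrum g" "w \<notin> mat_spectrum g"
  shows "resolvent g w - resolvent g z = - (scal_mat (w - z) * (resolvent g w * resolvent g z))"
proof -
  have "resolvent g w * ((scal_mat z - Mat g) - (scal_mat w - Mat g)) * resolvent g z =
      resolvent g w * ((scal_mat z - Mat g) * resolvent g z) - (resolvent g w * (scal_mat w - Mat g)) * resolvent g z"
    by (simp only: right_diff_distrib left_diff_distrib mult.assoc)
  also have "\<dots> = resolvent g w - resolvent g z"
    using resolvent[OF assms(1)] resolvent[OF assms(2)] by simp
  also have "(scal_mat z - Mat g) - (scal_mat w - Mat g) = - scal_mat (w - z)" by (simp add: scal_mat_diff)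
  finally show ?thesis by (simp add: scal_mat_commute mult.assoc)
qed

text \<open>With R the resolvent at z one has w - g = (z - g) (1 - X) for X = - (w - z) R, and 1 - X
  is inverted by a Neumann series.\<close>

lemma spectrum_ball:
  fixes g :: "'n::finite torus_op^'m::finite^'m"
  assumes z: "z \<notin> mat_spectrum g" and w: "cmod (w - z) * norm (resolvent g z) < 1"
  shows "w \<notin> mat_spectrum g"
proof -
  let ?R = "resolvent g z" and ?X = "- (scal_mat (w - z) * resolvent g z)"
  have "norm ?X \<le> norm (scal_mat (w - z) :: ('n, 'm) torus_mat) * norm ?R" by (simp add: norm_mult_ineq)
  also have "\<dots> \<le> cmod (w - z) * norm ?R" by (intro mult_right_mono norm_scal_mat_le) auto
  finally have X: "norm ?X < 1" using w by simp
  have e1: "(scal_mat z - Mat g) * (1 - ?X) = scal_mat w - Mat g"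
  proof -
    have "(scal_mat z - Mat g) * (scal_mat (w - z) * ?R) = scal_mat (w - z) * ((scal_mat z - Mat g) * ?R)"
      by (metis mult.assoc scal_mat_commute)
    then show ?thesis using resolvent(1)[OF z] by (simp add: distrib_left scal_mat_diff)
  qed
  have e2: "(1 - ?X) * (scal_mat z - Mat g) = scal_mat w - Mat g"
    using resolvent(2)[OF z] by (simp add: distrib_right mult.assoc scal_mat_diff)
  have r1: "(scal_mat w - Mat g) * (npow 1 ?X * ?R) = 1"
  proof -
    have "(scal_mat w - Mat g) * (npow 1 ?X * ?R) = (scal_mat z - Mat g) * ((1 - ?X) * npow 1 ?X) * ?R"
      unfolding e1[symmetric] by (simp only: mult.assoc)
    then show ?thesis by (simp only: neumann_inverse[OF X] resolvent[OF z] mult_1_right)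
  qed
  have r2: "(?R * npow 1 ?X) * (scal_mat w - Mat g) = 1"
  proof -
    have "(?R * npow 1 ?X) * (scal_mat w - Mat g) = ?R * (npow 1 ?X * (1 - ?X)) * (scal_mat z - Mat g)"
      unfolding e2[symmetric] by (simp only: mult.assoc)
    then show ?thesis by (simp only: neumann_inverse[OF X] resolvent[OF z] mult_1_right)
  qed
  \<comment> \<open>A left and a right inverse agree, so that one of them is two-sided.\<close>
  have "?R * npow 1 ?X = (?R * npow 1 ?X) * ((scal_mat w - Mat g) * (npow 1 ?X * ?R))"
    by (simp only: r1 mult_1_right)
  also have "\<dots> = ((?R * npow 1 ?X) * (scal_mat w - Mat g)) * (npow 1 ?X * ?R)" by (simp only: mult.assoc)
  also have "\<dots> = npow 1 ?X * ?R" by (simp only: r2 mult_1_left)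
  finally have "(npow 1 ?X * ?R) * (scal_mat w - Mat g) = 1" using r2 by simp
  with r1 show ?thesis by (rule resolvent_eqI(1))
qed

lemma open_resolvent_set: "open (- mat_spectrum g)"
proof (rule openI)
  fix z assume z: "z \<in> - mat_spectrum g"
  define e where "e = 1 / (norm (resolvent g z) + 1)"
  have e: "0 < e" by (simp add: e_def add_nonneg_pos)
  have "w \<in> - mat_spectrum g" if "w \<in> ball z e" for w
  proof -
    have "cmod (w - z) < e" using that by (simp add: dist_norm norm_minus_commute)
    then have "cmod (w - z) * norm (resolvent g z) \<le> e * norm (resolvent g z)"
      by (intro mult_right_mono) auto
    also have "\<dots> < 1" by (simp add: e_def divide_less_eq add_nonneg_pos)
    finally show ?thesis using spectrum_ball z by blast
  qed
  then show "\<exists>e>0. ball z e \<subseteq> - mat_spectrum g" using e by blast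
qed

text \<open>By the resolvent identity the difference is at most |w - z| |R(w)| |R(z)|. For |w - z|
  |R(z)| \<le> 1/2 this first yields |R(w)| \<le> 2 |R(z)|, and then a Lipschitz bound.\<close>

lemma continuous_resolvent:
  fixes g :: "'n::finite torus_op^'m::finite^'m"
  shows "continuous_on (- mat_spectrum g) (resolvent g)"
  unfolding continuous_on_def
proof
  fix z assume z: "z \<in> - mat_spectrum g"
  let ?N = "norm (resolvent g z)"
  have bound: "norm (resolvent g w - resolvent g z) \<le> cmod (w - z) * (2 * ?N * ?N)"
    if w: "w \<in> - mat_spectrum g" "cmod (w - z) * ?N \<le> 1 / 2" for w
  proof -
    have d: "norm (resolvent g w - resolvent g z) \<le> cmod (w - z) * (norm (resolvent g w) * ?N)"
    proof -
      have "norm (resolvent g w - resolvent g z) \<le> norm (scal_mat (w - z) :: ('n, 'm) torus_mat) * norm (resolvent g w * resolvent g z)"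
        using resolvent_identity[of z g w] z w(1) norm_mult_ineq[of "scal_mat (w - z)" "resolvent g w * resolvent g z"] by simp
      also have "\<dots> \<le> cmod (w - z) * (norm (resolvent g w) * ?N)"
        by (intro mult_mono norm_scal_mat_le norm_mult_ineq) auto
      finally show ?thesis .
    qed
    have "norm (resolvent g w) \<le> ?N + norm (resolvent g w - resolvent g z)"
      using norm_triangle_ineq[of "resolvent g z" "resolvent g w - resolvent g z"] by simp
    also have "\<dots> \<le> ?N + (cmod (w - z) * ?N) * norm (resolvent g w)" using d by (simp add: mult_ac)
    also have "\<dots> \<le> ?N + 1 / 2 * norm (resolvent g w)" by (intro add_left_mono mult_right_mono w) auto
    finally have "norm (resolvent g w) \<le> 2 * ?N" by simp
    then have "cmod (w - z) * (norm (resolvent g w) * ?N) \<le> cmod (w - z) * (2 * ?N * ?N)"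
      by (intro mult_left_mono mult_right_mono) auto
    then show ?thesis using d by linarith
  qed
  have "((\<lambda>w. resolvent g w - resolvent g z) \<longlongrightarrow> 0) (at z within - mat_spectrum g)"
  proof (rule Lim_null_comparison)
    have "((\<lambda>w. cmod (w - z) * ?N) \<longlongrightarrow> cmod (z - z) * ?N) (at z within - mat_spectrum g)"
      by (intro tendsto_intros)
    then have "\<forall>\<^sub>F w in at z within - mat_spectrum g. cmod (w - z) * ?N < 1 / 2"
      by (rule order_tendstoD(2)) simp
    moreover have "\<forall>\<^sub>F w in at z within - mat_spectrum g. w \<in> - mat_spectrum g" by (simp add: eventually_at_filter)
    ultimately show "\<forall>\<^sub>F w in at z within - mat_spectrum g. norm (resolvent g w - resolvent g z) \<le> cmod (w - z) * (2 * ?N * ?N)"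
      by eventually_elim (use bound in auto)
    have "((\<lambda>w. cmod (w - z) * (2 * ?N * ?N)) \<longlongrightarrow> cmod (z - z) * (2 * ?N * ?N)) (at z within - mat_spectrum g)"
      by (intro tendsto_intros)
    then show "((\<lambda>w. cmod (w - z) * (2 * ?N * ?N)) \<longlongrightarrow> 0) (at z within - mat_spectrum g)" by simp
  qed
  then show "(resolvent g \<longlongrightarrow> resolvent g z) (at z within - mat_spectrum g)" by (rule LIM_zero_cancel)
qed

text \<open>By the resolvent identity the difference quotient is the coefficient of - R(w) R(z),
  which converges by continuity of the resolvent.\<close>

lemma holomorphic_resolvent_coeff: "(\<lambda>z. mat_coeff i j f f' (mat_of (resolvent g z))) holomorphic_on - mat_spectrum g"
proof (rule holomorphic_onI)
  fix z assume z: "z \<in> - mat_spectrum g"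
  define \<psi> where "\<psi> A = mat_coeff i j f f' (mat_of A)" for A
  have \<psi>: "bounded_linear \<psi>"
    unfolding \<psi>_def by (rule bounded_linear_compose[OF bounded_linear_mat_coeff bounded_linear_mat_of])
  have "((\<lambda>w. (\<psi> (resolvent g w) - \<psi> (resolvent g z)) / (w - z)) \<longlongrightarrow> \<psi> (- (resolvent g z * resolvent g z))) (at z within - mat_spectrum g)"
  proof (rule Lim_transform_eventually)
    have "(resolvent g \<longlongrightarrow> resolvent g z) (at z within - mat_spectrum g)"
      using continuous_resolvent[unfolded continuous_on_def] z by blast
    then show "((\<lambda>w. \<psi> (- (resolvent g w * resolvent g z))) \<longlongrightarrow> \<psi> (- (resolvent g z * resolvent g z))) (at z within - mat_spectrum g)"
      by (intro bounded_linear.tendsto[OF \<psi>] tendsto_intros)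
    have "\<forall>\<^sub>F w in at z within - mat_spectrum g. w \<in> - mat_spectrum g \<and> w \<noteq> z" by (simp add: eventually_at_filter)
    then show "\<forall>\<^sub>F w in at z within - mat_spectrum g. \<psi> (- (resolvent g w * resolvent g z)) =
        (\<psi> (resolvent g w) - \<psi> (resolvent g z)) / (w - z)"
    proof eventually_elim
      fix w assume w: "w \<in> - mat_spectrum g \<and> w \<noteq> z"
      have "\<psi> (resolvent g w) - \<psi> (resolvent g z) = \<psi> (- (scal_mat (w - z) * (resolvent g w * resolvent g z)))"
        using resolvent_identity[of z g w] z w by (simp flip: linear_simps(2)[OF \<psi>])
      also have "\<dots> = (w - z) * \<psi> (- (resolvent g w * resolvent g z))"
        by (simp add: linear_simps[OF \<psi>]) (simp add: \<psi>_def scal_mat_mult_eq mat_coeff_scaleC)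
      finally show "\<psi> (- (resolvent g w * resolvent g z)) = (\<psi> (resolvent g w) - \<psi> (resolvent g z)) / (w - z)"
        using w by simp
    qed
  qed
  then show "(\<lambda>z. mat_coeff i j f f' (mat_of (resolvent g z))) field_differentiable at z within - mat_spectrum g"
    unfolding field_differentiable_def has_field_derivative_iff \<psi>_def by blast
qed

section \<open>The contour integral for the logarithm of a positive matrix\<close>

lemma higher_deriv_Ln:
  "z \<notin> \<real>\<^sub>\<le>\<^sub>0 \<Longrightarrow> (deriv ^^ Suc m) Ln z = (- 1) ^ m * fact m / z ^ Suc m"
proof (induction m arbitrary: z)
  case 0
  then show ?case by (simp add: DERIV_imp_deriv[OF has_field_derivative_Ln] inverse_eq_divide)
next
  case (Suc m)
  have z: "z \<noteq> 0" using Suc.prems by auto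
  have "((\<lambda>z. (- 1) ^ m * fact m / z ^ Suc m) has_field_derivative ((- 1) ^ Suc m * fact (Suc m) / z ^ Suc (Suc m))) (at z)"
    using z by (auto intro!: derivative_eq_intros simp: divide_simps)
      (cases m; simp add: algebra_simps)
  then have "((deriv ^^ Suc m) Ln has_field_derivative ((- 1) ^ Suc m * fact (Suc m) / z ^ Suc (Suc m))) (at z)"
    by (rule has_field_derivative_transform_within_open[of _ _ _ "- \<real>\<^sub>\<le>\<^sub>0"])
       (use Suc in \<open>auto simp: open_Compl\<close>)
  then show ?case by (simp add: DERIV_imp_deriv)
qed

text \<open>The series of - log (1 - b), indexed from 0 so that no division by zero occurs.\<close>

definition nlog :: "'a::{real_normed_algebra_1,banach} \<Rightarrow> 'a" where
  "nlog b = (\<Sum>m. (1 / real (Suc m)) *\<^sub>R b ^ Suc m)"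

lemma summable_nlog:
  fixes b :: "'a::{real_normed_algebra_1,banach}"
  assumes "norm b < 1"
  shows "summable (\<lambda>m. norm ((1 / real (Suc m)) *\<^sub>R b ^ Suc m))"
proof (rule summable_comparison_test'[of "\<lambda>m. norm b ^ Suc m" 0])
  show "summable (\<lambda>m. norm b ^ Suc m)"
    using assms by (subst summable_Suc_iff) (simp add: summable_geometric)
  fix m
  have "norm ((1 / real (Suc m)) *\<^sub>R b ^ Suc m) \<le> 1 * norm (b ^ Suc m)"
    unfolding norm_scaleR by (intro mult_right_mono) auto
  also have "\<dots> \<le> norm b ^ Suc m" using norm_power_ineq[of b "Suc m"] by simp
  finally show "norm (norm ((1 / real (Suc m)) *\<^sub>R b ^ Suc m)) \<le> norm b ^ Suc m" by simp
qed

lemma nlog_sums: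
  fixes b :: "'a::{real_normed_algebra_1,banach}"
  assumes "norm b < 1"
  shows "(\<lambda>m. (1 / real (Suc m)) *\<^sub>R b ^ Suc m) sums nlog b"
  unfolding nlog_def by (rule summable_sums[OF summable_norm_cancel[OF summable_nlog[OF assms]]])

lemma bounded_linear_scal_mat: "bounded_linear (scal_mat :: complex \<Rightarrow> ('n::finite, 'm::finite) torus_mat)"
proof (rule bounded_linear_intro[of _ 1])
  fix r :: real and z :: complex
  have "scal_mat (r *\<^sub>R z) = scal_mat (complex_of_real r) * (scal_mat z :: ('n, 'm) torus_mat)"
    by (simp add: scaleR_conv_of_real[of r z] scal_mat_mult)
  then show "(scal_mat (r *\<^sub>R z) :: ('n, 'm) torus_mat) = r *\<^sub>R scal_mat z" by (simp add: scal_mat_of_real)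
qed (simp_all add: scal_mat_add norm_scal_mat_le)

text \<open>
  The spectrum lies on the real axis, so that the complement of the spectrum and of the negative
  half-line is connected through the upper or the lower half-plane.
\<close>

lemma path_off_real_axis:
  fixes z z0 :: complex
  assumes z0: "z0 \<in> U" "z0 \<in> \<real>" and z: "z \<in> U" and U: "- \<real> \<subseteq> U"
  obtains p where "valid_path p" "pathstart p = z" "pathfinish p = z0" "path_image p \<subseteq> U"
proof -
  \<comment> \<open>The sign e tells the half-plane of z; the path goes by way of the point y, which
    lies above or below z0 on that side.\<close>
  obtain e :: real where e: "\<bar>e\<bar> = 1" "0 \<le> e * Im z"
    by (cases "0 \<le> Im z") (auto intro: that[of 1] that[of "- 1"])
  define y where "y = z0 + of_real e * \<i>"
  have y: "Im y = e" using z0(2) by (auto simp: y_def complex_is_Real_iff)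
  have seg: "closed_segment x y \<subseteq> U" if x: "x \<in> U" "0 \<le> e * Im x" for x
  proof
    fix w assume "w \<in> closed_segment x y"
    then obtain u where u: "0 \<le> u" "u \<le> 1" "w = (1 - u) *\<^sub>R x + u *\<^sub>R y" by (auto simp: closed_segment_def)
    show "w \<in> U"
    proof (cases "u = 0")
      case False
      have "e * Im w = (1 - u) * (e * Im x) + u * (e * e)" by (simp add: u y algebra_simps)
      moreover have "e * e = 1" using e(1) by (auto simp: abs_if split: if_splits)
      ultimately have "0 < e * Im w" using False u x by (simp add: add_nonneg_pos)
      then have "w \<notin> \<real>" by (auto simp: complex_is_Real_iff)
      then show ?thesis using U by auto
    qed (use u x in simp)
  qed
  show ?thesis
  proof (rule that[of "linepath z y +++ linepath y z0"])
    show "path_image (linepath z y +++ linepath y z0) \<subseteq> U"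
      using seg[OF z e(2)] seg[OF z0(1)] z0(2)
      by (subst path_image_join) (auto simp: closed_segment_commute complex_is_Real_iff)
  qed auto
qed

text \<open>Cauchy's theorem is applied to one closed path: along \<gamma>, by p to the circle,
  backwards round the circle and back along p. The two passages of p cancel, and the winding number
  about a point outside U is the difference of the two given ones. The connecting path p exists
  because U contains all non-real numbers and the circle starts on the real axis.\<close>

lemma contour_integral_eq_circlepath:
  assumes U: "open U" "- \<real> \<subseteq> U" and f: "f holomorphic_on U"
    and \<gamma>: "valid_path \<gamma>" "pathfinish \<gamma> = pathstart \<gamma>" "path_image \<gamma> \<subseteq> U"
    and C: "path_image (circlepath (complex_of_real c) r) \<subseteq> U" "0 < r"
    and w: "\<And>z. z \<notin> U \<Longrightarrow> winding_number \<gamma> z = winding_number (circlepath (complex_of_real c) r) z"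
  shows "contour_integral \<gamma> f = contour_integral (circlepath (complex_of_real c) r) f"
proof -
  let ?C = "circlepath (complex_of_real c) r"
  have 1: "pathstart ?C \<in> U" "pathstart ?C \<in> \<real>" using C(1) pathstart_in_path_image[of ?C] by auto
  have 2: "pathstart \<gamma> \<in> U" using \<gamma>(3) pathstart_in_path_image[of \<gamma>] by auto
  obtain p where p: "valid_path p" "pathstart p = pathstart \<gamma>" "pathfinish p = pathstart ?C" "path_image p \<subseteq> U"
    using path_off_real_axis[OF 1 2 U(2)] .
  define q where "q = p +++ (reversepath ?C +++ reversepath p)"
  have Cl: "pathfinish ?C = pathstart ?C" by simp
  have vp: "valid_path (reversepath ?C +++ reversepath p)" "valid_path q"
    unfolding q_def using p by (auto intro!: valid_path_join simp: Cl)
  have im: "path_image q \<subseteq> U"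
    unfolding q_def using p C by (auto simp: path_image_join Cl)
  have qs: "pathstart q = pathfinish \<gamma>" "pathfinish q = pathstart \<gamma>"
    using p \<gamma>(2) by (simp_all add: q_def)
  note ci = contour_integrable_holomorphic_simple[OF f U(1)]
  have fi: "f contour_integrable_on \<gamma>" "f contour_integrable_on p" "f contour_integrable_on ?C" "f contour_integrable_on q"
    using ci \<gamma> p C vp im by auto
  have "(f has_contour_integral 0) (\<gamma> +++ q)"
  proof (rule Cauchy_theorem_global[OF U(1) f])
    show "valid_path (\<gamma> +++ q)" using \<gamma>(1) vp qs by auto
    show "pathfinish (\<gamma> +++ q) = pathstart (\<gamma> +++ q)" using qs by simp
    show "path_image (\<gamma> +++ q) \<subseteq> U" using \<gamma> im qs by (simp add: path_image_join)
    fix z assume z: "z \<notin> U"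
    have n: "z \<notin> path_image \<gamma>" "z \<notin> path_image p" "z \<notin> path_image ?C" "z \<notin> path_image q"
      using z \<gamma> p C im by auto
    have "winding_number (\<gamma> +++ q) z = winding_number \<gamma> z + winding_number q z"
      using n \<gamma>(1) vp qs by (intro winding_number_join) (auto simp: valid_path_imp_path)
    also have "winding_number q z = winding_number p z + winding_number (reversepath ?C +++ reversepath p) z"
      unfolding q_def using n p vp
      by (intro winding_number_join) (auto simp: valid_path_imp_path path_image_join Cl simp del: path_image_circlepath)
    also have "winding_number (reversepath ?C +++ reversepath p) z = winding_number (reversepath ?C) z + winding_number (reversepath p) z"
      using n p by (intro winding_number_join) (auto simp: valid_path_imp_path Cl simp del: path_image_circlepath)
    also have "winding_number (reversepath ?C) z = - winding_number ?C z"
      using n by (intro winding_number_reversepath) (auto simp: valid_path_imp_path simp del: path_image_circlepath)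
    also have "winding_number (reversepath p) z = - winding_number p z"
      using n p by (intro winding_number_reversepath) (auto simp: valid_path_imp_path)
    finally show "winding_number (\<gamma> +++ q) z = 0" using w[OF z] by simp
  qed
  then have "0 = contour_integral (\<gamma> +++ q) f" by (simp add: contour_integral_unique)
  also have "\<dots> = contour_integral \<gamma> f + contour_integral q f"
    using fi \<gamma>(1) vp qs by (intro contour_integral_join) auto
  also have "contour_integral q f = contour_integral p f + contour_integral (reversepath ?C +++ reversepath p) f"
    unfolding q_def using fi p vp
    by (intro contour_integral_join) (auto simp: contour_integrable_reversepath Cl intro!: contour_integrable_joinI)
  also have "contour_integral (reversepath ?C +++ reversepath p) f = - contour_integral ?C f - contour_integral p f"
    using fi p by (subst contour_integral_join) (auto simp: contour_integrable_reversepath contour_integral_reversepath Cl)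
  finally show ?thesis by simp
qed

lemma npow_1_sums:
  fixes b :: "'a::{real_normed_algebra_1,banach}"
  assumes "norm b < 1"
  shows "(\<lambda>m. b ^ m) sums npow 1 b"
  using npow_sums[OF assms, of 1] by (simp add: ncoef_def flip: pochhammer_fact)

text \<open>The counterpart of \<open>scaled_operator\<close> for matrices. The bounds d and c place
  the spectrum in a disc about c that avoids 0; \<open>pos\<close> keeps it on the real
  axis.\<close>

locale positive_matrix =
  fixes g :: "'n::finite torus_op^'m::finite^'m" and c d :: real
  assumes pos: "mat_positive g" and coercive: "mat.coercive d (Mat g)" and d: "0 < d" and norm_g: "norm (Mat g) \<le> c"
begin

definition B :: "('n, 'm) torus_mat" where "B = 1 - (1 / c) *\<^sub>R Mat g"
definition \<rho> where "\<rho> = 1 - d / c"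

lemma d_le_c: "d \<le> c"
proof -
  have "axis undefined one_vec \<noteq> (0 :: 'n torus_L2^'m)"
    by (metis norm_axis_vec norm_one_vec norm_zero zero_neq_one)
  from mat.coercive_le_norm[OF coercive this] show ?thesis using norm_g by simp
qed

lemma c: "0 < c" using d d_le_c by simp

lemma norm_B: "norm B \<le> \<rho>"
  unfolding B_def \<rho>_def by (rule mat.norm_one_minus_le[OF coercive norm_g d_le_c c])

lemma \<rho>: "0 \<le> \<rho>" "\<rho> < 1"
  using norm_B norm_ge_zero[of B] d c by (linarith, simp add: \<rho>_def)

lemma norm_B_less: "norm B < 1"
  using norm_B \<rho> by simp

lemma Mat_g: "Mat g = c *\<^sub>R (1 - B)"
  using c by (simp add: B_def)

text \<open>From g = c (1 - B) one gets w - g = (w - c) (1 - X), so outside the disc of radius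
  \<rho> c about c the resolvent is a Neumann series in B.\<close>

lemma resolvent_outside:
  assumes w: "\<rho> * c < cmod (w - complex_of_real c)"
  defines "X \<equiv> scal_mat (- complex_of_real c / (w - complex_of_real c)) * B"
  shows "w \<notin> mat_spectrum g" "norm X < 1" "resolvent g w = scal_mat (1 / (w - complex_of_real c)) * npow 1 X"
proof -
  let ?u = "w - complex_of_real c"
  have u: "?u \<noteq> 0" "0 < cmod ?u" using w \<rho> c by (auto simp: mult_less_0_iff)
  have "norm X \<le> cmod (- complex_of_real c / ?u) * \<rho>"
    unfolding X_def by (rule order_trans[OF norm_mult_ineq]) (intro mult_mono norm_scal_mat_le norm_B norm_ge_zero)
  also have "\<dots> = \<rho> * c / cmod ?u" using c by (simp add: norm_divide)
  also have "\<dots> < 1" using w u by simp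
  finally show X: "norm X < 1" .
  have "Mat g = scal_mat (complex_of_real c) - scal_mat (complex_of_real c) * B"
    by (simp add: Mat_g scal_mat_of_real algebra_simps)
  moreover have "scal_mat ?u * X = - (scal_mat (complex_of_real c) * B)"
  proof -
    have "scal_mat ?u * X = scal_mat (?u * (- complex_of_real c / ?u)) * B" by (simp only: X_def scal_mat_mult mult.assoc)
    also have "?u * (- complex_of_real c / ?u) = 0 - complex_of_real c" using u by simp
    also have "scal_mat (0 - complex_of_real c) = (scal_mat (complex_of_real 0) - scal_mat (complex_of_real c) :: ('n, 'm) torus_mat)"
      by (simp only: scal_mat_diff of_real_0)
    finally show ?thesis by (simp add: scal_mat_of_real del: of_real_0)
  qed
  ultimately have e: "scal_mat w - Mat g = scal_mat ?u * (1 - X)"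
    by (simp add: right_diff_distrib scal_mat_diff)
  have inv: "scal_mat ?u * scal_mat (1 / ?u) = (1 :: ('n, 'm) torus_mat)"
    using u by (simp add: scal_mat_1 flip: scal_mat_mult)
  have "(scal_mat w - Mat g) * (scal_mat (1 / ?u) * npow 1 X) = (scal_mat ?u * scal_mat (1 / ?u)) * ((1 - X) * npow 1 X)"
  proof -
    have "(1 - X) * (scal_mat (1 / ?u) * npow 1 X) = scal_mat (1 / ?u) * ((1 - X) * npow 1 X)"
      by (simp only: scal_mat_commute[of "1 - X"] mult.assoc[symmetric])
    then show ?thesis unfolding e by (simp only: mult.assoc)
  qed
  then have 1: "(scal_mat w - Mat g) * (scal_mat (1 / ?u) * npow 1 X) = 1" by (simp only: inv neumann_inverse[OF X] mult_1_right)
  have 2: "(scal_mat (1 / ?u) * npow 1 X) * (scal_mat w - Mat g) = 1"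
  proof -
    have "npow 1 X * (scal_mat ?u * (1 - X)) = scal_mat ?u * (npow 1 X * (1 - X))"
      by (simp only: scal_mat_commute[of "npow 1 X"] mult.assoc[symmetric])
    then have "(scal_mat (1 / ?u) * npow 1 X) * (scal_mat w - Mat g) = scal_mat (1 / ?u) * (scal_mat ?u * (npow 1 X * (1 - X)))"
      unfolding e by (simp only: mult.assoc)
    also have "\<dots> = scal_mat ?u * scal_mat (1 / ?u)"
      unfolding neumann_inverse[OF X] mult_1_right by (rule scal_mat_commute)
    finally show ?thesis by (simp only: inv)
  qed
  show "w \<notin> mat_spectrum g" "resolvent g w = scal_mat (1 / ?u) * npow 1 X" using resolvent_eqI[OF 1 2] by auto
qed

text \<open>Halfway between \<rho> c and c: the circle about c encloses the spectrum and leaves the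
  closed negative half-line outside.\<close>

definition rad where "rad = (\<rho> * c + c) / 2"

lemma rad: "0 < rad" "\<rho> * c < rad" "rad < c"
proof -
  have "\<rho> * c < 1 * c" using \<rho> c by (intro mult_strict_right_mono)
  moreover have "0 \<le> \<rho> * c" using \<rho> c by simp
  ultimately show "0 < rad" "\<rho> * c < rad" "rad < c" using c by (simp_all add: rad_def)
qed

lemma spectrum_subset: "mat_spectrum g \<subseteq> cball (complex_of_real c) (\<rho> * c) \<inter> \<real>\<^sub>\<ge>\<^sub>0 - {0}"
proof
  fix w assume w: "w \<in> mat_spectrum g"
  have "w \<in> \<real>\<^sub>\<ge>\<^sub>0" using w pos by (auto simp: mat_positive_def)
  moreover have b: "cmod (w - complex_of_real c) \<le> \<rho> * c" using resolvent_outside(1)[of w] w by force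
  moreover have "w \<noteq> 0" using b rad c \<rho> by (auto simp: norm_minus_commute)
  ultimately show "w \<in> cball (complex_of_real c) (\<rho> * c) \<inter> \<real>\<^sub>\<ge>\<^sub>0 - {0}" by (simp add: dist_norm norm_minus_commute)
qed

definition U where "U = - \<real>\<^sub>\<le>\<^sub>0 - mat_spectrum g"

lemma U: "open U" "- \<real> \<subseteq> U"
proof -
  have "U = (- \<real>\<^sub>\<le>\<^sub>0) \<inter> (- mat_spectrum g)" by (auto simp: U_def)
  then show "open U" using open_resolvent_set[of g] by (auto simp: open_Compl)
  show "- \<real> \<subseteq> U"
    using spectrum_subset by (auto simp: U_def nonneg_Reals_def nonpos_Reals_def)
qed

abbreviation "circle \<equiv> circlepath (complex_of_real c) rad"

lemma circle_subset: "path_image circle \<subseteq> U"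
proof
  fix z assume "z \<in> path_image circle"
  then have z: "cmod (z - complex_of_real c) = rad" using rad by (simp add: dist_norm norm_minus_commute)
  then have "z \<notin> mat_spectrum g" using resolvent_outside(1) rad by simp
  moreover have "z \<notin> \<real>\<^sub>\<le>\<^sub>0"
  proof
    assume "z \<in> \<real>\<^sub>\<le>\<^sub>0"
    then have "c \<le> cmod (z - complex_of_real c)" using abs_Re_le_cmod[of "z - complex_of_real c"] by (auto simp: nonpos_Reals_def)
    then show False using z rad by simp
  qed
  ultimately show "z \<in> U" by (simp add: U_def)
qed

lemma winding_number_circle:
  "z \<in> mat_spectrum g \<Longrightarrow> winding_number circle z = 1"
  "z \<in> \<real>\<^sub>\<le>\<^sub>0 \<Longrightarrow> winding_number circle z = 0"
proof -
  assume z: "z \<in> mat_spectrum g"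
  then have "cmod (z - complex_of_real c) \<le> \<rho> * c"
    using spectrum_subset by (auto simp: dist_norm norm_minus_commute)
  then show "winding_number circle z = 1" using rad by (intro winding_number_circlepath) simp
next
  assume "z \<in> \<real>\<^sub>\<le>\<^sub>0"
  then have "c \<le> cmod (z - complex_of_real c)" using abs_Re_le_cmod[of "z - complex_of_real c"] by (auto simp: nonpos_Reals_def)
  then show "winding_number circle z = 0"
    using rad by (intro winding_number_zero_outside[of _ "cball (complex_of_real c) rad"])
      (auto simp: dist_norm norm_minus_commute)
qed

definition L :: "('n, 'm) torus_mat" where "L = ln c *\<^sub>R 1 - nlog B"

text \<open>On the circle the resolvent is expanded in powers of B. Cauchy's formula for the
  derivatives of Ln at c evaluates each term, and the resulting Taylor series is ln c -
  \<open>nlog B\<close>. Uniform convergence on the circle justifies the exchange of sum and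
  integral.\<close>

lemma circle_integral:
  fixes i j :: 'm and f f' :: "'n torus_L2"
  defines "\<psi> \<equiv> \<lambda>A :: ('n, 'm) torus_mat. mat_coeff i j f f' (mat_of A)"
  shows "contour_integral circle (\<lambda>z. Ln z * \<psi> (resolvent g z)) = 2 * of_real pi * \<i> * \<psi> L"
proof -
  have \<psi>: "bounded_linear \<psi>"
    unfolding \<psi>_def by (rule bounded_linear_compose[OF bounded_linear_mat_coeff bounded_linear_mat_of])
  have \<psi>C: "\<psi> (scal_mat z * A) = z * \<psi> A" for z A
    by (simp add: \<psi>_def scal_mat_mult_eq mat_coeff_scaleC)
  define t where "t m z = Ln z / (z - complex_of_real c) ^ Suc m * ((- complex_of_real c) ^ m * \<psi> (B ^ m))" for m z
  have resolvent_term: "scal_mat (1 / u) * (scal_mat (- complex_of_real c / u) * B) ^ m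
      = scal_mat ((- complex_of_real c) ^ m / u ^ Suc m) * B ^ m" for u m
  proof -
    have "(scal_mat (- complex_of_real c / u) * B) ^ m = scal_mat ((- complex_of_real c / u) ^ m) * B ^ m"
      unfolding scal_mat_power[symmetric] by (rule power_mult_commuting) (rule scal_mat_commute)
    then have "scal_mat (1 / u) * (scal_mat (- complex_of_real c / u) * B) ^ m = scal_mat (1 / u * (- complex_of_real c / u) ^ m) * B ^ m"
      by (simp only: scal_mat_mult mult.assoc)
    moreover have "1 / u * (- complex_of_real c / u) ^ m = (- complex_of_real c) ^ m / u ^ Suc m"
      by (simp only: power_divide) simp
    ultimately show ?thesis by simp
  qed
  have sums: "(\<lambda>m. t m z) sums (Ln z * \<psi> (resolvent g z))" if z: "z \<in> sphere (complex_of_real c) rad" for z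
  proof -
    let ?u = "z - complex_of_real c"
    let ?X = "scal_mat (- complex_of_real c / ?u) * B"
    have w: "\<rho> * c < cmod ?u" using z rad by (simp add: dist_norm norm_minus_commute)
    have "(\<lambda>m. scal_mat (1 / ?u) * ?X ^ m) sums (scal_mat (1 / ?u) * npow 1 ?X)"
      by (rule sums_mult[OF npow_1_sums[OF resolvent_outside(2)[OF w]]])
    then have "(\<lambda>m. \<psi> (scal_mat (1 / ?u) * ?X ^ m)) sums \<psi> (resolvent g z)"
      unfolding resolvent_outside(3)[OF w] by (rule bounded_linear.sums[OF \<psi>])
    then have "(\<lambda>m. Ln z * \<psi> (scal_mat (1 / ?u) * ?X ^ m)) sums (Ln z * \<psi> (resolvent g z))" by (rule sums_mult)
    then show ?thesis unfolding resolvent_term \<psi>C t_def by (simp add: mult_ac)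
  qed
  \<comment> \<open>The Taylor coefficients of Ln at c multiplied by (- c)^m: ln c for m = 0 and - 1
    / m for m > 0.\<close>
  define a where "a m = (case m of 0 \<Rightarrow> complex_of_real (ln c) | Suc k \<Rightarrow> - (1 / of_nat (Suc k)))" for m
  have cR: "complex_of_real c \<notin> \<real>\<^sub>\<le>\<^sub>0" using c by (auto simp: nonpos_Reals_def)
  have disc: "cball (complex_of_real c) rad \<inter> \<real>\<^sub>\<le>\<^sub>0 = {}"
  proof -
    have "rad < cmod (z - complex_of_real c)" if "z \<in> \<real>\<^sub>\<le>\<^sub>0" for z
      using abs_Re_le_cmod[of "z - complex_of_real c"] that rad by (auto simp: nonpos_Reals_def)
    then show ?thesis by (fastforce simp: dist_norm norm_minus_commute)
  qed
  have ti: "(t m has_contour_integral (2 * of_real pi * \<i> * (a m * \<psi> (B ^ m)))) circle" for m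
  proof -
    have "((\<lambda>z. Ln z / (z - complex_of_real c) ^ Suc m) has_contour_integral
        ((2 * of_real pi * \<i>) / fact m * (deriv ^^ m) Ln (complex_of_real c))) circle"
    proof -
      have "continuous_on (cball (complex_of_real c) rad) Ln" using disc by (intro continuous_on_Ln) auto
      moreover have "Ln holomorphic_on ball (complex_of_real c) rad"
        using disc ball_subset_cball by (intro holomorphic_on_Ln) blast
      ultimately show ?thesis
        using Cauchy_has_contour_integral_higher_derivative_circlepath[of "complex_of_real c" rad Ln "complex_of_real c" m] rad by simp
    qed
    from has_contour_integral_rmul[OF this, of "(- complex_of_real c) ^ m * \<psi> (B ^ m)"]
    have "(t m has_contour_integral ((2 * of_real pi * \<i>) / fact m * (deriv ^^ m) Ln (complex_of_real c) *
        ((- complex_of_real c) ^ m * \<psi> (B ^ m)))) circle"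
      by (simp only: t_def[abs_def])
    moreover have "(deriv ^^ m) Ln (complex_of_real c) / fact m * (- complex_of_real c) ^ m = a m"
    proof (cases m)
      case 0
      then show ?thesis using c by (simp add: a_def Ln_of_real)
    next
      case (Suc k)
      have f: "fact k / (fact (Suc k) :: complex) = 1 / of_nat (Suc k)"
        unfolding fact_Suc using fact_nonzero[of k, where 'a = complex] by (simp del: of_nat_Suc)
      have e: "(- complex_of_real c) ^ Suc k = (- 1) ^ Suc k * complex_of_real c ^ Suc k" by (rule power_minus)
      have "(deriv ^^ m) Ln (complex_of_real c) / fact m * (- complex_of_real c) ^ m =
          ((- 1) ^ k * (- 1) ^ Suc k) * (complex_of_real c ^ Suc k / complex_of_real c ^ Suc k) * (fact k / fact (Suc k))"
        unfolding Suc higher_deriv_Ln[OF cR] e by (simp only: times_divide_eq_left times_divide_eq_right divide_divide_eq_left mult_ac)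
      also have "\<dots> = a m" unfolding f using c by (simp add: a_def Suc flip: power_mult_distrib)
      finally show ?thesis .
    qed
    moreover have "2 * of_real pi * \<i> / fact m * (deriv ^^ m) Ln (complex_of_real c) * ((- complex_of_real c) ^ m * \<psi> (B ^ m)) =
        2 * of_real pi * \<i> * ((deriv ^^ m) Ln (complex_of_real c) / fact m * (- complex_of_real c) ^ m * \<psi> (B ^ m))"
      by simp
    ultimately show ?thesis by (simp only:)
  qed
  obtain K where K: "\<And>z. z \<in> sphere (complex_of_real c) rad \<Longrightarrow> cmod (Ln z) \<le> K"
  proof -
    have "continuous_on (sphere (complex_of_real c) rad) Ln" using disc sphere_cball[of "complex_of_real c" rad] by (intro continuous_on_Ln) blast
    then have "bounded (Ln ` sphere (complex_of_real c) rad)"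
      by (intro compact_imp_bounded compact_continuous_image) auto
    then show ?thesis using that unfolding bounded_iff by blast
  qed
  obtain M where M: "\<And>A. cmod (\<psi> A) \<le> norm A * M" "0 \<le> M" using bounded_linear.nonneg_bounded[OF \<psi>] by blast
  have K0: "0 \<le> K"
  proof -
    have "complex_of_real c + complex_of_real rad \<in> sphere (complex_of_real c) rad" using rad by (simp add: dist_norm)
    from K[OF this] show ?thesis by (rule order_trans[OF norm_ge_zero])
  qed
  \<comment> \<open>The ratio of the Neumann series on the circle; it is below 1 because the radius
    exceeds \<rho> c.\<close>
  define q where "q = \<rho> * c / rad"
  have q: "0 \<le> q" "q < 1" using \<rho> c rad by (auto simp: q_def divide_simps)
  have bound: "cmod (t m z) \<le> K / rad * M * q ^ m" if z: "z \<in> sphere (complex_of_real c) rad" for m z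
  proof -
    have u: "cmod (z - complex_of_real c) = rad" using z by (simp add: dist_norm norm_minus_commute)
    have "cmod (\<psi> (B ^ m)) \<le> \<rho> ^ m * M"
      using M(1)[of "B ^ m"] mult_right_mono[OF norm_power_le[OF norm_B] M(2), of m] by linarith
    then have "cmod (t m z) \<le> K / rad ^ Suc m * (c ^ m * (\<rho> ^ m * M))"
      using K[OF z] rad(1) c K0 unfolding t_def norm_mult norm_divide norm_power u norm_minus_cancel norm_of_real
      by (intro mult_mono divide_right_mono) auto
    also have "\<dots> = K / rad * M * q ^ m" by (simp add: q_def power_divide power_mult_distrib)
    finally show ?thesis .
  qed
  have ul: "uniform_limit (sphere (complex_of_real c) rad) (\<lambda>n z. \<Sum>m<n. t m z) (\<lambda>z. \<Sum>m. t m z) sequentially"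
  proof (rule Weierstrass_m_test)
    show "summable (\<lambda>m. K / rad * M * q ^ m)" using q by (intro summable_mult summable_geometric) simp
    show "cmod (t m z) \<le> K / rad * M * q ^ m" if "z \<in> sphere (complex_of_real c) rad" for m z by (rule bound[OF that])
  qed
  have "uniform_limit (sphere (complex_of_real c) rad) (\<lambda>n z. \<Sum>m<n. t m z) (\<lambda>z. Ln z * \<psi> (resolvent g z)) sequentially"
  proof -
    have "(\<Sum>m. t m z) = Ln z * \<psi> (resolvent g z)" if "z \<in> sphere (complex_of_real c) rad" for z
      using sums[OF that] by (simp add: sums_iff)
    with ul show ?thesis
      using uniform_limit_cong'[of "sphere (complex_of_real c) rad" "\<lambda>n z. \<Sum>m<n. t m z" "\<lambda>n z. \<Sum>m<n. t m z"
          "\<lambda>z. \<Sum>m. t m z" "\<lambda>z. Ln z * \<psi> (resolvent g z)" sequentially] by blast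
  qed
  moreover have sumi: "((\<lambda>z. \<Sum>m<n. t m z) has_contour_integral (\<Sum>m<n. 2 * of_real pi * \<i> * (a m * \<psi> (B ^ m)))) circle" for n
    by (intro has_contour_integral_sum ti) simp
  ultimately have "(\<lambda>n. contour_integral circle (\<lambda>z. \<Sum>m<n. t m z)) \<longlonglongrightarrow> contour_integral circle (\<lambda>z. Ln z * \<psi> (resolvent g z))"
    using rad by (intro contour_integral_uniform_limit_circlepath(2)) (auto simp: contour_integrable_on_def intro!: always_eventually)
  then have "(\<lambda>m. 2 * of_real pi * \<i> * (a m * \<psi> (B ^ m))) sums contour_integral circle (\<lambda>z. Ln z * \<psi> (resolvent g z))"
    by (simp add: sums_def contour_integral_unique[OF sumi])
  moreover have "(\<lambda>m. 2 * of_real pi * \<i> * (a m * \<psi> (B ^ m))) sums (2 * of_real pi * \<i> * \<psi> L)"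
  proof (rule sums_mult)
    have "(\<lambda>m. \<psi> ((1 / real (Suc m)) *\<^sub>R B ^ Suc m)) sums \<psi> (nlog B)"
      by (rule bounded_linear.sums[OF \<psi> nlog_sums[OF norm_B_less]])
    then have "(\<lambda>m. - \<psi> ((1 / real (Suc m)) *\<^sub>R B ^ Suc m)) sums - \<psi> (nlog B)" by (rule sums_minus)
    also have "(\<lambda>m. - \<psi> ((1 / real (Suc m)) *\<^sub>R B ^ Suc m)) = (\<lambda>m. a (Suc m) * \<psi> (B ^ Suc m))"
      by (simp only: a_def linear_simps[OF \<psi>] nat.case) (simp add: scaleR_conv_of_real)
    finally have "(\<lambda>m. a m * \<psi> (B ^ m)) sums (- \<psi> (nlog B) + a 0 * \<psi> (B ^ 0))"
      by (rule sums_Suc)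
    also have "- \<psi> (nlog B) + a 0 * \<psi> (B ^ 0) = \<psi> L"
      by (simp only: L_def a_def linear_simps[OF \<psi>] nat.case power_0) (simp add: scaleR_conv_of_real)
    finally show "(\<lambda>m. a m * \<psi> (B ^ m)) sums \<psi> L" .
  qed
  ultimately show ?thesis by (rule sums_unique2)
qed

text \<open>The definition is a definite description over all admissible paths, so two things are
  needed: every such path yields the same value, which is Cauchy's theorem for the scalar
  coefficients, and some path has a convergent integral, which the circle provides by continuity of
  the integrand.\<close>

theorem mat_log_eq: "mat_log g = mat_of L"
proof -
  let ?V = "\<lambda>\<gamma> t. (Ln (\<gamma> t) * vector_derivative \<gamma> (at t within {0..1})) *\<^sub>C matrix_inv (\<gamma> t *\<^sub>C mat 1 - g)"
  let ?P = "\<lambda>\<gamma>. valid_path \<gamma> \<and> pathfinish \<gamma> = pathstart \<gamma> \<and> path_image \<gamma> \<subseteq> - \<real>\<^sub>\<le>\<^sub>0 - mat_spectrum g \<and>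
        (\<forall>z\<in>mat_spectrum g. winding_number \<gamma> z = 1) \<and> (\<forall>z. z \<notin> - \<real>\<^sub>\<le>\<^sub>0 \<longrightarrow> winding_number \<gamma> z = 0)"
  have inv: "matrix_inv (z *\<^sub>C mat 1 - g) = mat_of (resolvent g z)" for z
    by (simp add: resolvent_def Mat_inverse)
  have unique: "(1 / (2 * of_real pi * \<i>)) *\<^sub>C I = mat_of L" if \<gamma>: "?P \<gamma>" and I: "(?V \<gamma> has_integral I) {0..1}" for \<gamma> I
  proof (rule mat_coeff_eqI)
    fix i j f f'
    let ?f = "\<lambda>z. Ln z * mat_coeff i j f f' (mat_of (resolvent g z))"
    have "((\<lambda>t. mat_coeff i j f f' (?V \<gamma> t)) has_integral mat_coeff i j f f' I) {0..1}"
      using has_integral_linear[OF I bounded_linear_mat_coeff] by (simp add: o_def)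
    then have "(?f has_contour_integral mat_coeff i j f f' I) \<gamma>"
      by (simp add: has_contour_integral_def mat_coeff_scaleC inv mult_ac)
    then have "mat_coeff i j f f' I = contour_integral \<gamma> ?f" by (simp add: contour_integral_unique)
    also have "\<dots> = contour_integral circle ?f"
    proof (rule contour_integral_eq_circlepath[OF U])
      show "?f holomorphic_on U"
        by (intro holomorphic_on_mult holomorphic_on_Ln holomorphic_on_subset[OF holomorphic_resolvent_coeff])
           (auto simp: U_def)
      show "valid_path \<gamma>" "pathfinish \<gamma> = pathstart \<gamma>" "path_image \<gamma> \<subseteq> U" using \<gamma> by (auto simp: U_def)
      show "path_image circle \<subseteq> U" "0 < rad" by (rule circle_subset, rule rad)
      fix z assume "z \<notin> U"
      then consider "z \<in> mat_spectrum g" | "z \<in> \<real>\<^sub>\<le>\<^sub>0" by (auto simp: U_def)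
      then show "winding_number \<gamma> z = winding_number circle z"
        using \<gamma> by cases (simp_all add: winding_number_circle)
    qed
    also have "\<dots> = 2 * of_real pi * \<i> * mat_coeff i j f f' (mat_of L)" by (rule circle_integral)
    finally show "mat_coeff i j f f' ((1 / (2 * of_real pi * \<i>)) *\<^sub>C I) = mat_coeff i j f f' (mat_of L)"
      by (simp add: mat_coeff_scaleC)
  qed
  have circle: "?P circle"
    using circle_subset winding_number_circle by (simp add: U_def del: path_image_circlepath)
  have "continuous_on {0..1} (?V circle)"
  proof (rule continuous_on_eq)
    have "continuous_on {0..1} (\<lambda>t. resolvent g (circle t))"
    proof (rule continuous_on_compose2[OF continuous_resolvent])
      show "continuous_on {0..1} circle" using path_circlepath by (simp add: path_def)
      show "circle ` {0..1} \<subseteq> - mat_spectrum g" using circle_subset by (auto simp: path_image_def U_def)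
    qed
    moreover have "continuous_on {0..1} (\<lambda>t. Ln (circle t))"
    proof (rule continuous_on_Ln')
      show "continuous_on {0..1} circle" using path_circlepath by (simp add: path_def)
      show "circle t \<notin> \<real>\<^sub>\<le>\<^sub>0" if "t \<in> {0..1}" for t
        using circle_subset that unfolding path_image_def U_def by blast
    qed
    ultimately show "continuous_on {0..1} (\<lambda>t. mat_of (scal_mat (Ln (circle t) * (2 * of_real pi * \<i> * rad * exp (2 * of_real pi * \<i> * t))) * resolvent g (circle t)))"
    proof -
      assume R: "continuous_on {0..1} (\<lambda>t. resolvent g (circle t))" and Ln: "continuous_on {0..1} (\<lambda>t. Ln (circle t))"
      have "continuous_on {0..1} (\<lambda>t :: real. 2 * of_real pi * \<i> * rad * exp (2 * of_real pi * \<i> * t))"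
        by (intro continuous_intros)
      note bounded_linear.continuous_on[OF bounded_linear_scal_mat continuous_on_mult[OF Ln this]]
      from bounded_linear.continuous_on[OF bounded_linear_mat_of continuous_on_mult[OF this R]] show ?thesis .
    qed
    fix t :: real assume "t \<in> {0..1}"
    then show "mat_of (scal_mat (Ln (circle t) * (2 * of_real pi * \<i> * rad * exp (2 * of_real pi * \<i> * t))) * resolvent g (circle t)) = ?V circle t"
      by (simp add: scal_mat_mult_eq inv vector_derivative_circlepath01)
  qed
  then obtain I where I: "(?V circle has_integral I) {0..1}"
    using integrable_continuous_real by blast
  show ?thesis
    unfolding mat_log_def mat_hol_calc_def
  proof (rule the_equality)
    show "\<exists>\<gamma> I. valid_path \<gamma> \<and> pathfinish \<gamma> = pathstart \<gamma> \<and> path_image \<gamma> \<subseteq> - \<real>\<^sub>\<le>\<^sub>0 - mat_spectrum g \<and>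
        (\<forall>z\<in>mat_spectrum g. winding_number \<gamma> z = 1) \<and> (\<forall>z. z \<notin> - \<real>\<^sub>\<le>\<^sub>0 \<longrightarrow> winding_number \<gamma> z = 0) \<and>
        (?V \<gamma> has_integral I) {0..1} \<and> mat_of L = (1 / (2 * of_real pi * \<i>)) *\<^sub>C I"
      using circle I unique[OF circle I, symmetric] by blast
  qed (use unique in blast)
qed

end

section \<open>Differentiating exponentials along commuting families\<close>

lemma norm_exp_minus_affine_le:
  fixes z :: "'a::{real_normed_algebra_1,banach}"
  shows "norm (exp z - 1 - z) \<le> exp (norm z) - 1 - norm z"
proof -
  have z: "(\<lambda>n. z ^ (n + 2) /\<^sub>R fact (n + 2)) sums (exp z - (\<Sum>n<2. z ^ n /\<^sub>R fact n))"
    by (rule sums_split_initial_segment[OF exp_converges])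
  have n: "(\<lambda>n. norm z ^ (n + 2) /\<^sub>R fact (n + 2)) sums (exp (norm z) - (\<Sum>n<2. norm z ^ n /\<^sub>R fact n))"
    by (rule sums_split_initial_segment[OF exp_converges])
  have le: "norm (z ^ (n + 2) /\<^sub>R fact (n + 2)) \<le> norm z ^ (n + 2) /\<^sub>R fact (n + 2)" for n
    using norm_power_ineq[of z "n + 2"] by (simp add: mult_left_mono)
  have "norm (suminf (\<lambda>n. z ^ (n + 2) /\<^sub>R fact (n + 2))) \<le> suminf (\<lambda>n. norm z ^ (n + 2) /\<^sub>R fact (n + 2))"
    by (rule norm_suminf_le[OF le sums_summable[OF n]])
  then show ?thesis
    using sums_unique[OF z] sums_unique[OF n] by (simp add: numeral_2_eq_2 diff_diff_eq)
qed

lemma has_derivative_exp_0: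
  "(exp has_derivative (\<lambda>z. z)) (at (0 :: 'a::{real_normed_algebra_1,banach}))"
  unfolding has_derivative_at
proof
  show "bounded_linear (\<lambda>z :: 'a. z)" by (rule bounded_linear_ident)
  have r: "((\<lambda>h :: real. norm (exp h - 1 - h) / norm h) \<longlongrightarrow> 0) (at 0)"
    using DERIV_exp[of "0 :: real"] unfolding has_field_derivative_def has_derivative_at by simp
  have "((\<lambda>h :: 'a. norm (exp (norm h) - 1 - norm h) / norm (norm h)) \<longlongrightarrow> 0) (at 0)"
    by (rule filterlim_compose[OF r]) (auto simp: filterlim_at eventually_at_filter intro!: tendsto_norm_zero tendsto_ident_at)
  then show "((\<lambda>h :: 'a. norm (exp (0 + h) - exp 0 - h) / norm h) \<longlongrightarrow> 0) (at 0)"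
  proof (rule Lim_null_comparison[rotated], intro always_eventually allI)
    fix h :: 'a
    show "norm (norm (exp (0 + h) - exp 0 - h) / norm h) \<le> norm (exp (norm h) - 1 - norm h) / norm (norm h)"
      using norm_exp_minus_affine_le[of h] by (simp add: divide_right_mono)
  qed
qed

lemma exp_diff_commuting:
  fixes a b :: "'a::{real_normed_algebra_1,banach}"
  assumes "a * b = b * a"
  shows "exp b = exp a * exp (b - a)"
  by (subst exp_add_commuting[symmetric]) (simp_all add: algebra_simps assms)

text \<open>As A t commutes with A s, exp (A t) = exp (A s) exp (A t - A s), and only the derivative
  of exp at 0 is required.\<close>

lemma has_vector_derivative_exp_commuting:
  fixes A :: "real \<Rightarrow> 'a::{real_normed_algebra_1,banach}"
  assumes A: "(A has_vector_derivative A') (at s within S)" and s: "s \<in> S"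
    and comm: "\<And>t. t \<in> S \<Longrightarrow> A s * A t = A t * A s"
  shows "((\<lambda>t. exp (A t)) has_vector_derivative exp (A s) * A') (at s within S)"
proof -
  have "((\<lambda>t. A t - A s) has_derivative (\<lambda>h. h *\<^sub>R A')) (at s within S)"
    using A unfolding has_vector_derivative_def by (auto intro!: derivative_eq_intros)
  then have "((\<lambda>t. exp (A t - A s)) has_derivative (\<lambda>h. h *\<^sub>R A')) (at s within S)"
    by (rule has_derivative_compose[where g = exp and g' = "\<lambda>z. z"]) (simp add: has_derivative_exp_0)
  then have "((\<lambda>t. exp (A t - A s)) has_vector_derivative A') (at s within S)"
    by (simp add: has_vector_derivative_def)
  then have "((\<lambda>t. exp (A s) * exp (A t - A s)) has_vector_derivative exp (A s) * A') (at s within S)"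
    by (rule bounded_linear.has_vector_derivative[OF bounded_linear_mult_right])
  then show ?thesis
    by (rule has_vector_derivative_transform[OF s, rotated -1]) (rule exp_diff_commuting[OF comm])
qed

lemma continuous_on_exp_commuting:
  fixes A :: "'b::topological_space \<Rightarrow> 'a::{real_normed_algebra_1,banach}"
  assumes A: "continuous_on S A" and comm: "\<And>s t. s \<in> S \<Longrightarrow> t \<in> S \<Longrightarrow> A s * A t = A t * A s"
  shows "continuous_on S (\<lambda>t. exp (A t))"
  unfolding continuous_on_def
proof
  fix s assume s: "s \<in> S"
  have "((\<lambda>t. A t - A s) \<longlongrightarrow> A s - A s) (at s within S)"
    using A s by (intro tendsto_diff tendsto_const) (auto simp: continuous_on_def)
  then have "((\<lambda>t. exp (A t - A s)) \<longlongrightarrow> exp 0) (at s within S)"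
    using isCont_tendsto_compose[OF has_derivative_continuous[OF has_derivative_exp_0]] by fastforce
  then have "((\<lambda>t. exp (A s) * exp (A t - A s)) \<longlongrightarrow> exp (A s) * exp 0) (at s within S)"
    by (intro tendsto_mult tendsto_const)
  then show "((\<lambda>t. exp (A t)) \<longlongrightarrow> exp (A s)) (at s within S)"
    by (subst tendsto_cong[where g = "\<lambda>t. exp (A s) * exp (A t - A s)"])
       (auto simp: eventually_at_filter intro!: always_eventually exp_diff_commuting comm s)
qed

text \<open>For k above the norm of a and t, exp (- a) is e^(- k) exp (k - a), and the contraction
  estimate gives |k - a| \<le> k - t. The bare bound exp |a| would have the wrong sign.\<close>

lemma (in hilbert_rep) norm_exp_uminus_le:
  assumes a: "coercive t a"
  shows "norm (exp (- a)) \<le> exp (- t)"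
proof -
  define k where "k = max 1 (max (norm a) t)"
  have k: "0 < k" "norm a \<le> k" "t \<le> k" by (auto simp: k_def)
  have "norm (k *\<^sub>R 1 - a) = k * norm (1 - (1 / k) *\<^sub>R a)"
    using k(1) norm_scaleR[of k "1 - (1 / k) *\<^sub>R a"] by (simp add: scaleR_right_diff_distrib)
  also have "\<dots> \<le> k * (1 - t / k)"
    using k by (intro mult_left_mono norm_one_minus_le[OF a]) auto
  also have "\<dots> = k - t" using k by (simp add: field_simps)
  finally have le: "norm (k *\<^sub>R 1 - a) \<le> k - t" .
  have "exp (- a) = exp ((- k) *\<^sub>R 1 + (k *\<^sub>R 1 - a))" by simp
  also have "\<dots> = exp ((- k) *\<^sub>R 1) * exp (k *\<^sub>R 1 - a)" by (rule exp_add_commuting) (simp add: algebra_simps)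
  also have "exp ((- k) *\<^sub>R (1 :: 'a)) = exp (- k) *\<^sub>R 1"
    using exp_of_real[of "- k", where 'a = 'a] by (simp add: of_real_def)
  finally have "norm (exp (- a)) = exp (- k) * norm (exp (k *\<^sub>R 1 - a))" by simp
  also have "\<dots> \<le> exp (- k) * exp (k - t)"
    using norm_exp[of "k *\<^sub>R 1 - a"] le by (intro mult_left_mono) (auto intro: order_trans)
  also have "\<dots> = exp (- t)" by (simp flip: exp_add)
  finally show ?thesis .
qed

lemma norm_npow_1_le:
  fixes b :: "'a::{real_normed_algebra_1,banach}"
  assumes "norm b \<le> r" "r < 1"
  shows "norm (npow 1 b) \<le> 1 / (1 - r)"
proof -
  have r: "0 \<le> r" using assms(1) norm_ge_zero[of b] by linarith
  have "norm (npow 1 b) \<le> (\<Sum>m. \<bar>ncoef 1 m\<bar> * r ^ m)" by (rule norm_npow_le[OF assms])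
  also have "\<dots> = 1 / (1 - r)" using assms r by (simp add: ncoef_def suminf_geometric flip: pochhammer_fact)
  finally show ?thesis .
qed

lemma norm_scaleR_le_of_unit:
  fixes b :: "'a::real_normed_vector"
  assumes "norm b \<le> r" "s \<in> {0..1}"
  shows "norm (s *\<^sub>R b) \<le> r"
  using mult_mono[of s 1 "norm b" r] assms norm_ge_zero[of b] by auto

lemma npow_1_diff:
  fixes b :: "'a::{real_normed_algebra_1,banach}"
  assumes "norm (s *\<^sub>R b) < 1" "norm (t *\<^sub>R b) < 1"
  shows "npow 1 (t *\<^sub>R b) - npow 1 (s *\<^sub>R b) = (t - s) *\<^sub>R (npow 1 (t *\<^sub>R b) * (b * npow 1 (s *\<^sub>R b)))"
proof -
  let ?N = "\<lambda>s. npow 1 (s *\<^sub>R b)"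
  have "?N t * ((1 - s *\<^sub>R b) - (1 - t *\<^sub>R b)) * ?N s = ?N t * ((1 - s *\<^sub>R b) * ?N s) - (?N t * (1 - t *\<^sub>R b)) * ?N s"
    by (simp only: right_diff_distrib left_diff_distrib mult.assoc)
  then have "?N t - ?N s = ?N t * ((1 - s *\<^sub>R b) - (1 - t *\<^sub>R b)) * ?N s"
    using neumann_inverse[OF assms(1)] neumann_inverse[OF assms(2)] by simp
  also have "(1 - s *\<^sub>R b) - (1 - t *\<^sub>R b) = (t - s) *\<^sub>R b" by (simp add: algebra_simps)
  finally show ?thesis by (simp add: mult.assoc)
qed

lemma npow_1_continuous:
  fixes b :: "'a::{real_normed_algebra_1,banach}"
  assumes b: "norm b \<le> r" "r < 1"
  shows "continuous_on {0..1} (\<lambda>s. npow 1 (s *\<^sub>R b))"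
proof (rule continuous_onI)
  have bs: "norm (s *\<^sub>R b) \<le> r" if "s \<in> {0..1}" for s using norm_scaleR_le_of_unit[OF b(1) that] .
  define K where "K = 1 / (1 - r) * (r * (1 / (1 - r)))"
  have r: "0 \<le> r" using b norm_ge_zero[of b] by linarith
  then have K: "0 \<le> K" using b by (simp add: K_def)
  fix s :: real and e :: real assume s: "s \<in> {0..1}" and e: "0 < e"
  show "\<exists>d>0. \<forall>t\<in>{0..1}. dist t s < d \<longrightarrow> dist (npow 1 (t *\<^sub>R b)) (npow 1 (s *\<^sub>R b)) \<le> e"
  proof (intro exI[of _ "e / (K + 1)"] conjI ballI impI)
    fix t assume t: "t \<in> {0..1}" "dist t s < e / (K + 1)"
    have "norm (npow 1 (t *\<^sub>R b) * (b * npow 1 (s *\<^sub>R b))) \<le> norm (npow 1 (t *\<^sub>R b)) * (norm b * norm (npow 1 (s *\<^sub>R b)))"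
      by (intro order_trans[OF norm_mult_ineq] mult_left_mono norm_mult_ineq norm_ge_zero)
    also have "\<dots> \<le> K"
      unfolding K_def using r b by (intro mult_mono norm_npow_1_le bs s t) auto
    finally have "dist (npow 1 (t *\<^sub>R b)) (npow 1 (s *\<^sub>R b)) \<le> \<bar>t - s\<bar> * K"
      using bs[OF s] bs[OF t(1)] b unfolding dist_norm by (subst npow_1_diff) (auto intro!: mult_left_mono)
    also have "\<dots> \<le> e / (K + 1) * K" using t K by (intro mult_right_mono) (auto simp: dist_real_def)
    also have "\<dots> \<le> e" using K e by (simp add: divide_simps)
    finally show "dist (npow 1 (t *\<^sub>R b)) (npow 1 (s *\<^sub>R b)) \<le> e" .
  qed (use K e in simp)
qed

lemma npow_1_derivative:
  fixes b :: "'a::{real_normed_algebra_1,banach}"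
  assumes b: "norm b \<le> r" "r < 1" and s: "s \<in> {0..1}"
  shows "((\<lambda>s. npow 1 (s *\<^sub>R b)) has_vector_derivative npow 1 (s *\<^sub>R b) * (b * npow 1 (s *\<^sub>R b))) (at s within {0..1})"
  unfolding has_vector_derivative_def has_derivative_within
proof (intro conjI bounded_linear_scaleR_left)
  let ?N = "\<lambda>s. npow 1 (s *\<^sub>R b)"
  have bs: "norm (s *\<^sub>R b) < 1" if "s \<in> {0..1}" for s using norm_scaleR_le_of_unit[OF b(1) that] b by simp
  have "((\<lambda>t. (?N t - ?N s) * (b * ?N s)) \<longlongrightarrow> (?N s - ?N s) * (b * ?N s)) (at s within {0..1})"
    using npow_1_continuous[OF b] s by (intro tendsto_intros) (auto simp: continuous_on_def)
  then have l: "((\<lambda>t. norm ((?N t - ?N s) * (b * ?N s))) \<longlongrightarrow> 0) (at s within {0..1})"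
    by (intro tendsto_norm_zero) simp
  show "((\<lambda>t. (1 / norm (t - s)) *\<^sub>R (?N t - (?N s + (t - s) *\<^sub>R (?N s * (b * ?N s))))) \<longlongrightarrow> 0) (at s within {0..1})"
  proof (rule Lim_null_comparison[OF _ l])
    have "norm ((1 / norm (t - s)) *\<^sub>R (?N t - (?N s + (t - s) *\<^sub>R (?N s * (b * ?N s))))) \<le> norm ((?N t - ?N s) * (b * ?N s))"
      if t: "t \<in> {0..1}" for t
    proof -
      have "?N t - (?N s + (t - s) *\<^sub>R (?N s * (b * ?N s))) = (?N t - ?N s) - (t - s) *\<^sub>R (?N s * (b * ?N s))"
        by (simp add: diff_diff_eq)
      also have "?N t - ?N s = (t - s) *\<^sub>R (?N t * (b * ?N s))" by (rule npow_1_diff[OF bs[OF s] bs[OF t]])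
      also have "(t - s) *\<^sub>R (?N t * (b * ?N s)) - (t - s) *\<^sub>R (?N s * (b * ?N s)) = (t - s) *\<^sub>R ((?N t - ?N s) * (b * ?N s))"
        by (simp only: left_diff_distrib scaleR_right_diff_distrib)
      finally have "?N t - (?N s + (t - s) *\<^sub>R (?N s * (b * ?N s))) = (t - s) *\<^sub>R ((?N t - ?N s) * (b * ?N s))" .
      then show ?thesis by simp
    qed
    then show "\<forall>\<^sub>F t in at s within {0..1}. norm ((1 / norm (t - s)) *\<^sub>R (?N t - (?N s + (t - s) *\<^sub>R (?N s * (b * ?N s)))))
        \<le> norm ((?N t - ?N s) * (b * ?N s))"
      by (simp add: eventually_at_filter)
  qed
qed

text \<open>Differentiation term by term: the derived series s^m b^(m + 1) has the majorant r^(m +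
  1) on the whole interval, and its sum is b times the Neumann series.\<close>

lemma nlog_derivative:
  fixes b :: "'a::{real_normed_algebra_1,banach}"
  assumes b: "norm b \<le> r" "r < 1" and s: "s \<in> {0..1}"
  shows "((\<lambda>s. nlog (s *\<^sub>R b)) has_vector_derivative b * npow 1 (s *\<^sub>R b)) (at s within {0..1})"
proof -
  have r: "0 \<le> r" using b norm_ge_zero[of b] by linarith
  have bs: "norm (s *\<^sub>R b) < 1" if "s \<in> {0..1}" for s using norm_scaleR_le_of_unit[OF b(1) that] b by simp
  have pow: "(u *\<^sub>R b) ^ m = u ^ m *\<^sub>R b ^ m" for u m by (induction m) (simp_all add: mult.commute)
  have ul: "uniform_limit {0..1} (\<lambda>n s. \<Sum>m<n. s ^ m *\<^sub>R b ^ Suc m) (\<lambda>s. \<Sum>m. s ^ m *\<^sub>R b ^ Suc m) sequentially"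
  proof (rule Weierstrass_m_test)
    show "summable (\<lambda>m. r ^ Suc m)" using b r by (subst summable_Suc_iff) (simp add: summable_geometric)
    show "norm (s ^ m *\<^sub>R b ^ Suc m) \<le> r ^ Suc m" if "s \<in> {0..1}" for m s
    proof -
      have "\<bar>s ^ m\<bar> * norm (b ^ Suc m) \<le> 1 * r ^ Suc m"
        using that b by (intro mult_mono norm_power_le) (auto simp: power_le_one)
      then show ?thesis by simp
    qed
  qed
  have sum: "(\<Sum>m. u ^ m *\<^sub>R b ^ Suc m) = b * npow 1 (u *\<^sub>R b)" if "u \<in> {0..1}" for u
    using sums_mult[OF npow_1_sums[OF bs[OF that]], of b] by (simp add: pow sums_iff)
  have "\<exists>G. \<forall>s\<in>{0..1}. (\<lambda>m. (s ^ Suc m / real (Suc m)) *\<^sub>R b ^ Suc m) sums G s \<and>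
      (G has_derivative (\<lambda>h. h *\<^sub>R (b * npow 1 (s *\<^sub>R b)))) (at s within {0..1})"
  proof (rule has_derivative_series[where f' = "\<lambda>m s h. h *\<^sub>R (s ^ m *\<^sub>R b ^ Suc m)" and x = 0 and l = 0])
    show "((\<lambda>s. (s ^ Suc m / real (Suc m)) *\<^sub>R b ^ Suc m) has_derivative (\<lambda>h. h *\<^sub>R (s ^ m *\<^sub>R b ^ Suc m))) (at s within {0..1})" for m s
    proof -
      have "((\<lambda>s. s ^ Suc m / real (Suc m)) has_real_derivative s ^ m) (at s within {0..1})"
        using DERIV_cdivide[OF DERIV_pow[of "Suc m" s "{0..1}"], of "real (Suc m)"] by (simp del: of_nat_Suc)
      from has_derivative_scaleR_left[OF this[unfolded has_field_derivative_def], of "b ^ Suc m"]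
      show ?thesis by (rule has_derivative_eq_rhs) (simp add: mult.commute)
    qed
    fix e :: real assume "0 < e"
    with ul have "\<forall>\<^sub>F n in sequentially. \<forall>s\<in>{0..1}. dist (\<Sum>m<n. s ^ m *\<^sub>R b ^ Suc m) (\<Sum>m. s ^ m *\<^sub>R b ^ Suc m) < e"
      by (rule uniform_limitD)
    then show "\<forall>\<^sub>F n in sequentially. \<forall>s\<in>{0..1}. \<forall>h.
        norm ((\<Sum>m<n. h *\<^sub>R (s ^ m *\<^sub>R b ^ Suc m)) - h *\<^sub>R (b * npow 1 (s *\<^sub>R b))) \<le> e * norm h"
    proof eventually_elim
      case (elim n)
      show ?case
      proof (intro ballI allI)
        fix s h :: real assume s: "s \<in> {0..1}"
        have "norm ((\<Sum>m<n. h *\<^sub>R (s ^ m *\<^sub>R b ^ Suc m)) - h *\<^sub>R (b * npow 1 (s *\<^sub>R b)))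
            = \<bar>h\<bar> * dist (\<Sum>m<n. s ^ m *\<^sub>R b ^ Suc m) (\<Sum>m. s ^ m *\<^sub>R b ^ Suc m)"
          unfolding sum[OF s] dist_norm norm_scaleR[symmetric] scaleR_right_diff_distrib scaleR_sum_right ..
        also have "\<dots> \<le> e * norm h" 
          using mult_left_mono[OF less_imp_le[OF bspec[OF elim s]] abs_ge_zero[of h]] by (simp only: real_norm_def mult.commute[of e])
        finally show "norm ((\<Sum>m<n. h *\<^sub>R (s ^ m *\<^sub>R b ^ Suc m)) - h *\<^sub>R (b * npow 1 (s *\<^sub>R b))) \<le> e * norm h" .
      qed
    qed
  qed auto
  then obtain G where G: "\<And>s. s \<in> {0..1} \<Longrightarrow> (\<lambda>m. (s ^ Suc m / real (Suc m)) *\<^sub>R b ^ Suc m) sums G s"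
    "\<And>s. s \<in> {0..1} \<Longrightarrow> (G has_derivative (\<lambda>h. h *\<^sub>R (b * npow 1 (s *\<^sub>R b)))) (at s within {0..1})"
    by blast
  have "nlog (u *\<^sub>R b) = G u" if u: "u \<in> {0..1}" for u
    using nlog_sums[OF bs[OF u]] G(1)[OF u] by (simp add: pow sums_iff del: power_Suc)
  then show ?thesis
    using G(2)[OF s] s unfolding has_vector_derivative_def
    by (metis (no_types, lifting) has_derivative_transform)
qed

section \<open>Integrals of total derivatives\<close>

text \<open>G 1 x - G 0 x is the integral of D s x over s, and the majorant w, independent of s,
  permits Fubini. Used both for the parameter of the deformation and for translations.\<close>

lemma integral_difference:
  fixes D G :: "real \<Rightarrow> 'a::euclidean_space \<Rightarrow> real"
  assumes G: "\<And>s x. s \<in> {0..1} \<Longrightarrow> ((\<lambda>s. G s x) has_real_derivative D s x) (at s within {0..1})"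
    and D: "continuous_on ({0..1} \<times> UNIV) (\<lambda>p. D (fst p) (snd p))"
    and bound: "\<And>s x. s \<in> {0..1} \<Longrightarrow> \<bar>D s x\<bar> \<le> w x" and w: "integrable lborel w"
    and int: "integrable lborel (G 0)" "integrable lborel (G 1)"
  shows "(\<integral>x. G 1 x \<partial>lborel) - (\<integral>x. G 0 x \<partial>lborel) = (\<integral>s. indicator {0..1} s * (\<integral>x. D s x \<partial>lborel) \<partial>lborel)"
proof -
  let ?H = "\<lambda>s x. indicator {0..1} s * D s x"
  have ind: "(\<lambda>p. indicator ({0..1} \<times> UNIV) p *\<^sub>R D (fst p) (snd p)) = (\<lambda>(s, x). ?H s x)"
    by (auto simp: fun_eq_iff indicator_def)
  have "closed ({0..1 :: real} \<times> (UNIV :: 'a set))" by (intro closed_Times) auto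
  from borel_measurable_continuous_on_indicator[OF borel_closed[OF this] D]
  have meas: "(\<lambda>(s, x). ?H s x) \<in> borel_measurable (lborel \<Otimes>\<^sub>M lborel)"
    unfolding ind lborel_prod by simp
  have contx: "continuous_on UNIV (D s)" if "s \<in> {0..1}" for s
  proof -
    have "continuous_on UNIV (\<lambda>x. (s, x))" by (intro continuous_intros)
    from continuous_on_compose2[OF D this] that show ?thesis by (simp add: image_subset_iff)
  qed
  have conts: "continuous_on {0..1} (\<lambda>s. D s x)" for x
  proof -
    have "continuous_on {0..1} (\<lambda>s. (s, x))" by (intro continuous_intros)
    from continuous_on_compose2[OF D this] show ?thesis by (simp add: image_subset_iff)
  qed
  have Dint: "integrable lborel (D s)" if "s \<in> {0..1}" for s
    by (rule Bochner_Integration.integrable_bound[OF w])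
       (use contx[OF that] bound[OF that] in \<open>auto intro!: borel_measurable_continuous_onI always_eventually order_trans[OF _ abs_ge_self]\<close>)
  have w0: "0 \<le> w x" for x using bound[of 0 x] by simp
  have I: "integrable (lborel \<Otimes>\<^sub>M lborel) (\<lambda>(s, x). ?H s x)"
  proof (rule lborel_pair.Fubini_integrable[OF meas])
    show "AE s in lborel. integrable lborel (\<lambda>x. case (s, x) of (s, x) \<Rightarrow> ?H s x)"
      using Dint by (intro always_eventually allI) (auto simp: indicator_def)
    show "integrable lborel (\<lambda>s. \<integral>x. norm (case (s, x) of (s, x) \<Rightarrow> ?H s x) \<partial>lborel)"
    proof (rule Bochner_Integration.integrable_bound)
      show "integrable lborel (\<lambda>s :: real. indicator {0..1} s * (\<integral>x. w x \<partial>lborel))"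
        by (intro integrable_mult_left) (simp add: integrable_indicator_iff)
      show "(\<lambda>s. \<integral>x. norm (case (s, x) of (s, x) \<Rightarrow> ?H s x) \<partial>lborel) \<in> borel_measurable lborel"
        by (rule lborel.borel_measurable_lebesgue_integral) (use meas in measurable)
      show "AE s in lborel. norm (\<integral>x. norm (case (s, x) of (s, x) \<Rightarrow> ?H s x) \<partial>lborel) \<le> norm (indicator {0..1} s * (\<integral>x. w x \<partial>lborel))"
      proof (intro always_eventually allI)
        fix s :: real
        show "norm (\<integral>x. norm (case (s, x) of (s, x) \<Rightarrow> ?H s x) \<partial>lborel) \<le> norm (indicator {0..1} s * (\<integral>x. w x \<partial>lborel))"
        proof (cases "s \<in> {0..1}")
          case True
          have "(\<integral>x. \<bar>D s x\<bar> \<partial>lborel) \<le> (\<integral>x. w x \<partial>lborel)"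
            by (intro integral_mono integrable_abs Dint w bound True)
          then show ?thesis using True by (simp add: w0 abs_of_nonneg)
        qed simp
      qed
    qed
  qed
  have FTC: "(\<integral>s. ?H s x \<partial>lborel) = G 1 x - G 0 x" for x
    using integral_FTC_atLeastAtMost[of 0 1 "\<lambda>s. G s x" "\<lambda>s. D s x"] G conts
    by (simp add: has_real_derivative_iff_has_vector_derivative)
  have "(\<integral>x. G 1 x \<partial>lborel) - (\<integral>x. G 0 x \<partial>lborel) = (\<integral>x. (\<integral>s. ?H s x \<partial>lborel) \<partial>lborel)"
    unfolding FTC using int by simp
  also have "\<dots> = (\<integral>s. (\<integral>x. ?H s x \<partial>lborel) \<partial>lborel)"
    by (rule lborel_pair.Fubini_integral[OF I])
  finally show ?thesis by simp
qed

lemma lborel_translate: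
  fixes f :: "'a::euclidean_space \<Rightarrow> real"
  assumes f: "f \<in> borel_measurable borel"
  shows "(\<integral>x. f (x + a) \<partial>lborel) = (\<integral>x. f x \<partial>lborel)" "integrable lborel (\<lambda>x. f (x + a)) = integrable lborel f"
proof -
  have m: "(+) a \<in> measurable lborel borel" by simp
  show "(\<integral>x. f (x + a) \<partial>lborel) = (\<integral>x. f x \<partial>lborel)"
    using integral_distr[OF m, of f] f by (simp add: lborel_distr_plus add.commute)
  show "integrable lborel (\<lambda>x. f (x + a)) = integrable lborel f"
    using integrable_distr_eq[OF m, of f] f by (simp add: lborel_distr_plus add.commute)
qed

lemma integrable_gaussian:
  assumes "0 < c"
  shows "integrable lborel (\<lambda>x :: 'a::euclidean_space. exp (- c * (norm x)\<^sup>2))"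
proof (rule integrableI_nonneg)
  show "(\<integral>\<^sup>+x. ennreal (exp (- c * (norm x)\<^sup>2)) \<partial>(lborel :: 'a measure)) < \<infinity>"
    unfolding nn_integral_gaussian[OF assms] by simp
qed simp_all

lemma integral_gaussian:
  assumes "0 < c"
  shows "(\<integral>x. exp (- c * (norm x)\<^sup>2) \<partial>(lborel :: 'a::euclidean_space measure)) = (pi / c) powr (real DIM('a) / 2)"
  by (rule integral_eq_nn_integral[THEN trans]) (simp_all only: nn_integral_gaussian[OF assms], simp_all)

text \<open>Apply \<open>integral_difference\<close> to the translates of F along v. Translation
  invariance makes the left side vanish, and on the right the inner integral does not depend on
  s.\<close>

lemma integral_directional_derivative:
  fixes F D :: "'a::euclidean_space \<Rightarrow> real"
  assumes F: "\<And>x. ((\<lambda>t. F (x + t *\<^sub>R v)) has_real_derivative D x) (at 0)"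
    and D: "continuous_on UNIV D" and c: "0 < c" and bound: "\<And>x. \<bar>D x\<bar> \<le> C * exp (- c * (norm x)\<^sup>2)"
    and int: "integrable lborel F"
  shows "(\<integral>x. D x \<partial>lborel) = 0"
proof -
  have C: "0 \<le> C" using bound[of 0] by simp
  \<comment> \<open>A majorant for all translates by s v with s in the unit interval, from |x|^2
    \<le> 2 |x + s v|^2 + 2 |v|^2; this halves the exponent.\<close>
  let ?w = "\<lambda>x. C * exp (c * (norm v)\<^sup>2) * exp (- (c / 2) * (norm x)\<^sup>2)"
  have "(\<integral>x. F (x + 1 *\<^sub>R v) \<partial>lborel) - (\<integral>x. F (x + 0 *\<^sub>R v) \<partial>lborel) =
      (\<integral>s. indicator {0..1} s * (\<integral>x. D (x + s *\<^sub>R v) \<partial>lborel) \<partial>lborel)"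
  proof (rule integral_difference[where w = ?w])
    show "((\<lambda>s. F (x + s *\<^sub>R v)) has_real_derivative D (x + s *\<^sub>R v)) (at s within {0..1})" for s x
    proof -
      have "((\<lambda>t. F (x + (t + s) *\<^sub>R v)) has_real_derivative D (x + s *\<^sub>R v)) (at 0)"
        using F[of "x + s *\<^sub>R v"] by (simp add: scaleR_left_distrib add_ac)
      then have "((\<lambda>s. F (x + s *\<^sub>R v)) has_real_derivative D (x + s *\<^sub>R v)) (at (0 + s))"
        using DERIV_shift[of "\<lambda>s. F (x + s *\<^sub>R v)" "D (x + s *\<^sub>R v)" 0 s] by simp
      then show ?thesis by (simp add: has_field_derivative_at_within)
    qed
    show "continuous_on ({0..1} \<times> UNIV) (\<lambda>p. D (snd p + fst p *\<^sub>R v))"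
      by (intro continuous_on_compose2[OF D] continuous_intros) auto
    show "\<bar>D (x + s *\<^sub>R v)\<bar> \<le> ?w x" if s: "s \<in> {0..1}" for s x
    proof -
      have "norm x \<le> norm (x + s *\<^sub>R v) + norm (s *\<^sub>R v)"
        using norm_triangle_ineq4[of "x + s *\<^sub>R v" "s *\<^sub>R v"] by simp
      also have "norm (s *\<^sub>R v) \<le> norm v" using norm_scaleR_le_of_unit[OF order_refl s] .
      finally have "(norm x)\<^sup>2 \<le> (norm (x + s *\<^sub>R v) + norm v)\<^sup>2" by (intro power_mono) auto
      also have "\<dots> \<le> 2 * (norm (x + s *\<^sub>R v))\<^sup>2 + 2 * (norm v)\<^sup>2"
        using sum_squares_bound[of "norm (x + s *\<^sub>R v)" "norm v"] by (simp add: power2_sum)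
      finally have "c / 2 * (norm x)\<^sup>2 \<le> c / 2 * (2 * (norm (x + s *\<^sub>R v))\<^sup>2 + 2 * (norm v)\<^sup>2)"
        using c by (intro mult_left_mono) auto
      then have "exp (- c * (norm (x + s *\<^sub>R v))\<^sup>2) \<le> exp (c * (norm v)\<^sup>2 + - (c / 2) * (norm x)\<^sup>2)"
        by (simp add: algebra_simps)
      then show ?thesis
        using order_trans[OF bound[of "x + s *\<^sub>R v"] mult_left_mono[OF _ C]] by (simp only: exp_add mult.assoc)
    qed
    show "integrable lborel ?w" using c by (intro integrable_mult_right integrable_gaussian) simp
    show "integrable lborel (\<lambda>x. F (x + 0 *\<^sub>R v))" "integrable lborel (\<lambda>x. F (x + 1 *\<^sub>R v))"
      using int by (simp_all add: lborel_translate(2) borel_measurable_integrable[of lborel, simplified])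
  qed
  moreover have "(\<integral>x. D (x + s *\<^sub>R v) \<partial>lborel) = (\<integral>x. D x \<partial>lborel)" for s
    by (rule lborel_translate) (rule borel_measurable_continuous_onI[OF D])
  moreover have "(\<integral>x. F (x + 1 *\<^sub>R v) \<partial>lborel) = (\<integral>x. F x \<partial>lborel)"
    using int by (intro lborel_translate) (simp add: borel_measurable_integrable[of lborel, simplified])
  ultimately show ?thesis by simp
qed

text \<open>Half of the exponent absorbs the polynomial: with y = e x^2 / 2 both 1 and y are at most
  exp y, and b x^2 = (2 b / e) y.\<close>

lemma poly_gaussian_le:
  fixes a b e x :: real
  assumes "0 < e" "0 \<le> a" "0 \<le> b"
  shows "(a + b * x\<^sup>2) * exp (- e * x\<^sup>2) \<le> (a + 2 * b / e) * exp (- (e / 2) * x\<^sup>2)"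
proof -
  let ?y = "e / 2 * x\<^sup>2"
  have y: "0 \<le> ?y" using assms by simp
  have "a + b * x\<^sup>2 = a * 1 + 2 * b / e * ?y" using assms by simp
  also have "\<dots> \<le> a * exp ?y + 2 * b / e * exp ?y"
  proof -
    have "1 \<le> exp ?y" "?y \<le> exp ?y" using y exp_ge_add_one_self[of ?y] by linarith+
    then show ?thesis using assms by (intro add_mono mult_left_mono) auto
  qed
  finally have "(a + b * x\<^sup>2) * exp (- e * x\<^sup>2) \<le> (a + 2 * b / e) * exp ?y * exp (- e * x\<^sup>2)"
    by (intro mult_right_mono) (simp_all add: distrib_right)
  also have "\<dots> = (a + 2 * b / e) * exp (?y + - e * x\<^sup>2)" by (simp only: exp_add mult.assoc)
  also have "?y + - e * x\<^sup>2 = - (e / 2) * x\<^sup>2" by (simp add: field_simps)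
  finally show ?thesis .
qed

section \<open>Metrics with commuting entries\<close>

definition mat_trace :: "('n::finite, 'm::finite) torus_mat \<Rightarrow> 'n torus_op" where
  "mat_trace A = trace (mat_of A)"

lemma bounded_linear_mat_trace: "bounded_linear mat_trace"
  unfolding mat_trace_def[abs_def] trace_def by (intro bounded_linear_sum bounded_linear_entry)

lemma bounded_linear_quad_form_mat: "bounded_linear (\<lambda>A. quad_form (mat_of A) \<xi>)"
  unfolding quad_form_def
  by (intro bounded_linear_sum bounded_linear_compose[OF bounded_linear_scaleR_right bounded_linear_entry])

locale commuting_matrix = positive_matrix g c d for g :: "'n::finite torus_op^'m::finite^'m" and c d +
  assumes adjoint_entries: "is_adjoint (g $ i $ j) (g $ i $ j)"
    and commuting_entries: "g $ i $ j * g $ k $ l = g $ k $ l * g $ i $ j"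
begin

text \<open>The bicommutant of the entries of \<open>g\<close>; it is commutative because the entries commute.\<close>

definition alg :: "'n torus_op set" where
  "alg = {a. \<forall>x. (\<forall>i j. x * g $ i $ j = g $ i $ j * x) \<longrightarrow> x * a = a * x}"

lemma algI: "(\<And>x. (\<And>i j. x * g $ i $ j = g $ i $ j * x) \<Longrightarrow> x * a = a * x) \<Longrightarrow> a \<in> alg"
  by (simp add: alg_def)

lemma alg_commute: "a \<in> alg \<Longrightarrow> b \<in> alg \<Longrightarrow> a * b = b * a"
proof -
  assume a: "a \<in> alg" and b: "b \<in> alg"
  have "b * g $ i $ j = g $ i $ j * b" for i j using b commuting_entries by (simp add: alg_def)
  then show "a * b = b * a" using a by (simp add: alg_def)
qed

lemma alg_entry: "g $ i $ j \<in> alg"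
  by (rule algI) simp

lemma alg_0: "0 \<in> alg" and alg_1: "1 \<in> alg"
  by (simp_all add: alg_def)

lemma alg_add: "a \<in> alg \<Longrightarrow> b \<in> alg \<Longrightarrow> a + b \<in> alg"
  by (simp add: alg_def distrib_left distrib_right)

lemma alg_diff: "a \<in> alg \<Longrightarrow> b \<in> alg \<Longrightarrow> a - b \<in> alg"
  by (simp add: alg_def left_diff_distrib right_diff_distrib)

lemma alg_scaleR: "a \<in> alg \<Longrightarrow> r *\<^sub>R a \<in> alg"
  by (simp add: alg_def)

lemma alg_mult: "a \<in> alg \<Longrightarrow> b \<in> alg \<Longrightarrow> a * b \<in> alg"
proof (rule algI)
  fix x assume a: "a \<in> alg" and b: "b \<in> alg" and x: "\<And>i j. x * g $ i $ j = g $ i $ j * x"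
  have xa: "x * a = a * x" and xb: "x * b = b * x" using a b x by (auto simp: alg_def)
  have "x * (a * b) = (a * x) * b" unfolding xa[symmetric] by (rule mult.assoc[symmetric])
  also have "\<dots> = a * (b * x)" unfolding xb[symmetric] by (rule mult.assoc)
  also have "\<dots> = (a * b) * x" by (rule mult.assoc[symmetric])
  finally show "x * (a * b) = (a * b) * x" .
qed

lemma alg_uminus: "a \<in> alg \<Longrightarrow> - a \<in> alg"
  using alg_scaleR[of a "- 1"] by simp

lemma alg_sum: "(\<And>i. i \<in> I \<Longrightarrow> f i \<in> alg) \<Longrightarrow> sum f I \<in> alg"
  by (induction I rule: infinite_finite_induct) (auto intro: alg_add alg_0)

lemma alg_lim: "(\<And>m. f m \<in> alg) \<Longrightarrow> f \<longlonglongrightarrow> a \<Longrightarrow> a \<in> alg"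
proof (rule algI)
  fix x assume f: "\<And>m. f m \<in> alg" "f \<longlonglongrightarrow> a" and x: "\<And>i j. x * g $ i $ j = g $ i $ j * x"
  have "x * f m = f m * x" for m using f(1)[of m] x by (auto simp: alg_def)
  moreover have "(\<lambda>m. x * f m) \<longlonglongrightarrow> x * a" "(\<lambda>m. f m * x) \<longlonglongrightarrow> a * x"
    by (intro tendsto_intros f)+
  ultimately show "x * a = a * x" using LIMSEQ_unique by simp
qed

text \<open>The invariant carried through all power series in B: it is kept by sums, limits and
  multiplication by B. Entries in \<open>alg\<close> commute with each other, and symmetry lets rows
  and columns be exchanged in \<open>quad_form_shift\<close> and \<open>divergence\<close>.\<close>

definition sym :: "('n, 'm) torus_mat set" where
  "sym = {A. (\<forall>i j. mat_of A $ i $ j \<in> alg) \<and> (\<forall>i j. mat_of A $ i $ j = mat_of A $ j $ i) \<and> A * B = B * A}"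

lemma sym_alg: "A \<in> sym \<Longrightarrow> mat_of A $ i $ j \<in> alg"
  and sym_sym: "A \<in> sym \<Longrightarrow> mat_of A $ i $ j = mat_of A $ j $ i"
  and sym_B: "A \<in> sym \<Longrightarrow> A * B = B * A"
  unfolding sym_def by blast+

text \<open>The entry (j, i) is the adjoint of the entry (i, j) because g is selfadjoint as a
  matrix, and each entry is its own adjoint.\<close>

lemma g_symmetric: "g $ i $ j = g $ j $ i"
proof (rule op_eqI)
  fix v
  have "inner (op_apply (g $ i $ j) v) w = inner (op_apply (g $ j $ i) v) w" for w
  proof -
    have "is_adjoint (g $ i $ j) (g $ j $ i)" using pos by (simp add: mat_positive_def)
    then have "inner (op_apply (g $ i $ j) v) w = inner v (op_apply (g $ j $ i) w)"
      by (simp add: is_adjoint_iff_inner)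
    also have "\<dots> = inner (op_apply (g $ j $ i) v) w"
      using adjoint_entries[of j i] by (simp add: is_adjoint_iff_inner)
    finally show ?thesis .
  qed
  then have "inner (op_apply (g $ i $ j) v - op_apply (g $ j $ i) v) (op_apply (g $ i $ j) v - op_apply (g $ j $ i) v) = 0"
    by (simp only: inner_diff_left diff_self)
  then show "op_apply (g $ i $ j) v = op_apply (g $ j $ i) v" by simp
qed

lemma sym_1: "1 \<in> sym"
  by (auto simp: sym_def entry_1 alg_0 alg_1)

lemma entry_B: "mat_of B $ i $ j = (if i = j then 1 else 0) - (1 / c) *\<^sub>R g $ i $ j"
  by (simp add: B_def entry_simps entry_1 Mat_inverse)

lemma sym_BB: "B \<in> sym"
  using g_symmetric by (auto simp: sym_def entry_B intro!: alg_diff alg_uminus alg_scaleR alg_0 alg_1 alg_entry)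

lemma sym_scaleR: "A \<in> sym \<Longrightarrow> r *\<^sub>R A \<in> sym"
  by (auto simp: sym_def entry_simps intro!: alg_scaleR)

lemma sym_add: "A \<in> sym \<Longrightarrow> A' \<in> sym \<Longrightarrow> A + A' \<in> sym"
  by (auto simp: sym_def entry_simps distrib_left distrib_right intro!: alg_add)

lemma sym_diff: "A \<in> sym \<Longrightarrow> A' \<in> sym \<Longrightarrow> A - A' \<in> sym"
  by (auto simp: sym_def entry_simps left_diff_distrib right_diff_distrib intro!: alg_diff)

lemma entry_mult_alg:
  "(\<And>i j. mat_of A $ i $ j \<in> alg) \<Longrightarrow> (\<And>i j. mat_of A' $ i $ j \<in> alg) \<Longrightarrow> mat_of (A * A') $ i $ j \<in> alg"
  unfolding entry_mult by (intro alg_sum alg_mult)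

text \<open>Transposing A B gives B A, as both factors are symmetric and their entries commute; B A
  = A B then yields symmetry.\<close>

lemma sym_mult_B:
  assumes A: "A \<in> sym"
  shows "A * B \<in> sym"
  unfolding sym_def
proof (intro CollectI conjI allI)
  fix i j
  show "mat_of (A * B) $ i $ j \<in> alg" by (intro entry_mult_alg sym_alg A sym_BB)
  have "mat_of (A * B) $ i $ j = mat_of (B * A) $ j $ i"
    unfolding entry_mult
  proof (intro sum.cong refl)
    fix k
    have "mat_of A $ i $ k * mat_of B $ k $ j = mat_of B $ k $ j * mat_of A $ i $ k"
      by (rule alg_commute[OF sym_alg[OF A] sym_alg[OF sym_BB]])
    then show "mat_of A $ i $ k * mat_of B $ k $ j = mat_of B $ j $ k * mat_of A $ k $ i"
      using sym_sym[OF A, of i k] sym_sym[OF sym_BB, of k j] by simp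
  qed
  then show "mat_of (A * B) $ i $ j = mat_of (A * B) $ j $ i" using sym_B[OF A] by simp
  show "(A * B) * B = B * (A * B)" by (simp only: mult.assoc[symmetric] sym_B[OF A, symmetric])
qed

lemma sym_power: "B ^ m \<in> sym"
proof (induction m)
  case (Suc m)
  have "B ^ m * B \<in> sym" by (rule sym_mult_B[OF Suc])
  then show ?case by (simp add: power_commutes)
qed (simp add: sym_1)

lemma sym_sum: "(\<And>i. i \<in> I \<Longrightarrow> f i \<in> sym) \<Longrightarrow> sum f I \<in> sym"
proof (induction I rule: infinite_finite_induct)
  case (insert x F)
  then show ?case by (simp add: sym_add)
qed (use sym_scaleR[OF sym_1, of 0] in simp_all)

lemma sym_sums:
  assumes f: "\<And>m. f m \<in> sym" and A: "f sums A"
  shows "A \<in> sym"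
proof -
  define F where "F n = (\<Sum>m<n. f m)" for n
  have F: "F n \<in> sym" for n unfolding F_def by (intro sym_sum f)
  have lim: "F \<longlonglongrightarrow> A" using A by (simp add: sums_def F_def[abs_def])
  have e: "(\<lambda>n. mat_of (F n) $ i $ j) \<longlonglongrightarrow> mat_of A $ i $ j" for i j
    by (rule bounded_linear.tendsto[OF bounded_linear_entry lim])
  show ?thesis
    unfolding sym_def
  proof (intro CollectI conjI allI)
    fix i j
    show "mat_of A $ i $ j \<in> alg" by (rule alg_lim[OF sym_alg[OF F] e])
    show "mat_of A $ i $ j = mat_of A $ j $ i"
      using e[of i j] e[of j i] unfolding sym_sym[OF F, of _ i j] by (rule LIMSEQ_unique)
    have "(\<lambda>n. F n * B) \<longlonglongrightarrow> A * B" "(\<lambda>n. B * F n) \<longlonglongrightarrow> B * A" by (intro tendsto_intros lim)+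
    then show "A * B = B * A" unfolding sym_B[OF F] by (rule LIMSEQ_unique)
  qed
qed

text \<open>Along the segment \<open>G s\<close> from the scalar c to g, \<open>H s\<close> is the
  inverse and \<open>Lg s\<close> the logarithm, while \<open>P s\<close> is minus the s-derivative
  of the logarithm; hence the derivative of H is H P, and that of G is - P G.\<close>

definition N :: "real \<Rightarrow> ('n, 'm) torus_mat" where "N s = npow 1 (s *\<^sub>R B)"
definition P :: "real \<Rightarrow> ('n, 'm) torus_mat" where "P s = N s * B"
definition H :: "real \<Rightarrow> ('n, 'm) torus_mat" where "H s = (1 / c) *\<^sub>R N s"
definition Lg :: "real \<Rightarrow> ('n, 'm) torus_mat" where "Lg s = ln c *\<^sub>R 1 - nlog (s *\<^sub>R B)"
definition G :: "real \<Rightarrow> ('n, 'm) torus_mat" where "G s = c *\<^sub>R (1 - s *\<^sub>R B)"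

lemma norm_sB: "s \<in> {0..1} \<Longrightarrow> norm (s *\<^sub>R B) \<le> \<rho>" "s \<in> {0..1} \<Longrightarrow> norm (s *\<^sub>R B) < 1"
  using norm_scaleR_le_of_unit[OF norm_B, of s] \<rho> by auto

lemma sym_N: "s \<in> {0..1} \<Longrightarrow> N s \<in> sym"
  unfolding N_def by (rule sym_sums[OF _ npow_1_sums[OF norm_sB(2)]]) (auto simp: scaleR_power intro: sym_scaleR sym_power)

lemma sym_P: "s \<in> {0..1} \<Longrightarrow> P s \<in> sym"
  unfolding P_def by (intro sym_mult_B sym_N)

lemma sym_H: "s \<in> {0..1} \<Longrightarrow> H s \<in> sym"
  unfolding H_def by (intro sym_scaleR sym_N)

lemma sym_Lg: "s \<in> {0..1} \<Longrightarrow> Lg s \<in> sym"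
  unfolding Lg_def
  by (intro sym_diff sym_scaleR sym_1 sym_sums[OF _ nlog_sums[OF norm_sB(2)]])
     (auto simp: scaleR_power simp del: power_Suc intro!: sym_scaleR sym_power)

lemma G_H: "s \<in> {0..1} \<Longrightarrow> G s * H s = 1" "s \<in> {0..1} \<Longrightarrow> H s * G s = 1"
  using neumann_inverse[OF norm_sB(2)] c by (simp_all add: G_def H_def N_def)

lemma G_1: "G 1 = Mat g" by (simp add: G_def Mat_g)
lemma G_0: "G 0 = c *\<^sub>R 1" by (simp add: G_def)
lemma Lg_1: "Lg 1 = L" by (simp add: Lg_def L_def)
lemma Lg_0: "Lg 0 = ln c *\<^sub>R 1" by (simp add: Lg_def nlog_def)

lemma H_0: "H 0 = (1 / c) *\<^sub>R 1"
  using neumann_inverse(1)[of "0 :: ('n, 'm) torus_mat"] by (simp add: H_def N_def)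

lemma H_1: "H 1 = Mat (matrix_inv g)"
proof -
  have "Mat g * H 1 = 1" "H 1 * Mat g = 1" using G_H[of 1] by (simp_all add: G_1)
  from arg_cong[OF this(1), of mat_of] arg_cong[OF this(2), of mat_of]
  have "matrix_inv g = mat_of (H 1)"
    by (intro matrix_inv_eqI) (simp_all add: times_torus_mat.rep_eq one_torus_mat.rep_eq Mat_inverse)
  then show ?thesis by (simp add: mat_of_inverse)
qed

lemma N_derivative: "s \<in> {0..1} \<Longrightarrow> (N has_vector_derivative N s * P s) (at s within {0..1})"
  using npow_1_derivative[OF norm_B \<rho>(2)] sym_B[OF sym_N] by (simp add: N_def[abs_def] P_def)

lemma H_derivative: "s \<in> {0..1} \<Longrightarrow> (H has_vector_derivative H s * P s) (at s within {0..1})"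
  using bounded_linear.has_vector_derivative[OF bounded_linear_scaleR_right N_derivative, of s "1 / c"]
  by (simp add: H_def[abs_def])

lemma Lg_derivative: "s \<in> {0..1} \<Longrightarrow> (Lg has_vector_derivative - P s) (at s within {0..1})"
  using has_vector_derivative_diff[OF has_vector_derivative_const nlog_derivative[OF norm_B \<rho>(2)], of s "ln c *\<^sub>R 1"]
    sym_B[OF sym_N] by (simp add: Lg_def[abs_def] P_def N_def)

lemma G_derivative: "(G has_vector_derivative - (c *\<^sub>R B)) (at s within {0..1})"
  unfolding G_def by (auto intro!: derivative_eq_intros)

lemma G_P: "s \<in> {0..1} \<Longrightarrow> P s * G s = c *\<^sub>R B" "s \<in> {0..1} \<Longrightarrow> G s * P s = c *\<^sub>R B"
proof -
  assume s: "s \<in> {0..1}"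
  have "G s * P s = c *\<^sub>R (((1 - s *\<^sub>R B) * npow 1 (s *\<^sub>R B)) * B)"
    by (simp add: G_def P_def N_def mult.assoc)
  then show "G s * P s = c *\<^sub>R B" by (simp only: neumann_inverse[OF norm_sB(2)[OF s]] mult_1_left)
  have "P s * G s = c *\<^sub>R (B * (npow 1 (s *\<^sub>R B) * (1 - s *\<^sub>R B)))"
    using sym_B[OF sym_N[OF s]] by (simp add: G_def P_def N_def mult.assoc)
  then show "P s * G s = c *\<^sub>R B" by (simp only: neumann_inverse[OF norm_sB(2)[OF s]] mult_1_right)
qed

lemma continuous_paths:
  "continuous_on {0..1} N" "continuous_on {0..1} P" "continuous_on {0..1} H" "continuous_on {0..1} Lg"
proof -
  show N: "continuous_on {0..1} N" using npow_1_continuous[OF norm_B \<rho>(2)] by (simp add: N_def[abs_def])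
  show "continuous_on {0..1} P" unfolding P_def[abs_def] by (intro continuous_intros N)
  show "continuous_on {0..1} H" unfolding H_def[abs_def] by (intro continuous_intros N)
  show "continuous_on {0..1} Lg" 
    unfolding continuous_on_eq_continuous_within using Lg_derivative has_vector_derivative_continuous by blast
qed

lemma alg_trace: "A \<in> sym \<Longrightarrow> mat_trace A \<in> alg"
  unfolding mat_trace_def trace_def by (intro alg_sum sym_alg)

lemma alg_quad_form: "(\<And>i j. mat_of A $ i $ j \<in> alg) \<Longrightarrow> quad_form (mat_of A) \<xi> \<in> alg"
  unfolding quad_form_def by (intro alg_sum alg_scaleR)

end

lemma (in hilbert_rep) coercive_scaleR: "coercive d a \<Longrightarrow> 0 \<le> r \<Longrightarrow> coercive (r * d) (r *\<^sub>R a)"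
  by (auto simp: coercive_def sa_scaleR act_simps mult.assoc mult_left_mono)

lemma path_bounded:
  fixes X :: "real \<Rightarrow> 'a::real_normed_vector"
  assumes "continuous_on {0..1} X"
  obtains M where "0 \<le> M" "\<And>s. s \<in> {0..1} \<Longrightarrow> norm (X s) \<le> M"
proof -
  have "bounded (X ` {0..1})" by (intro compact_imp_bounded compact_continuous_image assms) simp
  then obtain M where "\<And>s. s \<in> {0..1} \<Longrightarrow> norm (X s) \<le> M" unfolding bounded_iff by blast
  then show ?thesis using that[of "max 0 M"] by (meson max.cobounded1 max.coboundedI2)
qed

lemma norm_quad_form_mat_le:
  fixes A :: "('n::finite, 'm::finite) torus_mat"
  shows "norm (quad_form (mat_of A) \<xi>) \<le> (real CARD('m))\<^sup>2 * norm A * (norm \<xi>)\<^sup>2"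
proof -
  have "entry_sum (mat_of A) \<le> (\<Sum>i\<in>(UNIV :: 'm set). \<Sum>j\<in>(UNIV :: 'm set). norm A)"
    unfolding entry_sum_def by (intro sum_mono norm_entry_le)
  then have "entry_sum (mat_of A) \<le> (real CARD('m))\<^sup>2 * norm A" by (simp add: power2_eq_square mult.assoc)
  then show ?thesis using norm_quad_form_le[of "mat_of A" \<xi>] mult_right_mono zero_le_power2 order_trans by metis
qed

text \<open>Component k of M \<xi>; for symmetric M it is half the k-th partial derivative of
  \<open>quad_form M\<close>.\<close>

definition row_form :: "'n::finite torus_op^'m^'m \<Rightarrow> 'm \<Rightarrow> real^'m \<Rightarrow> 'n torus_op" where
  "row_form M k \<xi> = (\<Sum>l\<in>UNIV. \<xi> $ l *\<^sub>R M $ k $ l)"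

lemma norm_row_form_le:
  fixes A :: "('n::finite, 'm::finite) torus_mat"
  shows "norm (row_form (mat_of A) k \<xi>) \<le> real CARD('m) * norm A * norm \<xi>"
proof -
  have "norm (row_form (mat_of A) k \<xi>) \<le> (\<Sum>l\<in>(UNIV :: 'm set). norm \<xi> * norm A)"
    unfolding row_form_def
    by (intro sum_norm_le) (simp add: mult_mono component_le_norm_cart norm_entry_le)
  then show ?thesis by (simp add: mult_ac)
qed

lemma row_form_shift: "row_form M k (\<xi> + t *\<^sub>R axis k 1) = row_form M k \<xi> + t *\<^sub>R M $ k $ k"
proof -
  have "(\<xi> + t *\<^sub>R axis k 1) $ l *\<^sub>R M $ k $ l = \<xi> $ l *\<^sub>R M $ k $ l + (if l = k then t *\<^sub>R M $ k $ k else 0)" for l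
    by (simp add: axis_def scaleR_left_distrib)
  then show ?thesis by (simp add: row_form_def sum.distrib)
qed

lemma quad_form_row_form: "quad_form M \<xi> = (\<Sum>k\<in>UNIV. \<xi> $ k *\<^sub>R row_form M k \<xi>)"
  by (simp add: quad_form_def row_form_def scaleR_sum_right)

lemma quad_form_shift:
  assumes "\<And>i j. M $ i $ j = M $ j $ i"
  shows "quad_form M (\<xi> + t *\<^sub>R axis k 1) = quad_form M \<xi> + t *\<^sub>R (2 *\<^sub>R row_form M k \<xi>) + (t * t) *\<^sub>R M $ k $ k"
proof -
  let ?\<eta> = "\<xi> + t *\<^sub>R axis k 1"
  have r: "row_form M i ?\<eta> = row_form M i \<xi> + t *\<^sub>R M $ k $ i" for i
  proof -
    have "?\<eta> $ l *\<^sub>R M $ i $ l = \<xi> $ l *\<^sub>R M $ i $ l + (if l = k then t *\<^sub>R M $ i $ k else 0)" for l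
      by (simp add: axis_def scaleR_left_distrib)
    then show ?thesis by (simp add: row_form_def sum.distrib assms[of i k])
  qed
  have "?\<eta> $ i *\<^sub>R row_form M i ?\<eta> = \<xi> $ i *\<^sub>R row_form M i \<xi> + t *\<^sub>R (\<xi> $ i *\<^sub>R M $ k $ i) +
      (if i = k then t *\<^sub>R row_form M k \<xi> + (t * t) *\<^sub>R M $ k $ k else 0)" for i
    unfolding r by (simp add: axis_def scaleR_left_distrib scaleR_right_distrib distrib_left mult.commute)
  then have "quad_form M ?\<eta> = quad_form M \<xi> + t *\<^sub>R row_form M k \<xi> + (t *\<^sub>R row_form M k \<xi> + (t * t) *\<^sub>R M $ k $ k)"
    unfolding quad_form_row_form by (simp only: sum.distrib) (simp add: row_form_def scaleR_sum_right)
  then show ?thesis by (simp add: scaleR_2 scaleR_right_distrib)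
qed

lemma continuous_row_form: "continuous_on UNIV (row_form M k)"
  unfolding row_form_def[abs_def] by (intro continuous_intros)

lemma integrable_gaussian_dominated:
  fixes F :: "'a::euclidean_space \<Rightarrow> real"
  assumes "continuous_on UNIV F" "0 < c" "\<And>x. \<bar>F x\<bar> \<le> C * exp (- c * (norm x)\<^sup>2)"
  shows "integrable lborel F"
proof (rule Bochner_Integration.integrable_bound)
  show "integrable lborel (\<lambda>x :: 'a. C * exp (- c * (norm x)\<^sup>2))"
    using assms(2) by (intro integrable_mult_right integrable_gaussian)
  show "F \<in> borel_measurable lborel" using borel_measurable_continuous_onI[OF assms(1)] by simp
  show "AE x in lborel. norm (F x) \<le> norm (C * exp (- c * (norm x)\<^sup>2))"
    using assms(3) by (intro always_eventually allI) (auto intro: order_trans[OF _ abs_ge_self] simp del: abs_mult)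
qed

section \<open>The Gaussian along the segment and its conserved integral\<close>

context commuting_matrix
begin

definition q :: "real \<Rightarrow> real^'m \<Rightarrow> 'n torus_op" where "q s \<xi> = quad_form (mat_of (H s)) \<xi>"
definition A :: "real \<Rightarrow> real^'m \<Rightarrow> 'n torus_op" where "A s \<xi> = - ((1 / 2) *\<^sub>R mat_trace (Lg s)) - q s \<xi>"
definition A' :: "real \<Rightarrow> real^'m \<Rightarrow> 'n torus_op" where
  "A' s \<xi> = (1 / 2) *\<^sub>R mat_trace (P s) - quad_form (mat_of (H s * P s)) \<xi>"
definition f :: "real \<Rightarrow> real^'m \<Rightarrow> 'n torus_op" where "f s \<xi> = exp (A s \<xi>)"

lemma alg_exp: "a \<in> alg \<Longrightarrow> exp a \<in> alg"
proof -
  assume a: "a \<in> alg"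
  have "a ^ m \<in> alg" for m by (induction m) (auto intro: alg_1 alg_mult a)
  then have "(\<Sum>m<n. a ^ m /\<^sub>R fact m) \<in> alg" for n by (intro alg_sum alg_scaleR)
  then show ?thesis using exp_converges[of a] unfolding sums_def by (rule alg_lim)
qed

lemma alg_q: "s \<in> {0..1} \<Longrightarrow> q s \<xi> \<in> alg"
  unfolding q_def by (intro alg_quad_form sym_alg sym_H)

lemma alg_A: "s \<in> {0..1} \<Longrightarrow> A s \<xi> \<in> alg"
  unfolding A_def by (intro alg_diff alg_uminus alg_scaleR alg_trace sym_Lg alg_q)

lemma alg_f: "s \<in> {0..1} \<Longrightarrow> f s \<xi> \<in> alg"
  unfolding f_def by (intro alg_exp alg_A)

lemma alg_row_form: "X \<in> sym \<Longrightarrow> row_form (mat_of X) k \<xi> \<in> alg"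
  unfolding row_form_def by (intro alg_sum alg_scaleR sym_alg)

lemma f_derivative:
  assumes s: "s \<in> {0..1}"
  shows "((\<lambda>s. f s \<xi>) has_vector_derivative f s \<xi> * A' s \<xi>) (at s within {0..1})"
  unfolding f_def
proof (rule has_vector_derivative_exp_commuting[OF _ s])
  have 1: "((\<lambda>s. mat_trace (Lg s)) has_vector_derivative mat_trace (- P s)) (at s within {0..1})"
    by (rule bounded_linear.has_vector_derivative[OF bounded_linear_mat_trace Lg_derivative[OF s]])
  have 2: "((\<lambda>s. q s \<xi>) has_vector_derivative quad_form (mat_of (H s * P s)) \<xi>) (at s within {0..1})"
    unfolding q_def by (rule bounded_linear.has_vector_derivative[OF bounded_linear_quad_form_mat H_derivative[OF s]])
  have "((\<lambda>s. A s \<xi>) has_vector_derivative - ((1 / 2) *\<^sub>R mat_trace (- P s)) - quad_form (mat_of (H s * P s)) \<xi>) (at s within {0..1})"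
    unfolding A_def
    by (intro has_vector_derivative_diff has_vector_derivative_minus 2
        bounded_linear.has_vector_derivative[OF bounded_linear_scaleR_right 1])
  then show "((\<lambda>s. A s \<xi>) has_vector_derivative A' s \<xi>) (at s within {0..1})"
    by (simp add: A'_def linear_simps[OF bounded_linear_mat_trace])
qed (intro alg_commute alg_A s)

lemma continuous_fst_path: "continuous_on {0..1} X \<Longrightarrow> continuous_on ({0..1} \<times> UNIV) (\<lambda>p. X (fst p))"
  by (rule continuous_on_compose2[where g = X]) (auto intro: continuous_intros)

lemma continuous_quad_path:
  fixes X :: "real \<Rightarrow> ('n, 'm) torus_mat"
  assumes X: "continuous_on {0..1} X"
  shows "continuous_on ({0..1} \<times> UNIV) (\<lambda>p. quad_form (mat_of (X (fst p))) (snd p))"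
proof -
  have e: "continuous_on ({0..1} \<times> UNIV) (\<lambda>p. mat_of (X (fst p)) $ i $ j)" for i j
    by (rule bounded_linear.continuous_on[OF bounded_linear_entry continuous_fst_path[OF X]])
  show ?thesis unfolding quad_form_def by (intro continuous_on_sum continuous_on_scaleR e continuous_intros)
qed

lemma continuous_f: "continuous_on ({0..1} \<times> UNIV) (\<lambda>p. f (fst p) (snd p))"
  unfolding f_def
proof (rule continuous_on_exp_commuting)
  show "continuous_on ({0..1} \<times> UNIV) (\<lambda>p. A (fst p) (snd p))"
    unfolding A_def q_def
    by (intro continuous_on_diff continuous_on_minus continuous_quad_path continuous_paths
        continuous_on_scaleR continuous_on_const continuous_fst_path[where X = "\<lambda>s. mat_trace (Lg s)"]
        bounded_linear.continuous_on[OF bounded_linear_mat_trace])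
  fix p p' :: "real \<times> (real^'m)" assume "p \<in> {0..1} \<times> UNIV" "p' \<in> {0..1} \<times> UNIV"
  then show "A (fst p) (snd p) * A (fst p') (snd p') = A (fst p') (snd p') * A (fst p) (snd p)"
    by (intro alg_commute alg_A) auto
qed

lemma continuous_A': "continuous_on ({0..1} \<times> UNIV) (\<lambda>p. A' (fst p) (snd p))"
proof -
  have 1: "continuous_on ({0..1} \<times> UNIV) (\<lambda>p. quad_form (mat_of (H (fst p) * P (fst p))) (snd p))"
    using continuous_quad_path[OF continuous_on_mult[OF continuous_paths(3,2)]] .
  show ?thesis
    unfolding A'_def
    by (intro continuous_on_diff 1 continuous_paths
        continuous_on_scaleR continuous_on_const continuous_fst_path[where X = "\<lambda>s. mat_trace (P s)"]
        bounded_linear.continuous_on[OF bounded_linear_mat_trace])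
qed

lemma continuous_f_slice: "s \<in> {0..1} \<Longrightarrow> continuous_on UNIV (f s)"
proof -
  assume s: "s \<in> {0..1}"
  have "continuous_on UNIV (\<lambda>\<xi> :: real^'m. (s, \<xi>))" by (intro continuous_intros)
  from continuous_on_compose2[OF continuous_f this] s show ?thesis by (simp add: image_subset_iff)
qed

lemma f_split: "s \<in> {0..1} \<Longrightarrow> f s \<xi> = exp (- ((1 / 2) *\<^sub>R mat_trace (Lg s))) * exp (- q s \<xi>)"
  unfolding f_def A_def diff_conv_add_uminus
  by (intro exp_add_commuting alg_commute alg_uminus alg_scaleR alg_trace sym_Lg alg_q)

text \<open>Since the norm of s B stays below \<rho>, \<open>coercive_npow_uniform\<close> bounds H
  s from below by one constant for all s, and the trace factor is bounded by compactness. The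
  majorant is therefore independent of s.\<close>

lemma f_bound: obtains K e where "0 < e" "0 \<le> K" "\<And>s \<xi>. s \<in> {0..1} \<Longrightarrow> norm (f s \<xi>) \<le> K * exp (- e * (norm \<xi>)\<^sup>2)"
proof -
  obtain d' where d': "0 < d'" "\<And>b. mat.sa b \<Longrightarrow> norm b \<le> \<rho> \<Longrightarrow> mat.coercive d' (npow 1 (b :: ('n, 'm) torus_mat))"
    using mat.coercive_npow_uniform[OF \<rho>(2), of 1] by blast
  have saB: "mat.sa B"
    unfolding B_def using mat.coerciveD(1)[OF coercive] by (intro mat.sa_diff mat.sa_scaleR) auto
  have q: "op.coercive (d' / c * (norm \<xi>)\<^sup>2) (q s \<xi>)" if s: "s \<in> {0..1}" for s \<xi>
  proof -
    have "mat.coercive (1 / c * d') (H s)"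
      unfolding H_def N_def using c by (intro mat.coercive_scaleR d' mat.sa_scaleR saB norm_sB s) simp
    then show ?thesis unfolding q_def by (intro coercive_quad_form) simp
  qed
  have "continuous_on {0..1} (\<lambda>s. - ((1 / 2) *\<^sub>R mat_trace (Lg s)))"
    by (intro continuous_intros bounded_linear.continuous_on[OF bounded_linear_mat_trace] continuous_paths)
  then obtain M where M: "0 \<le> M" "\<And>s. s \<in> {0..1} \<Longrightarrow> norm (- ((1 / 2) *\<^sub>R mat_trace (Lg s))) \<le> M"
    using path_bounded by blast
  show ?thesis
  proof (rule that[of "d' / c" "exp M"])
    fix s :: real and \<xi> :: "real^'m" assume s: "s \<in> {0..1}"
    have "norm (exp (- ((1 / 2) *\<^sub>R mat_trace (Lg s)))) \<le> exp M"
      using order_trans[OF norm_exp] M(2)[OF s] by (metis exp_le_cancel_iff)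
    moreover have "norm (exp (- q s \<xi>)) \<le> exp (- (d' / c * (norm \<xi>)\<^sup>2))" by (rule op.norm_exp_uminus_le[OF q[OF s]])
    ultimately have "norm (f s \<xi>) \<le> exp M * exp (- (d' / c * (norm \<xi>)\<^sup>2))"
      unfolding f_split[OF s] by (intro order_trans[OF norm_mult_ineq] mult_mono) auto
    then show "norm (f s \<xi>) \<le> exp M * exp (- (d' / c) * (norm \<xi>)\<^sup>2)" by simp
  qed (use d' c in auto)
qed

lemma f_directional:
  assumes s: "s \<in> {0..1}"
  shows "((\<lambda>t. f s (\<xi> + t *\<^sub>R axis k 1)) has_vector_derivative f s \<xi> * - (2 *\<^sub>R row_form (mat_of (H s)) k \<xi>)) (at 0)"
proof -
  have "((\<lambda>t. q s (\<xi> + t *\<^sub>R axis k 1)) has_vector_derivative 2 *\<^sub>R row_form (mat_of (H s)) k \<xi>) (at 0)"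
    unfolding q_def quad_form_shift[OF sym_sym[OF sym_H[OF s]]] by (auto intro!: derivative_eq_intros)
  then have "((\<lambda>t. A s (\<xi> + t *\<^sub>R axis k 1)) has_vector_derivative 0 - 2 *\<^sub>R row_form (mat_of (H s)) k \<xi>) (at 0)"
    unfolding A_def by (intro has_vector_derivative_diff has_vector_derivative_const)
  then have "((\<lambda>t. exp (A s (\<xi> + t *\<^sub>R axis k 1))) has_vector_derivative
      exp (A s (\<xi> + 0 *\<^sub>R axis k 1)) * (0 - 2 *\<^sub>R row_form (mat_of (H s)) k \<xi>)) (at 0)"
    by (rule has_vector_derivative_exp_commuting[where S = UNIV and A = "\<lambda>t. A s (\<xi> + t *\<^sub>R axis k 1)"])
       (auto intro: alg_commute alg_A s)
  then show ?thesis by (simp add: f_def)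
qed

text \<open>
  The \<open>s\<close>-derivative of the Gaussian \<open>f s\<close> is the divergence of the vector field
  \<open>\<xi> \<mapsto> P s \<xi> * f s \<xi> / 2\<close>.
\<close>

definition flux :: "'m \<Rightarrow> real \<Rightarrow> real^'m \<Rightarrow> 'n torus_op" where
  "flux k s \<xi> = ((1 / 2) *\<^sub>R row_form (mat_of (P s)) k \<xi>) * f s \<xi>"

definition flux' :: "'m \<Rightarrow> real \<Rightarrow> real^'m \<Rightarrow> 'n torus_op" where
  "flux' k s \<xi> = ((1 / 2) *\<^sub>R row_form (mat_of (P s)) k \<xi>) * (f s \<xi> * - (2 *\<^sub>R row_form (mat_of (H s)) k \<xi>)) +
     ((1 / 2) *\<^sub>R mat_of (P s) $ k $ k) * f s \<xi>"

lemma flux_directional: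
  assumes s: "s \<in> {0..1}"
  shows "((\<lambda>t. flux k s (\<xi> + t *\<^sub>R axis k 1)) has_vector_derivative flux' k s \<xi>) (at 0)"
proof -
  have "((\<lambda>t. (1 / 2) *\<^sub>R row_form (mat_of (P s)) k (\<xi> + t *\<^sub>R axis k 1)) has_vector_derivative (1 / 2) *\<^sub>R mat_of (P s) $ k $ k) (at 0)"
    unfolding row_form_shift by (auto intro!: derivative_eq_intros)
  from has_vector_derivative_mult[OF this f_directional[OF s, of \<xi> k]]
  show ?thesis by (simp add: flux_def flux'_def)
qed

text \<open>Differentiating the components of P \<xi> / 2 contributes half the trace of P.
  Differentiating the exponential contributes minus the sum of (H \<xi>)_k (P \<xi>)_k, which is the
  form of H P by symmetry of H. The sum is A', and commutativity lets f stand in front.\<close>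

lemma divergence:
  assumes s: "s \<in> {0..1}"
  shows "f s \<xi> * A' s \<xi> = (\<Sum>k\<in>UNIV. flux' k s \<xi>)"
proof -
  let ?p = "\<lambda>k. row_form (mat_of (P s)) k \<xi>" and ?h = "\<lambda>k. row_form (mat_of (H s)) k \<xi>"
  have fl: "flux' k s \<xi> = f s \<xi> * ((1 / 2) *\<^sub>R mat_of (P s) $ k $ k) - f s \<xi> * (?h k * ?p k)" for k
  proof -
    have 1: "?p k * (f s \<xi> * ?h k) = f s \<xi> * (?h k * ?p k)"
    proof -
      have "?p k * (f s \<xi> * ?h k) = (f s \<xi> * ?h k) * ?p k"
        by (intro alg_commute alg_mult alg_row_form sym_P sym_H alg_f s)
      then show ?thesis by (simp only: mult.assoc)
    qed
    have 2: "mat_of (P s) $ k $ k * f s \<xi> = f s \<xi> * mat_of (P s) $ k $ k"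
      by (intro alg_commute sym_alg sym_P alg_f s)
    show ?thesis unfolding flux'_def by (simp add: 1 2)
  qed
  have "quad_form (mat_of (H s * P s)) \<xi> = (\<Sum>k\<in>UNIV. ?h k * ?p k)"
  proof -
    have "(\<Sum>k\<in>UNIV. ?h k * ?p k) = (\<Sum>k\<in>UNIV. \<Sum>i\<in>UNIV. \<Sum>j\<in>UNIV. (\<xi> $ i * \<xi> $ j) *\<^sub>R (mat_of (H s) $ i $ k * mat_of (P s) $ k $ j))"
      unfolding row_form_def by (simp add: sum_product sym_sym[OF sym_H[OF s], of _ k for k] mult.commute)
    also have "\<dots> = (\<Sum>i\<in>UNIV. \<Sum>k\<in>UNIV. \<Sum>j\<in>UNIV. (\<xi> $ i * \<xi> $ j) *\<^sub>R (mat_of (H s) $ i $ k * mat_of (P s) $ k $ j))"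
      by (rule sum.swap)
    also have "\<dots> = (\<Sum>i\<in>UNIV. \<Sum>j\<in>UNIV. \<Sum>k\<in>UNIV. (\<xi> $ i * \<xi> $ j) *\<^sub>R (mat_of (H s) $ i $ k * mat_of (P s) $ k $ j))"
      by (intro sum.cong refl sum.swap)
    finally show ?thesis by (simp add: quad_form_def entry_mult scaleR_sum_right)
  qed
  then show ?thesis
    by (simp add: A'_def mat_trace_def trace_def fl sum_subtractf right_diff_distrib sum_distrib_left scaleR_sum_right)
qed

lemma flux_integral:
  fixes \<phi> :: "'n torus_op \<Rightarrow> real"
  assumes s: "s \<in> {0..1}" and \<phi>: "bounded_linear \<phi>"
  shows "integrable lborel (\<lambda>\<xi>. \<phi> (flux' k s \<xi>))" "(\<integral>\<xi>. \<phi> (flux' k s \<xi>) \<partial>lborel) = 0"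
proof -
  obtain K e where K: "0 < e" "0 \<le> K" "\<And>\<xi>. norm (f s \<xi>) \<le> K * exp (- e * (norm \<xi>)\<^sup>2)" using f_bound s by metis
  obtain M where M: "0 \<le> M" "\<And>x. \<bar>\<phi> x\<bar> \<le> norm x * M" using bounded_linear.nonneg_bounded[OF \<phi>] by (auto simp: real_norm_def)
  define p h where "p = real CARD('m) * norm (P s)" and "h = real CARD('m) * norm (H s)"
  have ph: "0 \<le> p" "0 \<le> h" by (simp_all add: p_def h_def)
  have np: "norm (row_form (mat_of (P s)) k \<xi>) \<le> p * norm \<xi>" "norm (row_form (mat_of (H s)) k \<xi>) \<le> h * norm \<xi>" for \<xi>
    using norm_row_form_le[of "P s" k \<xi>] norm_row_form_le[of "H s" k \<xi>] by (simp_all add: p_def h_def)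
  let ?g = "\<lambda>\<xi>. K * exp (- e * (norm \<xi>)\<^sup>2)"
  have g0: "0 \<le> ?g \<xi>" for \<xi> :: "real^'m" using K by simp
  have n1: "norm (flux k s \<xi>) \<le> (p + p * (norm \<xi>)\<^sup>2) * ?g \<xi>" for \<xi>
  proof -
    have "norm \<xi> \<le> 1 + (norm \<xi>)\<^sup>2" using power2_diff[of "norm \<xi>" 1] zero_le_power2[of "norm \<xi> - 1"] by simp (smt (verit) norm_ge_zero)
    then have "p * norm \<xi> \<le> p + p * (norm \<xi>)\<^sup>2" using mult_left_mono[OF _ ph(1)] by (fastforce simp: distrib_left)
    then have "norm ((1 / 2) *\<^sub>R row_form (mat_of (P s)) k \<xi>) \<le> p + p * (norm \<xi>)\<^sup>2"
    proof -
      have "norm ((1 / 2) *\<^sub>R row_form (mat_of (P s)) k \<xi>) \<le> norm (row_form (mat_of (P s)) k \<xi>)" by simp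
      then show ?thesis using np(1)[of \<xi>] \<open>p * norm \<xi> \<le> p + p * (norm \<xi>)\<^sup>2\<close> by linarith
    qed
    then show ?thesis
      unfolding flux_def by (intro order_trans[OF norm_mult_ineq] mult_mono K(3)) (auto simp: ph)
  qed
  have n2: "norm (flux' k s \<xi>) \<le> (norm (P s) + p * h * (norm \<xi>)\<^sup>2) * ?g \<xi>" for \<xi>
  proof -
    let ?a = "(1 / 2) *\<^sub>R row_form (mat_of (P s)) k \<xi>" and ?b = "- (2 *\<^sub>R row_form (mat_of (H s)) k \<xi>)"
    have "norm (?a * (f s \<xi> * ?b)) \<le> norm ?a * (norm (f s \<xi>) * norm ?b)"
      by (intro order_trans[OF norm_mult_ineq] mult_left_mono norm_mult_ineq norm_ge_zero)
    also have "\<dots> = norm (row_form (mat_of (P s)) k \<xi>) * norm (row_form (mat_of (H s)) k \<xi>) * norm (f s \<xi>)" by simp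
    also have "\<dots> \<le> (p * norm \<xi>) * (h * norm \<xi>) * ?g \<xi>"
      by (intro mult_mono np K(3)) (auto simp: ph)
    finally have 1: "norm (?a * (f s \<xi> * ?b)) \<le> p * h * (norm \<xi>)\<^sup>2 * ?g \<xi>" by (simp add: power2_eq_square mult_ac)
    have "norm ((1 / 2) *\<^sub>R mat_of (P s) $ k $ k) \<le> norm (P s)"
    proof -
      have "norm ((1 / 2) *\<^sub>R mat_of (P s) $ k $ k) \<le> norm (mat_of (P s) $ k $ k)" by simp
      then show ?thesis using norm_entry_le by (rule order_trans)
    qed
    then have 2: "norm (((1 / 2) *\<^sub>R mat_of (P s) $ k $ k) * f s \<xi>) \<le> norm (P s) * ?g \<xi>"
      by (intro order_trans[OF norm_mult_ineq] mult_mono K(3)) auto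
    show ?thesis unfolding flux'_def by (rule order_trans[OF norm_triangle_ineq]) (use 1 2 in \<open>simp add: distrib_right\<close>)
  qed
  \<comment> \<open>Half of the Gaussian exponent absorbs the quadratic growth, which gives
    majorants of one kind for the flux and for its derivative.\<close>
  have dom: "\<bar>\<phi> (X \<xi>)\<bar> \<le> M * K * (a + 2 * b / e) * exp (- (e / 2) * (norm \<xi>)\<^sup>2)"
    if "\<And>\<xi>. norm (X \<xi>) \<le> (a + b * (norm \<xi>)\<^sup>2) * ?g \<xi>" "0 \<le> a" "0 \<le> b" for X :: "real^'m \<Rightarrow> 'n torus_op" and a b \<xi>
  proof -
    have "\<bar>\<phi> (X \<xi>)\<bar> \<le> (a + b * (norm \<xi>)\<^sup>2) * ?g \<xi> * M"
      using M(2)[of "X \<xi>"] mult_right_mono[OF that(1)[of \<xi>] M(1)] by linarith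
    also have "\<dots> = M * K * ((a + b * (norm \<xi>)\<^sup>2) * exp (- e * (norm \<xi>)\<^sup>2))" by (simp only: mult_ac)
    also have "\<dots> \<le> M * K * ((a + 2 * b / e) * exp (- (e / 2) * (norm \<xi>)\<^sup>2))"
      using M K by (intro mult_left_mono poly_gaussian_le that) auto
    finally show ?thesis by (simp only: mult.assoc)
  qed
  have e2: "0 < e / 2" using K by simp
  have cphi: "continuous_on UNIV X \<Longrightarrow> continuous_on UNIV (\<lambda>\<xi>. \<phi> (X \<xi>))" for X :: "real^'m \<Rightarrow> 'n torus_op"
    by (rule bounded_linear.continuous_on[OF \<phi>])
  have c1: "continuous_on UNIV (\<lambda>\<xi>. \<phi> (flux k s \<xi>))"
    unfolding flux_def by (intro cphi continuous_on_mult continuous_on_scaleR continuous_on_const continuous_row_form continuous_f_slice s)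
  have c2: "continuous_on UNIV (\<lambda>\<xi>. \<phi> (flux' k s \<xi>))"
    unfolding flux'_def by (intro cphi continuous_on_mult continuous_on_add continuous_on_minus continuous_on_scaleR continuous_on_const continuous_row_form continuous_f_slice s)
  show "integrable lborel (\<lambda>\<xi>. \<phi> (flux' k s \<xi>))"
    by (rule integrable_gaussian_dominated[OF c2 e2 dom[OF n2]]) (simp_all add: ph)
  show "(\<integral>\<xi>. \<phi> (flux' k s \<xi>) \<partial>lborel) = 0"
  proof (rule integral_directional_derivative[OF _ c2 e2 dom[OF n2]])
    show "((\<lambda>t. \<phi> (flux k s (\<xi> + t *\<^sub>R axis k 1))) has_real_derivative \<phi> (flux' k s \<xi>)) (at 0)" for \<xi>
      unfolding has_real_derivative_iff_has_vector_derivative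
      by (rule bounded_linear.has_vector_derivative[OF \<phi> flux_directional[OF s]])
    show "integrable lborel (\<lambda>\<xi>. \<phi> (flux k s \<xi>))"
      by (rule integrable_gaussian_dominated[OF c1 e2 dom[OF n1]]) (simp_all add: ph)
  qed (simp_all add: ph)
qed

lemma integral_f_constant:
  fixes \<phi> :: "'n torus_op \<Rightarrow> real"
  assumes \<phi>: "bounded_linear \<phi>"
  shows "(\<integral>\<xi>. \<phi> (f 1 \<xi>) \<partial>lborel) = (\<integral>\<xi>. \<phi> (f 0 \<xi>) \<partial>lborel)"
proof -
  obtain K e where K: "0 < e" "0 \<le> K" "\<And>s \<xi>. s \<in> {0..1} \<Longrightarrow> norm (f s \<xi>) \<le> K * exp (- e * (norm \<xi>)\<^sup>2)" using f_bound by metis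
  obtain M where M: "0 \<le> M" "\<And>x. \<bar>\<phi> x\<bar> \<le> norm x * M" using bounded_linear.nonneg_bounded[OF \<phi>] by (auto simp: real_norm_def)
  have "continuous_on {0..1} (\<lambda>s. (1 / 2) *\<^sub>R mat_trace (P s))"
    by (intro continuous_intros bounded_linear.continuous_on[OF bounded_linear_mat_trace] continuous_paths)
  then obtain a where a: "0 \<le> a" "\<And>s. s \<in> {0..1} \<Longrightarrow> norm ((1 / 2) *\<^sub>R mat_trace (P s)) \<le> a" using path_bounded by blast
  have "continuous_on {0..1} (\<lambda>s. H s * P s)" by (intro continuous_on_mult continuous_paths)
  then obtain b' where b': "0 \<le> b'" "\<And>s. s \<in> {0..1} \<Longrightarrow> norm (H s * P s) \<le> b'" using path_bounded by blast
  define b where "b = (real CARD('m))\<^sup>2 * b'"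
  have b: "0 \<le> b" using b' by (simp add: b_def)
  have nA: "norm (A' s \<xi>) \<le> a + b * (norm \<xi>)\<^sup>2" if s: "s \<in> {0..1}" for s \<xi>
  proof -
    have "norm (quad_form (mat_of (H s * P s)) \<xi>) \<le> b * (norm \<xi>)\<^sup>2"
      unfolding b_def by (rule order_trans[OF norm_quad_form_mat_le]) (intro mult_right_mono mult_left_mono b' s; simp)
    then show ?thesis unfolding A'_def using norm_triangle_ineq4 a(2)[OF s] by (smt (verit))
  qed
  let ?w = "\<lambda>\<xi> :: real^'m. M * K * (a + 2 * b / e) * exp (- (e / 2) * (norm \<xi>)\<^sup>2)"
  have e2: "0 < e / 2" using K by simp
  have "(\<integral>\<xi>. \<phi> (f 1 \<xi>) \<partial>lborel) - (\<integral>\<xi>. \<phi> (f 0 \<xi>) \<partial>lborel) =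
      (\<integral>s. indicator {0..1} s * (\<integral>\<xi>. \<phi> (f s \<xi> * A' s \<xi>) \<partial>lborel) \<partial>lborel)"
  proof (rule integral_difference[where w = ?w])
    show "((\<lambda>s. \<phi> (f s \<xi>)) has_real_derivative \<phi> (f s \<xi> * A' s \<xi>)) (at s within {0..1})" if "s \<in> {0..1}" for s \<xi>
      unfolding has_real_derivative_iff_has_vector_derivative
      by (rule bounded_linear.has_vector_derivative[OF \<phi> f_derivative[OF that]])
    show "continuous_on ({0..1} \<times> UNIV) (\<lambda>p. \<phi> (f (fst p) (snd p) * A' (fst p) (snd p)))"
      by (intro bounded_linear.continuous_on[OF \<phi>] continuous_on_mult continuous_f continuous_A')
    show "\<bar>\<phi> (f s \<xi> * A' s \<xi>)\<bar> \<le> ?w \<xi>" if s: "s \<in> {0..1}" for s \<xi>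
    proof -
      have "norm (f s \<xi> * A' s \<xi>) \<le> (K * exp (- e * (norm \<xi>)\<^sup>2)) * (a + b * (norm \<xi>)\<^sup>2)"
        by (intro order_trans[OF norm_mult_ineq] mult_mono nA s K(3)) (use K in auto)
      then have "\<bar>\<phi> (f s \<xi> * A' s \<xi>)\<bar> \<le> (K * exp (- e * (norm \<xi>)\<^sup>2)) * (a + b * (norm \<xi>)\<^sup>2) * M"
        using M(2)[of "f s \<xi> * A' s \<xi>"] mult_right_mono[OF _ M(1)] by (meson order_trans)
      also have "\<dots> = M * K * ((a + b * (norm \<xi>)\<^sup>2) * exp (- e * (norm \<xi>)\<^sup>2))" by (simp only: mult_ac)
      also have "\<dots> \<le> M * K * ((a + 2 * b / e) * exp (- (e / 2) * (norm \<xi>)\<^sup>2))"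
        using M K a b by (intro mult_left_mono poly_gaussian_le) auto
      finally show ?thesis by (simp only: mult.assoc)
    qed
    show "integrable lborel ?w" using e2 by (intro integrable_mult_right integrable_gaussian)
    have "integrable lborel (\<lambda>\<xi>. \<phi> (f s \<xi>))" if s: "s \<in> {0..1}" for s
    proof (rule integrable_gaussian_dominated[OF _ K(1)])
      show "continuous_on UNIV (\<lambda>\<xi>. \<phi> (f s \<xi>))" by (intro bounded_linear.continuous_on[OF \<phi>] continuous_f_slice s)
      show "\<bar>\<phi> (f s \<xi>)\<bar> \<le> K * M * exp (- e * (norm \<xi>)\<^sup>2)" for \<xi>
        using order_trans[OF M(2) mult_right_mono[OF K(3)[OF s] M(1)]] by (simp add: mult_ac)
    qed
    then show "integrable lborel (\<lambda>\<xi>. \<phi> (f 0 \<xi>))" "integrable lborel (\<lambda>\<xi>. \<phi> (f 1 \<xi>))" by auto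
  qed
  moreover have "indicator {0..1} s * (\<integral>\<xi>. \<phi> (f s \<xi> * A' s \<xi>) \<partial>lborel) = 0" for s :: real
  proof (cases "s \<in> {0..1}")
    case True
    have "\<phi> (f s \<xi> * A' s \<xi>) = (\<Sum>k\<in>UNIV. \<phi> (flux' k s \<xi>))" for \<xi>
      unfolding divergence[OF True] using linear_sum[OF bounded_linear.linear[OF \<phi>]] .
    then show ?thesis using flux_integral[OF True \<phi>] by simp
  qed simp
  ultimately show ?thesis by simp
qed

lemma mat_trace_scaleR_1: "mat_trace (r *\<^sub>R 1 :: ('n, 'm) torus_mat) = (real CARD('m) * r) *\<^sub>R 1"
proof -
  have "(of_nat CARD('m) :: 'n torus_op) = real CARD('m) *\<^sub>R 1" by (metis of_real_def of_real_of_nat_eq)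
  then show ?thesis by (simp add: mat_trace_def trace_def entry_simps entry_1 mult.commute)
qed

text \<open>The conserved integral is evaluated at s = 0, where the matrix is the scalar c: the
  factor c^(- n / 2) of the trace cancels the c^(n / 2) of the scalar Gaussian integral.\<close>

lemma gaussian_normalization:
  fixes \<phi> :: "'n torus_op \<Rightarrow> real"
  assumes \<phi>: "bounded_linear \<phi>"
  shows "(\<integral>\<xi>. \<phi> (exp (- ((1 / 2) *\<^sub>R trace (mat_log g))) * exp (- quad_form (matrix_inv g) \<xi>)) \<partial>lborel) =
    pi powr (real CARD('m) / 2) * \<phi> 1"
proof -
  let ?n = "real CARD('m)"
  have "f 1 \<xi> = exp (- ((1 / 2) *\<^sub>R trace (mat_log g))) * exp (- quad_form (matrix_inv g) \<xi>)" for \<xi>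
    by (simp add: f_split q_def H_1 Lg_1 mat_trace_def mat_log_eq Mat_inverse)
  moreover have "f 0 \<xi> = (c powr (- ?n / 2) * exp (- (1 / c) * (norm \<xi>)\<^sup>2)) *\<^sub>R 1" for \<xi>
  proof -
    have qf: "q 0 \<xi> = ((1 / c) * (norm \<xi>)\<^sup>2) *\<^sub>R 1"
    proof -
      have "(\<xi> $ i * \<xi> $ j) *\<^sub>R mat_of (H 0) $ i $ j = (if j = i then ((1 / c) * (\<xi> $ i)\<^sup>2) *\<^sub>R 1 else 0)" for i j
        by (auto simp: H_0 entry_simps entry_1 power2_eq_square mult_ac)
      moreover have "(norm \<xi>)\<^sup>2 = (\<Sum>i\<in>UNIV. (\<xi> $ i)\<^sup>2)"
        by (simp add: norm_vec_def L2_set_def sum_nonneg)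
      ultimately show ?thesis by (simp add: q_def quad_form_def sum_distrib_left scaleR_left.sum)
    qed
    have "A 0 \<xi> = (- (?n * ln c / 2) - (1 / c) * (norm \<xi>)\<^sup>2) *\<^sub>R 1"
      by (simp add: A_def Lg_0 mat_trace_scaleR_1 qf scaleR_left_diff_distrib)
    then have "f 0 \<xi> = exp (- (?n * ln c / 2) - (1 / c) * (norm \<xi>)\<^sup>2) *\<^sub>R 1"
      using exp_of_real[of "- (?n * ln c / 2) - (1 / c) * (norm \<xi>)\<^sup>2", where 'a = "'n torus_op"] by (simp add: f_def of_real_def)
    also have "exp (- (?n * ln c / 2) - (1 / c) * (norm \<xi>)\<^sup>2) = c powr (- ?n / 2) * exp (- (1 / c) * (norm \<xi>)\<^sup>2)"
    proof -
      have "c powr (- ?n / 2) = exp (- (?n * ln c / 2))" using c by (simp add: powr_def)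
      then show ?thesis by (simp only: exp_add[symmetric]) simp
    qed
    finally show ?thesis .
  qed
  moreover have "(\<integral>\<xi>. \<phi> ((c powr (- ?n / 2) * exp (- (1 / c) * (norm \<xi>)\<^sup>2)) *\<^sub>R 1) \<partial>(lborel :: (real^'m) measure)) =
      c powr (- ?n / 2) * (pi / (1 / c)) powr (?n / 2) * \<phi> 1"
  proof -
    have c1: "0 < 1 / c" using c by simp
    have "(\<integral>\<xi>. \<phi> ((c powr (- ?n / 2) * exp (- (1 / c) * (norm \<xi>)\<^sup>2)) *\<^sub>R 1) \<partial>(lborel :: (real^'m) measure)) =
        (\<integral>\<xi>. (c powr (- ?n / 2) * \<phi> 1) * exp (- (1 / c) * (norm \<xi>)\<^sup>2) \<partial>(lborel :: (real^'m) measure))"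
      unfolding linear_simps[OF \<phi>] by (simp only: real_scaleR_def mult_ac)
    also have "\<dots> = (c powr (- ?n / 2) * \<phi> 1) * (\<integral>\<xi>. exp (- (1 / c) * (norm \<xi>)\<^sup>2) \<partial>(lborel :: (real^'m) measure))"
      by (rule integral_mult_right_zero)
    finally show ?thesis using integral_gaussian[OF c1, where 'a = "real^'m"] by (simp add: mult_ac)
  qed
  moreover have "c powr (- ?n / 2) * (pi / (1 / c)) powr (?n / 2) = pi powr (?n / 2)"
    using c by (simp add: powr_mult powr_minus)
  ultimately show ?thesis using integral_f_constant[OF \<phi>] by simp
qed

end

section \<open>The determinant\<close>

text \<open>Products of operators are ordered, so invariance under permutation has to be derived
  from commutation of the factors that actually occur.\<close>

lemma prod_list_commute_mset:
  fixes xs ys :: "'a::monoid_mult list"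
  assumes "mset xs = mset ys" "\<And>x y. x \<in> set xs \<Longrightarrow> y \<in> set xs \<Longrightarrow> x * y = y * x"
  shows "prod_list xs = prod_list ys"
  using assms
proof (induction xs arbitrary: ys)
  case (Cons x xs)
  have "x \<in> set ys" using Cons.prems(1) by (metis list.set_intros(1) mset_eq_setD)
  then obtain us vs where ys: "ys = us @ x # vs" by (meson split_list)
  have us: "y \<in> set (x # xs)" if "y \<in> set us" for y
    using that mset_eq_setD[OF Cons.prems(1)] ys by auto
  have "x * prod_list us = prod_list us * x"
    using us
  proof (induction us)
    case (Cons u us)
    have "x * u = u * x" "x * prod_list us = prod_list us * x"
      using Cons \<open>\<And>x' y. x' \<in> set (x # xs) \<Longrightarrow> y \<in> set (x # xs) \<Longrightarrow> x' * y = y * x'\<close> by auto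
    then show ?case by (metis mult.assoc prod_list.Cons)
  qed simp
  moreover have "prod_list xs = prod_list (us @ vs)"
    using Cons.prems ys by (intro Cons.IH) auto
  ultimately show ?case by (simp add: ys mult.assoc[symmetric])
qed simp

lemma prod_list_derivative:
  fixes f :: "'i \<Rightarrow> real \<Rightarrow> 'a::real_normed_algebra_1"
  assumes "distinct xs" "\<And>i. i \<in> set xs \<Longrightarrow> (f i has_vector_derivative f' i) (at s within S)"
  shows "((\<lambda>s. prod_list (map (\<lambda>i. f i s) xs)) has_vector_derivative
    (\<Sum>i\<in>set xs. prod_list (map (\<lambda>j. if j = i then f' i else f j s) xs))) (at s within S)"
  using assms
proof (induction xs)
  case (Cons x xs)
  have x: "x \<notin> set xs" using Cons.prems by simp
  have 1: "map (\<lambda>j. if j = x then f' x else f j s) xs = map (\<lambda>i. f i s) xs" using x by auto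
  have 2: "prod_list (map (\<lambda>j. if j = i then f' i else f j s) (x # xs)) =
      f x s * prod_list (map (\<lambda>j. if j = i then f' i else f j s) xs)" if "i \<in> set xs" for i
    using that x by auto
  have "((\<lambda>s. f x s * prod_list (map (\<lambda>i. f i s) xs)) has_vector_derivative
      f x s * (\<Sum>i\<in>set xs. prod_list (map (\<lambda>j. if j = i then f' i else f j s) xs)) + f' x * prod_list (map (\<lambda>i. f i s) xs)) (at s within S)"
    by (intro has_vector_derivative_mult Cons.IH) (use Cons.prems in auto)
  then show ?case using x by (simp add: 1 2 sum_distrib_left add.commute del: map_eq_conv list.map(2) cong: sum.cong) (simp add: 1)
qed simp

lemma prod_list_row_sum:
  fixes y :: "'k \<Rightarrow> 'a::ring_1"
  assumes "distinct xs" "i \<in> set xs"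
  shows "prod_list (map (\<lambda>j. if j = i then (\<Sum>k\<in>K. y k) else h j) xs) =
    (\<Sum>k\<in>K. prod_list (map (\<lambda>j. if j = i then y k else h j) xs))"
  using assms
proof (induction xs)
  case (Cons x xs)
  show ?case
  proof (cases "x = i")
    case True
    then have "map (\<lambda>j. if j = i then z else h j) xs = map h xs" for z using Cons.prems by auto
    then have "prod_list (map (\<lambda>j. if j = i then z else h j) xs) = prod_list (map h xs)" for z by (simp only:)
    then show ?thesis using True by (simp add: sum_distrib_right)
  next
    case False
    then show ?thesis using Cons by (simp add: sum_distrib_left)
  qed
qed simp

lemma prod_list_row_mult:
  fixes a r :: "'a::monoid_mult"
  assumes "distinct xs" "i \<in> set xs" "\<And>j. a * h j = h j * a"
  shows "prod_list (map (\<lambda>j. if j = i then a * r else h j) xs) = a * prod_list (map (\<lambda>j. if j = i then r else h j) xs)"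
  using assms(1,2)
proof (induction xs)
  case (Cons x xs)
  show ?case
  proof (cases "x = i")
    case True
    then have "map (\<lambda>j. if j = i then z else h j) xs = map h xs" for z using Cons.prems by auto
    then have "prod_list (map (\<lambda>j. if j = i then z else h j) xs) = prod_list (map h xs)" for z by (simp only:)
    then show ?thesis using True by (simp add: mult.assoc)
  next
    case False
    then have "prod_list (map (\<lambda>j. if j = i then a * r else h j) (x # xs)) = h x * (a * prod_list (map (\<lambda>j. if j = i then r else h j) xs))"
      using Cons by simp
    also have "\<dots> = (a * h x) * prod_list (map (\<lambda>j. if j = i then r else h j) xs)"
      unfolding assms(3) by (rule mult.assoc[symmetric])
    finally show ?thesis using False by (simp add: mult.assoc)
  qed
qed simp

text \<open>The list fixes the order of the factors; \<open>nc_det_eq_leibniz\<close> holds for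
  every enumeration of the index set.\<close>

definition leibniz :: "'m list \<Rightarrow> 'a::ring_1^'m^'m \<Rightarrow> 'a" where
  "leibniz xs M = (\<Sum>\<sigma> | \<sigma> permutes UNIV. of_int (sign \<sigma>) * prod_list (map (\<lambda>i. M $ i $ \<sigma> i) xs))"

section \<open>The density as a square root of the determinant\<close>

lemma sa_diagonal:
  assumes "mat.sa A"
  shows "op.sa (mat_of A $ i $ i)"
  unfolding op.sa_def
proof (intro allI)
  fix v w
  have "inner (op_apply (mat_of A $ i $ i) v) w = inner (mat_act (mat_of A) (axis i v)) (axis i w)"
    by (simp add: inner_axis mat_act_axis)
  also have "\<dots> = inner (axis i v) (mat_act (mat_of A) (axis i w))" using assms by (simp add: mat.sa_def)
  also have "\<dots> = inner v (op_apply (mat_of A $ i $ i) w)" by (simp add: inner_axis' mat_act_axis)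
  finally show "inner (op_apply (mat_of A $ i $ i) v) w = inner v (op_apply (mat_of A $ i $ i) w)" .
qed

context positive_matrix
begin

lemma sa_trace_log: "op.sa (trace (mat_log g))"
proof -
  have B: "mat.sa B" unfolding B_def using mat.coerciveD(1)[OF coercive] by (intro mat.sa_diff mat.sa_scaleR) auto
  have "mat.sa (nlog B)" by (rule mat.sa_sums[OF _ nlog_sums[OF norm_B_less]]) (intro mat.sa_scaleR mat.sa_power B)
  then have "mat.sa L" unfolding L_def by (intro mat.sa_diff mat.sa_scaleR) auto
  then show ?thesis unfolding mat_log_eq trace_def by (intro op.sa_sum sa_diagonal)
qed

text \<open>The trace of the logarithm is selfadjoint, so its half has a positive exponential, whose
  square is the determinant; positive square roots are unique.\<close>

lemma riem_density_eq_sqrt: "riem_density g = op_sqrt (nc_det g)"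
proof -
  let ?T = "trace (mat_log g)"
  have half: "op.sa ((1 / 2) *\<^sub>R ?T)" by (intro op.sa_scaleR sa_trace_log)
  have "exp ((1 / 2) *\<^sub>R ?T) * exp ((1 / 2) *\<^sub>R ?T) = exp ((1 / 2) *\<^sub>R ?T + (1 / 2) *\<^sub>R ?T)"
    by (rule exp_add_commuting[symmetric]) simp
  also have "(1 / 2) *\<^sub>R ?T + (1 / 2) *\<^sub>R ?T = ?T" by (simp flip: scaleR_left_distrib)
  finally have sq: "exp ((1 / 2) *\<^sub>R ?T) * exp ((1 / 2) *\<^sub>R ?T) = exp ?T" .
  have nz: "exp (- ((1 / 2) *\<^sub>R ?T)) \<noteq> 0" using exp_minus_inverse[of "(1 / 2) *\<^sub>R ?T"] by (metis mult_zero_right zero_neq_one)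
  interpret scaled_operator "exp ?T" "norm (exp ?T)" "1 / (norm (exp (- ((1 / 2) *\<^sub>R ?T))))\<^sup>2"
    by unfold_locales (use op.coercive_exp[OF sa_trace_log] nz in auto)
  show ?thesis
    unfolding riem_density_def nc_det_def
    by (rule op_sqrt_unique[symmetric, OF op.coercive_mono[OF op.coercive_exp[OF half]] sq]) simp
qed

end

context commuting_matrix
begin

lemma entry_G_alg: "mat_of (G s) $ i $ j \<in> alg"
proof -
  have "G s \<in> sym" unfolding G_def by (intro sym_scaleR sym_diff sym_1 sym_BB)
  then show ?thesis by (rule sym_alg)
qed

text \<open>Composing \<sigma> with the transposition of i and k changes the sign and permutes the
  factors among themselves, because rows i and k coincide. As the factors commute, the sum equals
  its own negative.\<close>

lemma leibniz_repeated_row: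
  fixes M :: "'n torus_op^'m^'m"
  assumes xs: "distinct xs" "set xs = UNIV" and ik: "i \<noteq> k" and M: "\<And>i j. M $ i $ j \<in> alg"
  shows "(\<Sum>\<sigma> | \<sigma> permutes UNIV. of_int (sign \<sigma>) * prod_list (map (\<lambda>j. if j = i then M $ k $ \<sigma> i else M $ j $ \<sigma> j) xs)) = 0"
    (is "?E = 0")
proof -
  let ?\<tau> = "Transposition.transpose i k"
  define w where "w \<sigma> j = (if j = i then M $ k $ \<sigma> i else M $ j $ \<sigma> j)" for \<sigma> :: "'m \<Rightarrow> 'm" and j
  have \<tau>: "?\<tau> permutes UNIV" by (rule permutes_swap_id) auto
  have ms: "mset (map ?\<tau> xs) = mset xs"
  proof -
    have x: "mset xs = mset_set UNIV" using mset_set_set[OF xs(1)] xs(2) by (simp only:)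
    have "mset (map ?\<tau> xs) = image_mset ?\<tau> (mset_set UNIV)" unfolding mset_map x by (rule refl)
    also have "\<dots> = mset_set (?\<tau> ` UNIV)" by (rule image_mset_mset_set[OF permutes_inj_on[OF \<tau>]])
    finally show ?thesis unfolding permutes_image[OF \<tau>] x .
  qed
  have w: "prod_list (map (w (\<sigma> \<circ> ?\<tau>)) xs) = prod_list (map (w \<sigma>) xs)" for \<sigma>
  proof -
    have "w (\<sigma> \<circ> ?\<tau>) = w \<sigma> \<circ> ?\<tau>"
      using ik by (auto simp: w_def fun_eq_iff Transposition.transpose_def)
    then have "mset (map (w (\<sigma> \<circ> ?\<tau>)) xs) = mset (map (w \<sigma>) (map ?\<tau> xs))" by simp
    also have "\<dots> = image_mset (w \<sigma>) (mset (map ?\<tau> xs))" by (rule mset_map)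
    also have "\<dots> = mset (map (w \<sigma>) xs)" unfolding ms by (rule mset_map[symmetric])
    finally show ?thesis
      by (rule prod_list_commute_mset) (auto simp: w_def intro!: alg_commute M)
  qed
  have "?E = (\<Sum>\<sigma> | \<sigma> permutes UNIV. of_int (sign (\<sigma> \<circ> ?\<tau>)) * prod_list (map (w (\<sigma> \<circ> ?\<tau>)) xs))"
    unfolding w_def[symmetric] by (rule sum_permutations_compose_right[OF \<tau>])
  also have "\<dots> = (\<Sum>\<sigma> | \<sigma> permutes UNIV. - (of_int (sign \<sigma>) * prod_list (map (w \<sigma>) xs)))"
  proof (intro sum.cong refl)
    fix \<sigma> :: "'m \<Rightarrow> 'm" assume "\<sigma> \<in> {\<sigma>. \<sigma> permutes UNIV}"
    then have "sign (\<sigma> \<circ> ?\<tau>) = - sign \<sigma>"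
      using sign_compose[of \<sigma> ?\<tau>] ik \<tau> by (simp add: permutation_permutes sign_swap_id) (metis finite permutation_permutes)
    then show "of_int (sign (\<sigma> \<circ> ?\<tau>)) * prod_list (map (w (\<sigma> \<circ> ?\<tau>)) xs) = - (of_int (sign \<sigma>) * prod_list (map (w \<sigma>) xs))"
      unfolding w by simp
  qed
  also have "\<dots> = - ?E" unfolding sum_negf w_def by (rule refl)
  finally have "?E + ?E = 0" by (rule eq_neg_iff_add_eq_0[THEN iffD1])
  then have "2 *\<^sub>R ?E = 0" by (simp only: scaleR_2)
  then show ?thesis by simp
qed

text \<open>From the derivative - P G of G, differentiating row i replaces it by minus the sum over
  k of P_ik times row k. The terms with k \<noteq> i have a repeated row and vanish; those with k =
  i give - P_ii times the determinant.\<close>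

lemma leibniz_derivative:
  assumes xs: "distinct xs" "set xs = UNIV" and s: "s \<in> {0..1}"
  shows "((\<lambda>s. leibniz xs (mat_of (G s))) has_vector_derivative - mat_trace (P s) * leibniz xs (mat_of (G s))) (at s within {0..1})"
proof -
  let ?M = "mat_of (G s)" and ?p = "\<lambda>i k. mat_of (P s) $ i $ k"
  define W where "W i k \<sigma> = prod_list (map (\<lambda>j. if j = i then ?M $ k $ \<sigma> i else ?M $ j $ \<sigma> j) xs)" for i k and \<sigma> :: "'m \<Rightarrow> 'm"
  have entry: "((\<lambda>s. mat_of (G s) $ i $ j) has_vector_derivative (\<Sum>k\<in>UNIV. - ?p i k * ?M $ k $ j)) (at s within {0..1})" for i j
  proof -
    have "- (c *\<^sub>R B) = - (P s * G s)" using G_P(1)[OF s] by simp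
    then have "mat_of (- (c *\<^sub>R B)) $ i $ j = (\<Sum>k\<in>UNIV. - ?p i k * ?M $ k $ j)"
      by (simp only: linear_simps[OF bounded_linear_entry] entry_mult) (simp add: sum_negf)
    then show ?thesis
      using bounded_linear.has_vector_derivative[OF bounded_linear_entry[of i j] G_derivative[of s]] by simp
  qed
  have row: "prod_list (map (\<lambda>j. if j = i then (\<Sum>k\<in>UNIV. - ?p i k * ?M $ k $ \<sigma> i) else ?M $ j $ \<sigma> j) xs) =
      (\<Sum>k\<in>UNIV. - ?p i k * W i k \<sigma>)" for i \<sigma>
    unfolding W_def
  proof -
    have i: "i \<in> set xs" using xs by simp
    show "prod_list (map (\<lambda>j. if j = i then (\<Sum>k\<in>UNIV. - ?p i k * ?M $ k $ \<sigma> i) else ?M $ j $ \<sigma> j) xs) =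
        (\<Sum>k\<in>UNIV. - ?p i k * prod_list (map (\<lambda>j. if j = i then ?M $ k $ \<sigma> i else ?M $ j $ \<sigma> j) xs))"
      unfolding prod_list_row_sum[OF xs(1) i]
      by (intro sum.cong refl prod_list_row_mult xs(1) i alg_commute alg_uminus sym_alg sym_P s entry_G_alg)
  qed
  have "((\<lambda>s. prod_list (map (\<lambda>i. mat_of (G s) $ i $ \<sigma> i) xs)) has_vector_derivative
      (\<Sum>i\<in>UNIV. \<Sum>k\<in>UNIV. - ?p i k * W i k \<sigma>)) (at s within {0..1})" for \<sigma>
    using prod_list_derivative[OF xs(1), of "\<lambda>i s. mat_of (G s) $ i $ \<sigma> i" "\<lambda>i. \<Sum>k\<in>UNIV. - ?p i k * ?M $ k $ \<sigma> i" s "{0..1}", OF entry]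
    unfolding row xs(2) .
  then have "((\<lambda>s. leibniz xs (mat_of (G s))) has_vector_derivative
      (\<Sum>\<sigma> | \<sigma> permutes UNIV. of_int (sign \<sigma>) * (\<Sum>i\<in>UNIV. \<Sum>k\<in>UNIV. - ?p i k * W i k \<sigma>))) (at s within {0..1})"
    unfolding leibniz_def
    by (intro has_vector_derivative_sum bounded_linear.has_vector_derivative[OF bounded_linear_mult_right])
  also have "(\<Sum>\<sigma> | \<sigma> permutes UNIV. of_int (sign \<sigma>) * (\<Sum>i\<in>UNIV. \<Sum>k\<in>UNIV. - ?p i k * W i k \<sigma>)) =
      (\<Sum>i\<in>UNIV. \<Sum>k\<in>UNIV. - ?p i k * (\<Sum>\<sigma> | \<sigma> permutes UNIV. of_int (sign \<sigma>) * W i k \<sigma>))"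
  proof -
    have e: "of_int (sign \<sigma>) * (- ?p i k * W i k \<sigma>) = - ?p i k * (of_int (sign \<sigma>) * W i k \<sigma>)" for i k \<sigma>
      by (simp add: sign_def)
    have "(\<Sum>\<sigma> | \<sigma> permutes UNIV. of_int (sign \<sigma>) * (\<Sum>i\<in>UNIV. \<Sum>k\<in>UNIV. - ?p i k * W i k \<sigma>)) =
        (\<Sum>\<sigma> | \<sigma> permutes UNIV. \<Sum>i\<in>UNIV. \<Sum>k\<in>UNIV. - ?p i k * (of_int (sign \<sigma>) * W i k \<sigma>))"
      unfolding e[symmetric] by (simp only: sum_distrib_left)
    also have "\<dots> = (\<Sum>i\<in>UNIV. \<Sum>\<sigma> | \<sigma> permutes UNIV. \<Sum>k\<in>UNIV. - ?p i k * (of_int (sign \<sigma>) * W i k \<sigma>))" by (rule sum.swap)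
    also have "\<dots> = (\<Sum>i\<in>UNIV. \<Sum>k\<in>UNIV. \<Sum>\<sigma> | \<sigma> permutes UNIV. - ?p i k * (of_int (sign \<sigma>) * W i k \<sigma>))"
      by (intro sum.cong refl sum.swap)
    finally show ?thesis by (simp only: sum_distrib_left)
  qed
  also have "\<dots> = (\<Sum>i\<in>UNIV. \<Sum>k\<in>UNIV. if k = i then - ?p i i * leibniz xs ?M else 0)"
  proof (intro sum.cong refl)
    fix i k
    show "- ?p i k * (\<Sum>\<sigma> | \<sigma> permutes UNIV. of_int (sign \<sigma>) * W i k \<sigma>) = (if k = i then - ?p i i * leibniz xs ?M else 0)"
    proof (cases "k = i")
      case True
      have "W i i \<sigma> = prod_list (map (\<lambda>j. ?M $ j $ \<sigma> j) xs)" for \<sigma>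
        unfolding W_def by (intro arg_cong[of _ _ prod_list] map_cong) auto
      then show ?thesis by (simp add: True leibniz_def)
    next
      case False
      then show ?thesis using leibniz_repeated_row[OF xs _ entry_G_alg, of i k s] by (simp add: W_def)
    qed
  qed
  also have "\<dots> = - mat_trace (P s) * leibniz xs ?M"
    by (simp add: mat_trace_def trace_def sum_distrib_right sum_negf)
  finally show ?thesis .
qed

lemma leibniz_scalar:
  assumes xs: "distinct xs" "set xs = UNIV"
  shows "leibniz xs (mat_of (c *\<^sub>R 1 :: ('n, 'm) torus_mat)) = c ^ CARD('m) *\<^sub>R 1"
proof -
  let ?M = "mat_of (c *\<^sub>R 1 :: ('n, 'm) torus_mat)"
  have entry: "?M $ i $ j = (if i = j then c *\<^sub>R 1 else 0)" for i j by (simp add: entry_simps entry_1)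
  have "of_int (sign \<sigma>) * prod_list (map (\<lambda>i. ?M $ i $ \<sigma> i) xs) = (if \<sigma> = id then c ^ CARD('m) *\<^sub>R 1 else 0)" for \<sigma>
  proof (cases "\<sigma> = id")
    case True
    have "prod_list (map (\<lambda>i. c *\<^sub>R (1 :: 'n torus_op)) ys) = c ^ length ys *\<^sub>R 1" for ys :: "'m list"
      by (induction ys) (simp_all add: mult.commute)
    moreover have "length xs = CARD('m)" using xs distinct_card by fastforce
    ultimately show ?thesis using True by (simp add: entry)
  next
    case False
    then obtain i where "\<sigma> i \<noteq> i" by (auto simp: fun_eq_iff)
    then have "?M $ i $ \<sigma> i = 0" by (simp add: entry)
    then have "0 \<in> set (map (\<lambda>i. ?M $ i $ \<sigma> i) xs)" using xs by (force simp: image_iff)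
    moreover have "0 \<in> set ys \<Longrightarrow> prod_list ys = 0" for ys :: "'n torus_op list" by (induction ys) auto
    ultimately show ?thesis using False by simp
  qed
  then have "leibniz xs ?M = (\<Sum>\<sigma> | \<sigma> permutes (UNIV :: 'm set). if \<sigma> = id then c ^ CARD('m) *\<^sub>R 1 else 0)"
    unfolding leibniz_def by simp
  also have "\<dots> = c ^ CARD('m) *\<^sub>R 1" by (subst sum.delta) (auto simp: finite_permutations permutes_id)
  finally show ?thesis .
qed

theorem nc_det_eq_leibniz:
  assumes xs: "distinct xs" "set xs = UNIV"
  shows "nc_det g = leibniz xs g"
proof -
  let ?D = "\<lambda>s. leibniz xs (mat_of (G s))" and ?T = "\<lambda>s. exp (- mat_trace (Lg s))"
  have "((\<lambda>s. ?T s * ?D s) has_vector_derivative 0) (at s within {0..1})" if s: "s \<in> {0..1}" for s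
  proof -
    have "((\<lambda>s. - mat_trace (Lg s)) has_vector_derivative - mat_trace (- P s)) (at s within {0..1})"
      by (intro has_vector_derivative_minus bounded_linear.has_vector_derivative[OF bounded_linear_mat_trace] Lg_derivative s)
    then have T: "(?T has_vector_derivative ?T s * mat_trace (P s)) (at s within {0..1})"
      using s by (intro has_vector_derivative_exp_commuting alg_commute alg_uminus alg_trace sym_Lg)
        (simp_all add: linear_simps[OF bounded_linear_mat_trace])
    show ?thesis
      using has_vector_derivative_mult[OF T leibniz_derivative[OF xs s]] by (simp add: mult.assoc)
  qed
  then obtain C where C: "\<And>s. s \<in> {0..1} \<Longrightarrow> ?T s * ?D s = C"
    by (rule has_vector_derivative_zero_constant[rotated]) auto
  have "?T 1 * ?D 1 = ?T 0 * ?D 0" using C[of 0] C[of 1] by simp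
  \<comment> \<open>At s = 0 both factors are scalars, c^(- n) and c^n.\<close>
  also have "?T 0 * ?D 0 = 1"
  proof -
    have "?T 0 = exp (- (real CARD('m) * ln c)) *\<^sub>R 1"
      using exp_of_real[of "- (real CARD('m) * ln c)", where 'a = "'n torus_op"]
      by (simp add: Lg_0 mat_trace_scaleR_1 of_real_def)
    also have "exp (- (real CARD('m) * ln c)) = 1 / c ^ CARD('m)"
      using c by (simp add: exp_minus exp_of_nat_mult inverse_eq_divide)
    finally show ?thesis using c by (simp add: G_0 leibniz_scalar[OF xs])
  qed
  finally have 1: "?T 1 * ?D 1 = 1" .
  have "exp (mat_trace (Lg 1)) * (?T 1 * ?D 1) = (exp (mat_trace (Lg 1)) * ?T 1) * ?D 1" by (rule mult.assoc[symmetric])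
  then have "exp (mat_trace (Lg 1)) = ?D 1" unfolding 1 by (simp add: exp_minus_inverse)
  then show ?thesis by (simp add: nc_det_def mat_log_eq G_1 Lg_1 mat_trace_def Mat_inverse)
qed

end

text \<open>Let E be the exponential of minus half the trace of log g. The integral of \<phi> (E exp
  (- |\<xi>|_g^2)) is known in two ways: by \<open>gaussian_integral\<close> for the functional x to
  \<phi> (E x), and by \<open>gaussian_normalization\<close>. Comparing them for all \<phi> shows
  that E times the spectral density is 1, and E is the inverse of the Riemannian density.\<close>

lemma (in riem_metric) density_self_compatible:
  assumes comm: "\<And>i j k l. g $ i $ j * g $ k $ l = g $ k $ l * g $ i $ j"
  shows "spectral_density g = riem_density g" "riem_density g = op_sqrt (nc_det g)"
    "nc_det g = leibniz (sorted_list_of_set UNIV) g"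
proof -
  have nz: "Mat h \<noteq> 0" using Mat_inverse_h by (metis mult_zero_right zero_neq_one)
  have "mat.coercive (1 / norm (Mat h)) (Mat g)"
    using d_pos by (intro mat.coercive_inverse mat.coercive_mono[OF coercive_h] Mat_inverse_h) simp
  then interpret commuting_matrix g "norm (Mat g)" "1 / norm (Mat h)"
    using metric nz comm by unfold_locales (auto simp: riem_metrics_def)
  show "riem_density g = op_sqrt (nc_det g)" by (rule riem_density_eq_sqrt)
  show "nc_det g = leibniz (sorted_list_of_set UNIV) g" by (rule nc_det_eq_leibniz) auto
  let ?T = "trace (mat_log g)"
  let ?E = "exp (- ((1 / 2) *\<^sub>R ?T))"
  have key: "\<phi> (?E * spectral_density g) = \<phi> 1" if \<phi>: "bounded_linear \<phi>" for \<phi> :: "'n torus_op \<Rightarrow> real"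
  proof -
    have b: "bounded_linear (\<lambda>x. \<phi> (?E * x))" by (rule bounded_linear_compose[OF \<phi> bounded_linear_mult_right])
    from gaussian_integral[unfolded has_weak_integral_def, rule_format, OF b]
    have "(\<integral>\<xi>. \<phi> (?E * exp (- quad_form h \<xi>)) \<partial>lborel) = \<phi> (?E * (pi powr (real CARD('n) / 2) *\<^sub>R spectral_density g))"
      by (rule has_bochner_integral_integral_eq)
    then have "pi powr (real CARD('n) / 2) * \<phi> (?E * spectral_density g) = pi powr (real CARD('n) / 2) * \<phi> 1"
      using gaussian_normalization[OF \<phi>] by (simp add: h_def linear_simps[OF \<phi>])
    then show ?thesis by simp
  qed
  have E: "?E * spectral_density g = 1"
  proof (rule op_eqI)
    fix v
    let ?x = "op_apply (?E * spectral_density g) v" and ?y = "op_apply 1 v"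
    have i: "inner ?x w = inner ?y w" for w
      by (rule key[of "\<lambda>a. inner (op_apply a v) w"])
         (rule bounded_linear_compose[OF bounded_linear_inner_left op.bounded_linear_act])
    have "inner (?x - ?y) (?x - ?y) = 0" by (simp only: inner_diff_left i diff_self)
    then show "?x = ?y" by simp
  qed
  have "exp ((1 / 2) *\<^sub>R ?T) * (?E * spectral_density g) = (exp ((1 / 2) *\<^sub>R ?T) * ?E) * spectral_density g"
    by (rule mult.assoc[symmetric])
  then show "spectral_density g = riem_density g"
    unfolding E riem_density_def by (simp add: exp_minus_inverse)
qed

theorem proposition10p1:
  fixes \<theta> :: "real^'n::{finite,linorder}^'n::{finite,linorder}"
    and g :: "'n torus_op^'n::{finite,linorder}^'n::{finite,linorder}"
  assumes "CARD('n) \<ge> 2"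
    and "transpose \<theta> = - \<theta>"
    and "g \<in> riem_metrics \<theta>"
  shows "spectral_density g \<in> nc_smooth_pos \<theta> \<and>
         spectral_density g =
           pi powr (- (real CARD('n) / 2)) *\<^sub>R
             weak_integral lborel (\<lambda>\<xi> :: real^'n::{finite,linorder}. exp (- (covec_norm g \<xi>)\<^sup>2)) \<and>
         (\<forall>k \<in> nc_smooth_pos \<theta>. (\<forall>i j. k * g $ i $ j = g $ i $ j * k) \<longrightarrow>
           spectral_density (\<chi> i j. k\<^sup>2 * g $ i $ j) = k ^ CARD('n) * spectral_density g) \<and>
         ((\<forall>i j k l. g $ i $ j * g $ k $ l = g $ k $ l * g $ i $ j) \<longrightarrow>
           spectral_density g = riem_density g \<and>
           riem_density g = op_sqrt (nc_det g) \<and>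
           nc_det g =
             (\<Sum>\<sigma> | \<sigma> permutes UNIV. of_int (sign \<sigma>) *
                prod_list (map (\<lambda>i. g $ i $ \<sigma> i) (sorted_list_of_set UNIV))))"
proof -
  interpret riem_metric \<theta> g by unfold_locales fact
  show ?thesis
  proof (intro conjI ballI impI)
    show "spectral_density g \<in> nc_smooth_pos \<theta>" by (rule density_positive)
    show "spectral_density g = pi powr (- (real CARD('n) / 2)) *\<^sub>R
        weak_integral lborel (\<lambda>\<xi> :: real^'n::{finite,linorder}. exp (- (covec_norm g \<xi>)\<^sup>2))"
      by (rule density_eq_gaussian)
    show "spectral_density (\<chi> i j. k\<^sup>2 * g $ i $ j) = k ^ CARD('n) * spectral_density g"
      if "k \<in> nc_smooth_pos \<theta>" "\<forall>i j. k * g $ i $ j = g $ i $ j * k" for k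
      using that by (intro density_conformal) auto
    assume comm: "\<forall>i j k l. g $ i $ j * g $ k $ l = g $ k $ l * g $ i $ j"
    show "spectral_density g = riem_density g" "riem_density g = op_sqrt (nc_det g)"
      "nc_det g = (\<Sum>\<sigma> | \<sigma> permutes UNIV. of_int (sign \<sigma>) *
         prod_list (map (\<lambda>i. g $ i $ \<sigma> i) (sorted_list_of_set UNIV)))"
      using density_self_compatible comm unfolding leibniz_def by blast+
  qed
qed

end
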